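(* Let $k$ be a field of characteristic $2$, let $Q=Q_8$ be the quaternion group with $8$ elements, and let $\mathcal B=\{1,x,y,x^2,y^2,x^2y\}$, so that $\{b s^i\mid b\in\mathcal B,\ i\in\mathbb Z\}$ is a $k$-basis of $\hat H^*(Q)$. The canonical class $\gamma_Q\in HH^{3,-1}\hat H^*(Q)$ is represented by the Hochschild cocycle $m$ (a $k$-trilinear map) which satisfies $$m(as^{2h},bs^i,cs^j)=m(a,b,c)\,s^{2h+i+j}\qquad (h,i,j\in\mathbb Z,\ a\in\mathcal B\cup\mathcal Bs,\ b,c\in\mathcal B),$$ takes the values $m(x,y,x)=x^2$, $m(y,x,y)=y^2$, $m(s,x,y)=m(s,y,x)=(x+y)s$, $m(s,x,x^2)=m(s,x^2,x)=x^2s$, $m(s,x,y^2)=m(s,y^2,x)=(x^2+y^2)s$, $m(s,y,y^2)=m(s,y^2,y)=y^2s$, $m(s,x,x^2y)=m(s,x^2y,x)=x^2ys$, $m(sx,y,x)=m(sy,x,y)=(x^2+y^2)s$, $m(sx,x,y)=y^2s$, $m(sy,y,x)=x^2s$, $m(sx^2,x,y)=m(sy^2,x,y)=m(sx^2,y,x)=m(sy^2,y,x)=x^2ys$, $m(sy,x,x^2)=m(sy,x^2,x)=x^2ys$, $m(sx,x,y^2)=m(sy,x,y^2)=m(sx,y^2,x)=m(sy,y^2,x)=x^2ys$, $m(sx,y,y^2)=m(sx,y^2,y)=x^2ys$, and vanishes on all other triples in $(\mathcal B\cup\mathcal Bs)\times\mathcal B\times\mathcal B$.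
   Context: For a finite group $G$ and a field $k$, let $\hat P_*$ be a complete projective resolution of the trivial $kG$-module $k$. $\hat H^*(G)=H^*(\mathrm{Hom}_{kG}(\hat P_*,k))$ is the Tate cohomology algebra. Write $Q=\langle I,J,K\mid I^2=J^2=K^2,\ IJ=K\rangle$. It is known that $\hat H^*(Q)\cong k[x,y,s^{\pm1}]/(x^2+y^2=xy,\ x^3=y^3=0,\ x^2y=xy^2)$ with $|x|=|y|=1$, $|s|=4$. Here $x,y\in \hat H^1(Q)=\mathrm{Hom}(Q,k)$ are the homomorphisms with $x(I)=1,\ x(J)=0$ and $y(I)=0,\ y(J)=1$, and $s$ is the generator of the one-dimensional space $\hat H^4(Q)$ represented by the shift map of a $4$-periodic complete resolution. Endomorphism dga: $A^n=\prod_{j}\mathrm{Hom}_{kG}(\hat P_{j+n},\hat P_j)$ with $df=\partial f-(-1)^{n}f\partial$ for $f\in A^n$. There is an algebra isomorphism $H^*A\cong \hat H^*(G)$, $[f]\mapsto[\epsilon\circ f_0]$, with $\epsilon:\hat P_0\to k$ the augmentation. Hochschild cohomology: $C^{n,m}(\Lambda)=\mathrm{Hom}_k^m(\Lambda^{\otimes n},\Lambda)$ ($k$-linear maps raising degree by $m$) with $(\delta\varphi)(\lambda_1,\dots,\lambda_{n+1})=(-1)^{m|\lambda_1|}\lambda_1\varphi(\lambda_2,\dots,\lambda_{n+1})+\sum_{i=1}^n(-1)^i\varphi(\dots,\lambda_i\lambda_{i+1},\dots)+(-1)^{n+1}\varphi(\lambda_1,\dots,\lambda_n)\lambda_{n+1}$,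 and $HH^{s,t}(\Lambda)=H^s(C^{*,t}(\Lambda))$. The canonical class $\gamma_G\in HH^{3,-1}\hat H^*(G)$: choose a $k$-linear degree $0$ map $f_1:H^*A\to A$ sending each class to a representing cocycle, and a $k$-linear $f_2:H^*A\otimes H^*A\to A$ of degree $-1$ with $df_2(x,y)=f_1(xy)-f_1(x)f_1(y)$. The map sending $(a,b,c)$ to the class of the cocycle $f_2(a,b)f_1(c)-f_2(a,bc)+f_2(ab,c)-(-1)^{|a|}f_1(a)f_2(b,c)$ is a Hochschild cocycle whose class $\gamma_G$ is independent of the choices. *)

theory Defs
  imports
    Complex_Main
    "HOL-Algebra.Generated_Groups"
    "HOL-Library.Function_Algebras"
    "HOL-Library.FuncSet"
begin

section \<open>Modules over a group algebra\<close>

text \<open>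
  A \<open>kG\<close>-module is a \<open>k\<close>-vector space with a \<open>k\<close>-linear action of \<open>G\<close>. It is carried by a
  subspace of an ambient vector space, so that the modules of a complex, which are pairwise
  different, can share one type. Maps out of a module are total functions that are \<open>0\<close> outside the
  carrier; thus equality of module maps is equality of functions, and the pointwise group structure
  of \<^theory>\<open>HOL-Library.Function_Algebras\<close> is the usual one on spaces of module maps.
\<close>

record ('g, 'k, 'v) kG_mod =
  Mcarr :: "'v set"
  Mscale :: "'k \<Rightarrow> 'v \<Rightarrow> 'v"
  Mact :: "'g \<Rightarrow> 'v \<Rightarrow> 'v"

definition kG_module :: "'g monoid \<Rightarrow> ('g, 'k::field, 'v::ab_group_add) kG_mod \<Rightarrow> bool" where
  "kG_module G M \<longleftrightarrow>
     group G \<and> vector_space (Mscale M) \<and> module.subspace (Mscale M) (Mcarr M) \<and>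
     (\<forall>g\<in>carrier G. Vector_Spaces.linear (Mscale M) (Mscale M) (Mact M g) \<and>
        Mact M g ` Mcarr M \<subseteq> Mcarr M) \<and>
     (\<forall>v\<in>Mcarr M. Mact M \<one>\<^bsub>G\<^esub> v = v) \<and>
     (\<forall>g\<in>carrier G. \<forall>h\<in>carrier G. \<forall>v\<in>Mcarr M.
        Mact M (g \<otimes>\<^bsub>G\<^esub> h) v = Mact M g (Mact M h v))"

definition kG_hom ::
  "'g monoid \<Rightarrow> ('g, 'k, 'v::ab_group_add) kG_mod \<Rightarrow> ('g, 'k, 'w::ab_group_add) kG_mod
     \<Rightarrow> ('v \<Rightarrow> 'w) set" where
  "kG_hom G M N = {f.
     (\<forall>u\<in>Mcarr M. f u \<in> Mcarr N) \<and>
     (\<forall>u\<in>Mcarr M. \<forall>v\<in>Mcarr M. f (u + v) = f u + f v) \<and>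
     (\<forall>c. \<forall>u\<in>Mcarr M. f (Mscale M c u) = Mscale N c (f u)) \<and>
     (\<forall>g\<in>carrier G. \<forall>u\<in>Mcarr M. f (Mact M g u) = Mact N g (f u)) \<and>
     (\<forall>u. u \<notin> Mcarr M \<longrightarrow> f u = 0)}"

definition trivial_module :: "('g, 'k::field, 'k) kG_mod" where
  "trivial_module = \<lparr>Mcarr = UNIV, Mscale = (*), Mact = (\<lambda>g c. c)\<rparr>"

text \<open>
  The free \<open>kG\<close>-module with basis \<open>S\<close>: the function \<open>f\<close> stands for
  \<open>\<Sum>i\<in>S. \<Sum>h\<in>G. f (i, h) \<cdot> h e\<^sub>i\<close>.
\<close>

definition free_module :: "'g monoid \<Rightarrow> 'i set \<Rightarrow> ('g, 'k::field, 'i \<times> 'g \<Rightarrow> 'k) kG_mod" where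
  "free_module G S = \<lparr>
     Mcarr = {f. finite {p. f p \<noteq> 0} \<and> (\<forall>i h. f (i, h) \<noteq> 0 \<longrightarrow> i \<in> S \<and> h \<in> carrier G)},
     Mscale = (\<lambda>c f p. c * f p),
     Mact = (\<lambda>g f (i, h). if h \<in> carrier G then f (i, inv\<^bsub>G\<^esub> g \<otimes>\<^bsub>G\<^esub> h) else 0)\<rparr>"

text \<open>
  Projective means direct summand of a free module. A projective module is in particular a summand
  of the free module on its underlying set, so no quantification over basis types is needed.
\<close>

definition projective_module :: "'g monoid \<Rightarrow> ('g, 'k::field, 'v::ab_group_add) kG_mod \<Rightarrow> bool" where
  "projective_module G M \<longleftrightarrow> kG_module G M \<and>
     (\<exists>\<iota> \<in> kG_hom G M (free_module G (Mcarr M)). \<exists>\<pi> \<in> kG_hom G (free_module G (Mcarr M)) M.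
        \<forall>v\<in>Mcarr M. \<pi> (\<iota> v) = v)"


section \<open>Complete projective resolutions\<close>

record ('g, 'k, 'v) complete_res =
  Pobj :: "int \<Rightarrow> ('g, 'k, 'v) kG_mod"
  Pbd :: "int \<Rightarrow> 'v \<Rightarrow> 'v"
  Paug :: "'v \<Rightarrow> 'k"
  Pcoaug :: "'k \<Rightarrow> 'v"

text \<open>
  An exact complex of projectives, unbounded in both directions, whose differential
  \<open>P\<^sub>0 \<rightarrow> P\<^sub>-\<^sub>1\<close> factors as \<open>P\<^sub>0 \<rightarrow> k \<rightarrow> P\<^sub>-\<^sub>1\<close>, the augmentation followed by the coaugmentation.
\<close>

definition complete_resolution ::
  "'g monoid \<Rightarrow> ('g, 'k::field, 'v::ab_group_add) complete_res \<Rightarrow> bool" where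
  "complete_resolution G P \<longleftrightarrow>
     (\<forall>j. projective_module G (Pobj P j)) \<and>
     (\<forall>j. Pbd P j \<in> kG_hom G (Pobj P j) (Pobj P (j - 1))) \<and>
     (\<forall>j. Pbd P (j + 1) ` Mcarr (Pobj P (j + 1)) = {v \<in> Mcarr (Pobj P j). Pbd P j v = 0}) \<and>
     Paug P \<in> kG_hom G (Pobj P 0) trivial_module \<and>
     Paug P ` Mcarr (Pobj P 0) = UNIV \<and>
     Pcoaug P \<in> kG_hom G trivial_module (Pobj P (-1)) \<and>
     inj (Pcoaug P) \<and>
     (\<forall>v \<in> Mcarr (Pobj P 0). Pbd P 0 v = Pcoaug P (Paug P v))"

definition four_periodic :: "('g, 'k, 'v) complete_res \<Rightarrow> bool" where
  "four_periodic P \<longleftrightarrow> (\<forall>j. Pobj P (j + 4) = Pobj P j \<and> Pbd P (j + 4) = Pbd P j)"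

definition comparison_map ::
  "'g monoid \<Rightarrow> ('g, 'k::field, 'v::ab_group_add) complete_res
     \<Rightarrow> ('g, 'k, 'w::ab_group_add) complete_res \<Rightarrow> (int \<Rightarrow> 'v \<Rightarrow> 'w) \<Rightarrow> bool" where
  "comparison_map G P R \<theta> \<longleftrightarrow>
     (\<forall>j. \<theta> j \<in> kG_hom G (Pobj P j) (Pobj R j)) \<and>
     (\<forall>j. \<theta> (j - 1) \<circ> Pbd P j = Pbd R j \<circ> \<theta> j) \<and>
     Paug R \<circ> \<theta> 0 = Paug P"


section \<open>Cohomology classes and graded algebras\<close>

definition cocycles ::
  "(int \<Rightarrow> 'c::ab_group_add set) \<Rightarrow> (int \<Rightarrow> 'c \<Rightarrow> 'c) \<Rightarrow> int \<Rightarrow> 'c set" where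
  "cocycles C d n = {f \<in> C n. d n f = 0}"

definition coboundaries ::
  "(int \<Rightarrow> 'c::ab_group_add set) \<Rightarrow> (int \<Rightarrow> 'c \<Rightarrow> 'c) \<Rightarrow> int \<Rightarrow> 'c set" where
  "coboundaries C d n = d (n - 1) ` C (n - 1)"

text \<open>A cohomology class is stored with its degree, so classes of different degree are distinct.\<close>

definition coh_class ::
  "(int \<Rightarrow> 'c::ab_group_add set) \<Rightarrow> (int \<Rightarrow> 'c \<Rightarrow> 'c) \<Rightarrow> int \<Rightarrow> 'c \<Rightarrow> int \<times> 'c set" where
  "coh_class C d n f = (n, {g \<in> cocycles C d n. g - f \<in> coboundaries C d n})"

definition cohomology ::
  "(int \<Rightarrow> 'c::ab_group_add set) \<Rightarrow> (int \<Rightarrow> 'c \<Rightarrow> 'c) \<Rightarrow> int \<Rightarrow> (int \<times> 'c set) set" where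
  "cohomology C d n = coh_class C d n ` cocycles C d n"

definition repr :: "int \<times> 'c set \<Rightarrow> 'c" where
  "repr a = (SOME f. f \<in> snd a)"

text \<open>
  A graded algebra is described by its homogeneous elements: \<open>gadd\<close> is only meaningful for two
  elements of the same degree, and every degree has its own zero.
\<close>

record ('k, 'a) graded_alg =
  gcomp :: "int \<Rightarrow> 'a set"
  gdeg :: "'a \<Rightarrow> int"
  gzero :: "int \<Rightarrow> 'a"
  gadd :: "'a \<Rightarrow> 'a \<Rightarrow> 'a"
  gscale :: "'k \<Rightarrow> 'a \<Rightarrow> 'a"
  gone :: "'a"
  gmult :: "'a \<Rightarrow> 'a \<Rightarrow> 'a"

definition homog :: "('k, 'a) graded_alg \<Rightarrow> 'a set" where
  "homog \<Lambda> = (\<Union>n. gcomp \<Lambda> n)"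

definition gsum :: "('k, 'a) graded_alg \<Rightarrow> int \<Rightarrow> 'a list \<Rightarrow> 'a" where
  "gsum \<Lambda> n as = foldr (gadd \<Lambda>) as (gzero \<Lambda> n)"

definition ginv :: "('k, 'a) graded_alg \<Rightarrow> 'a \<Rightarrow> 'a" where
  "ginv \<Lambda> a = (THE b. b \<in> gcomp \<Lambda> (- gdeg \<Lambda> a) \<and>
     gmult \<Lambda> a b = gone \<Lambda> \<and> gmult \<Lambda> b a = gone \<Lambda>)"

definition gpow :: "('k, 'a) graded_alg \<Rightarrow> 'a \<Rightarrow> int \<Rightarrow> 'a" where
  "gpow \<Lambda> a i =
     (if 0 \<le> i then (gmult \<Lambda> a ^^ nat i) (gone \<Lambda>)
      else (gmult \<Lambda> (ginv \<Lambda> a) ^^ nat (- i)) (gone \<Lambda>))"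

text \<open>The family \<open>e\<close>, indexed by \<open>A\<close>, is a homogeneous \<open>k\<close>-basis.\<close>

definition homogeneous_basis ::
  "('k::field, 'a) graded_alg \<Rightarrow> 'i set \<Rightarrow> ('i \<Rightarrow> 'a) \<Rightarrow> bool" where
  "homogeneous_basis \<Lambda> A e \<longleftrightarrow>
     e ` A \<subseteq> homog \<Lambda> \<and>
     (\<forall>n. \<forall>a \<in> gcomp \<Lambda> n. \<exists>is c. set is \<subseteq> {i \<in> A. e i \<in> gcomp \<Lambda> n} \<and>
        a = gsum \<Lambda> n (map (\<lambda>i. gscale \<Lambda> (c i) (e i)) is)) \<and>
     (\<forall>n is c. distinct is \<and> set is \<subseteq> {i \<in> A. e i \<in> gcomp \<Lambda> n} \<and>
        gsum \<Lambda> n (map (\<lambda>i. gscale \<Lambda> (c i) (e i)) is) = gzero \<Lambda> n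
        \<longrightarrow> (\<forall>i \<in> set is. c i = 0))"


section \<open>The endomorphism dga and Tate cohomology\<close>

definition endo_cochains ::
  "'g monoid \<Rightarrow> ('g, 'k::field, 'v::ab_group_add) complete_res \<Rightarrow> int \<Rightarrow> (int \<Rightarrow> 'v \<Rightarrow> 'v) set" where
  "endo_cochains G P n = {f. \<forall>j. f j \<in> kG_hom G (Pobj P (j + n)) (Pobj P j)}"

definition endo_scale ::
  "('g, 'k::field, 'v::ab_group_add) complete_res \<Rightarrow> 'k \<Rightarrow> (int \<Rightarrow> 'v \<Rightarrow> 'v) \<Rightarrow> (int \<Rightarrow> 'v \<Rightarrow> 'v)" where
  "endo_scale P c f = (\<lambda>j v. Mscale (Pobj P j) c (f j v))"

definition endo_comp :: "int \<Rightarrow> (int \<Rightarrow> 'v \<Rightarrow> 'v) \<Rightarrow> (int \<Rightarrow> 'v \<Rightarrow> 'v) \<Rightarrow> (int \<Rightarrow> 'v \<Rightarrow> 'v)" where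
  "endo_comp n f g = (\<lambda>j. f j \<circ> g (j + n))"

definition endo_diff ::
  "('g, 'k::field, 'v::ab_group_add) complete_res \<Rightarrow> int \<Rightarrow> (int \<Rightarrow> 'v \<Rightarrow> 'v) \<Rightarrow> (int \<Rightarrow> 'v \<Rightarrow> 'v)" where
  "endo_diff P n f =
     (\<lambda>j. Pbd P (j + 1) \<circ> f (j + 1)) -
     endo_scale P ((-1) powi n) (\<lambda>j. f j \<circ> Pbd P (j + n + 1))"

abbreviation endo_class ::
  "'g monoid \<Rightarrow> ('g, 'k::field, 'v::ab_group_add) complete_res \<Rightarrow> int \<Rightarrow> (int \<Rightarrow> 'v \<Rightarrow> 'v)
     \<Rightarrow> int \<times> (int \<Rightarrow> 'v \<Rightarrow> 'v) set" where
  "endo_class G P \<equiv> coh_class (endo_cochains G P) (endo_diff P)"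

definition endo_alg ::
  "'g monoid \<Rightarrow> ('g, 'k::field, 'v::ab_group_add) complete_res
     \<Rightarrow> ('k, int \<times> (int \<Rightarrow> 'v \<Rightarrow> 'v) set) graded_alg" where
  "endo_alg G P = \<lparr>
     gcomp = cohomology (endo_cochains G P) (endo_diff P),
     gdeg = fst,
     gzero = (\<lambda>n. endo_class G P n 0),
     gadd = (\<lambda>a b. endo_class G P (fst a) (repr a + repr b)),
     gscale = (\<lambda>c a. endo_class G P (fst a) (endo_scale P c (repr a))),
     gone = endo_class G P 0 (\<lambda>j v. if v \<in> Mcarr (Pobj P j) then v else 0),
     gmult = (\<lambda>a b. endo_class G P (fst a + fst b) (endo_comp (fst a) (repr a) (repr b)))\<rparr>"

text \<open>
  The complex of module maps from the resolution to \<open>k\<close>. Sign conventions for its differential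
  affect neither cocycles nor coboundaries.
\<close>

definition tate_cochains ::
  "'g monoid \<Rightarrow> ('g, 'k::field, 'v::ab_group_add) complete_res \<Rightarrow> int \<Rightarrow> ('v \<Rightarrow> 'k) set" where
  "tate_cochains G P n = kG_hom G (Pobj P n) trivial_module"

definition tate_diff ::
  "('g, 'k::field, 'v::ab_group_add) complete_res \<Rightarrow> int \<Rightarrow> ('v \<Rightarrow> 'k) \<Rightarrow> ('v \<Rightarrow> 'k)" where
  "tate_diff P n \<phi> = \<phi> \<circ> Pbd P (n + 1)"

abbreviation tate_class ::
  "'g monoid \<Rightarrow> ('g, 'k::field, 'v::ab_group_add) complete_res \<Rightarrow> int \<Rightarrow> ('v \<Rightarrow> 'k)
     \<Rightarrow> int \<times> ('v \<Rightarrow> 'k) set" where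
  "tate_class G P \<equiv> coh_class (tate_cochains G P) (tate_diff P)"

text \<open>The isomorphism from the cohomology of the endomorphism dga, \<open>[f] \<mapsto> [\<epsilon> \<circ> f\<^sub>0]\<close>.\<close>

definition to_tate ::
  "'g monoid \<Rightarrow> ('g, 'k::field, 'v::ab_group_add) complete_res
     \<Rightarrow> int \<times> (int \<Rightarrow> 'v \<Rightarrow> 'v) set \<Rightarrow> int \<times> ('v \<Rightarrow> 'k) set" where
  "to_tate G P a = tate_class G P (fst a) (Paug P \<circ> repr a 0)"

definition from_tate ::
  "'g monoid \<Rightarrow> ('g, 'k::field, 'v::ab_group_add) complete_res
     \<Rightarrow> int \<times> ('v \<Rightarrow> 'k) set \<Rightarrow> int \<times> (int \<Rightarrow> 'v \<Rightarrow> 'v) set" where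
  "from_tate G P = inv_into (homog (endo_alg G P)) (to_tate G P)"

text \<open>
  Tate cohomology; its product is the one for which \<^const>\<open>to_tate\<close> is multiplicative.
\<close>

definition tate_alg ::
  "'g monoid \<Rightarrow> ('g, 'k::field, 'v::ab_group_add) complete_res
     \<Rightarrow> ('k, int \<times> ('v \<Rightarrow> 'k) set) graded_alg" where
  "tate_alg G P = \<lparr>
     gcomp = cohomology (tate_cochains G P) (tate_diff P),
     gdeg = fst,
     gzero = (\<lambda>n. tate_class G P n 0),
     gadd = (\<lambda>a b. tate_class G P (fst a) (repr a + repr b)),
     gscale = (\<lambda>c a. tate_class G P (fst a) (\<lambda>v. c * repr a v)),
     gone = tate_class G P 0 (Paug P),
     gmult = (\<lambda>a b. to_tate G P (gmult (endo_alg G P) (from_tate G P a) (from_tate G P b)))\<rparr>"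

text \<open>
  The identification of degree one classes with homomorphisms from \<open>G\<close> to \<open>k\<close>: if \<open>\<epsilon> u = 1\<close>, then
  \<open>g u - u = \<partial> v\<close> for some \<open>v\<close> in \<open>P\<^sub>1\<close>, and the homomorphism sends \<open>g\<close> to \<open>\<phi> v\<close>, where \<open>\<phi>\<close> is a cocycle
  representing the class. For the bar resolution this is \<open>g \<mapsto> \<phi> [g]\<close>.
\<close>

definition hom_of_class ::
  "('g, 'k::field, 'v::ab_group_add) complete_res \<Rightarrow> int \<times> ('v \<Rightarrow> 'k) set \<Rightarrow> 'g \<Rightarrow> 'k" where
  "hom_of_class P a g = (THE c. \<exists>\<phi> \<in> snd a. \<exists>u \<in> Mcarr (Pobj P 0). \<exists>v \<in> Mcarr (Pobj P 1).
     Paug P u = 1 \<and> Pbd P 1 v = Mact (Pobj P 0) g u - u \<and> c = \<phi> v)"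

text \<open>
  The shift map of a four-periodic complete resolution \<open>R\<close> is the identity
  \<open>R\<^sub>j\<^sub>+\<^sub>4 = R\<^sub>j \<rightarrow> R\<^sub>j\<close> in every degree. The class it represents in the cohomology computed from \<open>R\<close> is
  read in the cohomology computed from \<open>P\<close> by means of a comparison map \<open>\<theta>\<close> from \<open>P\<close> to \<open>R\<close>.
\<close>

definition shift_map ::
  "('g, 'k, 'v::ab_group_add) complete_res \<Rightarrow> int \<Rightarrow> 'v \<Rightarrow> 'v" where
  "shift_map R = (\<lambda>j v. if v \<in> Mcarr (Pobj R j) then v else 0)"

definition shift_class ::
  "'g monoid \<Rightarrow> ('g, 'k::field, 'v::ab_group_add) complete_res
     \<Rightarrow> ('g, 'k, 'w::ab_group_add) complete_res \<Rightarrow> (int \<Rightarrow> 'v \<Rightarrow> 'w) \<Rightarrow> int \<times> ('v \<Rightarrow> 'k) set" where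
  "shift_class G P R \<theta> = tate_class G P 4 (Paug R \<circ> shift_map R 0 \<circ> \<theta> 4)"


section \<open>Hochschild cohomology\<close>

text \<open>
  Graded maps \<open>\<Lambda>\<^sup>\<otimes>\<^sup>n \<rightarrow> \<Lambda>\<close> of degree \<open>m\<close> are multilinear maps on lists of \<open>n\<close> homogeneous elements.
\<close>

definition tuples :: "('k, 'a) graded_alg \<Rightarrow> nat \<Rightarrow> 'a list set" where
  "tuples \<Lambda> n = {as. length as = n \<and> set as \<subseteq> homog \<Lambda>}"

definition tdeg :: "('k, 'a) graded_alg \<Rightarrow> 'a list \<Rightarrow> int" where
  "tdeg \<Lambda> as = sum_list (map (gdeg \<Lambda>) as)"

definition hh_cochains ::
  "('k::field, 'a) graded_alg \<Rightarrow> nat \<Rightarrow> int \<Rightarrow> ('a list \<Rightarrow> 'a) set" where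
  "hh_cochains \<Lambda> n m = {\<phi> \<in> extensional (tuples \<Lambda> n).
     (\<forall>as \<in> tuples \<Lambda> n. \<phi> as \<in> gcomp \<Lambda> (tdeg \<Lambda> as + m)) \<and>
     (\<forall>as \<in> tuples \<Lambda> n. \<forall>i<n. \<forall>d. \<forall>a \<in> gcomp \<Lambda> d. \<forall>b \<in> gcomp \<Lambda> d.
        \<phi> (as[i := gadd \<Lambda> a b]) = gadd \<Lambda> (\<phi> (as[i := a])) (\<phi> (as[i := b]))) \<and>
     (\<forall>as \<in> tuples \<Lambda> n. \<forall>i<n. \<forall>c. \<forall>a \<in> homog \<Lambda>.
        \<phi> (as[i := gscale \<Lambda> c a]) = gscale \<Lambda> c (\<phi> (as[i := a])))}"

definition hh_zero :: "('k, 'a) graded_alg \<Rightarrow> nat \<Rightarrow> int \<Rightarrow> 'a list \<Rightarrow> 'a" where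
  "hh_zero \<Lambda> n m = (\<lambda>as \<in> tuples \<Lambda> n. gzero \<Lambda> (tdeg \<Lambda> as + m))"

text \<open>List positions are counted from \<open>0\<close>: in the \<open>i\<close>-th middle term \<open>as ! (i - 1)\<close> is \<open>\<lambda>\<^sub>i\<close>.\<close>

definition hh_diff ::
  "('k::field, 'a) graded_alg \<Rightarrow> nat \<Rightarrow> int \<Rightarrow> ('a list \<Rightarrow> 'a) \<Rightarrow> 'a list \<Rightarrow> 'a" where
  "hh_diff \<Lambda> n m \<phi> = (\<lambda>as \<in> tuples \<Lambda> (Suc n). gsum \<Lambda> (tdeg \<Lambda> as + m)
     ([gscale \<Lambda> ((-1) powi (m * gdeg \<Lambda> (hd as))) (gmult \<Lambda> (hd as) (\<phi> (tl as)))] @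
      map (\<lambda>i. gscale \<Lambda> ((-1) ^ i)
             (\<phi> (take (i - 1) as @ [gmult \<Lambda> (as ! (i - 1)) (as ! i)] @ drop (i + 1) as)))
        [1..<Suc n] @
      [gscale \<Lambda> ((-1) ^ Suc n) (gmult \<Lambda> (\<phi> (butlast as)) (last as))]))"

definition hh_cocycles :: "('k::field, 'a) graded_alg \<Rightarrow> nat \<Rightarrow> int \<Rightarrow> ('a list \<Rightarrow> 'a) set" where
  "hh_cocycles \<Lambda> n m = {\<phi> \<in> hh_cochains \<Lambda> n m. hh_diff \<Lambda> n m \<phi> = hh_zero \<Lambda> (Suc n) m}"

definition hh_coboundaries :: "('k::field, 'a) graded_alg \<Rightarrow> nat \<Rightarrow> int \<Rightarrow> ('a list \<Rightarrow> 'a) set" where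
  "hh_coboundaries \<Lambda> n m =
     (case n of 0 \<Rightarrow> {hh_zero \<Lambda> 0 m} | Suc l \<Rightarrow> hh_diff \<Lambda> l m ` hh_cochains \<Lambda> l m)"

text \<open>The class in \<open>HH\<^sup>n\<^sup>,\<^sup>m(\<Lambda>)\<close> represented by the cocycle \<open>\<phi>\<close>.\<close>

definition hh_class ::
  "('k::field, 'a) graded_alg \<Rightarrow> nat \<Rightarrow> int \<Rightarrow> ('a list \<Rightarrow> 'a) \<Rightarrow> ('a list \<Rightarrow> 'a) set" where
  "hh_class \<Lambda> n m \<phi> = {\<phi>' \<in> hh_cocycles \<Lambda> n m. \<exists>\<beta> \<in> hh_coboundaries \<Lambda> n m.
     \<phi>' = (\<lambda>as \<in> tuples \<Lambda> n. gadd \<Lambda> (\<phi> as) (\<beta> as))}"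


section \<open>The canonical class\<close>

definition canonical_choice ::
  "'g monoid \<Rightarrow> ('g, 'k::field, 'v::ab_group_add) complete_res
     \<Rightarrow> (int \<times> (int \<Rightarrow> 'v \<Rightarrow> 'v) set \<Rightarrow> (int \<Rightarrow> 'v \<Rightarrow> 'v))
     \<Rightarrow> (int \<times> (int \<Rightarrow> 'v \<Rightarrow> 'v) set \<Rightarrow> int \<times> (int \<Rightarrow> 'v \<Rightarrow> 'v) set \<Rightarrow> (int \<Rightarrow> 'v \<Rightarrow> 'v)) \<Rightarrow> bool" where
  "canonical_choice G P f1 f2 \<longleftrightarrow> (let H = endo_alg G P in
     (\<forall>a \<in> homog H. f1 a \<in> snd a) \<and>
     (\<forall>n. \<forall>a \<in> gcomp H n. \<forall>b \<in> gcomp H n. f1 (gadd H a b) = f1 a + f1 b) \<and>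
     (\<forall>c. \<forall>a \<in> homog H. f1 (gscale H c a) = endo_scale P c (f1 a)) \<and>
     (\<forall>a \<in> homog H. \<forall>b \<in> homog H. f2 a b \<in> endo_cochains G P (gdeg H a + gdeg H b - 1)) \<and>
     (\<forall>n. \<forall>a \<in> gcomp H n. \<forall>a' \<in> gcomp H n. \<forall>b \<in> homog H.
        f2 (gadd H a a') b = f2 a b + f2 a' b) \<and>
     (\<forall>n. \<forall>a \<in> homog H. \<forall>b \<in> gcomp H n. \<forall>b' \<in> gcomp H n.
        f2 a (gadd H b b') = f2 a b + f2 a b') \<and>
     (\<forall>c. \<forall>a \<in> homog H. \<forall>b \<in> homog H.
        f2 (gscale H c a) b = endo_scale P c (f2 a b) \<and>
        f2 a (gscale H c b) = endo_scale P c (f2 a b)) \<and>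
     (\<forall>a \<in> homog H. \<forall>b \<in> homog H.
        endo_diff P (gdeg H a + gdeg H b - 1) (f2 a b) =
          f1 (gmult H a b) - endo_comp (gdeg H a) (f1 a) (f1 b)))"

definition canonical_value ::
  "'g monoid \<Rightarrow> ('g, 'k::field, 'v::ab_group_add) complete_res
     \<Rightarrow> (int \<times> (int \<Rightarrow> 'v \<Rightarrow> 'v) set \<Rightarrow> (int \<Rightarrow> 'v \<Rightarrow> 'v))
     \<Rightarrow> (int \<times> (int \<Rightarrow> 'v \<Rightarrow> 'v) set \<Rightarrow> int \<times> (int \<Rightarrow> 'v \<Rightarrow> 'v) set \<Rightarrow> (int \<Rightarrow> 'v \<Rightarrow> 'v))
     \<Rightarrow> int \<times> (int \<Rightarrow> 'v \<Rightarrow> 'v) set \<Rightarrow> int \<times> (int \<Rightarrow> 'v \<Rightarrow> 'v) set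
     \<Rightarrow> int \<times> (int \<Rightarrow> 'v \<Rightarrow> 'v) set \<Rightarrow> int \<times> (int \<Rightarrow> 'v \<Rightarrow> 'v) set" where
  "canonical_value G P f1 f2 a b c = (let H = endo_alg G P; p = gdeg H a; q = gdeg H b; r = gdeg H c in
     endo_class G P (p + q + r - 1)
       (endo_comp (p + q - 1) (f2 a b) (f1 c) - f2 a (gmult H b c) + f2 (gmult H a b) c
        - endo_scale P ((-1) powi p) (endo_comp p (f1 a) (f2 b c))))"

text \<open>The same cocycle, on Tate cohomology.\<close>

definition canonical_cocycle ::
  "'g monoid \<Rightarrow> ('g, 'k::field, 'v::ab_group_add) complete_res
     \<Rightarrow> (int \<times> (int \<Rightarrow> 'v \<Rightarrow> 'v) set \<Rightarrow> (int \<Rightarrow> 'v \<Rightarrow> 'v))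
     \<Rightarrow> (int \<times> (int \<Rightarrow> 'v \<Rightarrow> 'v) set \<Rightarrow> int \<times> (int \<Rightarrow> 'v \<Rightarrow> 'v) set \<Rightarrow> (int \<Rightarrow> 'v \<Rightarrow> 'v))
     \<Rightarrow> (int \<times> ('v \<Rightarrow> 'k) set) list \<Rightarrow> int \<times> ('v \<Rightarrow> 'k) set" where
  "canonical_cocycle G P f1 f2 = (\<lambda>as \<in> tuples (tate_alg G P) 3.
     to_tate G P (canonical_value G P f1 f2
       (from_tate G P (as ! 0)) (from_tate G P (as ! 1)) (from_tate G P (as ! 2))))"

definition canonical_class ::
  "'g monoid \<Rightarrow> ('g, 'k::field, 'v::ab_group_add) complete_res
     \<Rightarrow> ((int \<times> ('v \<Rightarrow> 'k) set) list \<Rightarrow> int \<times> ('v \<Rightarrow> 'k) set) set" where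
  "canonical_class G P = (THE \<gamma>. \<exists>f1 f2. canonical_choice G P f1 f2 \<and>
     \<gamma> = hh_class (tate_alg G P) 3 (-1) (canonical_cocycle G P f1 f2))"


section \<open>The quaternion group\<close>

text \<open>
  The presentation \<open>\<langle>I, J, K | I\<^sup>2 = J\<^sup>2 = K\<^sup>2, I J = K\<rangle>\<close> defines a group of order \<open>8\<close>. Hence the presented
  group is characterised, up to a unique isomorphism respecting \<open>I\<close>, \<open>J\<close> and \<open>K\<close>, as a group of order
  \<open>8\<close> generated by elements that satisfy the relations.
\<close>

definition quaternion_group :: "'g monoid \<Rightarrow> 'g \<Rightarrow> 'g \<Rightarrow> 'g \<Rightarrow> bool" where
  "quaternion_group G I J K \<longleftrightarrow>
     group G \<and> order G = 8 \<and> {I, J, K} \<subseteq> carrier G \<and> generate G {I, J, K} = carrier G \<and>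
     I \<otimes>\<^bsub>G\<^esub> I = J \<otimes>\<^bsub>G\<^esub> J \<and> J \<otimes>\<^bsub>G\<^esub> J = K \<otimes>\<^bsub>G\<^esub> K \<and> I \<otimes>\<^bsub>G\<^esub> J = K"

text \<open>\<open>\<B> = {1, x, y, x\<^sup>2, y\<^sup>2, x\<^sup>2y}\<close>\<close>

definition Q_basis :: "('k, 'a) graded_alg \<Rightarrow> 'a \<Rightarrow> 'a \<Rightarrow> 'a list" where
  "Q_basis \<Lambda> x y = [gone \<Lambda>, x, y, gmult \<Lambda> x x, gmult \<Lambda> y y, gmult \<Lambda> (gmult \<Lambda> x x) y]"

definition Q_table :: "('k, 'a) graded_alg \<Rightarrow> 'a \<Rightarrow> 'a \<Rightarrow> 'a \<Rightarrow> ('a list \<times> 'a) list" where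
  "Q_table \<Lambda> x y s = (let mul = gmult \<Lambda>; add = gadd \<Lambda>;
      xx = mul x x; yy = mul y y; xxy = mul xx y;
      sx = mul s x; sy = mul s y; sxx = mul s xx; syy = mul s yy in
   [([x, y, x], xx), ([y, x, y], yy),
    ([s, x, y], mul (add x y) s), ([s, y, x], mul (add x y) s),
    ([s, x, xx], mul xx s), ([s, xx, x], mul xx s),
    ([s, x, yy], mul (add xx yy) s), ([s, yy, x], mul (add xx yy) s),
    ([s, y, yy], mul yy s), ([s, yy, y], mul yy s),
    ([s, x, xxy], mul xxy s), ([s, xxy, x], mul xxy s),
    ([sx, y, x], mul (add xx yy) s), ([sy, x, y], mul (add xx yy) s),
    ([sx, x, y], mul yy s), ([sy, y, x], mul xx s),
    ([sxx, x, y], mul xxy s), ([syy, x, y], mul xxy s),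
    ([sxx, y, x], mul xxy s), ([syy, y, x], mul xxy s),
    ([sy, x, xx], mul xxy s), ([sy, xx, x], mul xxy s),
    ([sx, x, yy], mul xxy s), ([sy, x, yy], mul xxy s),
    ([sx, yy, x], mul xxy s), ([sy, yy, x], mul xxy s),
    ([sx, y, yy], mul xxy s), ([sx, yy, y], mul xxy s)])"

definition Q_values :: "('k, 'a) graded_alg \<Rightarrow> 'a \<Rightarrow> 'a \<Rightarrow> 'a \<Rightarrow> ('a list \<Rightarrow> 'a) \<Rightarrow> bool" where
  "Q_values \<Lambda> x y s m \<longleftrightarrow> (let B = set (Q_basis \<Lambda> x y); BBs = B \<union> (\<lambda>b. gmult \<Lambda> b s) ` B in
     (\<forall>h i j. \<forall>a \<in> BBs. \<forall>b \<in> B. \<forall>c \<in> B.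
        m [gmult \<Lambda> a (gpow \<Lambda> s (2 * h)), gmult \<Lambda> b (gpow \<Lambda> s i), gmult \<Lambda> c (gpow \<Lambda> s j)]
          = gmult \<Lambda> (m [a, b, c]) (gpow \<Lambda> s (2 * h + i + j))) \<and>
     (\<forall>(as, v) \<in> set (Q_table \<Lambda> x y s). m as = v) \<and>
     (\<forall>a \<in> BBs. \<forall>b \<in> B. \<forall>c \<in> B. [a, b, c] \<notin> fst ` set (Q_table \<Lambda> x y s)
        \<longrightarrow> m [a, b, c] = gzero \<Lambda> (tdeg \<Lambda> [a, b, c] - 1)))"

end

theory Submission
  imports Defs
begin

text \<open>
  The quaternion group has a resolution by free modules of ranks \<open>1, 2, 2, 1\<close> that is periodic of period four and
  minimal: maps from it to \<open>k\<close> vanish on boundaries. Hence a class is read off from the augmented component in degree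
  \<open>0\<close> of a representing chain map, and the canonical cocycle becomes a finite computation once chain maps
  representing a basis and null homotopies for the products of basis elements are written down. The chain maps can be
  chosen to commute with the shift \<open>s\<close>, but the homotopies only with its square.

  The result is carried to an arbitrary complete resolution \<open>P\<close> along a homotopy equivalence. If \<open>\<alpha>\<beta> - 1 = \<partial>h + h\<partial>\<close>,
  then \<open>f\<^sub>1(a) = \<beta> X\<^sub>a \<alpha>\<close> and \<open>f\<^sub>2(a, b) = \<beta> (G\<^sub>a\<^sub>b + X\<^sub>a h X\<^sub>b) \<alpha>\<close> are admissible choices for \<open>P\<close> whenever \<open>X\<close> and \<open>G\<close> are
  for the minimal resolution, and the two canonical cocycles differ by an explicit boundary.
\<close>

section \<open>Modules, lifting and extension\<close>

text \<open>The canonical class is the one class obtained from any choice of \<open>f1\<close> and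
  \<open>f2\<close> for the given \<open>P\<close>. So the proof needs independence of the choice
  for \<open>P\<close> itself and one choice for \<open>P\<close> that is linear in the classes;
  linearity is why linear sections and coordinates in a basis occur.

  All data of the minimal resolution have coefficients in the prime field: a map is a list of
  labels, equality over any field of characteristic two is cancellation in pairs, and the values of
  the cocycle are found by evaluation.

  In \<open>f_1(a) f_2(b, c)\<close> the augmented component uses the homotopy
  \<open>f_2(b, c)\<close> in degree |a|. Multiplying \<open>a\<close> by \<open>s\<close> moves
  this degree by four, where a homotopy of period eight may look different.

  The class \<open>s\<close> of the theorem comes from an arbitrary four-periodic resolution and is
  known only up to a nonzero scalar. This is harmless: every prescribed value has the same power of
  \<open>s\<close> on both sides, so the table keeps its form when \<open>s\<close> is multiplied by
  a scalar.\<close>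

lemma char_2_self_add:
  fixes sc :: "'k::field \<Rightarrow> 'v::ab_group_add \<Rightarrow> 'v" and v :: 'v
  assumes "CHAR('k) = 2" "vector_space sc"
  shows "v + v = 0"
proof -
  interpret vector_space sc by fact
  have "(1::'k) + 1 = 0"
    using of_nat_CHAR[where ?'a = 'k] assms(1) by simp
  then show ?thesis
    using scale_left_distrib[of 1 1 v] by simp
qed

lemma char_2_minus_one: "CHAR('k::field) = 2 \<Longrightarrow> (-1 :: 'k) = 1"
  using of_nat_CHAR[where ?'a = 'k] by (simp add: add_eq_0_iff)

text \<open>Module maps are additive only on their carrier and vanish outside it. Extending from a
  basis of the carrier gives a total linear map, to which the theory of linear maps applies.\<close>

lemma linear_extension_on:
  fixes s1 :: "'k::field \<Rightarrow> 'a::ab_group_add \<Rightarrow> 'a" and s2 :: "'k \<Rightarrow> 'b::ab_group_add \<Rightarrow> 'b"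
  assumes "vector_space s1" "vector_space s2" and U: "module.subspace s1 U"
    and add: "\<And>u v. u \<in> U \<Longrightarrow> v \<in> U \<Longrightarrow> f (u + v) = f u + f v"
    and scale: "\<And>c u. u \<in> U \<Longrightarrow> f (s1 c u) = s2 c (f u)"
  obtains f' where "Vector_Spaces.linear s1 s2 f'" "\<And>u. u \<in> U \<Longrightarrow> f' u = f u"
proof -
  interpret vector_space_pair s1 s2
    using assms by (simp add: vector_space_pair_def)
  obtain B where B: "B \<subseteq> U" "vs1.independent B" "U \<subseteq> vs1.span B"
    by (rule vs1.basis_exists)
  obtain f' where f': "Vector_Spaces.linear s1 s2 f'" "\<forall>x\<in>B. f' x = f x"
    using linear_independent_extend[OF B(2)] by blast
  interpret f': Vector_Spaces.linear s1 s2 f' by fact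
  have "f 0 = 0"
    using scale[of 0 0] vs1.subspace_0[OF U] by simp
  have "u \<in> U \<and> f' u = f u" if "u \<in> vs1.span B" for u
    using that
  proof (induction rule: vs1.span_induct_alt)
    case base
    then show ?case
      using vs1.subspace_0[OF U] \<open>f 0 = 0\<close> by (simp add: f'.zero)
  next
    case (step c x y)
    then show ?case
      using B(1) f'(2) by (auto simp: vs1.subspace_add[OF U] vs1.subspace_scale[OF U] add scale f'.add f'.scale subset_iff)
  qed
  then show ?thesis
    using that f'(1) B(3) by blast
qed

text \<open>A linear right inverse of \<open>i\<close> is composed with \<open>f\<close>; two
  preimages of one element differ by an element of the kernel of \<open>i\<close>, which
  \<open>f\<close> kills. The bound on the range later keeps values inside the carrier of a
  module.\<close>

lemma linear_factor_through:
  fixes s1 :: "'k::field \<Rightarrow> 'a::ab_group_add \<Rightarrow> 'a" and s2 :: "'k \<Rightarrow> 'b::ab_group_add \<Rightarrow> 'b"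
    and s3 :: "'k \<Rightarrow> 'c::ab_group_add \<Rightarrow> 'c"
  assumes vs: "vector_space s1" "vector_space s2" "vector_space s3" and U: "module.subspace s1 U"
    and i: "\<And>u v. u \<in> U \<Longrightarrow> v \<in> U \<Longrightarrow> i (u + v) = i u + i v" "\<And>c u. u \<in> U \<Longrightarrow> i (s1 c u) = s2 c (i u)"
    and f: "\<And>u v. u \<in> U \<Longrightarrow> v \<in> U \<Longrightarrow> f (u + v) = f u + f v" "\<And>c u. u \<in> U \<Longrightarrow> f (s1 c u) = s3 c (f u)"
    and ker: "\<And>u. u \<in> U \<Longrightarrow> i u = 0 \<Longrightarrow> f u = 0"
  obtains \<psi> where "Vector_Spaces.linear s2 s3 \<psi>" "\<And>u. u \<in> U \<Longrightarrow> \<psi> (i u) = f u" "range \<psi> \<subseteq> f ` U"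
proof -
  interpret vector_space_pair s1 s2
    using vs by (simp add: vector_space_pair_def)
  interpret s3: vector_space s3 by fact
  obtain i' where i': "Vector_Spaces.linear s1 s2 i'" "\<And>u. u \<in> U \<Longrightarrow> i' u = i u"
    using linear_extension_on[of s1 s2 U i] vs U i by metis
  obtain f' where f': "Vector_Spaces.linear s1 s3 f'" "\<And>u. u \<in> U \<Longrightarrow> f' u = f u"
    using linear_extension_on[of s1 s3 U f] vs U f by metis
  obtain q where q: "q ` UNIV \<subseteq> U" "Vector_Spaces.linear s2 s1 q" "\<forall>v\<in>i' ` U. i' (q v) = v"
    using linear_exists_right_inverse_on[OF i'(1) U] by blast
  show thesis
  proof (rule that[of "f' \<circ> q"])
    show "Vector_Spaces.linear s2 s3 (f' \<circ> q)"
      using Vector_Spaces.linear_compose[OF q(2) f'(1)] .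
    show "range (f' \<circ> q) \<subseteq> f ` U"
      using q(1) f'(2) by (auto simp: subset_iff image_iff)
    interpret i': Vector_Spaces.linear s1 s2 i' by fact
    interpret f': Vector_Spaces.linear s1 s3 f' by fact
    fix u assume u: "u \<in> U"
    let ?w = "q (i u)"
    have w: "?w \<in> U" using q(1) by auto
    have "i' (?w - u) = 0"
      using q(3) u i'(2) by (simp add: i'.diff)
    then have "f (?w - u) = 0"
      using ker[of "?w - u"] i'(2) w u vs1.subspace_diff[OF U] by metis
    then have "f' (?w - u) = 0"
      using f'(2) w u vs1.subspace_diff[OF U] by metis
    then show "(f' \<circ> q) (i u) = f u"
      using f'(2)[OF u] by (simp add: f'.diff)
  qed
qed

section \<open>Elementary rules for kG-modules and their homomorphisms\<close>

context
  fixes G :: "'g monoid" and M :: "('g, 'k::field, 'v::ab_group_add) kG_mod"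
  assumes M: "kG_module G M"
begin

lemma module_vs: "vector_space (Mscale M)"
  and module_subspace: "module.subspace (Mscale M) (Mcarr M)"
  and module_group: "group G"
  using M by (auto simp: kG_module_def)

lemma module_zero: "0 \<in> Mcarr M"
  and module_add: "u \<in> Mcarr M \<Longrightarrow> v \<in> Mcarr M \<Longrightarrow> u + v \<in> Mcarr M"
  and module_diff: "u \<in> Mcarr M \<Longrightarrow> v \<in> Mcarr M \<Longrightarrow> u - v \<in> Mcarr M"
  and module_scale: "u \<in> Mcarr M \<Longrightarrow> Mscale M c u \<in> Mcarr M"
  and module_sum: "(\<And>x. x \<in> A \<Longrightarrow> F x \<in> Mcarr M) \<Longrightarrow> sum F A \<in> Mcarr M"
proof -
  interpret vector_space "Mscale M" by (rule module_vs)
  show "0 \<in> Mcarr M" "u \<in> Mcarr M \<Longrightarrow> v \<in> Mcarr M \<Longrightarrow> u + v \<in> Mcarr M"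
    "u \<in> Mcarr M \<Longrightarrow> v \<in> Mcarr M \<Longrightarrow> u - v \<in> Mcarr M"
    "u \<in> Mcarr M \<Longrightarrow> Mscale M c u \<in> Mcarr M"
    "(\<And>x. x \<in> A \<Longrightarrow> F x \<in> Mcarr M) \<Longrightarrow> sum F A \<in> Mcarr M"
    using module_subspace by (simp_all add: subspace_0 subspace_add subspace_diff subspace_scale subspace_sum)
qed

lemma module_act: "g \<in> carrier G \<Longrightarrow> u \<in> Mcarr M \<Longrightarrow> Mact M g u \<in> Mcarr M"
  and module_act_one: "u \<in> Mcarr M \<Longrightarrow> Mact M \<one>\<^bsub>G\<^esub> u = u"
  and module_act_mult: "g \<in> carrier G \<Longrightarrow> h \<in> carrier G \<Longrightarrow> u \<in> Mcarr M \<Longrightarrow>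
    Mact M (g \<otimes>\<^bsub>G\<^esub> h) u = Mact M g (Mact M h u)"
  and module_act_linear: "g \<in> carrier G \<Longrightarrow> Vector_Spaces.linear (Mscale M) (Mscale M) (Mact M g)"
  using M by (auto simp: kG_module_def)

lemma module_act_add: "g \<in> carrier G \<Longrightarrow> Mact M g (u + v) = Mact M g u + Mact M g v"
  and module_act_diff: "g \<in> carrier G \<Longrightarrow> Mact M g (u - v) = Mact M g u - Mact M g v"
  and module_act_zero: "g \<in> carrier G \<Longrightarrow> Mact M g 0 = 0"
  and module_act_scale: "g \<in> carrier G \<Longrightarrow> Mact M g (Mscale M c u) = Mscale M c (Mact M g u)"
  and module_act_sum: "g \<in> carrier G \<Longrightarrow> Mact M g (sum F A) = (\<Sum>x\<in>A. Mact M g (F x))"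
proof -
  assume "g \<in> carrier G"
  then interpret Vector_Spaces.linear "Mscale M" "Mscale M" "Mact M g" by (rule module_act_linear)
  show "Mact M g (u + v) = Mact M g u + Mact M g v" "Mact M g (u - v) = Mact M g u - Mact M g v"
    "Mact M g 0 = 0" "Mact M g (Mscale M c u) = Mscale M c (Mact M g u)"
    "Mact M g (sum F A) = (\<Sum>x\<in>A. Mact M g (F x))"
    by (simp_all add: add diff zero scale sum)
qed

end

lemma hom_mem: "f \<in> kG_hom G M N \<Longrightarrow> u \<in> Mcarr M \<Longrightarrow> f u \<in> Mcarr N"
  and hom_add: "f \<in> kG_hom G M N \<Longrightarrow> u \<in> Mcarr M \<Longrightarrow> v \<in> Mcarr M \<Longrightarrow> f (u + v) = f u + f v"
  and hom_scale: "f \<in> kG_hom G M N \<Longrightarrow> u \<in> Mcarr M \<Longrightarrow> f (Mscale M c u) = Mscale N c (f u)"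
  and hom_act: "f \<in> kG_hom G M N \<Longrightarrow> g \<in> carrier G \<Longrightarrow> u \<in> Mcarr M \<Longrightarrow> f (Mact M g u) = Mact N g (f u)"
  and hom_out: "f \<in> kG_hom G M N \<Longrightarrow> u \<notin> Mcarr M \<Longrightarrow> f u = 0"
  by (auto simp: kG_hom_def)

lemma hom_zero:
  assumes "f \<in> kG_hom G M N" "kG_module G M"
  shows "f 0 = 0"
  using hom_add[OF assms(1), of 0 0] module_zero[OF assms(2)] by simp

lemma hom_diff:
  assumes "f \<in> kG_hom G M N" "kG_module G M" "u \<in> Mcarr M" "v \<in> Mcarr M"
  shows "f (u - v) = f u - f v"
  using hom_add[OF assms(1), of "u - v" v] module_diff[OF assms(2-4)] assms(4)
  by (simp add: eq_diff_eq)

lemma hom_sum: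
  assumes f: "f \<in> kG_hom G M N" and M: "kG_module G M" and F: "\<And>x. x \<in> A \<Longrightarrow> F x \<in> Mcarr M"
  shows "f (sum F A) = (\<Sum>x\<in>A. f (F x))"
  using F
proof (induction A rule: infinite_finite_induct)
  case (insert x A)
  then have "f (F x + sum F A) = f (F x) + f (sum F A)"
    by (intro hom_add[OF f]) (auto intro: module_sum[OF M])
  then show ?case
    using insert by simp
qed (simp_all add: hom_zero[OF f M])

lemma hom_0: "kG_module G N \<Longrightarrow> 0 \<in> kG_hom G M N"
  by (auto simp: kG_hom_def module_zero module_act_zero module.scale_zero_right
      dest!: module_vs simp flip: module_iff_vector_space)

lemma hom_plus:
  assumes N: "kG_module G N" and f: "f \<in> kG_hom G M N" "g \<in> kG_hom G M N"
  shows "f + g \<in> kG_hom G M N"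
proof -
  interpret vector_space "Mscale N" using module_vs[OF N] .
  show ?thesis
    using f by (auto simp: kG_hom_def module_add[OF N] module_act_add[OF N] scale_right_distrib)
qed

lemma hom_smult:
  assumes N: "kG_module G N" and f: "f \<in> kG_hom G M N"
  shows "(\<lambda>v. Mscale N c (f v)) \<in> kG_hom G M N"
proof -
  interpret vector_space "Mscale N" using module_vs[OF N] .
  show ?thesis
    using f by (auto simp: kG_hom_def module_scale[OF N] module_act_scale[OF N] scale_right_distrib mult.commute)
qed

lemma hom_comp:
  assumes "kG_module G N" "f \<in> kG_hom G L M" "g \<in> kG_hom G M N" "kG_module G M"
  shows "g \<circ> f \<in> kG_hom G L N"
  using assms hom_zero[OF assms(3,4)] by (auto simp: kG_hom_def)

lemma hom_eqI:
  assumes "f \<in> kG_hom G M N" "g \<in> kG_hom G M N" "\<And>v. v \<in> Mcarr M \<Longrightarrow> f v = g v"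
  shows "f = g"
  using assms by (metis ext hom_out)

lemma trivial_kG_module: "group G \<Longrightarrow> kG_module G (trivial_module :: ('g, 'k::field, 'k) kG_mod)"
proof -
  assume "group G"
  have vs: "vector_space ((*) :: 'k \<Rightarrow> 'k \<Rightarrow> 'k)"
    by unfold_locales (auto simp: algebra_simps)
  interpret vector_space "(*) :: 'k \<Rightarrow> 'k \<Rightarrow> 'k" by fact
  show ?thesis
    using \<open>group G\<close> vs
    by (auto simp: kG_module_def trivial_module_def subspace_def Vector_Spaces.linear_iff)
qed

section \<open>Free modules, their universal property, and projective modules\<close>

lemma free_module_simps [simp]:
  "Mscale (free_module G S) c f p = c * f p"
  "Mact (free_module G S) g f (i, h) = (if h \<in> carrier G then f (i, inv\<^bsub>G\<^esub> g \<otimes>\<^bsub>G\<^esub> h) else 0)"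
  by (simp_all add: free_module_def)

lemma free_carr_iff:
  "f \<in> Mcarr (free_module G S) \<longleftrightarrow>
    finite {p. f p \<noteq> 0} \<and> (\<forall>i h. f (i, h) \<noteq> 0 \<longrightarrow> i \<in> S \<and> h \<in> carrier G)"
  by (simp add: free_module_def)

lemma free_vs: "vector_space (Mscale (free_module G S :: ('g, 'k::field, 'i \<times> 'g \<Rightarrow> 'k) kG_mod))"
  by unfold_locales (auto simp: fun_eq_iff free_module_def algebra_simps)

lemma free_kG_module:
  assumes G: "group G"
  shows "kG_module G (free_module G S :: ('g, 'k::field, 'i \<times> 'g \<Rightarrow> 'k) kG_mod)"
proof -
  interpret group G by fact
  let ?F = "free_module G S :: ('g, 'k, 'i \<times> 'g \<Rightarrow> 'k) kG_mod"
  interpret vector_space "Mscale ?F" by (rule free_vs)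
  have "subspace (Mcarr ?F)"
    unfolding subspace_def
  proof (intro conjI allI ballI)
    show "0 \<in> Mcarr ?F" by (simp add: free_carr_iff)
    fix x y assume x: "x \<in> Mcarr ?F" and y: "y \<in> Mcarr ?F"
    have "{p. (x + y) p \<noteq> 0} \<subseteq> {p. x p \<noteq> 0} \<union> {p. y p \<noteq> 0}"
      by auto
    then show "x + y \<in> Mcarr ?F"
      using x y by (auto simp: free_carr_iff intro: finite_subset)
  next
    fix c x assume x: "x \<in> Mcarr ?F"
    have "{p. Mscale ?F c x p \<noteq> 0} \<subseteq> {p. x p \<noteq> 0}"
      by auto
    then show "Mscale ?F c x \<in> Mcarr ?F"
      using x by (auto simp: free_carr_iff intro: finite_subset)
  qed
  moreover have "Mact ?F g x \<in> Mcarr ?F" if g: "g \<in> carrier G" and x: "x \<in> Mcarr ?F" for g x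
  proof -
    have "{p. Mact ?F g x p \<noteq> 0} \<subseteq> (\<lambda>(i, h). (i, g \<otimes>\<^bsub>G\<^esub> h)) ` {p. x p \<noteq> 0}"
    proof
      fix p assume "p \<in> {p. Mact ?F g x p \<noteq> 0}"
      then obtain i h where p: "p = (i, h)" "h \<in> carrier G" "x (i, inv\<^bsub>G\<^esub> g \<otimes>\<^bsub>G\<^esub> h) \<noteq> 0"
        by (cases p) (auto split: if_splits)
      then show "p \<in> (\<lambda>(i, h). (i, g \<otimes>\<^bsub>G\<^esub> h)) ` {p. x p \<noteq> 0}"
        using g by (intro image_eqI[of _ _ "(i, inv\<^bsub>G\<^esub> g \<otimes>\<^bsub>G\<^esub> h)"]) (auto simp: m_assoc[symmetric])
    qed
    then show ?thesis
      using x g by (auto simp: free_carr_iff intro: finite_subset split: if_splits)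
  qed
  moreover have "Vector_Spaces.linear (Mscale ?F) (Mscale ?F) (Mact ?F g)" for g
    by (auto simp: Vector_Spaces.linear_iff free_vs fun_eq_iff)
  moreover have "Mact ?F \<one>\<^bsub>G\<^esub> x = x" if "x \<in> Mcarr ?F" for x
    using that by (auto simp: fun_eq_iff free_carr_iff)
  moreover have "Mact ?F (g \<otimes>\<^bsub>G\<^esub> h) x = Mact ?F g (Mact ?F h x)"
    if "g \<in> carrier G" "h \<in> carrier G" "x \<in> Mcarr ?F" for g h x
    using that by (auto simp: fun_eq_iff inv_mult_group m_assoc)
  ultimately show ?thesis
    using G free_vs by (auto simp: kG_module_def)
qed

definition free_gen :: "'i \<Rightarrow> 'g \<Rightarrow> 'i \<times> 'g \<Rightarrow> 'k::field" where
  "free_gen i g = (\<lambda>p. if p = (i, g) then 1 else 0)"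

lemma free_gen_carr: "i \<in> S \<Longrightarrow> g \<in> carrier G \<Longrightarrow> free_gen i g \<in> Mcarr (free_module G S)"
  by (auto simp: free_carr_iff free_gen_def)

lemma free_gen_act:
  assumes "group G" "g \<in> carrier G" "h \<in> carrier G"
  shows "Mact (free_module G S) g (free_gen i h) = free_gen i (g \<otimes>\<^bsub>G\<^esub> h)"
proof -
  interpret group G by fact
  have "inv\<^bsub>G\<^esub> g \<otimes>\<^bsub>G\<^esub> h' = h \<longleftrightarrow> h' = g \<otimes>\<^bsub>G\<^esub> h" if "h' \<in> carrier G" for h'
    using assms that by (metis inv_solve_left)
  then show ?thesis
    using assms by (auto simp: fun_eq_iff free_gen_def)
qed

lemma sum_fun_apply: "(\<Sum>a\<in>A. f a) x = (\<Sum>a\<in>A. f a x)"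
  by (induction A rule: infinite_finite_induct) auto

lemma free_expansion:
  assumes "f \<in> Mcarr (free_module G S)"
  shows "f = (\<Sum>p | f p \<noteq> 0. Mscale (free_module G S) (f p) (free_gen (fst p) (snd p)))"
proof
  fix q
  have fin: "finite {p. f p \<noteq> 0}"
    using assms by (simp add: free_carr_iff)
  have "(\<Sum>p | f p \<noteq> 0. Mscale (free_module G S) (f p) (free_gen (fst p) (snd p))) q =
      (\<Sum>p | f p \<noteq> 0. if p = q then f q else 0)"
    unfolding sum_fun_apply by (rule sum.cong) (auto simp: free_gen_def)
  also have "\<dots> = f q"
    using fin by (simp add: sum.delta)
  finally show "f q = (\<Sum>p | f p \<noteq> 0. Mscale (free_module G S) (f p) (free_gen (fst p) (snd p))) q"
    by simp
qed

definition free_lift ::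
  "('g, 'k::field, 'v::ab_group_add) kG_mod \<Rightarrow> 'g monoid \<Rightarrow> 'i set \<Rightarrow> ('i \<Rightarrow> 'v) \<Rightarrow> ('i \<times> 'g \<Rightarrow> 'k) \<Rightarrow> 'v" where
  "free_lift N G S n f = (if f \<in> Mcarr (free_module G S)
     then \<Sum>p | f p \<noteq> 0. Mscale N (f p) (Mact N (snd p) (n (fst p))) else 0)"

lemma free_lift:
  fixes S :: "'i set" and N :: "('g, 'k::field, 'v::ab_group_add) kG_mod"
  assumes N: "kG_module G N" and n: "\<And>i. i \<in> S \<Longrightarrow> n i \<in> Mcarr N"
  shows free_lift_hom: "free_lift N G S n \<in> kG_hom G (free_module G S) N"
    and free_lift_gen: "i \<in> S \<Longrightarrow> g \<in> carrier G \<Longrightarrow> free_lift N G S n (free_gen i g) = Mact N g (n i)"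
proof -
  interpret group G using module_group[OF N] .
  interpret vector_space "Mscale N" using module_vs[OF N] .
  let ?F = "free_module G S :: ('g, 'k, 'i \<times> 'g \<Rightarrow> 'k) kG_mod"
  have F: "kG_module G ?F" by (rule free_kG_module) (rule group_axioms)
  define t where "t p = Mact N (snd p) (n (fst p))" for p
  have carr: "fst p \<in> S \<and> snd p \<in> carrier G" if "f \<in> Mcarr ?F" "f p \<noteq> 0" for f p
    using that by (cases p) (auto simp: free_carr_iff)
  have superset: "free_lift N G S n f = (\<Sum>p\<in>A. Mscale N (f p) (t p))"
    if "f \<in> Mcarr ?F" "finite A" "{p. f p \<noteq> 0} \<subseteq> A" for f A
    unfolding free_lift_def t_def using that by (auto intro!: sum.mono_neutral_left)
  have supp: "finite {p. f p \<noteq> 0}" if "f \<in> Mcarr ?F" for f :: "'i \<times> 'g \<Rightarrow> 'k"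
    using that by (simp add: free_carr_iff)
  show gen: "free_lift N G S n (free_gen i g) = Mact N g (n i)" if "i \<in> S" "g \<in> carrier G" for i g
    using superset[OF free_gen_carr[OF that], of "{(i, g)}"] by (auto simp: free_gen_def t_def split: if_splits)
  show "free_lift N G S n \<in> kG_hom G ?F N"
    unfolding kG_hom_def
  proof (intro CollectI conjI ballI allI impI)
    fix f assume f: "f \<in> Mcarr ?F"
    show "free_lift N G S n f \<in> Mcarr N"
      using f carr[OF f] by (auto simp: free_lift_def intro!: module_sum[OF N] module_scale[OF N] module_act[OF N] n)
    show "free_lift N G S n (Mscale ?F c f) = Mscale N c (free_lift N G S n f)" for c
      using superset[OF module_scale[OF F f], of "{p. f p \<noteq> 0}" c] superset[OF f, of "{p. f p \<noteq> 0}"] supp[OF f]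
      by (auto simp: scale_sum_right)
    fix h assume h: "h \<in> carrier G"
    \<comment> \<open>Acting by \<open>h\<close> translates the support, so the sum for the
      translate is reindexed over the support of \<open>f\<close>.\<close>
    let ?\<tau> = "\<lambda>p. (fst p, h \<otimes>\<^bsub>G\<^esub> snd p)"
    have inj: "inj_on ?\<tau> {p. f p \<noteq> 0}"
      using h carr[OF f] by (auto simp: inj_on_def)
    have "{p. Mact ?F h f p \<noteq> 0} \<subseteq> ?\<tau> ` {p. f p \<noteq> 0}"
    proof
      fix p assume "p \<in> {p. Mact ?F h f p \<noteq> 0}"
      then show "p \<in> ?\<tau> ` {p. f p \<noteq> 0}"
        using h by (cases p) (auto intro!: image_eqI[of _ _ "(fst p, inv\<^bsub>G\<^esub> h \<otimes>\<^bsub>G\<^esub> snd p)"] simp: m_assoc[symmetric] split: if_splits)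
    qed
    then have "free_lift N G S n (Mact ?F h f) = (\<Sum>p | f p \<noteq> 0. Mscale N (Mact ?F h f (?\<tau> p)) (t (?\<tau> p)))"
      using superset[OF module_act[OF F h f], of "?\<tau> ` {p. f p \<noteq> 0}"] supp[OF f]
      by (simp add: sum.reindex[OF inj] o_def del: free_module_simps)
    also have "\<dots> = (\<Sum>p | f p \<noteq> 0. Mact N h (Mscale N (f p) (t p)))"
    proof (rule sum.cong)
      fix p assume "p \<in> {p. f p \<noteq> 0}"
      then have p: "fst p \<in> S" "snd p \<in> carrier G" using carr[OF f] by auto
      then show "Mscale N (Mact ?F h f (?\<tau> p)) (t (?\<tau> p)) = Mact N h (Mscale N (f p) (t p))"
        using h n by (simp add: t_def module_act_scale[OF N] module_act_mult[OF N] m_assoc[symmetric])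
    qed simp
    also have "\<dots> = Mact N h (free_lift N G S n f)"
      using superset[OF f] supp[OF f] by (simp add: module_act_sum[OF N h])
    finally show "free_lift N G S n (Mact ?F h f) = Mact N h (free_lift N G S n f)" .
  next
    fix f f' assume f: "f \<in> Mcarr ?F" "f' \<in> Mcarr ?F"
    let ?A = "{p. f p \<noteq> 0} \<union> {p. f' p \<noteq> 0}"
    have "finite ?A" using f supp by auto
    moreover have "{p. (f + f') p \<noteq> 0} \<subseteq> ?A" by auto
    ultimately show "free_lift N G S n (f + f') = free_lift N G S n f + free_lift N G S n f'"
      using superset[OF module_add[OF F f], of ?A] superset[OF f(1), of ?A] superset[OF f(2), of ?A]
      by (simp add: scale_left_distrib sum.distrib)
  qed (simp add: free_lift_def)
qed

lemma free_hom_eqI: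
  fixes f f' :: "('i \<times> 'g \<Rightarrow> 'k::field) \<Rightarrow> 'v::ab_group_add"
  assumes N: "kG_module G N" and f: "f \<in> kG_hom G (free_module G S) N" "f' \<in> kG_hom G (free_module G S) N"
    and eq: "\<And>i. i \<in> S \<Longrightarrow> f (free_gen i \<one>\<^bsub>G\<^esub>) = f' (free_gen i \<one>\<^bsub>G\<^esub>)"
  shows "f = f'"
proof (rule hom_eqI[OF f])
  interpret group G using module_group[OF N] .
  fix v :: "'i \<times> 'g \<Rightarrow> 'k" assume v: "v \<in> Mcarr (free_module G S)"
  have F: "kG_module G (free_module G S)" by (rule free_kG_module) (rule group_axioms)
  have gen: "f (free_gen i g) = f' (free_gen i g)" if "i \<in> S" "g \<in> carrier G" for i g
  proof -
    have g: "Mact (free_module G S) g (free_gen i \<one>\<^bsub>G\<^esub>) = free_gen i g"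
      using that free_gen_act[OF group_axioms, of g "\<one>\<^bsub>G\<^esub>" S i] by simp
    have "free_gen i \<one>\<^bsub>G\<^esub> \<in> Mcarr (free_module G S)"
      using that by (simp add: free_gen_carr)
    from hom_act[OF f(1) that(2) this] hom_act[OF f(2) that(2) this] show ?thesis
      using eq[OF that(1)] by (simp only: g)
  qed
  have p: "fst p \<in> S \<and> snd p \<in> carrier G" if "v p \<noteq> 0" for p
    using that v by (cases p) (auto simp: free_carr_iff)
  have expand: "k v = (\<Sum>p | v p \<noteq> 0. Mscale N (v p) (k (free_gen (fst p) (snd p))))"
    if k: "k \<in> kG_hom G (free_module G S) N" for k
  proof -
    have "k v = k (\<Sum>p | v p \<noteq> 0. Mscale (free_module G S) (v p) (free_gen (fst p) (snd p)))"
      using free_expansion[OF v] by (rule arg_cong)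
    also have "\<dots> = (\<Sum>p | v p \<noteq> 0. k (Mscale (free_module G S) (v p) (free_gen (fst p) (snd p))))"
      by (rule hom_sum[OF k F]) (use p in \<open>auto intro!: module_scale[OF F] free_gen_carr\<close>)
    also have "\<dots> = (\<Sum>p | v p \<noteq> 0. Mscale N (v p) (k (free_gen (fst p) (snd p))))"
      by (rule sum.cong) (use p in \<open>auto simp: free_gen_carr hom_scale[OF k]\<close>)
    finally show ?thesis .
  qed
  show "f v = f' v"
    unfolding expand[OF f(1)] expand[OF f(2)] by (rule sum.cong) (use p gen in auto)
qed

text \<open>Projectivity is tested on the free module on the underlying set, so the free module on
  \<open>S\<close> must be exhibited as a summand of that much larger one: \<open>e_i\<close> goes
  to the generator indexed by the element \<open>e_i\<close>, and the projection evaluates a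
  generator to its index.\<close>

lemma projective_free:
  assumes G: "group G"
  shows "projective_module G (free_module G S :: ('g, 'k::field, 'i \<times> 'g \<Rightarrow> 'k) kG_mod)"
proof -
  interpret group G by fact
  let ?F = "free_module G S :: ('g, 'k, 'i \<times> 'g \<Rightarrow> 'k) kG_mod"
  let ?F2 = "free_module G (Mcarr ?F) :: ('g, 'k, ('i \<times> 'g \<Rightarrow> 'k) \<times> 'g \<Rightarrow> 'k) kG_mod"
  have F: "kG_module G ?F" "kG_module G ?F2" using free_kG_module[OF G] by auto
  let ?\<iota> = "free_lift ?F2 G S (\<lambda>i. free_gen (free_gen i \<one>\<^bsub>G\<^esub>) \<one>\<^bsub>G\<^esub>)"
  let ?\<pi> = "free_lift ?F G (Mcarr ?F) (\<lambda>v. v)"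
  have \<iota>: "?\<iota> \<in> kG_hom G ?F ?F2"
    by (intro free_lift_hom F free_gen_carr) auto
  have \<pi>: "?\<pi> \<in> kG_hom G ?F2 ?F"
    by (intro free_lift_hom F)
  have "?\<pi> \<circ> ?\<iota> = (\<lambda>v. if v \<in> Mcarr ?F then v else 0)"
  proof (rule free_hom_eqI[OF F(1)])
    show "?\<pi> \<circ> ?\<iota> \<in> kG_hom G ?F ?F" using hom_comp F \<iota> \<pi> by blast
    show "(\<lambda>v. if v \<in> Mcarr ?F then v else 0) \<in> kG_hom G ?F ?F"
      by (auto simp: kG_hom_def module_add[OF F(1)] module_scale[OF F(1)] module_act[OF F(1)])
    fix i assume i: "i \<in> S"
    have g: "free_gen i \<one>\<^bsub>G\<^esub> \<in> Mcarr ?F" using i by (intro free_gen_carr) auto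
    have "?\<iota> (free_gen i \<one>\<^bsub>G\<^esub>) = free_gen (free_gen i \<one>\<^bsub>G\<^esub>) \<one>\<^bsub>G\<^esub>"
      using i by (subst free_lift_gen) (auto simp: F(2) free_gen_carr free_gen_act[OF G])
    then show "(?\<pi> \<circ> ?\<iota>) (free_gen i \<one>\<^bsub>G\<^esub>) = (if free_gen i \<one>\<^bsub>G\<^esub> \<in> Mcarr ?F then free_gen i \<one>\<^bsub>G\<^esub> else 0)"
      using g by (simp add: free_lift_gen[OF F(1)] module_act_one[OF F(1)])
  qed
  then have "\<forall>v\<in>Mcarr ?F. ?\<pi> (?\<iota> v) = v"
    by (auto simp: fun_eq_iff)
  with F(1) \<iota> \<pi> show ?thesis
    unfolding projective_module_def by (intro conjI bexI)
qed

text \<open>On the free module covering \<open>M\<close> a lift arises by choosing preimages for the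
  images of the generators; composed with the section \<open>\<iota>\<close> it becomes a lift on
  \<open>M\<close>. Only an inclusion of images is assumed instead of surjectivity, because lifts
  are taken along differentials, whose images are the cycles.\<close>

lemma projective_lift:
  fixes M :: "('g, 'k::field, 'v::ab_group_add) kG_mod"
  assumes M: "projective_module G M" and N: "kG_module G N" "kG_module G N'"
    and p: "p \<in> kG_hom G N N'" and f: "f \<in> kG_hom G M N'" and sub: "f ` Mcarr M \<subseteq> p ` Mcarr N"
  obtains f' where "f' \<in> kG_hom G M N" "p \<circ> f' = f"
proof -
  let ?F = "free_module G (Mcarr M) :: ('g, 'k, 'v \<times> 'g \<Rightarrow> 'k) kG_mod"
  interpret group G using module_group[OF N(1)] .
  have F: "kG_module G ?F" by (rule free_kG_module) (rule group_axioms)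
  have M': "kG_module G M" using M by (simp add: projective_module_def)
  obtain \<iota> \<pi> where \<iota>: "\<iota> \<in> kG_hom G M ?F" and \<pi>: "\<pi> \<in> kG_hom G ?F M" and \<pi>\<iota>: "\<And>v. v \<in> Mcarr M \<Longrightarrow> \<pi> (\<iota> v) = v"
    using M by (auto simp: projective_module_def)
  have "\<exists>n\<in>Mcarr N. p n = f (\<pi> (free_gen i \<one>\<^bsub>G\<^esub>))" if "i \<in> Mcarr M" for i
    using hom_mem[OF \<pi> free_gen_carr[OF that one_closed]] sub by (metis (no_types, lifting) image_eqI image_iff subsetD)
  then obtain n where n: "\<And>i. i \<in> Mcarr M \<Longrightarrow> n i \<in> Mcarr N" "\<And>i. i \<in> Mcarr M \<Longrightarrow> p (n i) = f (\<pi> (free_gen i \<one>\<^bsub>G\<^esub>))"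
    by metis
  let ?l = "free_lift N G (Mcarr M) n"
  have l: "?l \<in> kG_hom G ?F N" using N(1) n(1) by (rule free_lift_hom)
  have "p \<circ> ?l = f \<circ> \<pi>"
    by (rule free_hom_eqI[OF N(2)])
      (use N F M' l p f \<pi> in \<open>auto intro: hom_comp simp: free_lift_gen[OF N(1) n(1)] module_act_one[OF N(1)] n\<close>)
  then have "p (?l (\<iota> v)) = f (\<pi> (\<iota> v))" for v
    by (rule o_eq_dest)
  then have "p (?l (\<iota> v)) = f v" for v
    using \<pi>\<iota> hom_out[OF f] hom_out[OF \<iota>] hom_zero[OF l F] hom_zero[OF p N(1)]
    by (cases "v \<in> Mcarr M") simp_all
  then have "p \<circ> (?l \<circ> \<iota>) = f"
    by (simp add: fun_eq_iff)
  moreover have "?l \<circ> \<iota> \<in> kG_hom G M N" using N(1) \<iota> l F by (rule hom_comp)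
  ultimately show thesis using that by blast
qed

text \<open>
  Over a finite group a free module is also coinduced, hence relatively injective: a map into it is
  determined by the coefficients at \<open>\<one>\<close>, and these extend \<open>k\<close>-linearly.
\<close>

lemma projective_extend:
  fixes M :: "('g, 'k::field, 'v::ab_group_add) kG_mod"
  assumes fin: "finite (carrier G)" and M: "projective_module G M"
    and N: "kG_module G N" "kG_module G N'"
    and i: "i \<in> kG_hom G N N'" and f: "f \<in> kG_hom G N M"
    and ker: "\<And>v. v \<in> Mcarr N \<Longrightarrow> i v = 0 \<Longrightarrow> f v = 0"
  obtains f' where "f' \<in> kG_hom G N' M" "f' \<circ> i = f"
proof -
  let ?F = "free_module G (Mcarr M) :: ('g, 'k, 'v \<times> 'g \<Rightarrow> 'k) kG_mod"
  interpret group G using module_group[OF N(1)] .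
  have F: "kG_module G ?F" by (rule free_kG_module) (rule group_axioms)
  have M': "kG_module G M" using M by (simp add: projective_module_def)
  obtain \<iota> \<pi> where \<iota>: "\<iota> \<in> kG_hom G M ?F" and \<pi>: "\<pi> \<in> kG_hom G ?F M" and \<pi>\<iota>: "\<And>v. v \<in> Mcarr M \<Longrightarrow> \<pi> (\<iota> v) = v"
    using M by (auto simp: projective_module_def)
  have "\<exists>\<psi>. Vector_Spaces.linear (Mscale N') (Mscale M) \<psi> \<and> (\<forall>v\<in>Mcarr N. \<psi> (i v) = f v) \<and> range \<psi> \<subseteq> f ` Mcarr N"
    by (rule linear_factor_through[OF module_vs[OF N(1)] module_vs[OF N(2)] module_vs[OF M'] module_subspace[OF N(1)], of i f])
      (simp_all add: hom_add[OF i] hom_scale[OF i] hom_add[OF f] hom_scale[OF f] ker, blast)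
  then obtain \<psi> where \<psi>: "Vector_Spaces.linear (Mscale N') (Mscale M) \<psi>" "\<And>v. v \<in> Mcarr N \<Longrightarrow> \<psi> (i v) = f v"
      "range \<psi> \<subseteq> f ` Mcarr N"
    by blast
  interpret \<psi>: Vector_Spaces.linear "Mscale N'" "Mscale M" \<psi> by fact
  have \<psi>M: "\<psi> w \<in> Mcarr M" for w
  proof -
    have "\<psi> w \<in> f ` Mcarr N" using \<psi>(3) by (rule subsetD) simp
    then show ?thesis by (auto simp: hom_mem[OF f])
  qed
  \<comment> \<open>The coefficient of an equivariant map at \<open>g\<close> is its coefficient at
    \<open>\<one>\<close> after acting by the inverse of \<open>g\<close>. So the merely linear map
    \<open>\<psi>\<close> suffices to define an equivariant one.\<close>
  define \<Theta> where "\<Theta> w = (if w \<in> Mcarr N' then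
    (\<lambda>(s, g). if g \<in> carrier G then \<iota> (\<psi> (Mact N' (inv\<^bsub>G\<^esub> g) w)) (s, \<one>\<^bsub>G\<^esub>) else 0) else 0)" for w
  have \<Theta>: "\<Theta> \<in> kG_hom G N' ?F"
    unfolding kG_hom_def
  proof (intro CollectI conjI ballI allI impI)
    fix w assume w: "w \<in> Mcarr N'"
    let ?A = "\<Union>g\<in>carrier G. (\<lambda>p. (fst p, g)) ` {p. \<iota> (\<psi> (Mact N' (inv\<^bsub>G\<^esub> g) w)) p \<noteq> 0}"
    have fr: "\<iota> (\<psi> v) \<in> Mcarr ?F" for v using hom_mem[OF \<iota> \<psi>M] .
    have "finite ?A" using fin fr by (auto simp: free_carr_iff)
    moreover have "{p. \<Theta> w p \<noteq> 0} \<subseteq> ?A"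
      using w by (auto simp: \<Theta>_def image_iff split: if_splits)
    ultimately have "finite {p. \<Theta> w p \<noteq> 0}" by (rule rev_finite_subset)
    moreover have "s \<in> Mcarr M \<and> g \<in> carrier G" if "\<Theta> w (s, g) \<noteq> 0" for s g
      using that w fr[of "Mact N' (inv\<^bsub>G\<^esub> g) w"] by (auto simp: \<Theta>_def free_carr_iff split: if_splits)
    ultimately show "\<Theta> w \<in> Mcarr ?F" by (auto simp: free_carr_iff)
    show "\<Theta> (Mscale N' c w) = Mscale ?F c (\<Theta> w)" for c
      using w by (auto simp: \<Theta>_def fun_eq_iff module_scale[OF N(2)] module_act_scale[OF N(2)] \<psi>.scale hom_scale[OF \<iota>] \<psi>M)
    show "\<Theta> (Mact N' h w) = Mact ?F h (\<Theta> w)" if "h \<in> carrier G" for h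
      using w that by (auto simp: \<Theta>_def fun_eq_iff module_act[OF N(2)] module_act_mult[OF N(2), symmetric] inv_mult_group)
  next
    fix u v assume "u \<in> Mcarr N'" "v \<in> Mcarr N'"
    then show "\<Theta> (u + v) = \<Theta> u + \<Theta> v"
      by (auto simp: \<Theta>_def fun_eq_iff module_add[OF N(2)] module_act_add[OF N(2)] \<psi>.add hom_add[OF \<iota>] \<psi>M)
  qed (simp add: \<Theta>_def)
  have "\<Theta> (i v) = \<iota> (f v)" if v: "v \<in> Mcarr N" for v
  proof
    fix p :: "'v \<times> 'g"
    obtain s g where p: "p = (s, g)" by (cases p)
    show "\<Theta> (i v) p = \<iota> (f v) p"
    proof (cases "g \<in> carrier G")
      case True
      have "\<psi> (Mact N' (inv\<^bsub>G\<^esub> g) (i v)) = Mact M (inv\<^bsub>G\<^esub> g) (f v)"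
        using True v \<psi>(2)[of "Mact N (inv\<^bsub>G\<^esub> g) v"] by (simp add: hom_act[OF i] hom_act[OF f] module_act[OF N(1)])
      then show ?thesis
        using True v by (simp add: p \<Theta>_def hom_mem[OF i] hom_act[OF \<iota>] hom_mem[OF f])
    next
      case False
      then show ?thesis
        using hom_mem[OF \<iota> hom_mem[OF f v]] hom_mem[OF i v] by (auto simp: p \<Theta>_def free_carr_iff)
    qed
  qed
  then have "\<pi> (\<Theta> (i v)) = f v" for v
    using \<pi>\<iota> hom_mem[OF f] hom_out[OF f] hom_out[OF i] hom_zero[OF \<Theta> N(2)] hom_zero[OF \<pi> F]
    by (cases "v \<in> Mcarr N") simp_all
  then have "\<pi> \<circ> \<Theta> \<circ> i = f"
    by (simp add: fun_eq_iff)
  moreover have "\<pi> \<circ> \<Theta> \<in> kG_hom G N' M" using M' \<Theta> \<pi> F by (rule hom_comp)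
  ultimately show thesis using that by blast
qed

section \<open>Chain maps and homotopies between complete resolutions\<close>

text \<open>Complete resolutions are unbounded in both directions, so families of maps are built
  from degree 0 upwards and downwards. \<open>I\<close> is the invariant that makes the next step
  possible, \<open>Q\<close> the relation between neighbours.\<close>

lemma int_dependent_choice:
  fixes I :: "int \<Rightarrow> 'a \<Rightarrow> bool"
  assumes start: "I 0 x0"
    and up: "\<And>j x. I j x \<Longrightarrow> \<exists>y. I (j + 1) y \<and> Q j x y"
    and down: "\<And>j y. I j y \<Longrightarrow> \<exists>x. I (j - 1) x \<and> Q (j - 1) x y"
  obtains h where "h 0 = x0" "\<And>j. I j (h j)" "\<And>j. Q j (h j) (h (j + 1))"
proof -
  obtain u where u0: "u 0 = x0" and u: "\<And>n. I (int n) (u n)" "\<And>n. Q (int n) (u n) (u (Suc n))"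
    using dependent_nat_choice[of "\<lambda>n x. I (int n) x \<and> (n = 0 \<longrightarrow> x = x0)" "\<lambda>n x y. Q (int n) x y"] start up
    by (metis nat.distinct(1) of_nat_0 of_nat_Suc add.commute)
  obtain l where l0: "l 0 = x0" and l: "\<And>n. I (- int n) (l n)" "\<And>n. Q (- int (Suc n)) (l (Suc n)) (l n)"
  proof -
    have "\<exists>y. (I (- int (Suc n)) y \<and> (Suc n = 0 \<longrightarrow> y = x0)) \<and> Q (- int (Suc n)) y x"
      if "I (- int n) x \<and> (n = 0 \<longrightarrow> x = x0)" for n x
    proof -
      have e: "- int (Suc n) = - int n - 1" by simp
      show ?thesis using down[of "- int n" x] that unfolding e by blast
    qed
    then show ?thesis
      using dependent_nat_choice[of "\<lambda>n x. I (- int n) x \<and> (n = 0 \<longrightarrow> x = x0)" "\<lambda>n x y. Q (- int (Suc n)) y x"] start that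
      by (metis minus_zero of_nat_0)
  qed
  define h where "h j = (if 0 \<le> j then u (nat j) else l (nat (- j)))" for j
  have neg: "h j = l (nat (- j))" if "j \<le> 0" for j
    using that u0 l0 by (cases "j = 0") (auto simp: h_def)
  show thesis
  proof (rule that)
    show "h 0 = x0" by (simp add: h_def u0)
    show "I j (h j)" for j
      using u(1)[of "nat j"] l(1)[of "nat (- j)"] by (auto simp: h_def)
    show "Q j (h j) (h (j + 1))" for j
    proof (cases "0 \<le> j")
      case True
      then show ?thesis
        using u(2)[of "nat j"] by (simp add: h_def nat_add_distrib)
    next
      case False
      define m where "m = nat (- j - 1)"
      have m: "- int (Suc m) = j" "nat (- j) = Suc m" "nat (- (j + 1)) = m"
        using False by (auto simp: m_def)
      show ?thesis
        using l(2)[of m] False neg[of j] neg[of "j + 1"] by (simp only: m)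
    qed
  qed
qed

section \<open>Elementary rules for complete resolutions\<close>

context
  fixes G :: "'g monoid" and P :: "('g, 'k::field, 'v::ab_group_add) complete_res"
  assumes P: "complete_resolution G P"
begin

lemma res_projective: "projective_module G (Pobj P j)"
  using P by (simp add: complete_resolution_def)

lemma res_module: "kG_module G (Pobj P j)"
  using res_projective[of j] by (simp add: projective_module_def)

lemma res_group: "group G"
  using module_group[OF res_module[of 0]] .

lemma res_bd: "Pbd P j \<in> kG_hom G (Pobj P j) (Pobj P (j - 1))"
  using P by (simp add: complete_resolution_def)

lemma res_bd': "Pbd P (j + 1) \<in> kG_hom G (Pobj P (j + 1)) (Pobj P j)"
  using res_bd[of "j + 1"] by simp

lemma res_image: "Pbd P (j + 1) ` Mcarr (Pobj P (j + 1)) = {v \<in> Mcarr (Pobj P j). Pbd P j v = 0}"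
  using P by (simp add: complete_resolution_def)

lemma res_bd_zero [simp]: "Pbd P j 0 = 0"
  using hom_zero[OF res_bd res_module] .

lemma res_bd_bd: "Pbd P j (Pbd P (j + 1) v) = 0"
proof (cases "v \<in> Mcarr (Pobj P (j + 1))")
  case True
  then have "Pbd P (j + 1) v \<in> {v \<in> Mcarr (Pobj P j). Pbd P j v = 0}"
    unfolding res_image[symmetric] by simp
  then show ?thesis by simp
qed (simp add: hom_out[OF res_bd])

lemma res_aug: "Paug P \<in> kG_hom G (Pobj P 0) trivial_module"
  and res_coaug: "Pcoaug P \<in> kG_hom G trivial_module (Pobj P (-1))"
  and res_aug_surj: "Paug P ` Mcarr (Pobj P 0) = UNIV"
  using P by (simp_all add: complete_resolution_def)

lemma trivial_simps [simp]:
  "Mcarr (trivial_module :: ('g, 'k, 'k) kG_mod) = UNIV"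
  "Mscale (trivial_module :: ('g, 'k, 'k) kG_mod) = (*)"
  "Mact (trivial_module :: ('g, 'k, 'k) kG_mod) g c = c"
  by (simp_all add: trivial_module_def)

lemma res_trivial: "kG_module G (trivial_module :: ('g, 'k, 'k) kG_mod)"
  by (rule trivial_kG_module) (rule res_group)

lemma res_aug_zero [simp]: "Paug P 0 = 0"
  using hom_zero[OF res_aug res_module] .

lemma res_coaug_zero [simp]: "Pcoaug P 0 = 0"
  using hom_zero[OF res_coaug res_trivial] .

lemma res_bd_0: "Pbd P 0 v = Pcoaug P (Paug P v)"
  using P hom_out[OF res_aug, of v] hom_out[OF res_bd, of v]
  by (cases "v \<in> Mcarr (Pobj P 0)") (auto simp: complete_resolution_def)

lemma res_coaug_eq_0: "Pcoaug P c = 0 \<longleftrightarrow> c = 0"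
proof -
  have "inj (Pcoaug P)" using P by (simp add: complete_resolution_def)
  then show ?thesis using injD[of "Pcoaug P" c 0] by auto
qed

lemma res_aug_bd: "Paug P (Pbd P 1 v) = 0"
  using res_bd_bd[of 0 v] by (simp add: res_bd_0 res_coaug_eq_0)

end

text \<open>The signs of the endomorphism dga disappear in characteristic two, and are left out.\<close>

lemma homotopy_extension:
  fixes P :: "('g, 'k::field, 'v::ab_group_add) complete_res"
    and R :: "('g, 'k, 'w::ab_group_add) complete_res"
  assumes fin: "finite (carrier G)" and char: "CHAR('k) = 2"
    and P: "complete_resolution G P" and R: "complete_resolution G R"
    and c: "\<And>j. c j \<in> kG_hom G (Pobj P (j + n)) (Pobj R j)"
    and closed: "\<And>j v. Pbd R (j + 1) (c (j + 1) v) = c j (Pbd P (j + n + 1) v)"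
    and h0: "h0 \<in> kG_hom G (Pobj P (n - 1)) (Pobj R 0)"
    and start: "\<And>v. Pbd R 0 (c 0 v + h0 (Pbd P n v)) = 0"
  obtains h where "\<And>j. h j \<in> kG_hom G (Pobj P (j + n - 1)) (Pobj R j)" "h 0 = h0"
    "\<And>j v. c j v = Pbd R (j + 1) (h (j + 1) v) + h j (Pbd P (j + n) v)"
proof -
  have add2: "w + w = 0" for w :: 'w
    using char_2_self_add[OF char module_vs[OF res_module[OF R]]] .
  have add2': "w + (w + w') = w'" for w w' :: 'w
    by (simp add: add2 flip: add.assoc)
  note mP = res_module[OF P] and mR = res_module[OF R]
  \<comment> \<open>\<open>I\<close> says that \<open>c j + h d\<close> takes values in the cycles,
    which is what projectivity needs for the next component upwards. \<open>Q\<close> is the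
    homotopy equation, which involves two neighbouring components.\<close>
  define I where "I j h \<longleftrightarrow> h \<in> kG_hom G (Pobj P (j + n - 1)) (Pobj R j) \<and>
    (\<forall>v. Pbd R j (c j v + h (Pbd P (j + n) v)) = 0)" for j h
  define Q where "Q j h h' \<longleftrightarrow> (\<forall>v. c j v = Pbd R (j + 1) (h' v) + h (Pbd P (j + n) v))" for j h h'
  have up: "\<exists>h'. I (j + 1) h' \<and> Q j h h'" if "I j h" for j h
  proof -
    have h: "h \<in> kG_hom G (Pobj P (j + n - 1)) (Pobj R j)" and v: "\<And>v. Pbd R j (c j v + h (Pbd P (j + n) v)) = 0"
      using that by (auto simp: I_def)
    let ?f = "c j + (h \<circ> Pbd P (j + n))"
    have f: "?f \<in> kG_hom G (Pobj P (j + n)) (Pobj R j)"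
    proof (rule hom_plus[OF mR c[of j]])
      show "h \<circ> Pbd P (j + n) \<in> kG_hom G (Pobj P (j + n)) (Pobj R j)"
        by (rule hom_comp[OF mR res_bd[OF P] h mP])
    qed
    have "?f ` Mcarr (Pobj P (j + n)) \<subseteq> Pbd R (j + 1) ` Mcarr (Pobj R (j + 1))"
      unfolding res_image[OF R] using v hom_mem[OF f] by auto
    from projective_lift[OF res_projective[OF P] mR mR res_bd'[OF R] f this]
    obtain h' where h': "h' \<in> kG_hom G (Pobj P (j + n)) (Pobj R (j + 1))" "Pbd R (j + 1) \<circ> h' = ?f" .
    have eq: "Pbd R (j + 1) (h' v) = c j v + h (Pbd P (j + n) v)" for v
      using fun_cong[OF h'(2), of v] by simp
    have h0: "h 0 = 0" using hom_zero[OF h mP] .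
    have "Pbd R (j + 1) (c (j + 1) v + h' (Pbd P (j + 1 + n) v)) = 0" for v
    proof (cases "v \<in> Mcarr (Pobj P (j + 1 + n))")
      case True
      have e: "j + 1 + n = j + n + 1" by simp
      have u: "Pbd P (j + 1 + n) v \<in> Mcarr (Pobj P (j + n))"
        using hom_mem[OF res_bd[OF P] True] by (simp add: algebra_simps)
      have "Pbd R (j + 1) (c (j + 1) v + h' (Pbd P (j + 1 + n) v)) =
          c j (Pbd P (j + n + 1) v) + Pbd R (j + 1) (h' (Pbd P (j + n + 1) v))"
        using hom_add[OF res_bd[OF R] hom_mem[OF c True] hom_mem[OF h'(1) u]] closed[of j v] by (simp add: e)
      also have "\<dots> = 0"
        by (simp add: eq res_bd_bd[OF P] h0 add2)
      finally show ?thesis .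
    next
      case False
      then show ?thesis
        using hom_out[OF c] hom_out[OF res_bd[OF P]] hom_zero[OF h'(1) mP] res_bd_zero[OF R] by simp
    qed
    then have "I (j + 1) h'" using h'(1) by (simp add: I_def algebra_simps)
    moreover have "Q j h h'" by (simp add: Q_def eq add.assoc add2)
    ultimately show ?thesis by blast
  qed
  \<comment> \<open>Downwards a component is prescribed on the image of a differential and must be
    extended to the whole module, which is possible for projectives over a finite group. The kernel
    of the differential consists of boundaries, where the map \<open>?w\<close> vanishes by the
    invariant.\<close>
  have down: "\<exists>h'. I (j - 1) h' \<and> Q (j - 1) h' h" if "I j h" for j h
  proof -
    have h: "h \<in> kG_hom G (Pobj P (j + n - 1)) (Pobj R j)" and v: "\<And>v. Pbd R j (c j v + h (Pbd P (j + n) v)) = 0"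
      using that by (auto simp: I_def)
    let ?w = "c (j - 1) + (Pbd R j \<circ> h)"
    have c': "c (j - 1) \<in> kG_hom G (Pobj P (j + n - 1)) (Pobj R (j - 1))"
      using c[of "j - 1"] by (simp add: algebra_simps)
    have w: "?w \<in> kG_hom G (Pobj P (j + n - 1)) (Pobj R (j - 1))"
      by (rule hom_plus[OF mR c' hom_comp[OF mR h res_bd[OF R] mR]])
    have ker: "?w u = 0" if u: "u \<in> Mcarr (Pobj P (j + n - 1))" and "Pbd P (j + n - 1) u = 0" for u
    proof -
      have "u \<in> {v \<in> Mcarr (Pobj P (j + n - 1)). Pbd P (j + n - 1) v = 0}" using that by simp
      then obtain v where v': "v \<in> Mcarr (Pobj P (j + n))" "u = Pbd P (j + n) v"
        unfolding res_image[OF P, symmetric] by auto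
      have "0 = Pbd R j (c j v) + Pbd R j (h u)"
        using v[of v] hom_add[OF res_bd[OF R] hom_mem[OF c v'(1)] hom_mem[OF h u]] by (simp add: v')
      also have "Pbd R j (c j v) = c (j - 1) u"
        using closed[of "j - 1" v] by (simp add: v' algebra_simps)
      finally show ?thesis by simp
    qed
    have i: "Pbd P (j + n - 1) \<in> kG_hom G (Pobj P (j + n - 1)) (Pobj P (j + n - 2))"
      using res_bd[OF P, of "j + n - 1"] by simp
    from projective_extend[OF fin res_projective[OF R] mP mP i w ker]
    obtain h' where h': "h' \<in> kG_hom G (Pobj P (j + n - 2)) (Pobj R (j - 1))" "h' \<circ> Pbd P (j + n - 1) = ?w" .
    have eq: "h' (Pbd P (j - 1 + n) v) = c (j - 1) v + Pbd R j (h v)" for v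
      using fun_cong[OF h'(2), of v] by (simp add: algebra_simps)
    have bb: "Pbd R (j - 1) (Pbd R j w) = 0" for w
      using res_bd_bd[OF R, of "j - 1" w] by simp
    have "I (j - 1) h'"
    proof -
      have e: "j - 1 + n - 1 = j + n - 2" by simp
      show ?thesis using h'(1) bb by (simp add: I_def eq add2' e)
    qed
    moreover have "Q (j - 1) h' h"
      by (simp add: Q_def eq add2 add.left_commute[of "Pbd R j _"])
    ultimately show ?thesis by blast
  qed
  have "I 0 h0" using h0 start by (simp add: I_def)
  from int_dependent_choice[of I, OF this up down]
  obtain h where "h 0 = h0" "\<And>j. I j (h j)" "\<And>j. Q j (h j) (h (j + 1))" by blast
  then show thesis
    using that[of h] by (simp add: I_def Q_def)
qed

text \<open>Without signs, a chain map is a null homotopy of the zero map of one degree more. The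
  first component is a lift \<open>f0\<close> of \<open>\<phi>\<close> through the augmentation; it
  satisfies the invariant since the differential out of degree 0 factors through the
  augmentation.\<close>

lemma chain_map_lifting:
  fixes P :: "('g, 'k::field, 'v::ab_group_add) complete_res"
    and R :: "('g, 'k, 'w::ab_group_add) complete_res"
  assumes fin: "finite (carrier G)" and char: "CHAR('k) = 2"
    and P: "complete_resolution G P" and R: "complete_resolution G R"
    and \<phi>: "\<phi> \<in> kG_hom G (Pobj P n) trivial_module" and closed: "\<And>v. \<phi> (Pbd P (n + 1) v) = 0"
  obtains f where "\<And>j. f j \<in> kG_hom G (Pobj P (j + n)) (Pobj R j)"
    "\<And>j v. Pbd R (j + 1) (f (j + 1) v) = f j (Pbd P (j + n + 1) v)" "\<And>v. Paug R (f 0 v) = \<phi> v"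
proof -
  have triv: "kG_module G (trivial_module :: ('g, 'k, 'k) kG_mod)"
    by (rule trivial_kG_module) (rule res_group[OF P])
  have "\<phi> ` Mcarr (Pobj P n) \<subseteq> Paug R ` Mcarr (Pobj R 0)"
    using res_aug_surj[OF R] by simp
  from projective_lift[OF res_projective[OF P] res_module[OF R] triv res_aug[OF R] \<phi> this]
  obtain f0 where f0: "f0 \<in> kG_hom G (Pobj P n) (Pobj R 0)" "Paug R \<circ> f0 = \<phi>" .
  have \<phi>': "Paug R (f0 v) = \<phi> v" for v using fun_cong[OF f0(2), of v] by simp
  obtain f where f: "\<And>j. f j \<in> kG_hom G (Pobj P (j + (n + 1) - 1)) (Pobj R j)" "f 0 = f0"
      "\<And>j v. 0 = Pbd R (j + 1) (f (j + 1) v) + f j (Pbd P (j + (n + 1)) v)"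
  proof (rule homotopy_extension[OF fin char P R, of "\<lambda>_ _. 0" "n + 1" f0])
    show "(\<lambda>_. 0) \<in> kG_hom G (Pobj P (j + (n + 1))) (Pobj R j)" for j
      using hom_0[OF res_module[OF R]] by (simp add: zero_fun_def)
    show "Pbd R 0 (0 + f0 (Pbd P (n + 1) v)) = 0" for v
      by (simp add: res_bd_0[OF R] \<phi>' closed res_coaug_zero[OF R])
    show "f0 \<in> kG_hom G (Pobj P (n + 1 - 1)) (Pobj R 0)" using f0(1) by simp
    show "Pbd R (j + 1) 0 = 0" for j by (rule res_bd_zero[OF R])
  qed (rule that)
  have "Pbd R (j + 1) (f (j + 1) v) = f j (Pbd P (j + n + 1) v)" for j v
  proof -
    have "x = y" if "0 = x + y" for x y :: 'w
      using that char_2_self_add[OF char module_vs[OF res_module[OF R]], of y] by (metis add_right_cancel)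
    then show ?thesis using f(3)[of j v] by (simp only: add.assoc)
  qed
  then show thesis
    using that[of f] f(1,2) \<phi>' by (simp add: algebra_simps)
qed

text \<open>A lift \<open>h0\<close> of \<open>\<psi>\<close> through the augmentation is an
  admissible first component: the augmentation of \<open>c 0 + h0 d\<close> is twice
  \<open>\<psi> d\<close>, hence zero, and so the differential out of degree 0 kills it.\<close>

lemma null_homotopy:
  fixes P :: "('g, 'k::field, 'v::ab_group_add) complete_res"
    and R :: "('g, 'k, 'w::ab_group_add) complete_res"
  assumes fin: "finite (carrier G)" and char: "CHAR('k) = 2"
    and P: "complete_resolution G P" and R: "complete_resolution G R"
    and c: "\<And>j. c j \<in> kG_hom G (Pobj P (j + n)) (Pobj R j)"
    and closed: "\<And>j v. Pbd R (j + 1) (c (j + 1) v) = c j (Pbd P (j + n + 1) v)"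
    and \<psi>: "\<psi> \<in> kG_hom G (Pobj P (n - 1)) trivial_module" "\<And>v. Paug R (c 0 v) = \<psi> (Pbd P n v)"
  obtains h where "\<And>j. h j \<in> kG_hom G (Pobj P (j + n - 1)) (Pobj R j)"
    "\<And>j v. c j v = Pbd R (j + 1) (h (j + 1) v) + h j (Pbd P (j + n) v)"
proof -
  have triv: "kG_module G (trivial_module :: ('g, 'k, 'k) kG_mod)"
    by (rule trivial_kG_module) (rule res_group[OF P])
  have "\<psi> ` Mcarr (Pobj P (n - 1)) \<subseteq> Paug R ` Mcarr (Pobj R 0)"
    using res_aug_surj[OF R] by simp
  from projective_lift[OF res_projective[OF P] res_module[OF R] triv res_aug[OF R] \<psi>(1) this]
  obtain h0 where h0: "h0 \<in> kG_hom G (Pobj P (n - 1)) (Pobj R 0)" "Paug R \<circ> h0 = \<psi>" .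
  have \<psi>': "Paug R (h0 v) = \<psi> v" for v using fun_cong[OF h0(2), of v] by simp
  have "Pbd R 0 (c 0 v + h0 (Pbd P n v)) = 0" for v
  proof (cases "v \<in> Mcarr (Pobj P n)")
    case True
    have "c 0 v \<in> Mcarr (Pobj R 0)" "h0 (Pbd P n v) \<in> Mcarr (Pobj R 0)"
      using True hom_mem[OF c[of 0]] hom_mem[OF h0(1) hom_mem[OF res_bd[OF P] True]] by auto
    then have "Paug R (c 0 v + h0 (Pbd P n v)) = \<psi> (Pbd P n v) + \<psi> (Pbd P n v)"
      by (simp add: hom_add[OF res_aug[OF R]] \<psi>' \<psi>(2))
    also have "\<dots> = 0"
      using char_2_self_add[OF char module_vs[OF triv], of "\<psi> (Pbd P n v)"] .
    finally show ?thesis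
      by (simp add: res_bd_0[OF R] res_coaug_zero[OF R])
  next
    case False
    then show ?thesis
      using hom_out[OF c[of 0], of v] hom_out[OF res_bd[OF P], of v] hom_zero[OF h0(1) res_module[OF P]] res_bd_zero[OF R]
      by simp
  qed
  from homotopy_extension[OF fin char P R c closed h0(1) this] that
  show thesis by metis
qed


section \<open>Additive endomorphisms\<close>

text \<open>
  Families of module maps are embedded into a ring of additive endomorphisms, in which the
  differential of the endomorphism dga is the commutator with the total differential. Identities in
  the dga thus become identities in a ring of characteristic two.
\<close>

typedef (overloaded) 'a aend = "{f :: 'a::ab_group_add \<Rightarrow> 'a. \<forall>x y. f (x + y) = f x + f y}"
  morphisms app Aend
  by (rule exI[of _ "\<lambda>x. x"]) simp

setup_lifting type_definition_aend

lemma app_add: "app f (x + y) = app f x + app f y"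
  using app[of f] by simp

instantiation aend :: (ab_group_add) ring
begin

lift_definition zero_aend :: "'a aend" is "\<lambda>_. 0" by simp
lift_definition plus_aend :: "'a aend \<Rightarrow> 'a aend \<Rightarrow> 'a aend" is "\<lambda>f g x. f x + g x"
  by (simp add: algebra_simps)
lift_definition minus_aend :: "'a aend \<Rightarrow> 'a aend \<Rightarrow> 'a aend" is "\<lambda>f g x. f x - g x"
  by (simp add: algebra_simps)
lift_definition uminus_aend :: "'a aend \<Rightarrow> 'a aend" is "\<lambda>f x. - f x"
  by simp
lift_definition times_aend :: "'a aend \<Rightarrow> 'a aend \<Rightarrow> 'a aend" is "\<lambda>f g x. f (g x)"
  by simp

instance
  by standard (transfer; simp add: fun_eq_iff algebra_simps)+

end

lemma aend_eqI: "(\<And>x. app f x = app g x) \<Longrightarrow> f = g"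
  by transfer auto

lemma app_simps [simp]:
  "app 0 x = 0" "app (f + g) x = app f x + app g x" "app (f * g) x = app f (app g x)"
  by (transfer; simp)+

section \<open>Cohomology classes\<close>

lemma coh_class_eq_iff:
  assumes "0 \<in> coboundaries C d n" and diff: "\<And>x y. x \<in> coboundaries C d n \<Longrightarrow> y \<in> coboundaries C d n \<Longrightarrow> x - y \<in> coboundaries C d n"
    and f: "f \<in> cocycles C d n" "g \<in> cocycles C d n"
  shows "coh_class C d n f = coh_class C d n g \<longleftrightarrow> f - g \<in> coboundaries C d n"
proof
  assume "coh_class C d n f = coh_class C d n g"
  moreover have "f \<in> snd (coh_class C d n f)"
    using assms by (simp add: coh_class_def)
  ultimately show "f - g \<in> coboundaries C d n"
    by (simp add: coh_class_def)
next
  assume fg: "f - g \<in> coboundaries C d n"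
  have "h - f \<in> coboundaries C d n \<longleftrightarrow> h - g \<in> coboundaries C d n" for h
    using diff[OF _ fg, of "h - g"] diff[OF _ diff[OF assms(1) fg], of "h - f"] by (auto simp: algebra_simps)
  then show "coh_class C d n f = coh_class C d n g"
    by (simp add: coh_class_def)
qed

lemma repr_coh_class:
  assumes "0 \<in> coboundaries C d n" "f \<in> cocycles C d n"
  shows "repr (coh_class C d n f) \<in> cocycles C d n" "repr (coh_class C d n f) - f \<in> coboundaries C d n"
proof -
  have "f \<in> snd (coh_class C d n f)"
    using assms by (simp add: coh_class_def)
  then have "repr (coh_class C d n f) \<in> snd (coh_class C d n f)"
    unfolding repr_def by (rule someI)
  then show "repr (coh_class C d n f) \<in> cocycles C d n" "repr (coh_class C d n f) - f \<in> coboundaries C d n"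
    by (auto simp: coh_class_def)
qed

lemma fst_coh_class [simp]: "fst (coh_class C d n f) = n"
  by (simp add: coh_class_def)

section \<open>Cochains of the endomorphism dga in characteristic two\<close>

locale char2_res =
  fixes G :: "'g monoid" and P :: "('g, 'k::field, 'v::ab_group_add) complete_res"
  assumes fin: "finite (carrier G)" and char: "CHAR('k) = 2" and P: "complete_resolution G P"
begin

lemmas mP = res_module[OF P]

lemma add_self [simp]: "v + v = (0 :: 'v)"
  using char_2_self_add[OF char module_vs[OF mP]] .

lemma add_self_left [simp]: "v + (v + w) = (w :: 'v)"
  by (simp flip: add.assoc)

lemma uminus_self: "- v = (v :: 'v)"
  by (rule minus_unique) simp

lemma minus_plus: "v - w = v + (w :: 'v)"
  by (simp add: diff_conv_add_uminus uminus_self del: add_uminus_conv_diff)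

lemma kadd_self [simp]: "c + c = (0 :: 'k)"
proof -
  have "(1::'k) + 1 = 0" using of_nat_CHAR[where ?'a = 'k] char by simp
  then have "c * (1 + 1) = 0" by simp
  then show ?thesis by (simp only: distrib_left mult_1_right)
qed

lemma kminus_plus: "c - e = c + (e :: 'k)"
  using kadd_self[of e] by (simp add: diff_eq_eq add.assoc)

lemma neg_one: "(-1 :: 'k) = 1"
  using char_2_minus_one[OF char] .

abbreviation A :: "int \<Rightarrow> (int \<Rightarrow> 'v \<Rightarrow> 'v) set" where "A \<equiv> endo_cochains G P"
abbreviation Z :: "int \<Rightarrow> (int \<Rightarrow> 'v \<Rightarrow> 'v) set" where "Z \<equiv> cocycles (endo_cochains G P) (endo_diff P)"

lemma A_hom: "f \<in> A n \<Longrightarrow> f j \<in> kG_hom G (Pobj P (j + n)) (Pobj P j)"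
  by (simp add: endo_cochains_def)

lemma A_mem: "f \<in> A n \<Longrightarrow> u \<in> Mcarr (Pobj P (j + n)) \<Longrightarrow> f j u \<in> Mcarr (Pobj P j)"
  using hom_mem[OF A_hom] .

lemma A_out: "f \<in> A n \<Longrightarrow> u \<notin> Mcarr (Pobj P (j + n)) \<Longrightarrow> f j u = 0"
  using hom_out[OF A_hom] .

lemma A_0: "f \<in> A n \<Longrightarrow> f j 0 = 0"
  using hom_zero[OF A_hom mP] .

lemma A_add: "f \<in> A n \<Longrightarrow> u \<in> Mcarr (Pobj P (j + n)) \<Longrightarrow> v \<in> Mcarr (Pobj P (j + n)) \<Longrightarrow> f j (u + v) = f j u + f j v"
  using hom_add[OF A_hom] .

lemma A_zero: "0 \<in> A n"
  by (auto simp: endo_cochains_def intro: hom_0[OF mP])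

lemma A_plus: "f \<in> A n \<Longrightarrow> g \<in> A n \<Longrightarrow> f + g \<in> A n"
  by (auto simp: endo_cochains_def intro: hom_plus[OF mP])

lemma A_scale: "f \<in> A n \<Longrightarrow> endo_scale P c f \<in> A n"
  by (auto simp: endo_cochains_def endo_scale_def intro: hom_smult[OF mP])

lemma A_comp: "f \<in> A n \<Longrightarrow> g \<in> A m \<Longrightarrow> endo_comp n f g \<in> A (n + m)"
proof -
  assume f: "f \<in> A n" and g: "g \<in> A m"
  have "f j \<circ> g (j + n) \<in> kG_hom G (Pobj P (j + n + m)) (Pobj P j)" for j
    by (rule hom_comp[OF mP A_hom[OF g] A_hom[OF f] mP])
  then show ?thesis by (simp add: endo_cochains_def endo_comp_def add.assoc)
qed

lemma A_minus_plus: "f - g = f + (g :: int \<Rightarrow> 'v \<Rightarrow> 'v)"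
  by (simp add: fun_eq_iff minus_plus)

lemma A_self_add [simp]: "f + f = (0 :: int \<Rightarrow> 'v \<Rightarrow> 'v)"
  by (simp add: fun_eq_iff)

lemma endo_scale_sign [simp]: "endo_scale P ((-1) powi n) f = f"
  by (simp add: endo_scale_def neg_one vector_space.vector_space_assms[OF module_vs[OF mP]])

lemma endo_diff_apply: "endo_diff P n f j v = Pbd P (j + 1) (f (j + 1) v) + f j (Pbd P (j + n + 1) v)"
  unfolding endo_diff_def endo_scale_sign by (simp add: minus_plus)

lemma bd_A: "(\<lambda>j. Pbd P (j + 1)) \<in> A 1"
  using res_bd'[OF P] by (simp add: endo_cochains_def)

lemma endo_diff_comp: "endo_diff P n f = endo_comp 1 (\<lambda>j. Pbd P (j + 1)) f + endo_comp n f (\<lambda>j. Pbd P (j + 1))"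
  by (simp add: fun_eq_iff endo_diff_apply endo_comp_def)

lemma A_diff: "f \<in> A n \<Longrightarrow> endo_diff P n f \<in> A (n + 1)"
  unfolding endo_diff_comp using A_comp[OF bd_A, of f n] A_comp[OF _ bd_A, of f n]
  by (auto intro!: A_plus simp: add.commute)

text \<open>A linear projection of the ambient space onto the carrier. Precomposing with it makes a
  module map additive everywhere, as membership in \<open>aend\<close> demands.\<close>

definition pr :: "int \<Rightarrow> 'v \<Rightarrow> 'v" where
  "pr j = (SOME q. Vector_Spaces.linear (Mscale (Pobj P j)) (Mscale (Pobj P j)) q \<and>
     (\<forall>v\<in>Mcarr (Pobj P j). q v = v) \<and> range q \<subseteq> Mcarr (Pobj P j))"

lemma pr: "Vector_Spaces.linear (Mscale (Pobj P j)) (Mscale (Pobj P j)) (pr j)"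
  and pr_id [simp]: "v \<in> Mcarr (Pobj P j) \<Longrightarrow> pr j v = v" and pr_mem [simp]: "pr j w \<in> Mcarr (Pobj P j)"
proof -
  let ?L = "\<lambda>q. Vector_Spaces.linear (Mscale (Pobj P j)) (Mscale (Pobj P j)) q \<and>
     (\<forall>v\<in>Mcarr (Pobj P j). q v = v) \<and> range q \<subseteq> Mcarr (Pobj P j)"
  have "\<exists>q. ?L q"
    by (rule linear_factor_through[OF module_vs[OF mP] module_vs[OF mP] module_vs[OF mP] module_subspace[OF mP[of j]],
          where i = "\<lambda>v. v" and f = "\<lambda>v. v"]) auto
  then have "?L (pr j)" unfolding pr_def by (rule someI_ex)
  then show "Vector_Spaces.linear (Mscale (Pobj P j)) (Mscale (Pobj P j)) (pr j)"
    "v \<in> Mcarr (Pobj P j) \<Longrightarrow> pr j v = v" "pr j w \<in> Mcarr (Pobj P j)" by auto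
qed

lemma pr_add: "pr j (u + v) = pr j u + pr j v" and pr_scale: "pr j (Mscale (Pobj P j) c u) = Mscale (Pobj P j) c (pr j u)"
  using pr[of j] by (auto simp: Vector_Spaces.linear_iff)

text \<open>Cochains of all degrees act on the same space of sequences, so the degree survives only
  as an index of \<open>em\<close>, and composition becomes the product of a ring.\<close>

definition em :: "int \<Rightarrow> (int \<Rightarrow> 'v \<Rightarrow> 'v) \<Rightarrow> (int \<Rightarrow> 'v) aend" where
  "em n f = Aend (\<lambda>u j. f j (pr (j + n) (u (j + n))))"

definition D :: "(int \<Rightarrow> 'v) aend" where "D = em 1 (\<lambda>j. Pbd P (j + 1))"

definition sc :: "'k \<Rightarrow> (int \<Rightarrow> 'v) aend" where
  "sc c = Aend (\<lambda>u j. Mscale (Pobj P j) c (u j))"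

lemma app_em: "f \<in> A n \<Longrightarrow> app (em n f) u j = f j (pr (j + n) (u (j + n)))"
  unfolding em_def by (subst Aend_inverse) (simp_all add: fun_eq_iff pr_add A_add)

lemma app_sc: "app (sc c) u j = Mscale (Pobj P j) c (u j)"
proof -
  have "Mscale (Pobj P j) c (u + v) = Mscale (Pobj P j) c u + Mscale (Pobj P j) c v" for j u v
  proof -
    interpret vector_space "Mscale (Pobj P j)" using module_vs[OF mP] .
    show ?thesis by (rule scale_right_distrib)
  qed
  then show ?thesis
    unfolding sc_def by (subst Aend_inverse) (simp_all add: fun_eq_iff)
qed

lemma em_inj:
  assumes "f \<in> A n" "g \<in> A n" "em n f = em n g"
  shows "f = g"
proof (intro ext)
  fix j v
  show "f j v = g j v"
  proof (cases "v \<in> Mcarr (Pobj P (j + n))")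
    case True
    then show ?thesis
      using app_em[OF assms(1), of "\<lambda>i. v" j] app_em[OF assms(2), of "\<lambda>i. v" j] assms(3) by simp
  qed (simp add: A_out[OF assms(1)] A_out[OF assms(2)])
qed

lemma em_plus: "f \<in> A n \<Longrightarrow> g \<in> A n \<Longrightarrow> em n (f + g) = em n f + em n g"
  by (intro aend_eqI) (simp add: fun_eq_iff app_em A_plus)

lemma em_minus: "f \<in> A n \<Longrightarrow> g \<in> A n \<Longrightarrow> em n (f - g) = em n f + em n g"
  by (simp add: A_minus_plus em_plus)

lemma em_zero [simp]: "em n 0 = 0"
  by (intro aend_eqI) (simp add: fun_eq_iff app_em[OF A_zero])

lemma em_comp: "f \<in> A n \<Longrightarrow> g \<in> A m \<Longrightarrow> em (n + m) (endo_comp n f g) = em n f * em m g"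
proof (intro aend_eqI ext)
  fix u j
  assume f: "f \<in> A n" and g: "g \<in> A m"
  have "g (j + n) (pr (j + n + m) (u (j + n + m))) \<in> Mcarr (Pobj P (j + n))"
    using g by (rule A_mem) simp
  then show "app (em (n + m) (endo_comp n f g)) u j = app (em n f * em m g) u j"
    by (simp add: app_em f g A_comp flip: add.assoc) (simp add: endo_comp_def)
qed

lemma em_diff: "f \<in> A n \<Longrightarrow> em (n + 1) (endo_diff P n f) = D * em n f + em n f * D"
  unfolding endo_diff_comp D_def
  using A_comp[OF bd_A, of f n] A_comp[OF _ bd_A, of f n] em_comp[OF bd_A, of f n] em_comp[OF _ bd_A, of f n]
  by (simp add: em_plus add.commute)

lemma em_scale: "f \<in> A n \<Longrightarrow> em n (endo_scale P c f) = sc c * em n f"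
  by (intro aend_eqI ext) (simp only: app_simps app_em A_scale app_sc, simp add: endo_scale_def)

lemma em_sc: "f \<in> A n \<Longrightarrow> em n f * sc c = sc c * em n f"
  by (intro aend_eqI)
    (simp add: fun_eq_iff app_em app_sc pr_scale hom_scale[OF A_hom])

lemma sc_mult: "sc c * sc e = sc (c * e)" and sc_add: "sc (c + e) = sc c + sc e" and sc_one: "sc 1 * x = x"
    "x * sc 1 = x" and sc_zero: "sc 0 = 0"
proof -
  have vs: "Mscale (Pobj P j) c (Mscale (Pobj P j) e v) = Mscale (Pobj P j) (c * e) v"
      "Mscale (Pobj P j) (c + e) v = Mscale (Pobj P j) c v + Mscale (Pobj P j) e v"
      "Mscale (Pobj P j) 1 v = v" "Mscale (Pobj P j) 0 v = 0" for j c e v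
  proof -
    interpret vector_space "Mscale (Pobj P j)" using module_vs[OF mP] .
    show "Mscale (Pobj P j) c (Mscale (Pobj P j) e v) = Mscale (Pobj P j) (c * e) v"
      "Mscale (Pobj P j) (c + e) v = Mscale (Pobj P j) c v + Mscale (Pobj P j) e v"
      "Mscale (Pobj P j) 1 v = v" "Mscale (Pobj P j) 0 v = 0"
      by (simp_all add: scale_left_distrib)
  qed
  show "sc c * sc e = sc (c * e)" "sc (c + e) = sc c + sc e" "sc 0 = 0"
    by (intro aend_eqI ext; simp add: app_sc vs)+
  have "app (sc 1) u = u" for u
    by (simp add: fun_eq_iff app_sc vs)
  then show "sc 1 * x = x" "x * sc 1 = x"
    by (intro aend_eqI; simp)+
qed

lemma ring_self [simp]: "x + x = (0 :: (int \<Rightarrow> 'v) aend)"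
  by (intro aend_eqI) (simp add: fun_eq_iff)

lemma ring_self_left [simp]: "x + (x + y) = (y :: (int \<Rightarrow> 'v) aend)"
  by (simp flip: add.assoc)

lemma ring_eq_iff: "x = y \<longleftrightarrow> x + y = (0 :: (int \<Rightarrow> 'v) aend)"
  by (metis add_0 ring_self_left ring_self add.right_neutral)

lemma ring_move: "x + y = z \<Longrightarrow> x = y + (z :: (int \<Rightarrow> 'v) aend)"
  by (auto simp: add.commute add.left_commute)

text \<open>Together with \<open>ring_self\<close> and \<open>ring_self_left\<close> these rules
  normalise noncommutative polynomials: equal monomials are brought next to each other and cancel in
  pairs.\<close>

lemmas c2_simps = distrib_left distrib_right mult.assoc add.assoc add.commute add.left_commute

lemma D_D [simp]: "D * D = 0"
proof -
  have "endo_comp 1 (\<lambda>j. Pbd P (j + 1)) (\<lambda>j. Pbd P (j + 1)) = 0"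
    by (simp only: endo_comp_def fun_eq_iff comp_apply res_bd_bd[OF P] zero_fun_apply simp_thms)
  then show ?thesis
    using em_comp[OF bd_A bd_A] by (simp add: D_def)
qed

lemma D_D_left [simp]: "D * (D * x) = 0"
  by (simp flip: mult.assoc)

lemma D_sc: "D * sc c = sc c * D"
  unfolding D_def by (rule em_sc) (rule bd_A)

section \<open>Cocycles, homotopies and the classes they represent\<close>

lemma Z_iff: "f \<in> Z n \<longleftrightarrow> f \<in> A n \<and> D * em n f = em n f * D"
proof -
  have "endo_diff P n f = 0 \<longleftrightarrow> em (n + 1) (endo_diff P n f) = 0" if "f \<in> A n"
    using em_inj[OF A_diff[OF that] A_zero] by auto
  then show ?thesis
    using em_diff[of f n] ring_eq_iff by (auto simp: cocycles_def)
qed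

lemma Z_A: "f \<in> Z n \<Longrightarrow> f \<in> A n" and Z_D: "f \<in> Z n \<Longrightarrow> D * em n f = em n f * D"
  by (simp_all add: Z_iff)

lemma Z_bd: "f \<in> Z n \<Longrightarrow> Pbd P (j + 1) (f (j + 1) v) = f j (Pbd P (j + n + 1) v)"
proof -
  assume "f \<in> Z n"
  then have "endo_diff P n f j v = 0" by (simp add: cocycles_def)
  then show ?thesis unfolding endo_diff_apply by (metis add_self add_right_cancel)
qed

lemma Z_zero: "0 \<in> Z n" and Z_plus: "f \<in> Z n \<Longrightarrow> g \<in> Z n \<Longrightarrow> f + g \<in> Z n"
  and Z_scale: "f \<in> Z n \<Longrightarrow> endo_scale P c f \<in> Z n"
  and Z_comp: "f \<in> Z n \<Longrightarrow> g \<in> Z m \<Longrightarrow> endo_comp n f g \<in> Z (n + m)"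
proof -
  show "0 \<in> Z n" by (simp add: Z_iff A_zero)
  show "f \<in> Z n \<Longrightarrow> g \<in> Z n \<Longrightarrow> f + g \<in> Z n"
    by (simp add: Z_iff A_plus em_plus distrib_left distrib_right)
  show "f \<in> Z n \<Longrightarrow> endo_scale P c f \<in> Z n"
    by (simp add: Z_iff A_scale em_scale D_sc flip: mult.assoc) (simp add: D_sc mult.assoc)
  show "f \<in> Z n \<Longrightarrow> g \<in> Z m \<Longrightarrow> endo_comp n f g \<in> Z (n + m)"
    by (simp add: Z_iff A_comp em_comp flip: mult.assoc) (simp add: mult.assoc)
qed

definition idc :: "int \<Rightarrow> 'v \<Rightarrow> 'v" where
  "idc = (\<lambda>j v. if v \<in> Mcarr (Pobj P j) then v else 0)"

lemma idc_A: "idc \<in> A 0"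
  by (auto simp: endo_cochains_def idc_def kG_hom_def module_add[OF mP] module_scale[OF mP] module_act[OF mP])

lemma idc_comp: "f \<in> A n \<Longrightarrow> endo_comp 0 idc f = f" "f \<in> A n \<Longrightarrow> endo_comp n f idc = f"
proof -
  assume f: "f \<in> A n"
  have "f j v = 0" if "f j v \<notin> Mcarr (Pobj P j)" for j v
    using that A_mem[OF f] A_out[OF f] by (cases "v \<in> Mcarr (Pobj P (j + n))") auto
  then show "endo_comp 0 idc f = f" "endo_comp n f idc = f"
    by (auto simp: fun_eq_iff endo_comp_def idc_def A_0[OF f] A_out[OF f])
qed

text \<open>\<open>em 0 idc\<close> is the projection onto the carriers. It acts as a unit on
  elements of the form \<open>em n f\<close>, but need not be a unit of the whole ring.\<close>

lemma em_idc: "f \<in> A n \<Longrightarrow> em 0 idc * em n f = em n f" "f \<in> A n \<Longrightarrow> em n f * em 0 idc = em n f"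
  using em_comp[OF idc_A, of f n] em_comp[OF _ idc_A, of f n] by (simp_all add: idc_comp)

lemma idc_Z: "idc \<in> Z 0"
  using em_idc[OF bd_A] by (simp add: Z_iff idc_A D_def)

definition ecl :: "int \<Rightarrow> (int \<Rightarrow> 'v \<Rightarrow> 'v) \<Rightarrow> int \<times> (int \<Rightarrow> 'v \<Rightarrow> 'v) set" where
  "ecl n f = endo_class G P n f"

text \<open>The Tate class that \<open>to_tate\<close> assigns to the chain map \<open>f\<close>.
  Every Tate class has this form, so computations in Tate cohomology are carried out on chain
  maps.\<close>

definition tcl :: "int \<Rightarrow> (int \<Rightarrow> 'v \<Rightarrow> 'v) \<Rightarrow> int \<times> ('v \<Rightarrow> 'k) set" where
  "tcl n f = tate_class G P n (Paug P \<circ> f 0)"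

definition homot :: "int \<Rightarrow> (int \<Rightarrow> 'v \<Rightarrow> 'v) \<Rightarrow> (int \<Rightarrow> 'v \<Rightarrow> 'v) \<Rightarrow> bool" where
  "homot n f g \<longleftrightarrow> (\<exists>h\<in>A (n - 1). em n f + em n g = D * em (n - 1) h + em (n - 1) h * D)"

lemma endo_cobd:
  "0 \<in> coboundaries A (endo_diff P) n"
  "x \<in> coboundaries A (endo_diff P) n \<Longrightarrow> y \<in> coboundaries A (endo_diff P) n \<Longrightarrow> x - y \<in> coboundaries A (endo_diff P) n"
proof -
  have z: "endo_diff P (n - 1) 0 = 0"
    using em_inj[OF A_diff[OF A_zero] A_zero] em_diff[OF A_zero] by simp
  show "0 \<in> coboundaries A (endo_diff P) n"
    unfolding coboundaries_def using A_zero z by (intro image_eqI[of _ _ 0]) auto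
  have "endo_diff P (n - 1) h - endo_diff P (n - 1) h' = endo_diff P (n - 1) (h + h')"
    if "h \<in> A (n - 1)" "h' \<in> A (n - 1)" for h h'
    using that by (intro em_inj[of _ n])
      (use A_diff[of h "n - 1"] A_diff[of h' "n - 1"] A_diff[OF A_plus[OF that]] em_diff[of h "n - 1"] em_diff[of h' "n - 1"]
        em_diff[OF A_plus[OF that]] in \<open>auto simp: A_minus_plus em_plus A_plus c2_simps\<close>)
  then show "x \<in> coboundaries A (endo_diff P) n \<Longrightarrow> y \<in> coboundaries A (endo_diff P) n \<Longrightarrow> x - y \<in> coboundaries A (endo_diff P) n"
    unfolding coboundaries_def by (auto intro!: image_eqI A_plus)
qed

lemma cobd_iff:
  assumes "f \<in> Z n" "g \<in> Z n"
  shows "f - g \<in> coboundaries A (endo_diff P) n \<longleftrightarrow> homot n f g"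
proof -
  have fg: "f - g \<in> A n" using assms by (simp add: A_minus_plus A_plus Z_A)
  have "f - g = endo_diff P (n - 1) h \<longleftrightarrow> em n f + em n g = D * em (n - 1) h + em (n - 1) h * D"
    if "h \<in> A (n - 1)" for h
    using em_inj[OF fg A_diff[OF that, simplified]] em_diff[OF that] em_minus[OF Z_A Z_A, OF assms] by auto
  then show ?thesis
    by (auto simp: coboundaries_def homot_def)
qed

lemma ecl_eq_iff: "f \<in> Z n \<Longrightarrow> g \<in> Z n \<Longrightarrow> ecl n f = ecl n g \<longleftrightarrow> homot n f g"
  unfolding ecl_def using coh_class_eq_iff[OF endo_cobd] cobd_iff by blast

lemma homot_refl: "homot n f f"
  using A_zero by (auto simp: homot_def intro!: bexI[of _ 0])

lemma repr_ecl:
  assumes "f \<in> Z n" shows "repr (ecl n f) \<in> Z n" "homot n (repr (ecl n f)) f"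
  using repr_coh_class[OF endo_cobd(1) assms] cobd_iff assms by (auto simp: ecl_def)

lemma snd_ecl: "f \<in> Z n \<Longrightarrow> g \<in> snd (ecl n f) \<longleftrightarrow> g \<in> Z n \<and> homot n g f"
  using cobd_iff by (auto simp: ecl_def coh_class_def)

lemma fst_ecl [simp]: "fst (ecl n f) = n" and fst_tcl [simp]: "fst (tcl n f) = n"
  by (simp_all add: ecl_def tcl_def)

abbreviation TC :: "int \<Rightarrow> ('v \<Rightarrow> 'k) set" where "TC \<equiv> tate_cochains G P"

lemma aug_Z:
  assumes "f \<in> Z n" shows "Paug P \<circ> f 0 \<in> cocycles TC (tate_diff P) n"
proof -
  have "Paug P \<circ> f 0 \<in> kG_hom G (Pobj P n) trivial_module"
    using hom_comp[OF res_trivial[OF P] A_hom[OF Z_A[OF assms], of 0] _ mP] res_aug[OF P] by simp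
  moreover have "(Paug P \<circ> f 0) \<circ> Pbd P (n + 1) = 0"
    using Z_bd[OF assms, of 0] res_aug_bd[OF P] by (simp add: fun_eq_iff flip: Z_bd[OF assms, of 0, simplified])
  ultimately show ?thesis
    by (simp add: cocycles_def tate_cochains_def tate_diff_def)
qed

lemma tate_cobd:
  "0 \<in> coboundaries TC (tate_diff P) n"
  "x \<in> coboundaries TC (tate_diff P) n \<Longrightarrow> y \<in> coboundaries TC (tate_diff P) n \<Longrightarrow> x - y \<in> coboundaries TC (tate_diff P) n"
proof -
  show "0 \<in> coboundaries TC (tate_diff P) n"
    using hom_0[OF res_trivial[OF P]]
    by (auto simp: coboundaries_def tate_diff_def tate_cochains_def fun_eq_iff intro!: image_eqI[of _ _ 0])
  have "p - q \<in> TC (n - 1)" if "p \<in> TC (n - 1)" "q \<in> TC (n - 1)" for p q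
  proof -
    have e: "p - q = p + q" by (simp add: fun_eq_iff kminus_plus del: diff_eq_eq)
    show ?thesis
      unfolding e tate_cochains_def
      by (rule hom_plus[OF res_trivial[OF P]]) (use that in \<open>simp_all add: tate_cochains_def\<close>)
  qed
  then show "x \<in> coboundaries TC (tate_diff P) n \<Longrightarrow> y \<in> coboundaries TC (tate_diff P) n \<Longrightarrow> x - y \<in> coboundaries TC (tate_diff P) n"
    by (auto simp: coboundaries_def tate_diff_def fun_eq_iff intro!: image_eqI[where x = "_ - _"])
qed

text \<open>This is both the well-definedness and the injectivity of \<open>to_tate\<close>. A
  primitive of the augmented component extends to a homotopy by \<open>null_homotopy\<close>;
  conversely the augmentation kills boundaries, so a homotopy \<open>h\<close> leaves only
  \<open>h_0 d\<close>.\<close>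

lemma tate_cobd_aug:
  assumes "f \<in> Z n" "g \<in> Z n"
  shows "(Paug P \<circ> f 0) - (Paug P \<circ> g 0) \<in> coboundaries TC (tate_diff P) n \<longleftrightarrow> homot n f g"
proof
  have fg: "f + g \<in> Z n" using assms by (rule Z_plus)
  have add: "Paug P ((f + g) 0 v) = Paug P (f 0 v) + Paug P (g 0 v)" for v
  proof (cases "v \<in> Mcarr (Pobj P n)")
    case True
    then show ?thesis
      using A_mem[OF Z_A[OF assms(1)], of v 0] A_mem[OF Z_A[OF assms(2)], of v 0] by (simp add: hom_add[OF res_aug[OF P]])
  next
    case False
    then show ?thesis
      using A_out[OF Z_A[OF assms(1)], of v 0] A_out[OF Z_A[OF assms(2)], of v 0] by (simp add: res_aug_zero[OF P])
  qed
  {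
    assume "(Paug P \<circ> f 0) - (Paug P \<circ> g 0) \<in> coboundaries TC (tate_diff P) n"
    then obtain \<psi> where \<psi>: "\<psi> \<in> kG_hom G (Pobj P (n - 1)) trivial_module" "(Paug P \<circ> f 0) - (Paug P \<circ> g 0) = \<psi> \<circ> Pbd P n"
      by (auto simp: coboundaries_def tate_cochains_def tate_diff_def)
    have "Paug P ((f + g) 0 v) = \<psi> (Pbd P n v)" for v
      using fun_cong[OF \<psi>(2), of v] unfolding add by (simp add: kminus_plus)
    from null_homotopy[OF fin char P P A_hom[OF Z_A[OF fg]] Z_bd[OF fg] \<psi>(1) this]
    obtain h where h: "\<And>j. h j \<in> kG_hom G (Pobj P (j + n - 1)) (Pobj P j)"
      "\<And>j v. (f + g) j v = Pbd P (j + 1) (h (j + 1) v) + h j (Pbd P (j + n) v)" by blast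
    have hA: "h \<in> A (n - 1)" using h(1) by (simp add: endo_cochains_def algebra_simps)
    have "f + g = endo_diff P (n - 1) h"
      unfolding fun_eq_iff h(2) endo_diff_apply by simp
    then have "em n (f + g) = D * em (n - 1) h + em (n - 1) h * D"
      using em_diff[OF hA] by simp
    then show "homot n f g"
      using hA em_plus[OF Z_A Z_A, OF assms] by (auto simp: homot_def)
  next
    assume "homot n f g"
    then obtain h where h: "h \<in> A (n - 1)" "f - g = endo_diff P (n - 1) h"
      using cobd_iff[OF assms] by (auto simp: coboundaries_def)
    have "Paug P (f 0 v) - Paug P (g 0 v) = Paug P (h 0 (Pbd P n v))" for v
    proof -
      have "Paug P (f 0 v) - Paug P (g 0 v) = Paug P (endo_diff P (n - 1) h 0 v)"
        using add[of v] by (simp add: kminus_plus minus_plus flip: h(2))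
      also have "\<dots> = Paug P (h 0 (Pbd P n v))"
      proof (cases "v \<in> Mcarr (Pobj P n)")
        case True
        have "h 1 v \<in> Mcarr (Pobj P 1)" using A_mem[OF h(1), of v 1] True by simp
        then have "Pbd P 1 (h 1 v) \<in> Mcarr (Pobj P 0)" using hom_mem[OF res_bd[OF P, of 1]] by simp
        moreover have "h 0 (Pbd P n v) \<in> Mcarr (Pobj P 0)"
          using A_mem[OF h(1), of "Pbd P n v" 0] hom_mem[OF res_bd[OF P] True] by simp
        ultimately show ?thesis
          by (simp add: endo_diff_apply hom_add[OF res_aug[OF P]] res_aug_bd[OF P])
      next
        case False
        then show ?thesis
          using A_out[OF h(1), of v 1] by (simp add: endo_diff_apply res_bd_zero[OF P])
      qed
      finally show ?thesis .
    qed
    then have "(Paug P \<circ> f 0) - (Paug P \<circ> g 0) = tate_diff P (n - 1) (Paug P \<circ> h 0)"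
      by (simp add: fun_eq_iff tate_diff_def)
    moreover have "Paug P \<circ> h 0 \<in> TC (n - 1)"
      using hom_comp[OF res_trivial[OF P] A_hom[OF h(1), of 0] _ mP] res_aug[OF P] by (simp add: tate_cochains_def)
    ultimately show "(Paug P \<circ> f 0) - (Paug P \<circ> g 0) \<in> coboundaries TC (tate_diff P) n"
      by (auto simp: coboundaries_def)
  }
qed

lemma tcl_eq_iff: "f \<in> Z n \<Longrightarrow> g \<in> Z n \<Longrightarrow> tcl n f = tcl n g \<longleftrightarrow> homot n f g"
  unfolding tcl_def using coh_class_eq_iff[OF tate_cobd aug_Z aug_Z] tate_cobd_aug by blast

lemma tate_surj:
  assumes "\<phi> \<in> cocycles TC (tate_diff P) n"
  obtains f where "f \<in> Z n" "Paug P \<circ> f 0 = \<phi>"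
proof -
  have \<phi>: "\<phi> \<in> kG_hom G (Pobj P n) trivial_module" "\<phi> (Pbd P (n + 1) v) = 0" for v
    using assms by (auto simp: cocycles_def tate_cochains_def tate_diff_def fun_eq_iff)
  from chain_map_lifting[OF fin char P P \<phi>]
  obtain f where f: "\<And>j. f j \<in> kG_hom G (Pobj P (j + n)) (Pobj P j)"
    "\<And>j v. Pbd P (j + 1) (f (j + 1) v) = f j (Pbd P (j + n + 1) v)" "\<And>v. Paug P (f 0 v) = \<phi> v" by blast
  have "f \<in> Z n"
    using f(1,2) by (auto simp: cocycles_def endo_cochains_def fun_eq_iff endo_diff_apply)
  then show thesis using that f(3) by (auto simp: fun_eq_iff)
qed

text \<open>The chosen representative of a Tate class is just some cocycle. To compute with it, it
  is lifted to a chain map, which is then homotopic to the given one.\<close>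

lemma repr_tcl:
  assumes "f \<in> Z n"
  obtains g where "g \<in> Z n" "homot n g f" "repr (tcl n f) = Paug P \<circ> g 0"
proof -
  have r: "repr (tcl n f) \<in> cocycles TC (tate_diff P) n" "repr (tcl n f) - (Paug P \<circ> f 0) \<in> coboundaries TC (tate_diff P) n"
    using repr_coh_class[OF tate_cobd(1) aug_Z[OF assms]] by (auto simp: tcl_def)
  obtain g where g: "g \<in> Z n" "Paug P \<circ> g 0 = repr (tcl n f)" using tate_surj[OF r(1)] .
  then show thesis using that tate_cobd_aug[OF g(1) assms] r(2) by metis
qed

lemma to_tate_ecl: "f \<in> Z n \<Longrightarrow> to_tate G P (ecl n f) = tcl n f"
proof -
  assume f: "f \<in> Z n"
  have "to_tate G P (ecl n f) = tcl n (repr (ecl n f))"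
    by (simp add: to_tate_def tcl_def)
  also have "\<dots> = tcl n f" using repr_ecl[OF f] f by (simp add: tcl_eq_iff)
  finally show ?thesis .
qed

abbreviation "H \<equiv> endo_alg G P"
abbreviation "\<Lambda> \<equiv> tate_alg G P"

lemma H_gcomp: "gcomp H n = ecl n ` Z n" and H_gdeg [simp]: "gdeg H = fst" and H_gone: "gone H = ecl 0 idc"
  and H_gzero: "gzero H n = ecl n 0"
  by (auto simp: endo_alg_def cohomology_def ecl_def idc_def fun_eq_iff)

lemma L_gdeg [simp]: "gdeg \<Lambda> = fst"
  by (simp add: tate_alg_def)

lemma L_gcomp: "gcomp \<Lambda> n = tcl n ` Z n"
proof -
  have "gcomp \<Lambda> n = tate_class G P n ` cocycles TC (tate_diff P) n"
    by (simp add: tate_alg_def cohomology_def)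
  also have "\<dots> = tcl n ` Z n"
    unfolding tcl_def using aug_Z by (auto simp: image_iff) (metis tate_surj)
  finally show ?thesis .
qed

lemma homog_H: "a \<in> homog H \<longleftrightarrow> (\<exists>n. \<exists>f\<in>Z n. a = ecl n f)" and homog_L: "b \<in> homog \<Lambda> \<longleftrightarrow> (\<exists>n. \<exists>f\<in>Z n. b = tcl n f)"
  by (auto simp: homog_def H_gcomp L_gcomp)

lemma ecl_homog: "f \<in> Z n \<Longrightarrow> ecl n f \<in> homog H" and tcl_homog: "f \<in> Z n \<Longrightarrow> tcl n f \<in> homog \<Lambda>"
  by (auto simp: homog_H homog_L)

lemma from_tate_tcl: "f \<in> Z n \<Longrightarrow> from_tate G P (tcl n f) = ecl n f"
proof -
  assume f: "f \<in> Z n"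
  have "inj_on (to_tate G P) (homog H)"
  proof (rule inj_onI)
    fix a b assume "a \<in> homog H" "b \<in> homog H" and eq: "to_tate G P a = to_tate G P b"
    then obtain n g m h where g: "g \<in> Z n" "a = ecl n g" and h: "h \<in> Z m" "b = ecl m h"
      by (auto simp: homog_H)
    then have t: "tcl n g = tcl m h" using eq by (simp add: to_tate_ecl)
    then have "n = m" by (metis fst_tcl)
    then show "a = b" using t g h tcl_eq_iff ecl_eq_iff by metis
  qed
  then show ?thesis
    unfolding from_tate_def using inv_into_f_f[of "to_tate G P" "homog H" "ecl n f"] f
    by (simp add: to_tate_ecl ecl_homog)
qed

section \<open>Operations of both graded algebras on representatives\<close>

lemma homotD: "homot n f g \<Longrightarrow> \<exists>h\<in>A (n - 1). em n f = em n g + D * em (n - 1) h + em (n - 1) h * D"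
  unfolding homot_def using ring_move by (metis add.assoc)

lemma homot_plus:
  assumes "homot n f f'" "homot n g g'" "f \<in> A n" "f' \<in> A n" "g \<in> A n" "g' \<in> A n"
  shows "homot n (f + g) (f' + g')"
proof -
  obtain h k where h: "h \<in> A (n - 1)" "em n f = em n f' + D * em (n - 1) h + em (n - 1) h * D"
    and k: "k \<in> A (n - 1)" "em n g = em n g' + D * em (n - 1) k + em (n - 1) k * D"
    using assms(1,2) homotD by metis
  show ?thesis unfolding homot_def
    by (rule bexI[of _ "h + k"]) (use assms h k in \<open>simp_all add: em_plus A_plus c2_simps\<close>)
qed

lemma homot_scale:
  assumes "homot n f f'" "f \<in> A n" "f' \<in> A n"
  shows "homot n (endo_scale P c f) (endo_scale P c f')"
proof -
  obtain h where h: "h \<in> A (n - 1)" "em n f = em n f' + D * em (n - 1) h + em (n - 1) h * D"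
    using assms(1) homotD by metis
  have "D * (sc c * x) = sc c * (D * x)" for x
    by (simp add: D_sc flip: mult.assoc)
  then show ?thesis unfolding homot_def
    by (intro bexI[of _ "endo_scale P c h"]) (use assms h in \<open>simp_all add: em_scale A_scale c2_simps\<close>)
qed

lemma homot_comp:
  assumes "homot n f f'" "homot m g g'" "f \<in> Z n" "f' \<in> Z n" "g \<in> Z m" "g' \<in> Z m"
  shows "homot (n + m) (endo_comp n f g) (endo_comp n f' g')"
proof -
  obtain h k where h: "h \<in> A (n - 1)" "em n f = em n f' + D * em (n - 1) h + em (n - 1) h * D"
    and k: "k \<in> A (m - 1)" "em m g = em m g' + D * em (m - 1) k + em (m - 1) k * D"
    using assms(1,2) homotD by metis
  note A = Z_A[OF assms(3)] Z_A[OF assms(4)] Z_A[OF assms(5)] Z_A[OF assms(6)]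
  have e: "n + m - 1 = (n - 1) + m" "n + m - 1 = n + (m - 1)" by auto
  have hg: "endo_comp (n - 1) h g \<in> A (n + m - 1)" "em (n + m - 1) (endo_comp (n - 1) h g) = em (n - 1) h * em m g"
    using A_comp[OF h(1) A(3)] em_comp[OF h(1) A(3)] by (simp_all add: e(1))
  have fk: "endo_comp n f' k \<in> A (n + m - 1)" "em (n + m - 1) (endo_comp n f' k) = em n f' * em (m - 1) k"
    using A_comp[OF A(2) k(1)] em_comp[OF A(2) k(1)] by (simp_all add: e(2))
  have c: "em m g * D = D * em m g" "em n f' * (D * x) = D * (em n f' * x)" for x
    using Z_D[OF assms(5)] Z_D[OF assms(4)] by (simp_all flip: mult.assoc)
  show ?thesis unfolding homot_def
  \<comment> \<open>The witness follows \<open>f g - f' g' = (f - f') g + f' (g - g')\<close>; the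
    outer factors \<open>g\<close> and \<open>f'\<close> are cocycles and commute with the
    differential.\<close>
  proof (rule bexI[of _ "endo_comp (n - 1) h g + endo_comp n f' k"])
    have k': "em m g' = em m g + (D * em (m - 1) k + em (m - 1) k * D)"
      using k(2) ring_move[of "em m g'" "em m g"] by (simp add: c2_simps)
    have "em n f * em m g + em n f' * em m g' = (D * em (n - 1) h + em (n - 1) h * D) * em m g +
        em n f' * (D * em (m - 1) k + em (m - 1) k * D)"
      unfolding h(2) k' by (simp add: c2_simps)
    then show "em (n + m) (endo_comp n f g) + em (n + m) (endo_comp n f' g') =
        D * em (n + m - 1) (endo_comp (n - 1) h g + endo_comp n f' k) + em (n + m - 1) (endo_comp (n - 1) h g + endo_comp n f' k) * D"
      unfolding em_comp[OF A(1) A(3)] em_comp[OF A(2) A(4)] em_plus[OF hg(1) fk(1)] hg(2) fk(2)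
      by (simp add: c c2_simps)
  qed (simp add: A_plus hg fk)
qed

lemma H_gadd: "f \<in> Z n \<Longrightarrow> g \<in> Z n \<Longrightarrow> gadd H (ecl n f) (ecl n g) = ecl n (f + g)"
  using repr_ecl[of f n] repr_ecl[of g n]
  by (simp add: endo_alg_def flip: ecl_def) (simp add: ecl_eq_iff Z_plus homot_plus Z_A)

lemma H_gscale: "f \<in> Z n \<Longrightarrow> gscale H c (ecl n f) = ecl n (endo_scale P c f)"
  using repr_ecl[of f n]
  by (simp add: endo_alg_def flip: ecl_def) (simp add: ecl_eq_iff Z_scale homot_scale Z_A)

lemma H_gmult: "f \<in> Z n \<Longrightarrow> g \<in> Z m \<Longrightarrow> gmult H (ecl n f) (ecl m g) = ecl (n + m) (endo_comp n f g)"
  using repr_ecl[of f n] repr_ecl[of g m]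
  by (simp add: endo_alg_def flip: ecl_def) (simp add: ecl_eq_iff Z_comp homot_comp)

lemma aug_plus:
  assumes "f \<in> Z n" "g \<in> Z n"
  shows "Paug P \<circ> (f + g) 0 = (Paug P \<circ> f 0) + (Paug P \<circ> g 0)"
proof (rule ext)
  fix v
  show "(Paug P \<circ> (f + g) 0) v = ((Paug P \<circ> f 0) + (Paug P \<circ> g 0)) v"
    using A_mem[OF Z_A[OF assms(1)], of v 0] A_mem[OF Z_A[OF assms(2)], of v 0]
      A_out[OF Z_A[OF assms(1)], of v 0] A_out[OF Z_A[OF assms(2)], of v 0]
    by (cases "v \<in> Mcarr (Pobj P n)") (simp_all add: hom_add[OF res_aug[OF P]] res_aug_zero[OF P])
qed

lemma aug_scale:
  assumes "f \<in> Z n"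
  shows "Paug P \<circ> endo_scale P c f 0 = (\<lambda>v. c * Paug P (f 0 v))"
proof (rule ext)
  fix v
  have "f 0 v \<in> Mcarr (Pobj P 0)"
    using A_mem[OF Z_A[OF assms(1)], of v 0] A_out[OF Z_A[OF assms(1)], of v 0] module_zero[OF mP[of 0]]
    by (cases "v \<in> Mcarr (Pobj P n)") simp_all
  then show "(Paug P \<circ> endo_scale P c f 0) v = c * Paug P (f 0 v)"
    by (simp add: endo_scale_def hom_scale[OF res_aug[OF P]] trivial_module_def)
qed

lemma L_gadd: "f \<in> Z n \<Longrightarrow> g \<in> Z n \<Longrightarrow> gadd \<Lambda> (tcl n f) (tcl n g) = tcl n (f + g)"
proof -
  assume f: "f \<in> Z n" and g: "g \<in> Z n"
  obtain f' where f': "f' \<in> Z n" "homot n f' f" "repr (tcl n f) = Paug P \<circ> f' 0" using repr_tcl[OF f] .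
  obtain g' where g': "g' \<in> Z n" "homot n g' g" "repr (tcl n g) = Paug P \<circ> g' 0" using repr_tcl[OF g] .
  have "gadd \<Lambda> (tcl n f) (tcl n g) = tcl n (f' + g')"
    unfolding tcl_def[of n "f' + g'"] aug_plus[OF f'(1) g'(1)] by (simp add: tate_alg_def f' g')
  then show ?thesis using f g f' g' by (simp add: tcl_eq_iff Z_plus homot_plus Z_A)
qed

lemma L_gscale: "f \<in> Z n \<Longrightarrow> gscale \<Lambda> c (tcl n f) = tcl n (endo_scale P c f)"
proof -
  assume f: "f \<in> Z n"
  obtain f' where f': "f' \<in> Z n" "homot n f' f" "repr (tcl n f) = Paug P \<circ> f' 0" using repr_tcl[OF f] .
  have "gscale \<Lambda> c (tcl n f) = tcl n (endo_scale P c f')"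
    by (simp add: tate_alg_def f' aug_scale[OF f'(1)] tcl_def[of n "endo_scale P c f'"])
  then show ?thesis using f f' by (simp add: tcl_eq_iff Z_scale homot_scale Z_A)
qed

lemma L_gmult: "f \<in> Z n \<Longrightarrow> g \<in> Z m \<Longrightarrow> gmult \<Lambda> (tcl n f) (tcl m g) = tcl (n + m) (endo_comp n f g)"
  by (simp add: tate_alg_def from_tate_tcl H_gmult to_tate_ecl Z_comp)

lemma L_gzero: "gzero \<Lambda> n = tcl n 0" and L_gone: "gone \<Lambda> = tcl 0 idc"
proof -
  have "Paug P \<circ> 0 = (0 :: 'v \<Rightarrow> 'k)" "Paug P \<circ> idc 0 = Paug P"
    by (auto simp: fun_eq_iff idc_def res_aug_zero[OF P] hom_out[OF res_aug[OF P]])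
  then show "gzero \<Lambda> n = tcl n 0" "gone \<Lambda> = tcl 0 idc"
    by (simp_all add: tate_alg_def tcl_def)
qed

end

section \<open>The canonical class\<close>

context char2_res
begin

lemma homog_HE: "a \<in> homog H \<Longrightarrow> (\<And>n f. f \<in> Z n \<Longrightarrow> a = ecl n f \<Longrightarrow> thesis) \<Longrightarrow> thesis"
  and homog_LE: "u \<in> homog \<Lambda> \<Longrightarrow> (\<And>n f. f \<in> Z n \<Longrightarrow> u = tcl n f \<Longrightarrow> thesis) \<Longrightarrow> thesis"
  by (auto simp: homog_H homog_L)

lemma H_mult_homog: "a \<in> homog H \<Longrightarrow> b \<in> homog H \<Longrightarrow> gmult H a b \<in> homog H"
  and fst_H_mult: "a \<in> homog H \<Longrightarrow> b \<in> homog H \<Longrightarrow> fst (gmult H a b) = fst a + fst b"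
  by (auto elim!: homog_HE simp: H_gmult intro!: ecl_homog Z_comp)

lemma H_mult_assoc:
  "a \<in> homog H \<Longrightarrow> b \<in> homog H \<Longrightarrow> c \<in> homog H \<Longrightarrow> gmult H (gmult H a b) c = gmult H a (gmult H b c)"
proof -
  have "endo_comp (n + m) (endo_comp n f g) h = endo_comp n f (endo_comp m g h)" for n m and f g h :: "int \<Rightarrow> 'v \<Rightarrow> 'v"
    by (simp add: endo_comp_def fun_eq_iff add.assoc)
  then show "a \<in> homog H \<Longrightarrow> b \<in> homog H \<Longrightarrow> c \<in> homog H \<Longrightarrow> gmult H (gmult H a b) c = gmult H a (gmult H b c)"
    by (auto simp: homog_H H_gmult Z_comp add.assoc)
qed

lemma gcomp_homog: "a \<in> gcomp H n \<Longrightarrow> a \<in> homog H" "u \<in> gcomp \<Lambda> n \<Longrightarrow> u \<in> homog \<Lambda>"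
  by (auto simp: homog_def)

lemma gcomp_fst: "a \<in> gcomp H n \<Longrightarrow> fst a = n" "u \<in> gcomp \<Lambda> n \<Longrightarrow> fst u = n"
  by (auto simp: H_gcomp L_gcomp)

lemma homog_gcomp: "a \<in> homog H \<Longrightarrow> a \<in> gcomp H (fst a)" "u \<in> homog \<Lambda> \<Longrightarrow> u \<in> gcomp \<Lambda> (fst u)"
  by (auto simp: homog_H homog_L H_gcomp L_gcomp)

lemma H_add_gcomp: "a \<in> gcomp H n \<Longrightarrow> b \<in> gcomp H n \<Longrightarrow> gadd H a b \<in> gcomp H n"
  by (auto simp: H_gcomp H_gadd intro: Z_plus)

lemma H_scale_homog: "a \<in> homog H \<Longrightarrow> gscale H c a \<in> homog H" "a \<in> homog H \<Longrightarrow> fst (gscale H c a) = fst a"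
  by (auto elim!: homog_HE simp: H_gscale intro!: ecl_homog Z_scale)

lemma H_distrib:
  "a \<in> gcomp H n \<Longrightarrow> a' \<in> gcomp H n \<Longrightarrow> b \<in> homog H \<Longrightarrow> gmult H (gadd H a a') b = gadd H (gmult H a b) (gmult H a' b)"
  "a \<in> gcomp H n \<Longrightarrow> a' \<in> gcomp H n \<Longrightarrow> b \<in> homog H \<Longrightarrow> gmult H b (gadd H a a') = gadd H (gmult H b a) (gmult H b a')"
proof -
  have 1: "endo_comp n (f + f') g = endo_comp n f g + endo_comp n f' g" for f f' g :: "int \<Rightarrow> 'v \<Rightarrow> 'v"
    by (simp add: endo_comp_def fun_eq_iff)
  have 2: "endo_comp m g (f + f') = endo_comp m g f + endo_comp m g f'"
    if "f \<in> A n" "f' \<in> A n" "g \<in> A m" for f f' g m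
    by (rule em_inj[of _ "m + n"]) (use that in \<open>auto simp: A_comp A_plus em_comp em_plus distrib_left\<close>)
  show "a \<in> gcomp H n \<Longrightarrow> a' \<in> gcomp H n \<Longrightarrow> b \<in> homog H \<Longrightarrow> gmult H (gadd H a a') b = gadd H (gmult H a b) (gmult H a' b)"
    "a \<in> gcomp H n \<Longrightarrow> a' \<in> gcomp H n \<Longrightarrow> b \<in> homog H \<Longrightarrow> gmult H b (gadd H a a') = gadd H (gmult H b a) (gmult H b a')"
    by (auto simp: H_gcomp homog_H H_gadd H_gmult Z_plus Z_comp 1 2 Z_A)
qed

lemma H_scale_mult:
  "a \<in> homog H \<Longrightarrow> b \<in> homog H \<Longrightarrow> gmult H (gscale H c a) b = gscale H c (gmult H a b)"
  "a \<in> homog H \<Longrightarrow> b \<in> homog H \<Longrightarrow> gmult H a (gscale H c b) = gscale H c (gmult H a b)"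
proof -
  have 1: "endo_comp n (endo_scale P c f) g = endo_scale P c (endo_comp n f g)" for n f g
    by (simp add: endo_comp_def endo_scale_def fun_eq_iff)
  have 2: "endo_comp n f (endo_scale P c g) = endo_scale P c (endo_comp n f g)" if "f \<in> A n" "g \<in> A m" for n m f g
  proof (rule em_inj[of _ "n + m"])
    show "em (n + m) (endo_comp n f (endo_scale P c g)) = em (n + m) (endo_scale P c (endo_comp n f g))"
      using that by (simp add: A_comp A_scale em_comp em_scale em_sc flip: mult.assoc)
  qed (use that in \<open>auto intro: A_comp A_scale\<close>)
  show "a \<in> homog H \<Longrightarrow> b \<in> homog H \<Longrightarrow> gmult H (gscale H c a) b = gscale H c (gmult H a b)"
    by (auto simp: homog_H H_gscale H_gmult Z_scale Z_comp 1)
  show "a \<in> homog H \<Longrightarrow> b \<in> homog H \<Longrightarrow> gmult H a (gscale H c b) = gscale H c (gmult H a b)"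
    by (auto simp: homog_H H_gscale H_gmult Z_scale Z_comp 2[OF Z_A Z_A])
qed

abbreviation ft :: "int \<times> ('v \<Rightarrow> 'k) set \<Rightarrow> int \<times> (int \<Rightarrow> 'v \<Rightarrow> 'v) set" where "ft \<equiv> from_tate G P"

lemma ft_homog: "u \<in> homog \<Lambda> \<Longrightarrow> ft u \<in> homog H" and fst_ft: "u \<in> homog \<Lambda> \<Longrightarrow> fst (ft u) = fst u"
  and ft_gcomp: "u \<in> gcomp \<Lambda> n \<Longrightarrow> ft u \<in> gcomp H n"
  by (auto elim!: homog_LE simp: L_gcomp H_gcomp from_tate_tcl intro!: ecl_homog)

lemma ft_add: "u \<in> gcomp \<Lambda> n \<Longrightarrow> v \<in> gcomp \<Lambda> n \<Longrightarrow> ft (gadd \<Lambda> u v) = gadd H (ft u) (ft v)"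
  by (auto simp: L_gcomp L_gadd from_tate_tcl H_gadd Z_plus)

lemma ft_scale: "u \<in> homog \<Lambda> \<Longrightarrow> ft (gscale \<Lambda> c u) = gscale H c (ft u)"
  by (auto simp: homog_L L_gscale from_tate_tcl H_gscale Z_scale)

lemma ft_mult: "u \<in> homog \<Lambda> \<Longrightarrow> v \<in> homog \<Lambda> \<Longrightarrow> ft (gmult \<Lambda> u v) = gmult H (ft u) (ft v)"
  by (auto simp: homog_L L_gmult from_tate_tcl H_gmult Z_comp)

lemma L_mult_homog: "u \<in> homog \<Lambda> \<Longrightarrow> v \<in> homog \<Lambda> \<Longrightarrow> gmult \<Lambda> u v \<in> homog \<Lambda>"
  and fst_L_mult: "u \<in> homog \<Lambda> \<Longrightarrow> v \<in> homog \<Lambda> \<Longrightarrow> fst (gmult \<Lambda> u v) = fst u + fst v"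
  and L_mult_gcomp: "u \<in> gcomp \<Lambda> n \<Longrightarrow> v \<in> gcomp \<Lambda> m \<Longrightarrow> gmult \<Lambda> u v \<in> gcomp \<Lambda> (n + m)"
  by (auto elim!: homog_LE simp: L_gcomp L_gmult intro!: tcl_homog Z_comp)

lemma L_add_gcomp: "u \<in> gcomp \<Lambda> n \<Longrightarrow> v \<in> gcomp \<Lambda> n \<Longrightarrow> gadd \<Lambda> u v \<in> gcomp \<Lambda> n"
  and L_scale_homog: "w \<in> homog \<Lambda> \<Longrightarrow> gscale \<Lambda> c w \<in> homog \<Lambda>"
  and fst_L_scale: "w \<in> homog \<Lambda> \<Longrightarrow> fst (gscale \<Lambda> c w) = fst w"
  by (auto elim!: homog_LE simp: L_gcomp L_gadd L_gscale intro!: tcl_homog Z_plus Z_scale)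

lemma L_scale_one [simp]: "u \<in> homog \<Lambda> \<Longrightarrow> gscale \<Lambda> 1 u = u"
proof -
  assume "u \<in> homog \<Lambda>"
  then obtain n f where f: "f \<in> Z n" "u = tcl n f" by (auto simp: homog_L)
  have "endo_scale P 1 f = f" using endo_scale_sign[of 0 f] by simp
  then show ?thesis using f by (simp add: L_gscale)
qed

lemma L_distrib:
  "u \<in> gcomp \<Lambda> n \<Longrightarrow> u' \<in> gcomp \<Lambda> n \<Longrightarrow> v \<in> homog \<Lambda> \<Longrightarrow> gmult \<Lambda> (gadd \<Lambda> u u') v = gadd \<Lambda> (gmult \<Lambda> u v) (gmult \<Lambda> u' v)"
  "u \<in> gcomp \<Lambda> n \<Longrightarrow> u' \<in> gcomp \<Lambda> n \<Longrightarrow> v \<in> homog \<Lambda> \<Longrightarrow> gmult \<Lambda> v (gadd \<Lambda> u u') = gadd \<Lambda> (gmult \<Lambda> v u) (gmult \<Lambda> v u')"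
proof -
  \<comment> \<open>\<open>from_tate\<close> is injective and turns the operations into those of the
    cohomology of the dga, where the laws come from composition of maps.\<close>
  have inj: "w = w'" if w: "w \<in> homog \<Lambda>" "w' \<in> homog \<Lambda>" "ft w = ft w'" for w w'
  proof -
    obtain n f m g where f: "f \<in> Z n" "w = tcl n f" and g: "g \<in> Z m" "w' = tcl m g"
      using w(1,2) by (auto simp: homog_L)
    then have "to_tate G P (ft w) = w" "to_tate G P (ft w') = w'"
      by (simp_all add: from_tate_tcl to_tate_ecl)
    then show ?thesis using w(3) by metis
  qed
  assume u: "u \<in> gcomp \<Lambda> n" "u' \<in> gcomp \<Lambda> n" and v: "v \<in> homog \<Lambda>"
  note h = gcomp_homog(2)[OF u(1)] gcomp_homog(2)[OF u(2)] gcomp_homog(2)[OF L_add_gcomp[OF u]]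
  note m = L_mult_gcomp[OF u(1) homog_gcomp(2)[OF v]] L_mult_gcomp[OF u(2) homog_gcomp(2)[OF v]]
    L_mult_gcomp[OF homog_gcomp(2)[OF v] u(1)] L_mult_gcomp[OF homog_gcomp(2)[OF v] u(2)]
  show "gmult \<Lambda> (gadd \<Lambda> u u') v = gadd \<Lambda> (gmult \<Lambda> u v) (gmult \<Lambda> u' v)"
    by (rule inj) (use h v u m in \<open>auto simp: ft_mult ft_add H_distrib(1)[OF ft_gcomp[OF u(1)] ft_gcomp[OF u(2)] ft_homog[OF v]]
      ft_add[OF m(1) m(2)] intro: L_mult_homog gcomp_homog L_add_gcomp\<close>)
  show "gmult \<Lambda> v (gadd \<Lambda> u u') = gadd \<Lambda> (gmult \<Lambda> v u) (gmult \<Lambda> v u')"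
    by (rule inj) (use h v u m in \<open>auto simp: ft_mult ft_add H_distrib(2)[OF ft_gcomp[OF u(1)] ft_gcomp[OF u(2)] ft_homog[OF v]]
      ft_add[OF m(3) m(4)] intro: L_mult_homog gcomp_homog L_add_gcomp\<close>)
qed

lemma L_gcompE: "u \<in> gcomp \<Lambda> n \<Longrightarrow> (\<And>f. f \<in> Z n \<Longrightarrow> u = tcl n f \<Longrightarrow> thesis) \<Longrightarrow> thesis"
  by (auto simp: L_gcomp)

lemma L_add_assoc: "u \<in> gcomp \<Lambda> n \<Longrightarrow> v \<in> gcomp \<Lambda> n \<Longrightarrow> w \<in> gcomp \<Lambda> n \<Longrightarrow>
    gadd \<Lambda> (gadd \<Lambda> u v) w = gadd \<Lambda> u (gadd \<Lambda> v w)"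
  and L_add_comm: "u \<in> gcomp \<Lambda> n \<Longrightarrow> v \<in> gcomp \<Lambda> n \<Longrightarrow> gadd \<Lambda> u v = gadd \<Lambda> v u"
  and L_add_self: "u \<in> gcomp \<Lambda> n \<Longrightarrow> gadd \<Lambda> u u = gzero \<Lambda> n"
  and L_add_zero: "u \<in> gcomp \<Lambda> n \<Longrightarrow> gadd \<Lambda> u (gzero \<Lambda> n) = u"
    "u \<in> gcomp \<Lambda> n \<Longrightarrow> gadd \<Lambda> (gzero \<Lambda> n) u = u"
proof -
  assume "u \<in> gcomp \<Lambda> n"
  then obtain f where f: "f \<in> Z n" "u = tcl n f" by (rule L_gcompE)
  show "gadd \<Lambda> u u = gzero \<Lambda> n" "gadd \<Lambda> u (gzero \<Lambda> n) = u" "gadd \<Lambda> (gzero \<Lambda> n) u = u"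
    by (simp_all add: f L_gadd L_gzero Z_zero)
  assume "v \<in> gcomp \<Lambda> n"
  then obtain g where g: "g \<in> Z n" "v = tcl n g" by (rule L_gcompE)
  show "gadd \<Lambda> u v = gadd \<Lambda> v u"
    by (simp add: f g L_gadd add.commute)
  assume "w \<in> gcomp \<Lambda> n"
  then obtain h where h: "h \<in> Z n" "w = tcl n h" by (rule L_gcompE)
  show "gadd \<Lambda> (gadd \<Lambda> u v) w = gadd \<Lambda> u (gadd \<Lambda> v w)"
    by (simp add: f g h L_gadd Z_plus add.assoc)
qed

lemma L_zero_gcomp: "gzero \<Lambda> n \<in> gcomp \<Lambda> n"
  using Z_zero by (auto simp: L_gcomp L_gzero)

lemma L_add_left_comm: "u \<in> gcomp \<Lambda> n \<Longrightarrow> v \<in> gcomp \<Lambda> n \<Longrightarrow> w \<in> gcomp \<Lambda> n \<Longrightarrow>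
    gadd \<Lambda> u (gadd \<Lambda> v w) = gadd \<Lambda> v (gadd \<Lambda> u w)"
  using L_add_assoc[of u n v w] L_add_assoc[of v n u w] L_add_comm[of u n v] by simp

text \<open>The shape is that of \<open>hh_diff_2\<close>, including the zero at the end of
  \<open>gsum\<close>. As \<open>gadd\<close> obeys its laws only within one degree, the sum is
  rearranged on representatives.\<close>

lemma L_add_four:
  assumes "a \<in> gcomp \<Lambda> n" "b \<in> gcomp \<Lambda> n" "c \<in> gcomp \<Lambda> n" "d \<in> gcomp \<Lambda> n"
    and "a' \<in> gcomp \<Lambda> n" "b' \<in> gcomp \<Lambda> n" "c' \<in> gcomp \<Lambda> n" "d' \<in> gcomp \<Lambda> n"
  shows "gadd \<Lambda> (gadd \<Lambda> a a') (gadd \<Lambda> (gadd \<Lambda> b b') (gadd \<Lambda> (gadd \<Lambda> c c') (gadd \<Lambda> (gadd \<Lambda> d d') (gzero \<Lambda> n)))) =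
    gadd \<Lambda> (gadd \<Lambda> a (gadd \<Lambda> b (gadd \<Lambda> c (gadd \<Lambda> d (gzero \<Lambda> n)))))
      (gadd \<Lambda> a' (gadd \<Lambda> b' (gadd \<Lambda> c' (gadd \<Lambda> d' (gzero \<Lambda> n)))))"
proof -
  obtain f1 f2 f3 f4 g1 g2 g3 g4 where
    "f1 \<in> Z n" "a = tcl n f1" "f2 \<in> Z n" "b = tcl n f2" "f3 \<in> Z n" "c = tcl n f3" "f4 \<in> Z n" "d = tcl n f4"
    "g1 \<in> Z n" "a' = tcl n g1" "g2 \<in> Z n" "b' = tcl n g2" "g3 \<in> Z n" "c' = tcl n g3" "g4 \<in> Z n" "d' = tcl n g4"
    using assms by (fastforce simp: L_gcomp)
  then show ?thesis
    by (simp add: L_gadd L_gzero Z_plus Z_zero) (simp add: add.assoc add.left_commute)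
qed

lemma tuples_2: "as \<in> tuples \<Lambda> 2 \<longleftrightarrow> (\<exists>u\<in>homog \<Lambda>. \<exists>v\<in>homog \<Lambda>. as = [u, v])"
  and tuples_3: "as \<in> tuples \<Lambda> 3 \<longleftrightarrow> (\<exists>u\<in>homog \<Lambda>. \<exists>v\<in>homog \<Lambda>. \<exists>w\<in>homog \<Lambda>. as = [u, v, w])"
  and tuples_4: "as \<in> tuples \<Lambda> 4 \<longleftrightarrow>
    (\<exists>u\<in>homog \<Lambda>. \<exists>v\<in>homog \<Lambda>. \<exists>w\<in>homog \<Lambda>. \<exists>x\<in>homog \<Lambda>. as = [u, v, w, x])"
  by (auto simp: tuples_def eval_nat_numeral length_Suc_conv)

lemma hh_diff_2:
  assumes \<psi>: "\<And>as. as \<in> tuples \<Lambda> 2 \<Longrightarrow> \<psi> as \<in> homog \<Lambda>" and h: "u \<in> homog \<Lambda>" "v \<in> homog \<Lambda>" "w \<in> homog \<Lambda>"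
  shows "hh_diff \<Lambda> 2 m \<psi> [u, v, w] = gadd \<Lambda> (gmult \<Lambda> u (\<psi> [v, w])) (gadd \<Lambda> (\<psi> [gmult \<Lambda> u v, w])
    (gadd \<Lambda> (\<psi> [u, gmult \<Lambda> v w]) (gadd \<Lambda> (gmult \<Lambda> (\<psi> [u, v]) w) (gzero \<Lambda> (tdeg \<Lambda> [u, v, w] + m)))))"
proof -
  have t: "[u, v] \<in> tuples \<Lambda> 2" "[v, w] \<in> tuples \<Lambda> 2" "[gmult \<Lambda> u v, w] \<in> tuples \<Lambda> 2" "[u, gmult \<Lambda> v w] \<in> tuples \<Lambda> 2"
    using h L_mult_homog by (auto simp: tuples_2)
  have t3: "[u, v, w] \<in> tuples \<Lambda> (Suc 2)" using h by (simp add: tuples_def)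
  have e: "[1..<Suc 2] = [1, 2]" by (simp add: upt_rec)
  show ?thesis
    unfolding hh_diff_def restrict_apply'[OF t3] e
    using \<psi>[OF t(1)] \<psi>[OF t(2)] \<psi>[OF t(3)] \<psi>[OF t(4)] h
    by (simp add: gsum_def neg_one L_mult_homog eval_nat_numeral)
qed

lemma hh_diff_3:
  assumes \<psi>: "\<And>as. as \<in> tuples \<Lambda> 3 \<Longrightarrow> \<psi> as \<in> homog \<Lambda>"
    and h: "u \<in> homog \<Lambda>" "v \<in> homog \<Lambda>" "w \<in> homog \<Lambda>" "x \<in> homog \<Lambda>"
  shows "hh_diff \<Lambda> 3 m \<psi> [u, v, w, x] = gadd \<Lambda> (gmult \<Lambda> u (\<psi> [v, w, x])) (gadd \<Lambda> (\<psi> [gmult \<Lambda> u v, w, x])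
    (gadd \<Lambda> (\<psi> [u, gmult \<Lambda> v w, x]) (gadd \<Lambda> (\<psi> [u, v, gmult \<Lambda> w x])
    (gadd \<Lambda> (gmult \<Lambda> (\<psi> [u, v, w]) x) (gzero \<Lambda> (tdeg \<Lambda> [u, v, w, x] + m))))))"
proof -
  have t: "[u, v, w] \<in> tuples \<Lambda> 3" "[v, w, x] \<in> tuples \<Lambda> 3" "[gmult \<Lambda> u v, w, x] \<in> tuples \<Lambda> 3"
    "[u, gmult \<Lambda> v w, x] \<in> tuples \<Lambda> 3" "[u, v, gmult \<Lambda> w x] \<in> tuples \<Lambda> 3"
    using h L_mult_homog by (auto simp: tuples_3)
  have t4: "[u, v, w, x] \<in> tuples \<Lambda> (Suc 3)" using h by (simp add: tuples_def)
  have e: "[1..<Suc 3] = [1, 2, 3]" by (simp add: upt_rec)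
  show ?thesis
    unfolding hh_diff_def restrict_apply'[OF t4] e
    using \<psi>[OF t(1)] \<psi>[OF t(2)] \<psi>[OF t(3)] \<psi>[OF t(4)] \<psi>[OF t(5)] h
    by (simp add: gsum_def neg_one L_mult_homog eval_nat_numeral)
qed

lemma hh_cochains_values: "\<phi> \<in> hh_cochains \<Lambda> n m \<Longrightarrow> as \<in> tuples \<Lambda> n \<Longrightarrow> \<phi> as \<in> gcomp \<Lambda> (tdeg \<Lambda> as + m)"
  by (simp add: hh_cochains_def)

lemma hh_diff_2_cochain:
  assumes \<psi>: "\<psi> \<in> hh_cochains \<Lambda> 2 m" and h: "u \<in> homog \<Lambda>" "v \<in> homog \<Lambda>" "w \<in> homog \<Lambda>"
  shows "hh_diff \<Lambda> 2 m \<psi> [u, v, w] = gadd \<Lambda> (gmult \<Lambda> u (\<psi> [v, w])) (gadd \<Lambda> (\<psi> [gmult \<Lambda> u v, w])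
    (gadd \<Lambda> (\<psi> [u, gmult \<Lambda> v w]) (gadd \<Lambda> (gmult \<Lambda> (\<psi> [u, v]) w) (gzero \<Lambda> (tdeg \<Lambda> [u, v, w] + m)))))"
  by (rule hh_diff_2[OF _ h]) (rule gcomp_homog(2)[OF hh_cochains_values[OF \<psi>]])

lemma hh_diff_3_cochain:
  assumes \<psi>: "\<psi> \<in> hh_cochains \<Lambda> 3 m" and h: "u \<in> homog \<Lambda>" "v \<in> homog \<Lambda>" "w \<in> homog \<Lambda>" "x \<in> homog \<Lambda>"
  shows "hh_diff \<Lambda> 3 m \<psi> [u, v, w, x] = gadd \<Lambda> (gmult \<Lambda> u (\<psi> [v, w, x])) (gadd \<Lambda> (\<psi> [gmult \<Lambda> u v, w, x])
    (gadd \<Lambda> (\<psi> [u, gmult \<Lambda> v w, x]) (gadd \<Lambda> (\<psi> [u, v, gmult \<Lambda> w x])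
    (gadd \<Lambda> (gmult \<Lambda> (\<psi> [u, v, w]) x) (gzero \<Lambda> (tdeg \<Lambda> [u, v, w, x] + m))))))"
  by (rule hh_diff_3[OF _ h]) (rule gcomp_homog(2)[OF hh_cochains_values[OF \<psi>]])

lemma hh_cochains_plus:
  assumes \<phi>: "\<phi> \<in> hh_cochains \<Lambda> n m" "\<psi> \<in> hh_cochains \<Lambda> n m"
  shows "(\<lambda>as\<in>tuples \<Lambda> n. gadd \<Lambda> (\<phi> as) (\<psi> as)) \<in> hh_cochains \<Lambda> n m"
proof -
  have upd: "as[i := a] \<in> tuples \<Lambda> n" if "as \<in> tuples \<Lambda> n" "a \<in> homog \<Lambda>" for as i a
    using that set_update_subset_insert[of as i a] by (auto simp: tuples_def)
  have deg: "tdeg \<Lambda> (as[i := a]) = tdeg \<Lambda> (as[i := b])"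
    if "as \<in> tuples \<Lambda> n" "fst a = fst b" for as i and a b :: "int \<times> ('v \<Rightarrow> 'k) set"
    using that by (simp add: tdeg_def map_update)
  show ?thesis
    unfolding hh_cochains_def
  proof (intro CollectI conjI ballI allI impI)
    fix as i d a b assume as: "as \<in> tuples \<Lambda> n" and i: "i < n" and a: "a \<in> gcomp \<Lambda> d" and b: "b \<in> gcomp \<Lambda> d"
    note h = gcomp_homog(2)[OF a] gcomp_homog(2)[OF b] gcomp_homog(2)[OF L_add_gcomp[OF a b]]
    have f: "fst a = d" "fst b = d" using a b gcomp_fst by auto
    note v = hh_cochains_values[OF \<phi>(1) upd[OF as h(1), of i]] hh_cochains_values[OF \<phi>(1) upd[OF as h(2), of i]]
      hh_cochains_values[OF \<phi>(2) upd[OF as h(1), of i]] hh_cochains_values[OF \<phi>(2) upd[OF as h(2), of i]]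
    have d: "tdeg \<Lambda> (as[i := b]) = tdeg \<Lambda> (as[i := a])" using deg[OF as, of b a i] f by simp
    have 1: "\<phi> (as[i := gadd \<Lambda> a b]) = gadd \<Lambda> (\<phi> (as[i := a])) (\<phi> (as[i := b]))"
      "\<psi> (as[i := gadd \<Lambda> a b]) = gadd \<Lambda> (\<psi> (as[i := a])) (\<psi> (as[i := b]))"
      using \<phi> as i a b by (auto simp: hh_cochains_def)
    show "(\<lambda>as\<in>tuples \<Lambda> n. gadd \<Lambda> (\<phi> as) (\<psi> as)) (as[i := gadd \<Lambda> a b]) =
        gadd \<Lambda> ((\<lambda>as\<in>tuples \<Lambda> n. gadd \<Lambda> (\<phi> as) (\<psi> as)) (as[i := a])) ((\<lambda>as\<in>tuples \<Lambda> n. gadd \<Lambda> (\<phi> as) (\<psi> as)) (as[i := b]))"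
      using L_add_assoc L_add_left_comm L_add_gcomp v unfolding d
      by (simp add: upd[OF as] h 1)
  next
    fix as i c a assume as: "as \<in> tuples \<Lambda> n" and i: "i < n" and a: "a \<in> homog \<Lambda>"
    have 1: "\<phi> (as[i := gscale \<Lambda> c a]) = gscale \<Lambda> c (\<phi> (as[i := a]))"
      "\<psi> (as[i := gscale \<Lambda> c a]) = gscale \<Lambda> c (\<psi> (as[i := a]))"
      using \<phi> as i a by (auto simp: hh_cochains_def)
    have "gscale \<Lambda> c (gadd \<Lambda> u v) = gadd \<Lambda> (gscale \<Lambda> c u) (gscale \<Lambda> c v)" if "u \<in> gcomp \<Lambda> N" "v \<in> gcomp \<Lambda> N" for u v N
    proof -
      obtain f g where f: "f \<in> Z N" "u = tcl N f" and g: "g \<in> Z N" "v = tcl N g" using \<open>u \<in> gcomp \<Lambda> N\<close> \<open>v \<in> gcomp \<Lambda> N\<close> by (auto simp: L_gcomp)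
      have "endo_scale P c (f + g) = endo_scale P c f + endo_scale P c g"
        by (rule em_inj[of _ N]) (use f g in \<open>auto simp: A_scale A_plus Z_A em_scale em_plus distrib_left\<close>)
      then show ?thesis using f g by (simp add: L_gadd L_gscale Z_plus Z_scale)
    qed
    from this[OF hh_cochains_values[OF \<phi>(1) upd[OF as a]] hh_cochains_values[OF \<phi>(2) upd[OF as a]]]
    show "(\<lambda>as\<in>tuples \<Lambda> n. gadd \<Lambda> (\<phi> as) (\<psi> as)) (as[i := gscale \<Lambda> c a]) =
        gscale \<Lambda> c ((\<lambda>as\<in>tuples \<Lambda> n. gadd \<Lambda> (\<phi> as) (\<psi> as)) (as[i := a]))"
      using upd[OF as a] upd[OF as L_scale_homog[OF a]] by (simp add: 1)
  qed (use \<phi> in \<open>auto intro: L_add_gcomp hh_cochains_values\<close>)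
qed

lemma tdeg_simps [simp]: "tdeg \<Lambda> [] = 0" "tdeg \<Lambda> (u # us) = fst u + tdeg \<Lambda> us"
  by (simp_all add: tdeg_def)

lemma hh_diff_2_plus:
  assumes \<phi>: "\<phi> \<in> hh_cochains \<Lambda> 2 m" "\<psi> \<in> hh_cochains \<Lambda> 2 m"
  shows "hh_diff \<Lambda> 2 m (\<lambda>as\<in>tuples \<Lambda> 2. gadd \<Lambda> (\<phi> as) (\<psi> as)) =
    (\<lambda>as\<in>tuples \<Lambda> 3. gadd \<Lambda> (hh_diff \<Lambda> 2 m \<phi> as) (hh_diff \<Lambda> 2 m \<psi> as))"
proof
  fix as
  show "hh_diff \<Lambda> 2 m (\<lambda>as\<in>tuples \<Lambda> 2. gadd \<Lambda> (\<phi> as) (\<psi> as)) as =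
    (\<lambda>as\<in>tuples \<Lambda> 3. gadd \<Lambda> (hh_diff \<Lambda> 2 m \<phi> as) (hh_diff \<Lambda> 2 m \<psi> as)) as"
  proof (cases "as \<in> tuples \<Lambda> 3")
    case False
    then show ?thesis by (simp add: hh_diff_def)
  next
    case True
    then obtain u v w where h: "u \<in> homog \<Lambda>" "v \<in> homog \<Lambda>" "w \<in> homog \<Lambda>" and as: "as = [u, v, w]"
      by (auto simp: tuples_3)
    define N where "N = fst u + fst v + fst w + m"
    have t: "[u, v] \<in> tuples \<Lambda> 2" "[v, w] \<in> tuples \<Lambda> 2" "[gmult \<Lambda> u v, w] \<in> tuples \<Lambda> 2" "[u, gmult \<Lambda> v w] \<in> tuples \<Lambda> 2"
      using h L_mult_homog by (auto simp: tuples_2)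
    note sum = hh_cochains_plus[OF \<phi>]
    have N: "\<chi> [gmult \<Lambda> u v, w] \<in> gcomp \<Lambda> N" "\<chi> [u, gmult \<Lambda> v w] \<in> gcomp \<Lambda> N"
      "gmult \<Lambda> u (\<chi> [v, w]) \<in> gcomp \<Lambda> N" "gmult \<Lambda> (\<chi> [u, v]) w \<in> gcomp \<Lambda> N"
      "\<chi> [v, w] \<in> gcomp \<Lambda> (fst v + fst w + m)" "\<chi> [u, v] \<in> gcomp \<Lambda> (fst u + fst v + m)"
      if "\<chi> \<in> hh_cochains \<Lambda> 2 m" for \<chi>
      using hh_cochains_values[OF that t(1)] hh_cochains_values[OF that t(2)] hh_cochains_values[OF that t(3)]
        hh_cochains_values[OF that t(4)] h
        L_mult_gcomp[OF homog_gcomp(2)[OF h(1)] hh_cochains_values[OF that t(2)]]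
        L_mult_gcomp[OF hh_cochains_values[OF that t(1)] homog_gcomp(2)[OF h(3)]]
      by (simp_all add: N_def fst_L_mult algebra_simps)
    have dist: "gmult \<Lambda> u (gadd \<Lambda> (\<phi> [v, w]) (\<psi> [v, w])) = gadd \<Lambda> (gmult \<Lambda> u (\<phi> [v, w])) (gmult \<Lambda> u (\<psi> [v, w]))"
      "gmult \<Lambda> (gadd \<Lambda> (\<phi> [u, v]) (\<psi> [u, v])) w = gadd \<Lambda> (gmult \<Lambda> (\<phi> [u, v]) w) (gmult \<Lambda> (\<psi> [u, v]) w)"
      using L_distrib(2)[OF N(5)[OF \<phi>(1)] N(5)[OF \<phi>(2)] h(1)] L_distrib(1)[OF N(6)[OF \<phi>(1)] N(6)[OF \<phi>(2)] h(3)] by auto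
    have td: "tdeg \<Lambda> [u, v, w] + m = N" by (simp add: N_def)
    note NN = N[OF \<phi>(1)] N[OF \<phi>(2)]
    show ?thesis
      unfolding as restrict_apply'[OF True[unfolded as]]
      unfolding hh_diff_2_cochain[OF \<phi>(1) h] hh_diff_2_cochain[OF \<phi>(2) h] hh_diff_2_cochain[OF sum h] td
        restrict_apply'[OF t(1)] restrict_apply'[OF t(2)] restrict_apply'[OF t(3)] restrict_apply'[OF t(4)] dist
      by (rule L_add_four) (rule NN)+
  qed
qed

text \<open>The two cosets are compared elementwise: a cochain \<open>\<chi>\<close> for
  \<open>\<phi>\<close> is replaced by \<open>\<psi> + \<chi>\<close> for \<open>\<phi>'\<close>.
  Adding the coboundary of \<open>\<psi>\<close> twice changes nothing in characteristic two, so the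
  same \<open>\<psi>\<close> gives both inclusions.\<close>

lemma hh_class_cong:
  assumes \<psi>: "\<psi> \<in> hh_cochains \<Lambda> 2 m" and val: "\<And>as. as \<in> tuples \<Lambda> 3 \<Longrightarrow> \<phi> as \<in> gcomp \<Lambda> (tdeg \<Lambda> as + m)"
      "\<And>as. as \<in> tuples \<Lambda> 3 \<Longrightarrow> \<phi>' as \<in> gcomp \<Lambda> (tdeg \<Lambda> as + m)"
    and eq: "\<And>as. as \<in> tuples \<Lambda> 3 \<Longrightarrow> \<phi> as = gadd \<Lambda> (\<phi>' as) (hh_diff \<Lambda> 2 m \<psi> as)"
  shows "hh_class \<Lambda> 3 m \<phi> = hh_class \<Lambda> 3 m \<phi>'"
proof -
  have cob: "hh_coboundaries \<Lambda> 3 m = hh_diff \<Lambda> 2 m ` hh_cochains \<Lambda> 2 m"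
    by (simp add: hh_coboundaries_def eval_nat_numeral)
  have dv: "hh_diff \<Lambda> 2 m \<chi> as \<in> gcomp \<Lambda> (tdeg \<Lambda> as + m)" if \<chi>: "\<chi> \<in> hh_cochains \<Lambda> 2 m" and as: "as \<in> tuples \<Lambda> 3" for \<chi> as
  proof -
    obtain u v w where h: "u \<in> homog \<Lambda>" "v \<in> homog \<Lambda>" "w \<in> homog \<Lambda>" and as': "as = [u, v, w]"
      using as by (auto simp: tuples_3)
    have t: "[u, v] \<in> tuples \<Lambda> 2" "[v, w] \<in> tuples \<Lambda> 2" "[gmult \<Lambda> u v, w] \<in> tuples \<Lambda> 2" "[u, gmult \<Lambda> v w] \<in> tuples \<Lambda> 2"
      using h L_mult_homog by (auto simp: tuples_2)
    show ?thesis
      unfolding as' hh_diff_2_cochain[OF \<chi> h]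
      using hh_cochains_values[OF \<chi> t(3)] hh_cochains_values[OF \<chi> t(4)]
        L_mult_gcomp[OF homog_gcomp(2)[OF h(1)] hh_cochains_values[OF \<chi> t(2)]]
        L_mult_gcomp[OF hh_cochains_values[OF \<chi> t(1)] homog_gcomp(2)[OF h(3)]]
      by (intro L_add_gcomp L_zero_gcomp) (simp_all add: fst_L_mult h add.assoc add.commute add.left_commute)
  qed
  have "hh_class \<Lambda> 3 m \<phi>1 \<subseteq> hh_class \<Lambda> 3 m \<phi>2"
    if val: "\<And>as. as \<in> tuples \<Lambda> 3 \<Longrightarrow> \<phi>2 as \<in> gcomp \<Lambda> (tdeg \<Lambda> as + m)"
      and eq: "\<And>as. as \<in> tuples \<Lambda> 3 \<Longrightarrow> \<phi>1 as = gadd \<Lambda> (\<phi>2 as) (hh_diff \<Lambda> 2 m \<psi> as)" for \<phi>1 \<phi>2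
  proof
    fix \<zeta> assume "\<zeta> \<in> hh_class \<Lambda> 3 m \<phi>1"
    then obtain \<chi> where z: "\<zeta> \<in> hh_cocycles \<Lambda> 3 m" and \<chi>: "\<chi> \<in> hh_cochains \<Lambda> 2 m"
      and e: "\<zeta> = (\<lambda>as\<in>tuples \<Lambda> 3. gadd \<Lambda> (\<phi>1 as) (hh_diff \<Lambda> 2 m \<chi> as))"
      by (auto simp: hh_class_def cob)
    let ?s = "\<lambda>as\<in>tuples \<Lambda> 2. gadd \<Lambda> (\<psi> as) (\<chi> as)"
    have "\<zeta> = (\<lambda>as\<in>tuples \<Lambda> 3. gadd \<Lambda> (\<phi>2 as) (hh_diff \<Lambda> 2 m ?s as))"
      unfolding e hh_diff_2_plus[OF \<psi> \<chi>]
    proof (rule restrict_ext)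
      fix as assume as: "as \<in> tuples \<Lambda> 3"
      show "gadd \<Lambda> (\<phi>1 as) (hh_diff \<Lambda> 2 m \<chi> as) =
         gadd \<Lambda> (\<phi>2 as) ((\<lambda>as\<in>tuples \<Lambda> 3. gadd \<Lambda> (hh_diff \<Lambda> 2 m \<psi> as) (hh_diff \<Lambda> 2 m \<chi> as)) as)"
        using L_add_assoc[OF val[OF as] dv[OF \<psi> as] dv[OF \<chi> as]] by (simp add: eq[OF as] as)
    qed
    moreover have "?s \<in> hh_cochains \<Lambda> 2 m" using \<psi> \<chi> by (rule hh_cochains_plus)
    ultimately show "\<zeta> \<in> hh_class \<Lambda> 3 m \<phi>2"
      using z by (auto simp: hh_class_def cob)
  qed
  note sub = this
  have "\<phi>' as = gadd \<Lambda> (\<phi> as) (hh_diff \<Lambda> 2 m \<psi> as)" if as: "as \<in> tuples \<Lambda> 3" for as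
    using L_add_assoc[OF val(2)[OF as] dv[OF \<psi> as] dv[OF \<psi> as]] L_add_self[OF dv[OF \<psi> as]] L_add_zero(1)[OF val(2)[OF as]]
    by (simp add: eq[OF as])
  then show ?thesis
    using sub[of \<phi>' \<phi>, OF val(2) eq] sub[of \<phi> \<phi>', OF val(1)] by blast
qed

end

section \<open>The canonical cocycle of one choice of \<open>f1\<close> and
  \<open>f2\<close>\<close>

locale char2_choice = char2_res G P
  for G :: "'g monoid" and P :: "('g, 'k::field, 'v::ab_group_add) complete_res" +
  fixes f1 f2
  assumes choice: "canonical_choice G P f1 f2"
begin

lemma f1_snd: "a \<in> homog H \<Longrightarrow> f1 a \<in> snd a"
  and f1_add: "a \<in> gcomp H n \<Longrightarrow> b \<in> gcomp H n \<Longrightarrow> f1 (gadd H a b) = f1 a + f1 b"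
  and f1_scale: "a \<in> homog H \<Longrightarrow> f1 (gscale H c a) = endo_scale P c (f1 a)"
  and f2_A: "a \<in> homog H \<Longrightarrow> b \<in> homog H \<Longrightarrow> f2 a b \<in> A (fst a + fst b - 1)"
  and f2_add: "a \<in> gcomp H n \<Longrightarrow> a' \<in> gcomp H n \<Longrightarrow> b \<in> homog H \<Longrightarrow> f2 (gadd H a a') b = f2 a b + f2 a' b"
    "b \<in> homog H \<Longrightarrow> a \<in> gcomp H n \<Longrightarrow> a' \<in> gcomp H n \<Longrightarrow> f2 b (gadd H a a') = f2 b a + f2 b a'"
  and f2_scale: "a \<in> homog H \<Longrightarrow> b \<in> homog H \<Longrightarrow> f2 (gscale H c a) b = endo_scale P c (f2 a b)"
    "a \<in> homog H \<Longrightarrow> b \<in> homog H \<Longrightarrow> f2 a (gscale H c b) = endo_scale P c (f2 a b)"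
  and f2_diff: "a \<in> homog H \<Longrightarrow> b \<in> homog H \<Longrightarrow>
    endo_diff P (fst a + fst b - 1) (f2 a b) = f1 (gmult H a b) - endo_comp (fst a) (f1 a) (f1 b)"
  using choice unfolding canonical_choice_def Let_def H_gdeg by (elim conjE; (simp | metis))+

lemma f1_Z: "a \<in> homog H \<Longrightarrow> f1 a \<in> Z (fst a)"
  using f1_snd[of a] snd_ecl by (auto elim!: homog_HE)

lemmas f1_A = Z_A[OF f1_Z]

lemma f1_ecl: "a \<in> homog H \<Longrightarrow> ecl (fst a) (f1 a) = a"
proof -
  assume a: "a \<in> homog H"
  then obtain n g where g: "g \<in> Z n" "a = ecl n g" by (rule homog_HE)
  then have "homot n (f1 a) g" using f1_snd[OF a] snd_ecl by simp
  then show ?thesis using g f1_Z[OF a] ecl_eq_iff[of "f1 a" n g] by simp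
qed

lemma f1_tcl: "u \<in> homog \<Lambda> \<Longrightarrow> u = tcl (fst (ft u)) (f1 (ft u))"
proof -
  assume u: "u \<in> homog \<Lambda>"
  then obtain n g where g: "g \<in> Z n" "u = tcl n g" by (rule homog_LE)
  then have "homot n (f1 (ft u)) g"
    using f1_snd[OF ft_homog[OF u]] snd_ecl by (simp add: from_tate_tcl)
  then show ?thesis
    using g f1_Z[OF ft_homog[OF u]] tcl_eq_iff[of "f1 (ft u)" n g] by (simp add: from_tate_tcl)
qed

definition F1 where "F1 a = em (fst a) (f1 a)"
definition F2 where "F2 a b = em (fst a + fst b - 1) (f2 a b)"

lemma D_F1: "a \<in> homog H \<Longrightarrow> D * F1 a = F1 a * D"
  unfolding F1_def by (rule Z_D) (rule f1_Z)

text \<open>The equation for \<open>d f2\<close> is oriented as a rewrite rule that moves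
  \<open>D\<close> to the right. Once all \<open>D\<close> stand at the right end of their
  monomials, identities are decided by cancellation.\<close>

lemma D_F2: "a \<in> homog H \<Longrightarrow> b \<in> homog H \<Longrightarrow> D * F2 a b = F2 a b * D + F1 (gmult H a b) + F1 a * F1 b"
proof -
  assume a: "a \<in> homog H" and b: "b \<in> homog H"
  have "em (fst a + fst b) (endo_diff P (fst a + fst b - 1) (f2 a b)) = D * F2 a b + F2 a b * D"
    using em_diff[OF f2_A[OF a b]] by (simp add: F2_def)
  moreover have "em (fst a + fst b) (endo_diff P (fst a + fst b - 1) (f2 a b)) = F1 (gmult H a b) + F1 a * F1 b"
    unfolding f2_diff[OF a b] F1_def fst_H_mult[OF a b]
    using f1_A[OF H_mult_homog[OF a b]] f1_A[OF a] f1_A[OF b]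
    by (simp add: em_minus A_comp em_comp fst_H_mult a b)
  ultimately have "F2 a b * D + D * F2 a b = F1 (gmult H a b) + F1 a * F1 b" by (simp add: add.commute)
  from ring_move[OF this[unfolded add.commute[of "F2 a b * D"]]] show ?thesis by (simp add: add.assoc)
qed

lemma D_F_left:
  "a \<in> homog H \<Longrightarrow> D * (F1 a * x) = F1 a * (D * x)"
  "a \<in> homog H \<Longrightarrow> b \<in> homog H \<Longrightarrow> D * (F2 a b * x) = F2 a b * (D * x) + F1 (gmult H a b) * x + F1 a * (F1 b * x)"
  by (simp_all add: D_F1 D_F2 distrib_right flip: mult.assoc)

text \<open>The cochain whose class is \<open>canonical_value\<close>. The sign depending on the
  degree of \<open>a\<close> is dropped.\<close>

definition MM where
  "MM a b c = endo_comp (fst a + fst b - 1) (f2 a b) (f1 c) - f2 a (gmult H b c) + f2 (gmult H a b) c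
     - endo_comp (fst a) (f1 a) (f2 b c)"

context
  fixes a b c assumes h: "a \<in> homog H" "b \<in> homog H" "c \<in> homog H"
begin

lemma MM_A: "MM a b c \<in> A (fst a + fst b + fst c - 1)"
  and em_MM: "em (fst a + fst b + fst c - 1) (MM a b c) = F2 a b * F1 c + F2 a (gmult H b c) + F2 (gmult H a b) c + F1 a * F2 b c"
proof -
  have 1: "endo_comp (fst a + fst b - 1) (f2 a b) (f1 c) \<in> A (fst a + fst b + fst c - 1)"
    "em (fst a + fst b + fst c - 1) (endo_comp (fst a + fst b - 1) (f2 a b) (f1 c)) = F2 a b * F1 c"
    using A_comp[OF f2_A[OF h(1,2)] f1_A[OF h(3)]] em_comp[OF f2_A[OF h(1,2)] f1_A[OF h(3)]]
    by (simp_all add: F1_def F2_def algebra_simps)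
  have 2: "f2 a (gmult H b c) \<in> A (fst a + fst b + fst c - 1)"
    "em (fst a + fst b + fst c - 1) (f2 a (gmult H b c)) = F2 a (gmult H b c)"
    using f2_A[OF h(1) H_mult_homog[OF h(2,3)]] by (simp_all add: fst_H_mult h F2_def algebra_simps)
  have 3: "f2 (gmult H a b) c \<in> A (fst a + fst b + fst c - 1)"
    "em (fst a + fst b + fst c - 1) (f2 (gmult H a b) c) = F2 (gmult H a b) c"
    using f2_A[OF H_mult_homog[OF h(1,2)] h(3)] by (simp_all add: fst_H_mult h F2_def algebra_simps)
  have e: "fst a + (fst b + fst c - 1) = fst a + fst b + fst c - 1" by simp
  have 4: "endo_comp (fst a) (f1 a) (f2 b c) \<in> A (fst a + fst b + fst c - 1)"
    "em (fst a + fst b + fst c - 1) (endo_comp (fst a) (f1 a) (f2 b c)) = F1 a * F2 b c"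
    using A_comp[OF f1_A[OF h(1)] f2_A[OF h(2,3)]] em_comp[OF f1_A[OF h(1)] f2_A[OF h(2,3)]]
    unfolding e by (simp_all add: F1_def F2_def)
  show "MM a b c \<in> A (fst a + fst b + fst c - 1)"
    unfolding MM_def A_minus_plus by (intro A_plus 1 2 3 4)
  show "em (fst a + fst b + fst c - 1) (MM a b c) = F2 a b * F1 c + F2 a (gmult H b c) + F2 (gmult H a b) c + F1 a * F2 b c"
    unfolding MM_def A_minus_plus by (simp add: em_plus A_plus 1 2 3 4)
qed

lemma MM_Z: "MM a b c \<in> Z (fst a + fst b + fst c - 1)"
proof -
  have "D * (F2 a b * F1 c + F2 a (gmult H b c) + F2 (gmult H a b) c + F1 a * F2 b c) =
      (F2 a b * F1 c + F2 a (gmult H b c) + F2 (gmult H a b) c + F1 a * F2 b c) * D"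
    using h by (simp add: D_F1 D_F2 D_F_left H_mult_homog H_mult_assoc c2_simps)
  then show ?thesis
    using MM_A em_MM by (simp add: Z_iff)
qed

lemma canonical_value_eq: "canonical_value G P f1 f2 a b c = ecl (fst a + fst b + fst c - 1) (MM a b c)"
  by (simp add: canonical_value_def Let_def ecl_def MM_def)

end

lemma canonical_cocycle_eq:
  assumes "u \<in> homog \<Lambda>" "v \<in> homog \<Lambda>" "w \<in> homog \<Lambda>"
  shows "canonical_cocycle G P f1 f2 [u, v, w] = tcl (fst u + fst v + fst w - 1) (MM (ft u) (ft v) (ft w))"
proof -
  have "[u, v, w] \<in> tuples \<Lambda> 3" using assms by (auto simp: tuples_3)
  then show ?thesis
    using canonical_value_eq[OF ft_homog ft_homog ft_homog, OF assms] MM_Z[OF ft_homog ft_homog ft_homog, OF assms]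
    by (simp add: canonical_cocycle_def eval_nat_numeral to_tate_ecl fst_ft assms)
qed

lemma F1_add: "a \<in> gcomp H n \<Longrightarrow> b \<in> gcomp H n \<Longrightarrow> F1 (gadd H a b) = F1 a + F1 b"
  using f1_A[of a] f1_A[of b] gcomp_fst(1)[OF H_add_gcomp[of a n b]]
  by (simp add: F1_def f1_add gcomp_fst gcomp_homog em_plus)

lemma F1_scale: "a \<in> homog H \<Longrightarrow> F1 (gscale H c a) = sc c * F1 a"
  using f1_A[of a] by (simp add: F1_def f1_scale H_scale_homog em_scale)

lemma F2_add:
  "a \<in> gcomp H n \<Longrightarrow> a' \<in> gcomp H n \<Longrightarrow> b \<in> homog H \<Longrightarrow> F2 (gadd H a a') b = F2 a b + F2 a' b"
  "a \<in> gcomp H n \<Longrightarrow> a' \<in> gcomp H n \<Longrightarrow> b \<in> homog H \<Longrightarrow> F2 b (gadd H a a') = F2 b a + F2 b a'"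
proof -
  assume a: "a \<in> gcomp H n" "a' \<in> gcomp H n" and b: "b \<in> homog H"
  note f = gcomp_fst(1)[OF a(1)] gcomp_fst(1)[OF a(2)] gcomp_fst(1)[OF H_add_gcomp[OF a]]
  note hh = gcomp_homog(1)[OF a(1)] gcomp_homog(1)[OF a(2)]
  show "F2 (gadd H a a') b = F2 a b + F2 a' b"
    using f2_A[OF hh(1) b] f2_A[OF hh(2) b] by (simp add: F2_def f2_add(1)[OF a b] f em_plus)
  show "F2 b (gadd H a a') = F2 b a + F2 b a'"
    using f2_A[OF b hh(1)] f2_A[OF b hh(2)] by (simp add: F2_def f2_add(2)[OF b a] f em_plus)
qed

lemma F2_scale:
  "a \<in> homog H \<Longrightarrow> b \<in> homog H \<Longrightarrow> F2 (gscale H c a) b = sc c * F2 a b"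
  "a \<in> homog H \<Longrightarrow> b \<in> homog H \<Longrightarrow> F2 a (gscale H c b) = sc c * F2 a b"
  using f2_A[of a b] by (simp_all add: F2_def f2_scale H_scale_homog em_scale)

lemma F_sc:
  "a \<in> homog H \<Longrightarrow> F1 a * (sc c * x) = sc c * (F1 a * x)"
  "a \<in> homog H \<Longrightarrow> b \<in> homog H \<Longrightarrow> F2 a b * (sc c * x) = sc c * (F2 a b * x)"
  using em_sc[OF f1_A[of a], of c] em_sc[OF f2_A[of a b], of c] by (simp_all add: F1_def F2_def flip: mult.assoc)

lemma MM_add:
  assumes "a \<in> gcomp H n" "a' \<in> gcomp H n" and b: "b \<in> homog H" "c \<in> homog H"
  shows "MM (gadd H a a') b c = MM a b c + MM a' b c" "MM b (gadd H a a') c = MM b a c + MM b a' c"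
    "MM b c (gadd H a a') = MM b c a + MM b c a'"
proof -
  note a = assms(1,2)
  note hh = gcomp_homog(1)[OF a(1)] gcomp_homog(1)[OF a(2)] gcomp_homog(1)[OF H_add_gcomp[OF a]]
  note f = gcomp_fst(1)[OF a(1)] gcomp_fst(1)[OF a(2)] gcomp_fst(1)[OF H_add_gcomp[OF a]]
  have mg: "gmult H a b \<in> gcomp H (n + fst b)" "gmult H a' b \<in> gcomp H (n + fst b)"
    "gmult H b a \<in> gcomp H (fst b + n)" "gmult H b a' \<in> gcomp H (fst b + n)" if "b \<in> homog H" for b
    using homog_gcomp(1)[OF H_mult_homog[OF hh(1) that]] homog_gcomp(1)[OF H_mult_homog[OF hh(2) that]]
      homog_gcomp(1)[OF H_mult_homog[OF that hh(1)]] homog_gcomp(1)[OF H_mult_homog[OF that hh(2)]]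
    by (simp_all add: fst_H_mult hh that f)
  note lin = F1_add[OF a] F2_add[OF a] H_distrib[OF a] F2_add[OF mg(1,2)] F2_add[OF mg(3,4)]
  note A = MM_A[OF hh(1) b] MM_A[OF hh(2) b] MM_A[OF hh(3) b] MM_A[OF b(1) hh(1) b(2)] MM_A[OF b(1) hh(2) b(2)]
    MM_A[OF b(1) hh(3) b(2)] MM_A[OF b hh(1)] MM_A[OF b hh(2)] MM_A[OF b hh(3)]
  note E = em_MM[OF hh(1) b] em_MM[OF hh(2) b] em_MM[OF hh(3) b] em_MM[OF b(1) hh(1) b(2)] em_MM[OF b(1) hh(2) b(2)]
    em_MM[OF b(1) hh(3) b(2)] em_MM[OF b hh(1)] em_MM[OF b hh(2)] em_MM[OF b hh(3)]
  show "MM (gadd H a a') b c = MM a b c + MM a' b c"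
    by (rule em_inj[of _ "n + fst b + fst c - 1"])
      (use A E in \<open>simp_all add: A_plus em_plus f lin b hh H_mult_homog c2_simps\<close>)
  show "MM b (gadd H a a') c = MM b a c + MM b a' c"
    by (rule em_inj[of _ "fst b + n + fst c - 1"])
      (use A E in \<open>simp_all add: A_plus em_plus f lin b hh H_mult_homog c2_simps\<close>)
  show "MM b c (gadd H a a') = MM b c a + MM b c a'"
    by (rule em_inj[of _ "fst b + fst c + n - 1"])
      (use A E in \<open>simp_all add: A_plus em_plus f lin b hh H_mult_homog c2_simps\<close>)
qed

lemma MM_scale:
  assumes a: "a \<in> homog H" and b: "b \<in> homog H" "c \<in> homog H"
  shows "MM (gscale H e a) b c = endo_scale P e (MM a b c)" "MM b (gscale H e a) c = endo_scale P e (MM b a c)"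
    "MM b c (gscale H e a) = endo_scale P e (MM b c a)"
proof -
  note s = H_scale_homog[OF a]
  note A = MM_A[OF a b] MM_A[OF b(1) a b(2)] MM_A[OF b a] MM_A[OF s(1) b] MM_A[OF b(1) s(1) b(2)] MM_A[OF b s(1)]
  note E = em_MM[OF a b] em_MM[OF b(1) a b(2)] em_MM[OF b a] em_MM[OF s(1) b] em_MM[OF b(1) s(1) b(2)] em_MM[OF b s(1)]
  show "MM (gscale H e a) b c = endo_scale P e (MM a b c)"
    by (rule em_inj[of _ "fst a + fst b + fst c - 1"])
      (use A E in \<open>simp_all add: A_scale em_scale s a b F1_scale F2_scale F_sc H_scale_mult H_mult_homog distrib_left mult.assoc\<close>)
  show "MM b (gscale H e a) c = endo_scale P e (MM b a c)"
    by (rule em_inj[of _ "fst b + fst a + fst c - 1"])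
      (use A E in \<open>simp_all add: A_scale em_scale s a b F1_scale F2_scale F_sc H_scale_mult H_mult_homog distrib_left mult.assoc\<close>)
  show "MM b c (gscale H e a) = endo_scale P e (MM b c a)"
    by (rule em_inj[of _ "fst b + fst c + fst a - 1"])
      (use A E in \<open>simp_all add: A_scale em_scale s a b F1_scale F2_scale F_sc H_scale_mult H_mult_homog distrib_left mult.assoc\<close>)
qed

lemma canonical_cocycle_cochain: "canonical_cocycle G P f1 f2 \<in> hh_cochains \<Lambda> 3 (-1)"
  unfolding hh_cochains_def
proof (intro CollectI conjI ballI allI impI)
  show "canonical_cocycle G P f1 f2 \<in> extensional (tuples \<Lambda> 3)"
    by (simp add: canonical_cocycle_def)
  fix as assume "as \<in> tuples \<Lambda> 3"
  then obtain u v w where h: "u \<in> homog \<Lambda>" "v \<in> homog \<Lambda>" "w \<in> homog \<Lambda>" and as: "as = [u, v, w]"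
    by (auto simp: tuples_3)
  show "canonical_cocycle G P f1 f2 as \<in> gcomp \<Lambda> (tdeg \<Lambda> as + -1)"
    using MM_Z[OF ft_homog ft_homog ft_homog, OF h]
    by (simp add: as canonical_cocycle_eq h L_gcomp fst_ft add.assoc[symmetric])
  fix i :: nat assume "i < 3"
  then have i: "i = 0 \<or> i = 1 \<or> i = 2" by auto
  {
    fix d a b assume a: "a \<in> gcomp \<Lambda> d" and b: "b \<in> gcomp \<Lambda> d"
    note hab = gcomp_homog(2)[OF a] gcomp_homog(2)[OF b] gcomp_homog(2)[OF L_add_gcomp[OF a b]]
    note f = gcomp_fst(2)[OF a] gcomp_fst(2)[OF b] gcomp_fst(2)[OF L_add_gcomp[OF a b]]
    note g = ft_gcomp[OF a] ft_gcomp[OF b]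
    have zz: "\<And>p q r. p \<in> homog \<Lambda> \<Longrightarrow> q \<in> homog \<Lambda> \<Longrightarrow> r \<in> homog \<Lambda> \<Longrightarrow> MM (ft p) (ft q) (ft r) \<in> Z (fst p + fst q + fst r - 1)"
      using MM_Z[OF ft_homog ft_homog ft_homog] by (simp add: fst_ft)
    show "canonical_cocycle G P f1 f2 (as[i := gadd \<Lambda> a b]) =
        gadd \<Lambda> (canonical_cocycle G P f1 f2 (as[i := a])) (canonical_cocycle G P f1 f2 (as[i := b]))"
      using i zz[OF hab(1) h(2,3)] zz[OF hab(2) h(2,3)] zz[OF h(1) hab(1) h(3)] zz[OF h(1) hab(2) h(3)]
        zz[OF h(1,2) hab(1)] zz[OF h(1,2) hab(2)]
      by (auto simp: as canonical_cocycle_eq h hab f ft_add[OF a b] MM_add[OF g] ft_homog L_gadd)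
  next
    fix c a assume a: "a \<in> homog \<Lambda>"
    have zz: "\<And>p q r. p \<in> homog \<Lambda> \<Longrightarrow> q \<in> homog \<Lambda> \<Longrightarrow> r \<in> homog \<Lambda> \<Longrightarrow> MM (ft p) (ft q) (ft r) \<in> Z (fst p + fst q + fst r - 1)"
      using MM_Z[OF ft_homog ft_homog ft_homog] by (simp add: fst_ft)
    show "canonical_cocycle G P f1 f2 (as[i := gscale \<Lambda> c a]) = gscale \<Lambda> c (canonical_cocycle G P f1 f2 (as[i := a]))"
      using i zz[OF a h(2,3)] zz[OF h(1) a h(3)] zz[OF h(1,2) a]
      by (auto simp: as canonical_cocycle_eq h a L_scale_homog fst_L_scale ft_scale MM_scale ft_homog L_gscale)
  }
qed

lemma canonical_cocycle_cocycle: "canonical_cocycle G P f1 f2 \<in> hh_cocycles \<Lambda> 3 (-1)"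
proof -
  let ?\<phi> = "canonical_cocycle G P f1 f2"
  have "hh_diff \<Lambda> 3 (-1) ?\<phi> as = hh_zero \<Lambda> (Suc 3) (-1) as" for as
  proof (cases "as \<in> tuples \<Lambda> 4")
    case False
    then show ?thesis by (simp add: hh_diff_def hh_zero_def)
  next
    case True
    then obtain u v w x where h: "u \<in> homog \<Lambda>" "v \<in> homog \<Lambda>" "w \<in> homog \<Lambda>" "x \<in> homog \<Lambda>" and as: "as = [u, v, w, x]"
      by (auto simp: tuples_4)
    define a b c e where "a = ft u" and "b = ft v" and "c = ft w" and "e = ft x"
    have hh: "a \<in> homog H" "b \<in> homog H" "c \<in> homog H" "e \<in> homog H"
      using h ft_homog by (simp_all add: a_def b_def c_def e_def)
    have f: "fst u = fst a" "fst v = fst b" "fst w = fst c" "fst x = fst e"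
      using h fst_ft by (simp_all add: a_def b_def c_def e_def)
    define N where "N = fst a + fst b + fst c + fst e - 1"
    have u: "u = tcl (fst a) (f1 a)" and x: "x = tcl (fst e) (f1 e)"
      using f1_tcl[OF h(1)] f1_tcl[OF h(4)] by (simp_all add: a_def e_def)
    have e: "fst a + (fst b + fst c + fst e - 1) = N" "fst a + fst b + fst c - 1 + fst e = N"
      by (simp_all add: N_def)
    have terms: "gmult \<Lambda> u (?\<phi> [v, w, x]) = tcl N (endo_comp (fst a) (f1 a) (MM b c e))"
      "?\<phi> [gmult \<Lambda> u v, w, x] = tcl N (MM (gmult H a b) c e)" "?\<phi> [u, gmult \<Lambda> v w, x] = tcl N (MM a (gmult H b c) e)"
      "?\<phi> [u, v, gmult \<Lambda> w x] = tcl N (MM a b (gmult H c e))"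
      "gmult \<Lambda> (?\<phi> [u, v, w]) x = tcl N (endo_comp (fst a + fst b + fst c - 1) (MM a b c) (f1 e))"
    proof -
      show "gmult \<Lambda> u (?\<phi> [v, w, x]) = tcl N (endo_comp (fst a) (f1 a) (MM b c e))"
        unfolding canonical_cocycle_eq[OF h(2-4)] f
        by (subst u) (simp add: L_gmult f1_Z hh MM_Z e flip: b_def c_def e_def)
      show "gmult \<Lambda> (?\<phi> [u, v, w]) x = tcl N (endo_comp (fst a + fst b + fst c - 1) (MM a b c) (f1 e))"
        unfolding canonical_cocycle_eq[OF h(1-3)] f
        by (subst x) (simp add: L_gmult f1_Z hh MM_Z e flip: a_def b_def c_def)
    qed (simp_all add: canonical_cocycle_eq h L_mult_homog fst_L_mult ft_mult f N_def add.assoc flip: a_def b_def c_def e_def)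
    have z: "endo_comp (fst a) (f1 a) (MM b c e) \<in> Z N" "endo_comp (fst a + fst b + fst c - 1) (MM a b c) (f1 e) \<in> Z N"
      "MM (gmult H a b) c e \<in> Z N" "MM a (gmult H b c) e \<in> Z N" "MM a b (gmult H c e) \<in> Z N"
      using Z_comp[OF f1_Z[OF hh(1)] MM_Z[OF hh(2-4)], unfolded e(1)] Z_comp[OF MM_Z[OF hh(1-3)] f1_Z[OF hh(4)], unfolded e(2)]
        MM_Z[OF H_mult_homog[OF hh(1,2)] hh(3,4)] MM_Z[OF hh(1) H_mult_homog[OF hh(2,3)] hh(4)]
        MM_Z[OF hh(1,2) H_mult_homog[OF hh(3,4)]]
      by (simp_all add: N_def fst_H_mult hh add.assoc)
    let ?s = "endo_comp (fst a) (f1 a) (MM b c e) + (MM (gmult H a b) c e + (MM a (gmult H b c) e +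
      (MM a b (gmult H c e) + endo_comp (fst a + fst b + fst c - 1) (MM a b c) (f1 e))))"
    have sum: "hh_diff \<Lambda> 3 (-1) ?\<phi> as = tcl N ?s"
    proof -
      have "tdeg \<Lambda> [u, v, w, x] + -1 = N" by (simp add: f N_def)
      then show ?thesis
        unfolding as hh_diff_3_cochain[OF canonical_cocycle_cochain h] terms by (simp add: L_gzero L_gadd z Z_plus Z_zero)
    qed
    have ems: "em N ?s = F1 a * (F2 b c * F1 e + F2 b (gmult H c e) + F2 (gmult H b c) e + F1 b * F2 c e) +
      (F2 (gmult H a b) c * F1 e + F2 (gmult H a b) (gmult H c e) + F2 (gmult H (gmult H a b) c) e + F1 (gmult H a b) * F2 c e) +
      (F2 a (gmult H b c) * F1 e + F2 a (gmult H (gmult H b c) e) + F2 (gmult H a (gmult H b c)) e + F1 a * F2 (gmult H b c) e) +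
      (F2 a b * F1 (gmult H c e) + F2 a (gmult H b (gmult H c e)) + F2 (gmult H a b) (gmult H c e) + F1 a * F2 b (gmult H c e)) +
      (F2 a b * F1 c + F2 a (gmult H b c) + F2 (gmult H a b) c + F1 a * F2 b c) * F1 e"
    proof -
      have m: "em N (MM (gmult H a b) c e) = F2 (gmult H a b) c * F1 e + F2 (gmult H a b) (gmult H c e) + F2 (gmult H (gmult H a b) c) e + F1 (gmult H a b) * F2 c e"
        "em N (MM a (gmult H b c) e) = F2 a (gmult H b c) * F1 e + F2 a (gmult H (gmult H b c) e) + F2 (gmult H a (gmult H b c)) e + F1 a * F2 (gmult H b c) e"
        "em N (MM a b (gmult H c e)) = F2 a b * F1 (gmult H c e) + F2 a (gmult H b (gmult H c e)) + F2 (gmult H a b) (gmult H c e) + F1 a * F2 b (gmult H c e)"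
        using em_MM[OF H_mult_homog[OF hh(1,2)] hh(3,4)] em_MM[OF hh(1) H_mult_homog[OF hh(2,3)] hh(4)]
          em_MM[OF hh(1,2) H_mult_homog[OF hh(3,4)]]
        by (simp_all add: N_def fst_H_mult hh add.assoc)
      have c: "em N (endo_comp (fst a) (f1 a) (MM b c e)) = F1 a * em (fst b + fst c + fst e - 1) (MM b c e)"
        "em N (endo_comp (fst a + fst b + fst c - 1) (MM a b c) (f1 e)) = em (fst a + fst b + fst c - 1) (MM a b c) * F1 e"
        using em_comp[OF f1_A[OF hh(1)] MM_A[OF hh(2-4)]] em_comp[OF MM_A[OF hh(1-3)] f1_A[OF hh(4)]]
        by (simp_all add: e F1_def)
      note zA = Z_A[OF z(1)] Z_A[OF z(2)] Z_A[OF z(3)] Z_A[OF z(4)] Z_A[OF z(5)]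
      note s1 = A_plus[OF zA(5,2)]
      note s2 = A_plus[OF zA(4) s1]
      note s3 = A_plus[OF zA(3) s2]
      show ?thesis
        unfolding em_plus[OF zA(1) s3] em_plus[OF zA(3) s2] em_plus[OF zA(4) s1] em_plus[OF zA(5,2)]
          m c em_MM[OF hh(2-4)] em_MM[OF hh(1-3)]
        by (simp add: add.assoc)
    qed
    \<comment> \<open>The sum of the five terms is the boundary of \<open>f2 a b\<close> times
      \<open>f2 c e\<close>: differentiating either factor yields the products with
      \<open>f1\<close>, and the remaining terms cancel by associativity of the product of
      classes.\<close>
    let ?k = "endo_comp (fst a + fst b - 1) (f2 a b) (f2 c e)"
    have k: "?k \<in> A (N - 1)" "em (N - 1) ?k = F2 a b * F2 c e"
    proof -
      have e: "fst a + fst b - 1 + (fst c + fst e - 1) = N - 1" by (simp add: N_def)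
      show "?k \<in> A (N - 1)" "em (N - 1) ?k = F2 a b * F2 c e"
        using A_comp[OF f2_A[OF hh(1,2)] f2_A[OF hh(3,4)]] em_comp[OF f2_A[OF hh(1,2)] f2_A[OF hh(3,4)]]
        unfolding e by (simp_all add: F2_def)
    qed
    have "em N ?s = D * em (N - 1) ?k + em (N - 1) ?k * D"
      unfolding ems k(2) using hh by (simp add: H_mult_assoc H_mult_homog D_F1 D_F2 D_F_left c2_simps)
    then have "homot N ?s 0"
      using k(1) by (auto simp: homot_def)
    then have "tcl N ?s = tcl N 0"
      using z by (subst tcl_eq_iff) (auto intro!: Z_plus Z_zero)
    then show ?thesis
      using True sum by (simp add: hh_zero_def L_gzero as f N_def add.assoc)
  qed
  then show ?thesis
    using canonical_cocycle_cochain by (auto simp: hh_cocycles_def fun_eq_iff)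
qed

end

section \<open>Independence of the choice of \<open>f1\<close> and \<open>f2\<close>\<close>

context char2_res
begin

lemma endo_vs: "vector_space (endo_scale P)"
proof -
  have "vector_space (Mscale (Pobj P j))" for j using module_vs[OF mP] .
  then show ?thesis
    unfolding vector_space_def endo_scale_def fun_eq_iff by simp
qed

lemma A_subspace: "module.subspace (endo_scale P) (A n)"
  using endo_vs by (simp add: module.subspace_def module_iff_vector_space A_zero A_plus A_scale)

lemma endo_diff_linear:
  assumes "f \<in> A n"
  shows "g \<in> A n \<Longrightarrow> endo_diff P n (f + g) = endo_diff P n f + endo_diff P n g"
    and "endo_diff P n (endo_scale P c f) = endo_scale P c (endo_diff P n f)"
proof -
  show "endo_diff P n (f + g) = endo_diff P n f + endo_diff P n g" if g: "g \<in> A n"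
  proof (rule em_inj[OF A_diff[OF A_plus[OF assms g]] A_plus[OF A_diff[OF assms] A_diff[OF g]]])
    show "em (n + 1) (endo_diff P n (f + g)) = em (n + 1) (endo_diff P n f + endo_diff P n g)"
      unfolding em_diff[OF A_plus[OF assms g]] em_plus[OF A_diff[OF assms] A_diff[OF g]] em_diff[OF assms] em_diff[OF g]
        em_plus[OF assms g] by (simp add: c2_simps)
  qed
  have c: "D * (sc c * x) = sc c * (D * x)" for x
    by (simp add: D_sc flip: mult.assoc)
  show "endo_diff P n (endo_scale P c f) = endo_scale P c (endo_diff P n f)"
  proof (rule em_inj[OF A_diff[OF A_scale[OF assms]] A_scale[OF A_diff[OF assms]]])
    show "em (n + 1) (endo_diff P n (endo_scale P c f)) = em (n + 1) (endo_scale P c (endo_diff P n f))"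
      unfolding em_diff[OF A_scale[OF assms]] em_scale[OF A_diff[OF assms]] em_diff[OF assms] em_scale[OF assms]
      by (simp add: c distrib_left mult.assoc)
  qed
qed

text \<open>The comparison of two choices has to produce a multilinear Hochschild cochain. So
  primitives of coboundaries must be chosen linearly, not one by one.\<close>

lemma diff_section:
  obtains \<sigma> where "Vector_Spaces.linear (endo_scale P) (endo_scale P) \<sigma>" "\<And>x. \<sigma> x \<in> A n"
    "\<And>h. h \<in> A n \<Longrightarrow> endo_diff P n (\<sigma> (endo_diff P n h)) = endo_diff P n h"
proof -
  obtain d' where d': "Vector_Spaces.linear (endo_scale P) (endo_scale P) d'" "\<And>f. f \<in> A n \<Longrightarrow> d' f = endo_diff P n f"
    using linear_extension_on[OF endo_vs endo_vs A_subspace[of n], of "endo_diff P n"] endo_diff_linear by metis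
  interpret vector_space_pair "endo_scale P" "endo_scale P"
    using endo_vs by (simp add: vector_space_pair_def)
  obtain \<sigma> where \<sigma>: "\<sigma> ` UNIV \<subseteq> A n" "Vector_Spaces.linear (endo_scale P) (endo_scale P) \<sigma>" "\<forall>v\<in>d' ` A n. d' (\<sigma> v) = v"
    using linear_exists_right_inverse_on[OF d'(1) A_subspace[of n]] by blast
  have \<sigma>A: "\<sigma> x \<in> A n" for x using \<sigma>(1) by auto
  show thesis
  proof (rule that[OF \<sigma>(2) \<sigma>A])
    fix h assume h: "h \<in> A n"
    have "d' (\<sigma> (d' h)) = d' h" using \<sigma>(3) h by blast
    then show "endo_diff P n (\<sigma> (endo_diff P n h)) = endo_diff P n h"
      by (simp add: d'(2)[OF h] d'(2)[OF \<sigma>A])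
  qed
qed

text \<open>
  If \<open>f\<^sub>1 - g\<^sub>1 = d h\<close>, then \<open>f\<^sub>2 - g\<^sub>2\<close> differs from the homotopy induced by \<open>h\<close> by cocycles, and
  their classes form the cochain that relates the two canonical cocycles.
\<close>

lemma canonical_class_independent:
  assumes cf: "canonical_choice G P f1 f2" and cg: "canonical_choice G P g1 g2"
  shows "hh_class \<Lambda> 3 (-1) (canonical_cocycle G P f1 f2) = hh_class \<Lambda> 3 (-1) (canonical_cocycle G P g1 g2)"
proof -
  interpret f: char2_choice G P f1 f2 by unfold_locales (rule cf)
  interpret g: char2_choice G P g1 g2 by unfold_locales (rule cg)
  obtain \<sigma> where \<sigma>: "\<And>n. Vector_Spaces.linear (endo_scale P) (endo_scale P) (\<sigma> n)" "\<And>n x. \<sigma> n x \<in> A n"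
    "\<And>n h. h \<in> A n \<Longrightarrow> endo_diff P n (\<sigma> n (endo_diff P n h)) = endo_diff P n h"
  proof -
    have "\<exists>\<sigma>. Vector_Spaces.linear (endo_scale P) (endo_scale P) \<sigma> \<and> (\<forall>x. \<sigma> x \<in> A n) \<and>
      (\<forall>h\<in>A n. endo_diff P n (\<sigma> (endo_diff P n h)) = endo_diff P n h)" for n
      by (rule diff_section[of n]) blast
    then obtain \<sigma> where "\<forall>n. Vector_Spaces.linear (endo_scale P) (endo_scale P) (\<sigma> n) \<and> (\<forall>x. \<sigma> n x \<in> A n) \<and>
      (\<forall>h\<in>A n. endo_diff P n (\<sigma> n (endo_diff P n h)) = endo_diff P n h)"
      by (rule_tac choice[OF allI, THEN exE])
    then show thesis using that[of \<sigma>] by blast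
  qed
  have \<sigma>_add: "\<sigma> n (x + y) = \<sigma> n x + \<sigma> n y" and \<sigma>_scale: "\<sigma> n (endo_scale P c x) = endo_scale P c (\<sigma> n x)" for n x y c
    using \<sigma>(1)[of n] by (auto simp: Vector_Spaces.linear_iff)
  \<comment> \<open>\<open>f1 a\<close> and \<open>g1 a\<close> represent the same class, so
    \<open>\<sigma>\<close> finds a primitive of their difference, and this primitive depends
    linearly on \<open>a\<close>.\<close>
  define h where "h a = \<sigma> (fst a - 1) (f1 a + g1 a)" for a
  define K where "K a = em (fst a - 1) (h a)" for a
  have hA: "h a \<in> A (fst a - 1)" for a by (simp add: h_def \<sigma>)
  have DK: "D * K a = K a * D + f.F1 a + g.F1 a" if a: "a \<in> homog H" for a
  proof -
    have "homot (fst a) (f1 a) (g1 a)"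
      using ecl_eq_iff[OF f.f1_Z g.f1_Z, OF a a] f.f1_ecl[OF a] g.f1_ecl[OF a] by simp
    then obtain x where x: "x \<in> A (fst a - 1)" "f1 a - g1 a = endo_diff P (fst a - 1) x"
      using cobd_iff[OF f.f1_Z g.f1_Z, OF a a] by (auto simp: coboundaries_def)
    have "endo_diff P (fst a - 1) (h a) = f1 a + g1 a"
      using \<sigma>(3)[OF x(1)] x(2) by (simp add: h_def A_minus_plus)
    then have "D * K a + K a * D = f.F1 a + g.F1 a"
      using em_diff[OF hA[of a]] by (simp add: K_def f.F1_def g.F1_def em_plus f.f1_A g.f1_A a)
    then have "K a * D + D * K a = f.F1 a + g.F1 a" by (simp add: add.commute)
    from ring_move[OF this[unfolded add.commute[of "K a * D"]]] show ?thesis by (simp add: add.assoc)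
  qed
  have DK_left: "D * (K a * x) = K a * (D * x) + f.F1 a * x + g.F1 a * x" if "a \<in> homog H" for a x
    using DK[OF that] by (simp add: distrib_right flip: mult.assoc)
  have h_add: "h (gadd H a b) = h a + h b" if "a \<in> gcomp H n" "b \<in> gcomp H n" for a b n
    using that gcomp_fst(1)[OF H_add_gcomp[OF that]]
    by (simp add: h_def f.f1_add g.f1_add gcomp_fst add.assoc add.left_commute flip: \<sigma>_add)
  have h_scale: "h (gscale H c a) = endo_scale P c (h a)" if "a \<in> homog H" for a c
  proof -
    have "endo_scale P c (f1 a + g1 a) = endo_scale P c (f1 a) + endo_scale P c (g1 a)"
      using endo_vs by (simp add: vector_space_def)
    then show ?thesis
      using that by (simp add: h_def f.f1_scale g.f1_scale H_scale_homog flip: \<sigma>_scale)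
  qed
  define e where "e a b = f2 a b + g2 a b + h (gmult H a b) + endo_comp (fst a - 1) (h a) (f1 b) + endo_comp (fst a) (g1 a) (h b)" for a b
  define E where "E a b = f.F2 a b + g.F2 a b + K (gmult H a b) + K a * f.F1 b + g.F1 a * K b" for a b
  have eA: "e a b \<in> A (fst a + fst b - 1)" and em_e: "em (fst a + fst b - 1) (e a b) = E a b"
    if a: "a \<in> homog H" and b: "b \<in> homog H" for a b
  proof -
    have i: "fst a - 1 + fst b = fst a + fst b - 1" "fst a + (fst b - 1) = fst a + fst b - 1" by auto
    have 1: "h (gmult H a b) \<in> A (fst a + fst b - 1)" "em (fst a + fst b - 1) (h (gmult H a b)) = K (gmult H a b)"
      using hA[of "gmult H a b"] by (simp_all add: K_def fst_H_mult a b)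
    have 2: "endo_comp (fst a - 1) (h a) (f1 b) \<in> A (fst a + fst b - 1)"
      "em (fst a + fst b - 1) (endo_comp (fst a - 1) (h a) (f1 b)) = K a * f.F1 b"
      using A_comp[OF hA[of a] f.f1_A[OF b]] em_comp[OF hA[of a] f.f1_A[OF b]] unfolding i by (simp_all add: K_def f.F1_def)
    have 3: "endo_comp (fst a) (g1 a) (h b) \<in> A (fst a + fst b - 1)"
      "em (fst a + fst b - 1) (endo_comp (fst a) (g1 a) (h b)) = g.F1 a * K b"
      using A_comp[OF g.f1_A[OF a] hA[of b]] em_comp[OF g.f1_A[OF a] hA[of b]] unfolding i by (simp_all add: K_def g.F1_def)
    show "e a b \<in> A (fst a + fst b - 1)"
      unfolding e_def by (intro A_plus f.f2_A g.f2_A a b 1 2 3)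
    show "em (fst a + fst b - 1) (e a b) = E a b"
      unfolding e_def E_def by (simp add: em_plus A_plus f.f2_A g.f2_A a b 1 2 3 f.F2_def g.F2_def)
  qed
  \<comment> \<open>All rules move \<open>D\<close> to the right, so that the closedness of
    \<open>E\<close> and the final comparison reduce to cancellation of monomials.\<close>
  note D_simps = f.D_F1 g.D_F1 f.D_F2 g.D_F2 f.D_F_left g.D_F_left DK DK_left H_mult_homog H_mult_assoc c2_simps
  have DE: "D * E a b = E a b * D" if "a \<in> homog H" "b \<in> homog H" for a b
    using that by (simp add: E_def D_simps)
  have eZ: "e a b \<in> Z (fst a + fst b - 1)" if "a \<in> homog H" "b \<in> homog H" for a b
    using eA[OF that] em_e[OF that] DE[OF that] by (simp add: Z_iff)
  have e_add: "e (gadd H a a') b = e a b + e a' b" "e b (gadd H a a') = e b a + e b a'"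
    if a: "a \<in> gcomp H n" "a' \<in> gcomp H n" and b: "b \<in> homog H" for a a' b n
  proof -
    note hh = gcomp_homog(1)[OF a(1)] gcomp_homog(1)[OF a(2)] gcomp_homog(1)[OF H_add_gcomp[OF a]]
    note f = gcomp_fst(1)[OF a(1)] gcomp_fst(1)[OF a(2)] gcomp_fst(1)[OF H_add_gcomp[OF a]]
    have mg: "gmult H a b \<in> gcomp H (n + fst b)" "gmult H a' b \<in> gcomp H (n + fst b)"
      "gmult H b a \<in> gcomp H (fst b + n)" "gmult H b a' \<in> gcomp H (fst b + n)"
      using homog_gcomp(1)[OF H_mult_homog[OF hh(1) b]] homog_gcomp(1)[OF H_mult_homog[OF hh(2) b]]
        homog_gcomp(1)[OF H_mult_homog[OF b hh(1)]] homog_gcomp(1)[OF H_mult_homog[OF b hh(2)]]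
      by (simp_all add: fst_H_mult hh b f)
    have K_add: "K (gadd H x y) = K x + K y" if "x \<in> gcomp H n" "y \<in> gcomp H n" for x y n
      using hA[of x] hA[of y] gcomp_fst(1)[OF that(1)] gcomp_fst(1)[OF that(2)] gcomp_fst(1)[OF H_add_gcomp[OF that]]
      by (simp add: K_def h_add[OF that] em_plus)
    note lin = f.F1_add[OF a] g.F1_add[OF a] f.F2_add[OF a] g.F2_add[OF a] H_distrib[OF a] K_add[OF a] K_add[OF mg(1,2)] K_add[OF mg(3,4)]
    show "e (gadd H a a') b = e a b + e a' b"
      by (rule em_inj[of _ "n + fst b - 1"])
        (use eA[OF hh(1) b] eA[OF hh(2) b] eA[OF hh(3) b] em_e[OF hh(1) b] em_e[OF hh(2) b] em_e[OF hh(3) b]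
          in \<open>simp_all add: A_plus em_plus f lin b hh E_def c2_simps\<close>)
    show "e b (gadd H a a') = e b a + e b a'"
      by (rule em_inj[of _ "fst b + n - 1"])
        (use eA[OF b hh(1)] eA[OF b hh(2)] eA[OF b hh(3)] em_e[OF b hh(1)] em_e[OF b hh(2)] em_e[OF b hh(3)]
          in \<open>simp_all add: A_plus em_plus f lin b hh E_def c2_simps\<close>)
  qed
  have e_scale: "e (gscale H c a) b = endo_scale P c (e a b)" "e b (gscale H c a) = endo_scale P c (e b a)"
    if a: "a \<in> homog H" and b: "b \<in> homog H" for a b c
  proof -
    note s = H_scale_homog[OF a]
    have K_scale: "K (gscale H c x) = sc c * K x" if "x \<in> homog H" for x
      using hA[of x] H_scale_homog[OF that] by (simp add: K_def h_scale[OF that] em_scale)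
    have K_sc: "K x * (sc c * y) = sc c * (K x * y)" for x y
      using em_sc[OF hA[of x], of c] by (simp add: K_def flip: mult.assoc)
    note lin = f.F1_scale g.F1_scale f.F2_scale g.F2_scale f.F_sc g.F_sc K_scale K_sc H_scale_mult H_mult_homog distrib_left mult.assoc
    show "e (gscale H c a) b = endo_scale P c (e a b)"
      by (rule em_inj[of _ "fst a + fst b - 1"])
        (use eA[OF a b] eA[OF s(1) b] em_e[OF a b] em_e[OF s(1) b]
          in \<open>simp_all add: A_scale em_scale s a b E_def lin\<close>)
    show "e b (gscale H c a) = endo_scale P c (e b a)"
      by (rule em_inj[of _ "fst b + fst a - 1"])
        (use eA[OF b a] eA[OF b s(1)] em_e[OF b a] em_e[OF b s(1)]
          in \<open>simp_all add: A_scale em_scale s a b E_def lin\<close>)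
  qed
  define \<psi> where "\<psi> = (\<lambda>as\<in>tuples \<Lambda> 2. tcl (fst (as ! 0) + fst (as ! 1) - 1) (e (ft (as ! 0)) (ft (as ! 1))))"
  have \<psi>: "\<psi> [u, v] = tcl (fst u + fst v - 1) (e (ft u) (ft v))" if "u \<in> homog \<Lambda>" "v \<in> homog \<Lambda>" for u v
    using that by (simp add: \<psi>_def tuples_2)
  have eZ': "e (ft u) (ft v) \<in> Z (fst u + fst v - 1)" if "u \<in> homog \<Lambda>" "v \<in> homog \<Lambda>" for u v
    using eZ[OF ft_homog ft_homog, OF that] by (simp add: fst_ft that)
  have \<psi>_cochain: "\<psi> \<in> hh_cochains \<Lambda> 2 (-1)"
    unfolding hh_cochains_def
  proof (intro CollectI conjI ballI allI impI)
    show "\<psi> \<in> extensional (tuples \<Lambda> 2)" by (simp add: \<psi>_def)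
    fix as assume "as \<in> tuples \<Lambda> 2"
    then obtain u v where hu: "u \<in> homog \<Lambda>" "v \<in> homog \<Lambda>" and as: "as = [u, v]"
      by (auto simp: tuples_2)
    show "\<psi> as \<in> gcomp \<Lambda> (tdeg \<Lambda> as + -1)"
      using eZ'[OF hu] by (simp add: as \<psi> hu L_gcomp)
    fix i :: nat assume "i < 2"
    then have i: "i = 0 \<or> i = 1" by auto
    {
      fix d a b assume a: "a \<in> gcomp \<Lambda> d" and b: "b \<in> gcomp \<Lambda> d"
      note hab = gcomp_homog(2)[OF a] gcomp_homog(2)[OF b] gcomp_homog(2)[OF L_add_gcomp[OF a b]]
      note f = gcomp_fst(2)[OF a] gcomp_fst(2)[OF b] gcomp_fst(2)[OF L_add_gcomp[OF a b]]
      show "\<psi> (as[i := gadd \<Lambda> a b]) = gadd \<Lambda> (\<psi> (as[i := a])) (\<psi> (as[i := b]))"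
        using i eZ'[OF hab(1) hu(2)] eZ'[OF hab(2) hu(2)] eZ'[OF hu(1) hab(1)] eZ'[OF hu(1) hab(2)]
        by (auto simp: as \<psi> hu hab f ft_add[OF a b] e_add[OF ft_gcomp[OF a] ft_gcomp[OF b]] ft_homog L_gadd)
    next
      fix c a assume a: "a \<in> homog \<Lambda>"
      show "\<psi> (as[i := gscale \<Lambda> c a]) = gscale \<Lambda> c (\<psi> (as[i := a]))"
        using i eZ'[OF a hu(2)] eZ'[OF hu(1) a]
        by (auto simp: as \<psi> hu a L_scale_homog fst_L_scale ft_scale e_scale ft_homog L_gscale)
    }
  qed
  show ?thesis
  proof (rule hh_class_cong[OF \<psi>_cochain])
    fix as assume as3: "as \<in> tuples \<Lambda> 3"
    show "canonical_cocycle G P f1 f2 as \<in> gcomp \<Lambda> (tdeg \<Lambda> as + -1)"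
      "canonical_cocycle G P g1 g2 as \<in> gcomp \<Lambda> (tdeg \<Lambda> as + -1)"
      using hh_cochains_values[OF f.canonical_cocycle_cochain as3] hh_cochains_values[OF g.canonical_cocycle_cochain as3] .
    obtain u v w where hu: "u \<in> homog \<Lambda>" "v \<in> homog \<Lambda>" "w \<in> homog \<Lambda>" and as: "as = [u, v, w]"
      using as3 by (auto simp: tuples_3)
    define a b c where "a = ft u" and "b = ft v" and "c = ft w"
    have hh: "a \<in> homog H" "b \<in> homog H" "c \<in> homog H"
      using hu ft_homog by (simp_all add: a_def b_def c_def)
    have fs: "fst u = fst a" "fst v = fst b" "fst w = fst c"
      using hu fst_ft by (simp_all add: a_def b_def c_def)
    define N where "N = fst a + fst b + fst c - 1"
    have i: "fst a + (fst b + fst c - 1) = N" "fst a + fst b - 1 + fst c = N" by (simp_all add: N_def)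
    have u: "u = tcl (fst a) (f1 a)" and w: "w = tcl (fst c) (f1 c)"
      using f.f1_tcl[OF hu(1)] f.f1_tcl[OF hu(3)] by (simp_all add: a_def c_def)
    have terms: "gmult \<Lambda> u (\<psi> [v, w]) = tcl N (endo_comp (fst a) (f1 a) (e b c))"
      "\<psi> [gmult \<Lambda> u v, w] = tcl N (e (gmult H a b) c)" "\<psi> [u, gmult \<Lambda> v w] = tcl N (e a (gmult H b c))"
      "gmult \<Lambda> (\<psi> [u, v]) w = tcl N (endo_comp (fst a + fst b - 1) (e a b) (f1 c))"
    proof -
      show "gmult \<Lambda> u (\<psi> [v, w]) = tcl N (endo_comp (fst a) (f1 a) (e b c))"
        unfolding \<psi>[OF hu(2,3)] fs
        by (subst u) (simp add: L_gmult f.f1_Z hh eZ i flip: b_def c_def)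
      show "gmult \<Lambda> (\<psi> [u, v]) w = tcl N (endo_comp (fst a + fst b - 1) (e a b) (f1 c))"
        unfolding \<psi>[OF hu(1,2)] fs
        by (subst w) (simp add: L_gmult f.f1_Z hh eZ i flip: a_def b_def)
    qed (simp_all add: \<psi> hu L_mult_homog fst_L_mult ft_mult fs N_def add.assoc flip: a_def b_def c_def)
    have z: "endo_comp (fst a) (f1 a) (e b c) \<in> Z N" "endo_comp (fst a + fst b - 1) (e a b) (f1 c) \<in> Z N"
      "e (gmult H a b) c \<in> Z N" "e a (gmult H b c) \<in> Z N" "f.MM a b c \<in> Z N" "g.MM a b c \<in> Z N"
      using Z_comp[OF f.f1_Z[OF hh(1)] eZ[OF hh(2,3)], unfolded i] Z_comp[OF eZ[OF hh(1,2)] f.f1_Z[OF hh(3)], unfolded i]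
        eZ[OF H_mult_homog[OF hh(1,2)] hh(3)] eZ[OF hh(1) H_mult_homog[OF hh(2,3)]] f.MM_Z[OF hh] g.MM_Z[OF hh]
      by (simp_all add: N_def fst_H_mult hh add.assoc)
    let ?s = "endo_comp (fst a) (f1 a) (e b c) + (e (gmult H a b) c + (e a (gmult H b c) + endo_comp (fst a + fst b - 1) (e a b) (f1 c)))"
    have td: "tdeg \<Lambda> [u, v, w] + -1 = N" by (simp add: fs N_def)
    have sum: "hh_diff \<Lambda> 2 (-1) \<psi> as = tcl N ?s"
      unfolding as hh_diff_2_cochain[OF \<psi>_cochain hu] terms td by (simp add: L_gzero L_gadd z Z_plus Z_zero)
    \<comment> \<open>Two summands account for the difference of \<open>f1\<close> and
      \<open>g1\<close> in the last and in the first factor. The third exchanges \<open>g1 a\<close>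
      for \<open>f1 a\<close> in front of \<open>e b c\<close>: in the coboundary of
      \<open>\<psi>\<close> the class of \<open>a\<close> is represented by \<open>f1 a\<close>,
      while \<open>e\<close> is built with \<open>g1 a\<close>.\<close>
    let ?k = "endo_comp (fst a + fst b - 1) (g2 a b) (h c) + endo_comp (fst a - 1) (h a) (f2 b c) + endo_comp (fst a - 1) (h a) (e b c)"
    have k: "?k \<in> A (N - 1)" "em (N - 1) ?k = g.F2 a b * K c + K a * f.F2 b c + K a * E b c"
    proof -
      have i: "fst a + fst b - 1 + (fst c - 1) = N - 1" "fst a - 1 + (fst b + fst c - 1) = N - 1" by (simp_all add: N_def)
      note A = A_comp[OF g.f2_A[OF hh(1,2)] hA[of c], unfolded i] A_comp[OF hA[of a] f.f2_A[OF hh(2,3)], unfolded i]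
        A_comp[OF hA[of a] eA[OF hh(2,3)], unfolded i]
      show "?k \<in> A (N - 1)" by (intro A_plus A)
      show "em (N - 1) ?k = g.F2 a b * K c + K a * f.F2 b c + K a * E b c"
        using em_comp[OF g.f2_A[OF hh(1,2)] hA[of c], unfolded i] em_comp[OF hA[of a] f.f2_A[OF hh(2,3)], unfolded i]
          em_comp[OF hA[of a] eA[OF hh(2,3)], unfolded i]
        by (simp add: em_plus A_plus A K_def g.F2_def f.F2_def em_e hh)
    qed
    have ems: "em N (f.MM a b c) + em N (g.MM a b c + ?s) = f.F2 a b * f.F1 c + f.F2 a (gmult H b c) + f.F2 (gmult H a b) c + f.F1 a * f.F2 b c +
      (g.F2 a b * g.F1 c + g.F2 a (gmult H b c) + g.F2 (gmult H a b) c + g.F1 a * g.F2 b c) +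
      (f.F1 a * E b c + (E (gmult H a b) c + (E a (gmult H b c) + E a b * f.F1 c)))"
    proof -
      have m: "em N (f.MM a b c) = f.F2 a b * f.F1 c + f.F2 a (gmult H b c) + f.F2 (gmult H a b) c + f.F1 a * f.F2 b c"
        "em N (g.MM a b c) = g.F2 a b * g.F1 c + g.F2 a (gmult H b c) + g.F2 (gmult H a b) c + g.F1 a * g.F2 b c"
        using f.em_MM[OF hh] g.em_MM[OF hh] by (simp_all add: N_def)
      have t: "em N (e (gmult H a b) c) = E (gmult H a b) c" "em N (e a (gmult H b c)) = E a (gmult H b c)"
        using em_e[OF H_mult_homog[OF hh(1,2)] hh(3)] em_e[OF hh(1) H_mult_homog[OF hh(2,3)]]
        by (simp_all add: N_def fst_H_mult hh add.assoc)
      have l: "em N (endo_comp (fst a) (f1 a) (e b c)) = f.F1 a * E b c"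
        "em N (endo_comp (fst a + fst b - 1) (e a b) (f1 c)) = E a b * f.F1 c"
        using em_comp[OF f.f1_A[OF hh(1)] eA[OF hh(2,3)], unfolded i] em_comp[OF eA[OF hh(1,2)] f.f1_A[OF hh(3)], unfolded i]
        by (simp_all add: em_e hh f.F1_def)
      show ?thesis
        by (simp add: em_plus A_plus Z_A[OF z(1)] Z_A[OF z(2)] Z_A[OF z(3)] Z_A[OF z(4)] Z_A[OF z(5)] Z_A[OF z(6)] m t l add.assoc)
    qed
    have "em N (f.MM a b c) + em N (g.MM a b c + ?s) = D * em (N - 1) ?k + em (N - 1) ?k * D"
      unfolding ems k(2) E_def using hh by (simp add: D_simps)
    then have "homot N (f.MM a b c) (g.MM a b c + ?s)"
      using k(1) by (auto simp: homot_def)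
    then have "tcl N (f.MM a b c) = tcl N (g.MM a b c + ?s)"
      using z by (subst tcl_eq_iff) (auto intro!: Z_plus)
    then show "canonical_cocycle G P f1 f2 as = gadd \<Lambda> (canonical_cocycle G P g1 g2 as) (hh_diff \<Lambda> 2 (-1) \<psi> as)"
      unfolding sum unfolding as f.canonical_cocycle_eq[OF hu] g.canonical_cocycle_eq[OF hu] fs
      using z by (simp add: L_gadd Z_plus flip: a_def b_def c_def N_def)
  qed
qed

lemma canonical_class_eq:
  assumes "canonical_choice G P f1 f2"
  shows "canonical_class G P = hh_class \<Lambda> 3 (-1) (canonical_cocycle G P f1 f2)"
  unfolding canonical_class_def using assms canonical_class_independent by (intro the_equality) blast+

end

section \<open>The quaternion group and its minimal resolution\<close>

text \<open>
  Group elements are encoded by \<open>(c, a, b) \<mapsto> z\<^sup>c I\<^sup>a J\<^sup>b\<close> with \<open>z = I\<^sup>2\<close>. A map between free modules is a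
  list of labels: \<open>(i, j, t)\<close> stands for \<open>e\<^sub>i \<mapsto> t e\<^sub>j\<close>, and a list for the sum of its members. A family of maps
  that is periodic of period eight is a list of length eight.
\<close>

type_synonym q8 = "bool \<times> bool \<times> bool"
type_synonym lab = "nat \<times> nat \<times> q8"
type_synonym fam = "lab list list"

text \<open>The exponent of \<open>z\<close> collects three contributions besides \<open>c\<close>
  and \<open>c'\<close>: \<open>b a'\<close> from \<open>J I = z I J\<close>, \<open>a a'\<close>
  from \<open>I^2 = z\<close>, and \<open>b b'\<close> from \<open>J^2 = z\<close>.\<close>

fun qmul :: "q8 \<Rightarrow> q8 \<Rightarrow> q8" where
  "qmul (c, a, b) (c', a', b') = ((c \<noteq> c') \<noteq> ((b \<and> a') \<noteq> ((a \<and> a') \<noteq> (b \<and> b'))), a \<noteq> a', b \<noteq> b')"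

abbreviation (input) q1 :: q8 where "q1 \<equiv> (False, False, False)"
abbreviation (input) qI :: q8 where "qI \<equiv> (False, True, False)"
abbreviation (input) qJ :: q8 where "qJ \<equiv> (False, False, True)"
abbreviation (input) qK :: q8 where "qK \<equiv> (False, True, True)"
abbreviation (input) qz :: q8 where "qz \<equiv> (True, False, False)"
abbreviation (input) qzI :: q8 where "qzI \<equiv> (True, True, False)"
abbreviation (input) qzJ :: q8 where "qzJ \<equiv> (True, False, True)"
abbreviation (input) qzK :: q8 where "qzK \<equiv> (True, True, True)"

definition all_q8 :: "q8 list" where
  "all_q8 = [q1, qI, qJ, qK, qz, qzI, qzJ, qzK]"

definition entries :: "(nat \<times> nat \<times> q8 list) list \<Rightarrow> lab list" where
  "entries es = concat (map (\<lambda>(i, j, ts). map (\<lambda>t. (i, j, t)) ts) es)"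

text \<open>Cancels equal members of a sum in pairs.\<close>

definition toggle :: "'a \<Rightarrow> 'a list \<Rightarrow> 'a list" where
  "toggle x ys = (if x \<in> set ys then remove1 x ys else x # ys)"

fun reduce :: "'a list \<Rightarrow> 'a list" where
  "reduce [] = []"
| "reduce (x # xs) = toggle x (reduce xs)"

text \<open>Composition is in order of application: \<open>e_i\<close> goes to \<open>t e_j\<close>
  and, by equivariance, on to \<open>t t' e_l\<close>. So the group elements are multiplied in the
  same order as the labels.\<close>

fun lab_comp1 :: "lab \<Rightarrow> lab list \<Rightarrow> lab list" where
  "lab_comp1 x [] = []"
| "lab_comp1 (i, j, t) ((j', l, t') # ms) =
     (if j = j' then (i, l, qmul t t') # lab_comp1 (i, j, t) ms else lab_comp1 (i, j, t) ms)"

fun lab_comp :: "lab list \<Rightarrow> lab list \<Rightarrow> lab list" where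
  "lab_comp [] ms = []"
| "lab_comp (x # ls) ms = lab_comp1 x ms @ lab_comp ls ms"

definition rot :: "nat \<Rightarrow> 'a list \<Rightarrow> 'a list" where
  "rot m f = drop m f @ take m f"

text \<open>The composite of families of degrees \<open>m\<close> and \<open>n\<close> at \<open>j\<close> is \<open>f\<^sub>j \<circ> g\<^sub>j\<^sub>+\<^sub>m\<close>, as in \<^const>\<open>endo_comp\<close>.\<close>

definition fcomp :: "nat \<Rightarrow> fam \<Rightarrow> fam \<Rightarrow> fam" where
  "fcomp m f g = map2 lab_comp (rot m g) f"

definition fadd :: "fam \<Rightarrow> fam \<Rightarrow> fam" where
  "fadd f g = map2 (@) f g"

text \<open>Every label occurs an even number of times, so the family is zero in characteristic
  two.\<close>

definition fnull :: "fam \<Rightarrow> bool" where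
  "fnull f \<longleftrightarrow> list_all (\<lambda>ls. reduce ls = []) f"

definition fzero :: fam where
  "fzero = replicate 8 []"

definition twice :: "'a list \<Rightarrow> 'a list" where
  "twice f = f @ f"

text \<open>Entry \<open>j\<close> is the differential from degree \<open>j + 1\<close> to degree
  \<open>j\<close>. The first sends the generators to \<open>1 + I\<close> and \<open>1 + J\<close>;
  the second consists of the Fox derivatives modulo two of the relations \<open>I^2 = J^2\<close>
  and \<open>I J I = J\<close>; the fourth is multiplication by the norm element, the sum of all
  group elements, which joins consecutive periods. The list is doubled because the homotopies have
  period eight.\<close>

definition famD :: fam where
  "famD = twice (map entries
    [[(0, 0, [q1, qI]), (1, 0, [q1, qJ])], [(0, 0, [q1, qI]), (0, 1, [q1, qJ]), (1, 0, [q1, qK]), (1, 1, [q1, qI])],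
    [(0, 0, [q1, qI]), (0, 1, [q1, qK])], [(0, 0, [q1, qI, qz, qzI, qJ, qK, qzJ, qzK])]])"

text \<open>
  Representatives of \<open>1\<close>, \<open>x\<close>, \<open>y\<close>, \<open>x\<^sup>2\<close>, \<open>y\<^sup>2\<close>, \<open>x\<^sup>2y\<close> that commute with the shift, and homotopies from
  the products of representatives to the representatives of the products. They solve systems of linear equations
  over \<open>\<F>\<^sub>2\<close>. The homotopies cannot be chosen to commute with the shift; this is where the values of the canonical
  class that involve \<open>s\<close> come from. Adding cocycles to the homotopies changes the canonical cocycle by a coboundary,
  and they are normalised such that it takes exactly the required values.
\<close>

definition fam1 :: "fam list" where
  "fam1 = map (\<lambda>f. twice (map entries f)) [
    [[(0, 0, [q1])], [(0, 0, [q1]), (1, 1, [q1])], [(0, 0, [q1]), (1, 1, [q1])], [(0, 0, [q1])]],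
    [[(0, 0, [qI])], [(0, 0, [q1]), (0, 1, [q1, qJ]), (1, 0, [q1]), (1, 1, [q1])], [(0, 0, [q1]), (0, 1, [q1])], [(0,
    0, [q1, qz, qJ, qzJ])]],
    [[(1, 0, [q1])], [(0, 1, [q1]), (1, 0, [q1])], [(0, 1, [q1])], [(0, 0, [q1, qI, qz, qzI])]],
    [[(0, 0, [qI]), (1, 0, [qI])], [(0, 1, [qJ])], [(0, 0, [q1, qz, qJ, qzJ]), (0, 1, [q1, qz, qJ, qzJ])], [(0, 0,
    [qI, qzI, qK, qzK])]],
    [[(0, 0, [q1])], [(0, 0, [q1])], [(0, 1, [q1, qI, qz, qzI])], [(1, 0, [q1, qI, qz, qzI])]],
    [[(0, 0, [qI])], [(0, 1, [qJ, qK, qzJ, qzK])], [(1, 0, [q1, qz, qJ, qzJ]), (1, 1, [q1, qz, qJ, qzJ])], [(1, 0,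
    [qI, qzI, qK, qzK])]]]"

definition fam2 :: "fam list list" where
  "fam2 = (let z = replicate 8 [] in map (map (map entries)) [
    [z, z, z, z, z, z],
    [z,
    z,
    [[(1, 0, [q1])], [(0, 0, [q1]), (0, 1, [q1]), (1, 0, [q1])], [(0, 0, [q1]), (0, 1, [q1])], [(0, 0, [q1, qI, qzJ,
    qzK])], [(0, 0, [q1])], [(1, 0, [q1]), (1, 1, [qI])], [(0, 1, [q1])], [(0, 0, [qI, qz, qK, qzJ])]],
    [[(0, 0, [q1]), (1, 0, [q1])], [(0, 1, [qI])], [(0, 0, [qI, qJ]), (0, 1, [qz, qJ])], [(0, 0, [qz, qJ]), (1, 0,
    [qI, qJ])], [], [], [(0, 0, [qz, qzJ]), (0, 1, [qK, qzJ])], [(0, 0, [qI, qzJ]), (1, 0, [q1, qI])]],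
    [[], [], [(0, 0, [qzI, qzJ]), (0, 1, [qI, qK])], [(0, 0, [qzI, qJ, qK, qzJ]), (1, 0, [q1, qJ, qzJ, qzK])], [(1,
    0, [q1])], [(0, 0, [q1]), (0, 1, [qI])], [(0, 0, [qI, qzK]), (0, 1, [qJ, qK])], [(0, 0, [qI, qJ]), (1, 0, [qK,
    qzJ])]],
    [[(0, 0, [q1])], [(0, 1, [q1, qI, qz, qzI])], [(1, 0, [qI, qJ]), (1, 1, [qz, qJ])], [(0, 0, [qI, qJ]), (1, 0,
    [qz, qJ])], [], [], [(1, 0, [qz, qzJ]), (1, 1, [qK, qzJ])], [(0, 0, [q1, qI]), (1, 0, [qI, qzJ])]]],
    [z,
    [[(1, 0, [q1])], [(0, 0, [q1])], [(0, 0, [q1])], [(0, 0, [q1, qzI, qJ, qK])], [(0, 0, [qI])], [(0, 1, [qJ]), (1,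
    1, [q1])], [], [(0, 0, [q1, qI, qK, qzJ])]],
    z,
    [[(0, 0, [q1])], [(0, 1, [q1])], [(0, 1, [q1, qzI, qK, qzJ])], [(1, 0, [qz, qzI, qJ, qzK])], [(0, 0, [qI]), (1,
    0, [q1, qK])], [(0, 1, [q1])], [(0, 0, [qJ, qzJ]), (0, 1, [q1, qz])], [(0, 0, [qK, qzK])]],
    [[(0, 0, [q1])], [(0, 0, [q1])], [(0, 0, [qz, qzJ]), (0, 1, [qz, qzI])], [(0, 0, [q1, qI, qzI, qJ, qK, qzJ]), (1,
    0, [q1, qI])], [], [], [(0, 0, [q1, qJ]), (0, 1, [qz, qzI])], [(0, 0, [q1, qK]), (1, 0, [q1, qI])]],
    [[(0, 0, [qJ])], [(0, 0, [q1, qJ]), (0, 1, [qzI, qJ])], [(0, 0, [q1, qK]), (1, 1, [qzI, qzJ])], [(0, 0, [q1,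
    qzJ]), (1, 0, [q1, qI])], [(0, 0, [qI])], [(0, 0, [qI, qzI])], [(0, 0, [q1, qzJ]), (0, 1, [qK, qzJ]), (1, 0, [q1,
    qK]), (1, 1, [qz, qzJ])], [(0, 0, [qK, qzK])]]],
    [z,
    [[(0, 0, [q1]), (1, 0, [q1])], [(0, 1, [qI])], [(0, 0, [qI, qJ]), (0, 1, [qz, qJ])], [(0, 0, [qz, qJ]), (1, 0,
    [qI, qJ])], [], [], [(0, 0, [qz, qzJ]), (0, 1, [qK, qzJ])], [(0, 0, [qI, qzJ]), (1, 0, [q1, qI])]],
    z,
    [[], [(0, 1, [qI, qzI, qK, qzK])], [(0, 0, [qz, qK]), (0, 1, [qzI, qK])], [(0, 0, [qI, qzK]), (1, 0, [qI, qz])],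
    [], [], [(0, 0, [qzI, qzJ]), (0, 1, [q1, qzJ])], [(0, 0, [q1, qzJ]), (1, 0, [qzJ, qzK])]],
    [[(0, 0, [q1])], [(0, 0, [qI, qJ]), (0, 1, [qI, qz])], [(0, 0, [qI, qK]), (1, 0, [qI, qJ])], [(0, 0, [qz, qzI,
    qzJ, qzK])], [(0, 0, [qz])], [(0, 0, [qI, qJ]), (0, 1, [qI, qz])], [(0, 0, [qI, qK]), (1, 0, [qI, qJ])], [(0, 0,
    [q1, qI, qJ, qK])]],
    [[], [(1, 1, [qI, qzI, qK, qzK])], [(1, 0, [qz, qK]), (1, 1, [qzI, qK])], [(0, 0, [qI, qz])], [], [], [(1, 0,
    [qzI, qzK]), (1, 1, [qzJ, qzK])], [(0, 0, [q1, qzJ])]]],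
    [z,
    [[], [(0, 0, [q1])], [(0, 0, [qI, qJ, qK, qzK]), (0, 1, [qz, qzJ])], [(0, 0, [qI, qzK]), (1, 0, [qzI, qzJ])],
    [(1, 0, [qzJ])], [(0, 1, [qzJ])], [(0, 0, [qz, qK]), (0, 1, [q1, qzJ])], [(0, 0, [qz, qzJ]), (1, 0, [q1, qK])]],
    [[(0, 0, [q1])], [(0, 0, [q1])], [(0, 0, [qz, qzJ]), (0, 1, [qz, qzI])], [(0, 0, [q1, qI, qzI, qJ, qK, qzJ]), (1,
    0, [q1, qI])], [], [], [(0, 0, [q1, qJ]), (0, 1, [qz, qzI])], [(0, 0, [q1, qK]), (1, 0, [q1, qI])]],
    [[], [(0, 0, [q1, qJ]), (0, 1, [qz, qzK])], [(0, 0, [qzI, qJ]), (1, 0, [qzJ, qzK]), (1, 1, [q1, qz])], [(0, 0,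
    [qJ, qzJ])], [(0, 0, [q1, qJ])], [(0, 1, [qJ, qzJ])], [(0, 0, [qz, qJ]), (0, 1, [qJ, qK]), (1, 0, [qI, qJ, qK,
    qzJ]), (1, 1, [qI, qz])], [(0, 0, [qzI, qzK]), (1, 0, [q1, qzI])]],
    [[], [(0, 0, [q1, qI, qz, qzI])], [(1, 0, [qz, qzJ]), (1, 1, [qz, qzI])], [(0, 0, [q1, qI]), (1, 0, [qz, qzK])],
    [(0, 0, [qI, qJ])], [], [(1, 0, [q1, qJ]), (1, 1, [qz, qzI])], [(0, 0, [q1, qI]), (1, 0, [q1, qK])]],
    [[], [(1, 0, [qzI, qzJ]), (1, 1, [qJ, qK])], [(0, 0, [q1, qK]), (0, 1, [qI, qzI]), (1, 0, [q1, qzJ])], [], [(0,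
    0, [qzJ, qzK])], [(0, 1, [q1, qzJ]), (1, 0, [qJ, qzJ]), (1, 1, [qz, qK])], [(0, 1, [q1, qI, qJ, qK]), (1, 1, [qI,
    qzI])], []]],
    [z,
    [[(0, 0, [qI, qJ])], [(0, 1, [qK, qzK])], [(1, 0, [qI, qJ]), (1, 1, [qz, qJ])], [(0, 0, [qI, qJ]), (1, 0, [q1,
    qzJ])], [(0, 0, [qK])], [(0, 1, [qJ, qzJ])], [(1, 0, [qz, qJ]), (1, 1, [qz, qzI])], [(0, 0, [qK, qzJ]), (1, 0,
    [qzI, qzJ])]],
    [[(0, 0, [q1])], [(0, 0, [qI, qJ]), (0, 1, [qI, qz])], [(0, 0, [qI, qK]), (1, 0, [qI, qJ])], [(0, 0, [qz, qzI,
    qzJ, qzK])], [(0, 0, [qz])], [(0, 0, [qI, qJ]), (0, 1, [qI, qz])], [(0, 0, [qI, qK]), (1, 0, [qI, qJ])], [(0, 0,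
    [q1, qI, qJ, qK])]],
    [[], [(0, 1, [qJ, qzJ])], [(1, 0, [q1, qJ, qK, qzJ]), (1, 1, [qI, qzK])], [(0, 0, [qI, qz])], [(0, 0, [qzI,
    qK])], [(0, 1, [qJ, qK]), (1, 1, [qzI, qzK])], [(1, 0, [qzI, qJ]), (1, 1, [qzI, qzK])], [(0, 0, [qz, qzI])]],
    [[(0, 0, [q1, qK])], [(0, 1, [qI, qzJ]), (1, 1, [qJ, qK])], [], [], [(0, 0, [qzI, qJ])], [(0, 1, [q1, qK]), (1,
    1, [q1, qI])], [], []],
    [[], [(1, 0, [qzI, qzJ]), (1, 1, [qJ, qK])], [(0, 0, [qz, qJ]), (0, 1, [qz, qJ])], [], [(1, 0, [qI, qzJ])], [(0,
    1, [qzJ, qzK]), (1, 1, [q1, qzK])], [], []]]])"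

text \<open>A \<open>k\<close>-linear contraction; \<open>(i, t, [(j, t'), \<dots>])\<close> stands for \<open>t e\<^sub>i \<mapsto> t' e\<^sub>j + \<dots>\<close>.\<close>

definition contraction :: "(nat \<times> q8 \<times> (nat \<times> q8) list) list list" where
  "contraction =
    [[(0, q1, [(0, q1), (0, qI)]), (0, qI, [(0, qI)]), (0, qzI, [(0, qz)]), (0, qJ, [(1, qK), (0, qz), (0, qK)]), (0,
    qK, [(1, qK), (0, qz)]), (0, qzJ, [(1, qzK), (0, qI), (0, qzK)]), (0, qzK, [(1, qzK), (0, qI)])], [(0, qzI, [(1,
    qz), (1, qJ), (0, qJ), (0, qzI)]), (0, qJ, [(1, qJ), (1, qK)]), (0, qzJ, [(0, qzK), (0, qI)]), (1, q1, [(0, qI),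
    (1, q1)]), (1, qI, [(0, qI)]), (1, qz, [(1, qJ), (0, qJ)]), (1, qzI, [(1, qz), (1, qJ), (0, qJ)]), (1, qJ, [(1,
    qK)]), (1, qzJ, [(1, qzK)])], [(0, q1, [(0, q1)]), (0, qz, [(0, qz)]), (0, qK, [(0, qK)]), (0, qzJ, [(0, qzK)]),
    (1, qI, [(0, qJ)]), (1, qzI, [(0, qzI), (0, q1)]), (1, qzJ, [(0, qz), (0, qJ), (0, qI)])], [(0, qzJ, [(0, qz)])]]"

text \<open>From here on the indices 0 to 5 stand for
  \<open>1, x, y, x^2, y^2, x^2 y\<close>.\<close>

definition bdeg :: "nat \<Rightarrow> nat" where
  "bdeg l = [0, 1, 1, 2, 2, 3] ! l"

text \<open>A product of two basis elements as a sum of basis elements, by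
  \<open>x y = x^2 + y^2\<close>, \<open>x^3 = y^3 = 0\<close> and
  \<open>x^2 y = x y^2\<close>.\<close>

definition ptab :: "nat \<Rightarrow> nat \<Rightarrow> nat list" where
  "ptab l l' = [[[0], [1], [2], [3], [4], [5]], [[1], [3], [3, 4], [], [5], []], [[2], [3, 4], [4], [5], [], []],
     [[3], [], [5], [], [], []], [[4], [5], [], [], [], []], [[5], [], [], [], [], []]] ! l ! l'"

definition rk :: "nat \<Rightarrow> nat" where
  "rk j = [1, 2, 2, 1, 1, 2, 2, 1] ! j"

definition fsum :: "nat list \<Rightarrow> fam" where
  "fsum ls = foldr (\<lambda>l. fadd (fam1 ! l)) ls fzero"

definition fdiff :: "nat \<Rightarrow> fam \<Rightarrow> fam" where
  "fdiff n f = fadd (fcomp 1 famD f) (fcomp n f famD)"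

definition fam_ok :: "nat \<Rightarrow> fam \<Rightarrow> bool" where
  "fam_ok n f \<longleftrightarrow> length f = 8 \<and> list_all2 (\<lambda>(m, m') ls. list_all (\<lambda>(i, l, t). i < m \<and> l < m') ls)
     (zip (rot n (map rk [0..<8])) (map rk [0..<8])) f"
text \<open>Row \<open>l\<close> of the augmented matrix, with repetitions: composing the
  coefficient sum at \<open>e_l\<close> with the map gives the coefficient sums at these
  \<open>e_i\<close>.\<close>

fun arow1 :: "nat \<Rightarrow> lab list \<Rightarrow> nat list" where
  "arow1 l [] = []"
| "arow1 l ((i, l', t) # ls) = (if l' = l then i # arow1 l ls else arow1 l ls)"

fun arow :: "nat list \<Rightarrow> lab list \<Rightarrow> nat list" where
  "arow [] ls = []"
| "arow (l # r) ls = arow1 l ls @ arow r ls"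

text \<open>
  The augmentation of \<open>e\<^sub>i \<mapsto> t e\<^sub>j\<close> forgets \<open>t\<close>. As the resolution is minimal, a class is determined by the
  augmented component in degree \<open>0\<close>.
\<close>

definition row :: "fam \<Rightarrow> nat list" where
  "row f = map fst (f ! 0)"

text \<open>The table of the theorem in terms of indices, in the order of \<open>Q_table\<close>.
  The flag says whether the first argument, and with it the value, carries a factor
  \<open>s\<close>.\<close>

definition mlist :: "((bool \<times> nat \<times> nat \<times> nat) \<times> nat list) list" where
  "mlist = [((False, 1, 2, 1), [3]), ((False, 2, 1, 2), [4]),
    ((True, 0, 1, 2), [1, 2]), ((True, 0, 2, 1), [1, 2]), ((True, 0, 1, 3), [3]), ((True, 0, 3, 1), [3]),
    ((True, 0, 1, 4), [3, 4]), ((True, 0, 4, 1), [3, 4]), ((True, 0, 2, 4), [4]), ((True, 0, 4, 2), [4]),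
    ((True, 0, 1, 5), [5]), ((True, 0, 5, 1), [5]), ((True, 1, 2, 1), [3, 4]), ((True, 2, 1, 2), [3, 4]),
    ((True, 1, 1, 2), [4]), ((True, 2, 2, 1), [3]), ((True, 3, 1, 2), [5]), ((True, 4, 1, 2), [5]),
    ((True, 3, 2, 1), [5]), ((True, 4, 2, 1), [5]), ((True, 2, 1, 3), [5]), ((True, 2, 3, 1), [5]),
    ((True, 1, 1, 4), [5]), ((True, 2, 1, 4), [5]), ((True, 1, 4, 1), [5]), ((True, 2, 4, 1), [5]),
    ((True, 1, 2, 4), [5]), ((True, 1, 4, 2), [5])]"

definition mtab :: "bool \<Rightarrow> nat \<Rightarrow> nat \<Rightarrow> nat \<Rightarrow> nat list" where
  "mtab p a b c = (case map_of mlist (p, a, b, c) of None \<Rightarrow> [] | Some ls \<Rightarrow> ls)"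

text \<open>The augmented rows of \<open>f_2(a, b) f_1(c)\<close>, \<open>f_2(a, bc)\<close>,
  \<open>f_2(ab, c)\<close> and \<open>f_1(a) f_2(b, c)\<close>, followed by the required value; the
  total must cancel. The flag influences the fourth term, which needs a homotopy in the degree of
  the first argument, a degree that matters modulo eight. In the first term the degree of a
  representative is needed only modulo four.\<close>

definition mrow :: "bool \<Rightarrow> nat \<Rightarrow> nat \<Rightarrow> nat \<Rightarrow> nat list" where
  "mrow p a b c =
     arow (row (fam2 ! a ! b)) (fam1 ! c ! ((bdeg a + bdeg b + 7) mod 8)) @
     concat (map (\<lambda>l. row (fam2 ! a ! l)) (ptab b c)) @
     concat (map (\<lambda>l. row (fam2 ! l ! c)) (ptab a b)) @
     arow (row (fam1 ! a)) (fam2 ! b ! c ! ((bdeg a + (if p then 4 else 0)) mod 8)) @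
     concat (map (\<lambda>l. row (fam1 ! l)) (mtab p a b c))"

type_synonym hlab = "(nat \<times> q8) \<times> (nat \<times> q8)"

text \<open>The contraction is not equivariant, so exactness is checked on the linear basis
  \<open>u e_i\<close>, coded by \<open>(i, u)\<close>; an equivariant label then splits into eight
  entries.\<close>

definition expand :: "lab list \<Rightarrow> hlab list" where
  "expand ls = concat (map (\<lambda>(i, j, t). map (\<lambda>u. ((i, u), (j, qmul u t))) all_q8) ls)"

definition hentries :: "(nat \<times> q8 \<times> (nat \<times> q8) list) list \<Rightarrow> hlab list" where
  "hentries es = concat (map (\<lambda>(i, t, ps). map (\<lambda>p. ((i, t), p)) ps) es)"

fun hcomp1 :: "hlab \<Rightarrow> hlab list \<Rightarrow> hlab list" where
  "hcomp1 x [] = []"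
| "hcomp1 (p, q) ((p', q') # ms) = (if q = p' then (p, q') # hcomp1 (p, q) ms else hcomp1 (p, q) ms)"

fun hcomp :: "hlab list \<Rightarrow> hlab list \<Rightarrow> hlab list" where
  "hcomp [] ms = []"
| "hcomp (x # ls) ms = hcomp1 x ms @ hcomp ls ms"

definition hid :: "nat \<Rightarrow> hlab list" where
  "hid m = concat (map (\<lambda>i. map (\<lambda>t. ((i, t), (i, t))) all_q8) [0..<m])"

definition contr :: "nat \<Rightarrow> hlab list" where
  "contr j = hentries (twice contraction ! j)"

section \<open>Evaluations of the data over the field with two elements\<close>

lemma famD_check: "fam_ok 1 famD" "fnull (fcomp 1 famD famD)" "famD ! 7 = map (\<lambda>t. (0, 0, t)) [q1, qI, qz, qzI, qJ, qK, qzJ, qzK]"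
  by code_simp+

lemma famD_gen: "famD ! 0 = [(0, 0, q1), (0, 0, qI), (1, 0, q1), (1, 0, qJ)]"
  by code_simp

text \<open>Every entry of the differential is a sum of an even number of group elements, so its
  augmentation vanishes in characteristic two. This is the minimality of the resolution.\<close>

lemma famD_minimal: "\<forall>j\<in>set [0..<8]. \<forall>i\<in>set [0..<2]. reduce (arow1 i (famD ! j)) = []"
  by code_simp

text \<open>Modulo two this is \<open>d h + h d + 1 = 0\<close> on the linear bases. It yields
  exactness in every degree at once.\<close>

lemma contraction_check:
  "\<forall>j\<in>set [0..<8]. reduce (hcomp (contr j) (expand (famD ! j)) @
     hcomp (expand (famD ! ((j + 7) mod 8))) (contr ((j + 7) mod 8)) @ hid (rk j)) = []"
  by code_simp

lemma contraction_ok: "\<forall>j\<in>set [0..<8]. list_all (\<lambda>((i, t), (l, t')). l < rk ((j + 1) mod 8)) (contr j)"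
  by code_simp

lemma fam1_check: "\<forall>l\<in>set [0..<6]. fam_ok (bdeg l) (fam1 ! l) \<and> fnull (fdiff (bdeg l) (fam1 ! l))"
  by code_simp

lemma fam1_periodic: "\<forall>l\<in>set [0..<6]. \<forall>j\<in>set [0..<4]. fam1 ! l ! j = fam1 ! l ! (j + 4)"
  by code_simp

lemma fam1_rows: "map row fam1 = [[0], [0], [1], [0, 1], [0], [0]]"
  by code_simp

lemma fam2_ok: "\<forall>l\<in>set [0..<6]. \<forall>l'\<in>set [0..<6]. fam_ok ((bdeg l + bdeg l' + 7) mod 8) (fam2 ! l ! l')"
  by code_simp

lemma fam2_check: "\<forall>l\<in>set [0..<6]. \<forall>l'\<in>set [0..<6].
  fnull (fadd (fdiff ((bdeg l + bdeg l' + 7) mod 8) (fam2 ! l ! l'))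
    (fadd (fsum (ptab l l')) (fcomp (bdeg l) (fam1 ! l) (fam1 ! l'))))"
  by code_simp

text \<open>All values of the canonical cocycle on basis elements are contained in this evaluation
  of 432 cases, including those that have to vanish.\<close>

lemma mrow_check: "\<forall>p\<in>set [False, True]. \<forall>a\<in>set [0..<6]. \<forall>b\<in>set [0..<6]. \<forall>c\<in>set [0..<6]. reduce (mrow p a b c) = []"
  by code_simp

lemma ptab_deg: "\<forall>a\<in>set [0..<6]. \<forall>b\<in>set [0..<6]. \<forall>l\<in>set (ptab a b). l < 6 \<and> bdeg l = bdeg a + bdeg b"
  by code_simp

lemma mtab_deg: "\<forall>p\<in>set [False, True]. \<forall>a\<in>set [0..<6]. \<forall>b\<in>set [0..<6]. \<forall>c\<in>set [0..<6]. \<forall>l\<in>set (mtab p a b c).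
    l < 6 \<and> bdeg l + 1 = bdeg a + bdeg b + bdeg c"
  by code_simp

declare qmul.simps [simp del]

text \<open>Removing equal members in pairs is sound in any group of exponent two; so one evaluation
  on lists serves every field of characteristic two.\<close>

lemma sum_list_reduce:
  fixes \<phi> :: "'a \<Rightarrow> 'b::ab_group_add"
  assumes add2: "\<And>y :: 'b. y + y = 0"
  shows "(\<Sum>x\<leftarrow>reduce ls. \<phi> x) = (\<Sum>x\<leftarrow>ls. \<phi> x)"
proof (induction ls)
  case (Cons x ls)
  have "(\<Sum>x\<leftarrow>ys. \<phi> x) = \<phi> x + (\<Sum>x\<leftarrow>remove1 x ys. \<phi> x)" if "x \<in> set ys" for ys
    using that by (induction ys) (auto simp: add.left_commute)
  then have "(\<Sum>x\<leftarrow>toggle x ys. \<phi> x) = \<phi> x + (\<Sum>x\<leftarrow>ys. \<phi> x)" for ys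
    using add2[of "\<phi> x"] by (auto simp: toggle_def simp flip: add.assoc)
  then show ?case using Cons by simp
qed simp

section \<open>The elements of the quaternion group\<close>

locale quat =
  fixes G :: "'g monoid" and I J K :: 'g and ty :: "'k::field itself"
  assumes Q: "quaternion_group G I J K" and char: "CHAR('k) = 2"
begin

lemma group: "group G"
  using Q by (simp add: quaternion_group_def)

sublocale group G by (rule group)

definition zz :: 'g where "zz = I \<otimes>\<^bsub>G\<^esub> I"

definition el_of :: "q8 \<Rightarrow> 'g" where
  "el_of = (\<lambda>(c, a, b). (if c then zz else \<one>\<^bsub>G\<^esub>) \<otimes>\<^bsub>G\<^esub> ((if a then I else \<one>\<^bsub>G\<^esub>) \<otimes>\<^bsub>G\<^esub> (if b then J else \<one>\<^bsub>G\<^esub>)))"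

lemma IJ [simp]: "I \<in> carrier G" "J \<in> carrier G" "zz \<in> carrier G"
  using Q by (auto simp: quaternion_group_def zz_def)

lemma quat_rules:
  shows "I \<otimes>\<^bsub>G\<^esub> I = zz" "J \<otimes>\<^bsub>G\<^esub> J = zz" "zz \<otimes>\<^bsub>G\<^esub> zz = \<one>\<^bsub>G\<^esub>" "I \<otimes>\<^bsub>G\<^esub> zz = zz \<otimes>\<^bsub>G\<^esub> I" "J \<otimes>\<^bsub>G\<^esub> zz = zz \<otimes>\<^bsub>G\<^esub> J"
    "J \<otimes>\<^bsub>G\<^esub> I = zz \<otimes>\<^bsub>G\<^esub> (I \<otimes>\<^bsub>G\<^esub> J)"
proof -
  show II: "I \<otimes>\<^bsub>G\<^esub> I = zz" by (simp add: zz_def)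
  show JJ: "J \<otimes>\<^bsub>G\<^esub> J = zz" using Q by (simp add: quaternion_group_def zz_def)
  show Iz: "I \<otimes>\<^bsub>G\<^esub> zz = zz \<otimes>\<^bsub>G\<^esub> I" by (simp add: zz_def m_assoc)
  show Jz: "J \<otimes>\<^bsub>G\<^esub> zz = zz \<otimes>\<^bsub>G\<^esub> J" by (simp add: JJ[symmetric] m_assoc)
  have "I \<otimes>\<^bsub>G\<^esub> J \<otimes>\<^bsub>G\<^esub> (I \<otimes>\<^bsub>G\<^esub> J) = I \<otimes>\<^bsub>G\<^esub> I" using Q by (simp add: quaternion_group_def)
  then have JIJ: "J \<otimes>\<^bsub>G\<^esub> (I \<otimes>\<^bsub>G\<^esub> J) = I"
    using Units_l_cancel[of I "J \<otimes>\<^bsub>G\<^esub> (I \<otimes>\<^bsub>G\<^esub> J)" I] by (simp add: m_assoc)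
  then have JIz: "J \<otimes>\<^bsub>G\<^esub> (I \<otimes>\<^bsub>G\<^esub> zz) = I \<otimes>\<^bsub>G\<^esub> J"
    by (metis IJ(1,2) JJ m_assoc m_closed)
  \<comment> \<open>Using \<open>J I z = I J\<close> twice turns \<open>z J\<close> into
    \<open>z^3 J\<close>; cancelling \<open>z J\<close> leaves \<open>z^2 = 1\<close>.\<close>
  have "zz \<otimes>\<^bsub>G\<^esub> J = I \<otimes>\<^bsub>G\<^esub> (J \<otimes>\<^bsub>G\<^esub> (I \<otimes>\<^bsub>G\<^esub> zz))"
    unfolding JIz by (simp add: II[symmetric] m_assoc)
  also have "\<dots> = I \<otimes>\<^bsub>G\<^esub> J \<otimes>\<^bsub>G\<^esub> zz \<otimes>\<^bsub>G\<^esub> I"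
    by (simp add: Iz m_assoc)
  also have "\<dots> = J \<otimes>\<^bsub>G\<^esub> (I \<otimes>\<^bsub>G\<^esub> zz) \<otimes>\<^bsub>G\<^esub> zz \<otimes>\<^bsub>G\<^esub> I"
    unfolding JIz ..
  also have "\<dots> = J \<otimes>\<^bsub>G\<^esub> (zz \<otimes>\<^bsub>G\<^esub> (zz \<otimes>\<^bsub>G\<^esub> (I \<otimes>\<^bsub>G\<^esub> I)))"
    by (metis IJ Iz m_assoc m_closed)
  also have "\<dots> = zz \<otimes>\<^bsub>G\<^esub> zz \<otimes>\<^bsub>G\<^esub> zz \<otimes>\<^bsub>G\<^esub> J"
    unfolding II by (metis IJ Jz m_assoc m_closed)
  finally have "\<one>\<^bsub>G\<^esub> \<otimes>\<^bsub>G\<^esub> (zz \<otimes>\<^bsub>G\<^esub> J) = zz \<otimes>\<^bsub>G\<^esub> zz \<otimes>\<^bsub>G\<^esub> (zz \<otimes>\<^bsub>G\<^esub> J)"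
    by (simp add: m_assoc)
  then show z2: "zz \<otimes>\<^bsub>G\<^esub> zz = \<one>\<^bsub>G\<^esub>"
    using r_cancel_one'[of "zz \<otimes>\<^bsub>G\<^esub> J" "zz \<otimes>\<^bsub>G\<^esub> zz"] by simp
  have "J \<otimes>\<^bsub>G\<^esub> I = J \<otimes>\<^bsub>G\<^esub> (I \<otimes>\<^bsub>G\<^esub> zz) \<otimes>\<^bsub>G\<^esub> zz"
    by (simp add: m_assoc z2)
  then show "J \<otimes>\<^bsub>G\<^esub> I = zz \<otimes>\<^bsub>G\<^esub> (I \<otimes>\<^bsub>G\<^esub> J)"
    unfolding JIz by (metis IJ Iz Jz m_assoc m_closed)
qed

lemma quat_rules_left:
  assumes "x \<in> carrier G"
  shows "I \<otimes>\<^bsub>G\<^esub> (I \<otimes>\<^bsub>G\<^esub> x) = zz \<otimes>\<^bsub>G\<^esub> x" "J \<otimes>\<^bsub>G\<^esub> (J \<otimes>\<^bsub>G\<^esub> x) = zz \<otimes>\<^bsub>G\<^esub> x" "zz \<otimes>\<^bsub>G\<^esub> (zz \<otimes>\<^bsub>G\<^esub> x) = x"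
    "I \<otimes>\<^bsub>G\<^esub> (zz \<otimes>\<^bsub>G\<^esub> x) = zz \<otimes>\<^bsub>G\<^esub> (I \<otimes>\<^bsub>G\<^esub> x)" "J \<otimes>\<^bsub>G\<^esub> (zz \<otimes>\<^bsub>G\<^esub> x) = zz \<otimes>\<^bsub>G\<^esub> (J \<otimes>\<^bsub>G\<^esub> x)"
    "J \<otimes>\<^bsub>G\<^esub> (I \<otimes>\<^bsub>G\<^esub> x) = zz \<otimes>\<^bsub>G\<^esub> (I \<otimes>\<^bsub>G\<^esub> (J \<otimes>\<^bsub>G\<^esub> x))"
  using assms quat_rules by (simp_all flip: m_assoc)

lemma el_closed [simp]: "el_of t \<in> carrier G"
  by (cases t) (simp add: el_of_def)

lemma el_mult: "el_of s \<otimes>\<^bsub>G\<^esub> el_of t = el_of (qmul s t)"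
proof -
  obtain c a b c' a' b' where "s = (c, a, b)" "t = (c', a', b')" by (metis prod_cases3)
  then show ?thesis
    by (cases c; cases a; cases b; cases c'; cases a'; cases b')
      (simp_all add: el_of_def m_assoc quat_rules quat_rules_left qmul.simps)
qed

lemma el_simps: "el_of q1 = \<one>\<^bsub>G\<^esub>" "el_of qI = I" "el_of qJ = J" "el_of qK = I \<otimes>\<^bsub>G\<^esub> J"
  by (simp_all add: el_of_def)

lemma el_inv: "\<exists>t'. inv\<^bsub>G\<^esub> (el_of t) = el_of t'"
proof -
  have "\<exists>t'. qmul t' t = q1"
  proof -
    obtain c a b where t: "t = (c, a, b)" by (metis prod_cases3)
    show ?thesis
      by (rule exI[of _ "(c \<noteq> (a \<or> b), a, b)"]) (auto simp: t qmul.simps)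
  qed
  then obtain t' where "qmul t' t = q1" ..
  then have "el_of t' \<otimes>\<^bsub>G\<^esub> el_of t = \<one>\<^bsub>G\<^esub>" by (simp add: el_mult el_simps)
  then show ?thesis using inv_equality by (intro exI[of _ t']) simp
qed

text \<open>The elements \<open>z^c I^a J^b\<close> include the generators and are closed under
  products and inverses, so they exhaust the group. As there are eight codes and the group has order
  eight, the parametrisation is injective.\<close>

lemma el_bij: "bij_betw el_of UNIV (carrier G)"
proof -
  have "h \<in> range el_of" if "h \<in> generate G {I, J, K}" for h
    using that
  proof (induction rule: generate.induct)
    case one
    show ?case using el_simps(1) by (metis rangeI)
  next
    case (incl h)
    then show ?case using Q el_simps by (auto simp: quaternion_group_def) (metis rangeI)+
  next
    case (inv h)
    have "h \<in> range el_of" using inv Q el_simps by (auto simp: quaternion_group_def) (metis rangeI)+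
    then obtain t where "h = el_of t" by (rule imageE)
    then show ?case using el_inv[of t] by (metis rangeI)
  next
    case (eng h1 h2)
    from eng.IH(1) obtain s where s: "h1 = el_of s" by (rule imageE)
    from eng.IH(2) obtain t where t: "h2 = el_of t" by (rule imageE)
    show ?case unfolding s t el_mult by (rule rangeI)
  qed
  then have r: "range el_of = carrier G" using Q by (auto simp: quaternion_group_def)
  have "card (range el_of) = 8" unfolding r using Q by (simp add: quaternion_group_def order_def)
  moreover have "card (UNIV :: q8 set) = 8" by (simp add: card_cartesian_product flip: UNIV_Times_UNIV)
  ultimately have "inj el_of" by (intro eq_card_imp_inj_on) (auto simp: card_ge_0_finite)
  then show ?thesis using r by (simp add: bij_betw_def)
qed

lemma el_inj [simp]: "el_of s = el_of t \<longleftrightarrow> s = t"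
  using el_bij by (simp add: bij_betw_def inj_eq)

lemma el_cases: "h \<in> carrier G \<Longrightarrow> (\<And>t. h = el_of t \<Longrightarrow> thesis) \<Longrightarrow> thesis"
  using el_bij unfolding bij_betw_def by (metis imageE)

lemma finite_G: "finite (carrier G)"
  using el_bij by (metis bij_betw_finite finite)

section \<open>Maps between free modules given by labels\<close>

lemma add2 [simp]: "c + c = (0 :: 'k)"
proof -
  have "(1::'k) + 1 = 0" using of_nat_CHAR[where ?'a = 'k] char by simp
  then have "c * (1 + 1) = 0" by simp
  then show ?thesis by (simp only: distrib_left mult_1_right)
qed

lemma add2f [simp]: "f + f = (0 :: 'a \<Rightarrow> 'k)"
  by (rule ext) (simp only: plus_fun_apply add2 zero_fun_apply)

lemma add2f_left [simp]: "f + (f + g) = (g :: 'a \<Rightarrow> 'k)"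
  by (simp flip: add.assoc)

lemma add2f_move: "f + (g + h) = (0 :: 'a \<Rightarrow> 'k) \<Longrightarrow> h = f + g"
proof -
  assume eq: "f + (g + h) = 0"
  have "h = h + (f + (g + h))" by (simp only: eq add_0_right)
  also have "\<dots> = f + g" by (simp only: add.assoc add.left_commute[of h] add2f add_0_right)
  finally show "h = f + g" .
qed

text \<open>The label takes \<open>h e_i\<close> to \<open>h t e_j\<close>, so the coefficient at
  \<open>h e_j\<close> comes from \<open>h\<close> times the inverse of \<open>t\<close>.
  Multiplication on the right commutes with the action on the left.\<close>

definition el :: "lab \<Rightarrow> (nat \<times> 'g \<Rightarrow> 'k) \<Rightarrow> nat \<times> 'g \<Rightarrow> 'k" where
  "el = (\<lambda>(i, j, t) f (l, h). if l = j \<and> h \<in> carrier G then f (i, h \<otimes>\<^bsub>G\<^esub> inv\<^bsub>G\<^esub> (el_of t)) else 0)"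

definition lop :: "lab list \<Rightarrow> (nat \<times> 'g \<Rightarrow> 'k) \<Rightarrow> nat \<times> 'g \<Rightarrow> 'k" where
  "lop ls f = (\<Sum>x\<leftarrow>ls. el x f)"

lemma lop_simps [simp]: "lop [] f = 0" "lop (x # ls) f = el x f + lop ls f" "lop (ls @ ms) f = lop ls f + lop ms f"
  by (simp_all add: lop_def)

lemma el_add: "el x (f + g) = el x f + el x g" and el_zero [simp]: "el x 0 = 0"
  by (auto simp: el_def fun_eq_iff split: prod.splits)

lemma lop_add: "lop ls (f + g) = lop ls f + lop ls g" and lop_zero [simp]: "lop ls 0 = 0"
  by (induction ls) (simp_all add: el_add add.assoc add.left_commute)

lemma el_el: "el (j', l, t') (el (i, j, t) f) = (if j = j' then el (i, l, qmul t t') f else 0)"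
proof -
  have "h \<otimes>\<^bsub>G\<^esub> inv\<^bsub>G\<^esub> el_of t' \<otimes>\<^bsub>G\<^esub> inv\<^bsub>G\<^esub> el_of t = h \<otimes>\<^bsub>G\<^esub> inv\<^bsub>G\<^esub> el_of (qmul t t')" if "h \<in> carrier G" for h
    using that by (simp add: inv_mult_group m_assoc flip: el_mult)
  then show ?thesis by (auto simp: el_def fun_eq_iff)
qed

lemma lop_comp: "lop (lab_comp ls ms) f = lop ms (lop ls f)"
proof (induction ls)
  case (Cons x ls)
  have c1: "lop (lab_comp1 x ms) f = lop ms (el x f)" for f
  proof (induction ms)
    case (Cons y ms)
    obtain i j t j' l t' where xy: "x = (i, j, t)" "y = (j', l, t')" by (metis prod_cases3)
    show ?case
      using Cons unfolding xy by (cases "j = j'") (simp_all only: lab_comp1.simps lop_simps el_el if_True if_False simp_thms add_0_left)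
  next
    case Nil
    show ?case unfolding lab_comp1.simps lop_simps ..
  qed
  show ?case unfolding lab_comp.simps lop_simps c1 Cons.IH lop_add ..
next
  case Nil
  show ?case unfolding lab_comp.simps lop_simps lop_zero ..
qed

lemma lop_reduce: "lop (reduce ls) f = lop ls f"
  unfolding lop_def by (rule sum_list_reduce) simp

lemma lop_null: "reduce ls = [] \<Longrightarrow> lop ls f = 0"
  using lop_reduce[of ls f] by simp

abbreviation F :: "nat \<Rightarrow> ('g, 'k, nat \<times> 'g \<Rightarrow> 'k) kG_mod" where
  "F m \<equiv> free_module G {..<m}"

lemma F_module: "kG_module G (F m)"
  by (rule free_kG_module) (rule group)

lemma F_carr: "f \<in> Mcarr (F m) \<longleftrightarrow> (\<forall>i h. f (i, h) \<noteq> 0 \<longrightarrow> i < m \<and> h \<in> carrier G)"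
proof -
  have "finite {p. f p \<noteq> 0}" if "\<forall>i h. f (i, h) \<noteq> 0 \<longrightarrow> i < m \<and> h \<in> carrier G"
    by (rule finite_subset[of _ "{..<m} \<times> carrier G"]) (use that finite_G in auto)
  then show ?thesis by (auto simp: free_carr_iff)
qed

lemma el_carr: "j < m' \<Longrightarrow> el (i, j, t) f \<in> Mcarr (F m')"
  by (auto simp: F_carr el_def split: if_splits)

lemma lop_carr: "\<forall>(i, j, t)\<in>set ls. j < m' \<Longrightarrow> lop ls f \<in> Mcarr (F m')"
proof (induction ls)
  case (Cons x ls)
  have "el x f \<in> Mcarr (F m')"
    using Cons.prems by (cases x) (auto intro: el_carr)
  moreover have "lop ls f \<in> Mcarr (F m')"
    using Cons by simp
  ultimately show ?case
    unfolding lop_simps by (rule module_add[OF F_module])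
qed (simp add: module_zero[OF F_module])

lemma el_scale: "el x (Mscale (F m) c f) = Mscale (F m) c (el x f)"
  by (auto simp: el_def fun_eq_iff split: prod.splits)

lemma lop_scale: "lop ls (Mscale (F m) c f) = Mscale (F m) c (lop ls f)"
proof -
  interpret vector_space "Mscale (F m)" by (rule free_vs)
  show ?thesis by (induction ls) (simp_all only: lop_simps scale_zero_right el_scale scale_right_distrib)
qed

lemma el_act: "g \<in> carrier G \<Longrightarrow> el x (Mact (F m) g f) = Mact (F m') g (el x f)"
  by (auto simp: el_def fun_eq_iff m_assoc split: prod.splits)

lemma lop_act: "g \<in> carrier G \<Longrightarrow> lop ls (Mact (F m) g f) = Mact (F m') g (lop ls f)"
proof (induction ls)
  case Nil
  show ?case unfolding lop_simps by (rule module_act_zero[OF F_module Nil, symmetric])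
next
  case (Cons x ls)
  show ?case
    unfolding lop_simps module_act_add[OF F_module Cons.prems] el_act[OF Cons.prems, of x m f m'] Cons.IH[OF Cons.prems] ..
qed

definition ix :: "int \<Rightarrow> nat" where "ix j = nat (j mod 8)"

lemma ix_less [simp]: "ix j < 8"
  by (simp add: ix_def nat_less_iff)

lemma ix_add: "ix (j + n) = (ix j + ix n) mod 8"
proof -
  have "int ((ix j + ix n) mod 8) = (j mod 8 + n mod 8) mod 8"
    by (simp add: ix_def zmod_int)
  also have "\<dots> = int (ix (j + n))"
    by (simp add: ix_def mod_add_eq)
  finally show ?thesis by (simp only: of_nat_eq_iff)
qed

definition Eob :: "int \<Rightarrow> ('g, 'k, nat \<times> 'g \<Rightarrow> 'k) kG_mod" where "Eob j = F (rk (ix j))"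

definition fm :: "int \<Rightarrow> fam \<Rightarrow> int \<Rightarrow> (nat \<times> 'g \<Rightarrow> 'k) \<Rightarrow> nat \<times> 'g \<Rightarrow> 'k" where
  "fm n d = (\<lambda>j u. if u \<in> Mcarr (Eob (j + n)) then lop (d ! ix j) u else 0)"

lemma rot_nth: "length f = 8 \<Longrightarrow> n < 8 \<Longrightarrow> a < 8 \<Longrightarrow> rot n f ! a = f ! ((a + n) mod 8)"
  by (simp add: rot_def nth_append mod_if add.commute) linarith?

lemma rot_length [simp]: "length (rot n f) = length f"
  by (simp add: rot_def)

lemma fam_okD:
  assumes "fam_ok n d" "n < 8"
  shows "length d = 8" "a < 8 \<Longrightarrow> (i, l, t) \<in> set (d ! a) \<Longrightarrow> i < rk ((a + n) mod 8) \<and> l < rk a"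
  using assms by (auto simp: fam_ok_def list_all2_conv_all_nth rot_nth list_all_iff)

lemma fcomp_nth: "length f = 8 \<Longrightarrow> length g = 8 \<Longrightarrow> m < 8 \<Longrightarrow> a < 8 \<Longrightarrow>
    fcomp m f g ! a = lab_comp (g ! ((a + m) mod 8)) (f ! a)"
  by (simp add: fcomp_def rot_nth)

lemma fam_length [simp]: "length f = 8 \<Longrightarrow> length g = 8 \<Longrightarrow> length (fcomp m f g) = 8"
  "length f = 8 \<Longrightarrow> length g = 8 \<Longrightarrow> length (fadd f g) = 8"
  by (simp_all add: fcomp_def fadd_def)

lemma Eob_module: "kG_module G (Eob j)"
  unfolding Eob_def by (rule F_module)

lemma lop_Eob: "fam_ok (ix n) d \<Longrightarrow> lop (d ! ix j) u \<in> Mcarr (Eob j)"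
  unfolding Eob_def by (rule lop_carr) (use fam_okD(2)[of "ix n" d "ix j"] in auto)

lemma fm_hom: "fam_ok (ix n) d \<Longrightarrow> fm n d j \<in> kG_hom G (Eob (j + n)) (Eob j)"
proof -
  assume d: "fam_ok (ix n) d"
  have E: "Eob i = F (rk (ix i))" for i by (simp add: Eob_def)
  show ?thesis
    unfolding kG_hom_def fm_def
  proof (intro CollectI conjI ballI allI impI)
    fix u assume u: "u \<in> Mcarr (Eob (j + n))"
    show "(if u \<in> Mcarr (Eob (j + n)) then lop (d ! ix j) u else 0) \<in> Mcarr (Eob j)"
      using lop_Eob[OF d] u by simp
    show "(if Mscale (Eob (j + n)) c u \<in> Mcarr (Eob (j + n)) then lop (d ! ix j) (Mscale (Eob (j + n)) c u) else 0) =
        Mscale (Eob j) c (if u \<in> Mcarr (Eob (j + n)) then lop (d ! ix j) u else 0)" for c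
      unfolding if_P[OF u] if_P[OF module_scale[OF Eob_module u]]
      unfolding E lop_scale by (simp only: free_module_def kG_mod.simps)
    show "(if Mact (Eob (j + n)) g u \<in> Mcarr (Eob (j + n)) then lop (d ! ix j) (Mact (Eob (j + n)) g u) else 0) =
        Mact (Eob j) g (if u \<in> Mcarr (Eob (j + n)) then lop (d ! ix j) u else 0)" if g: "g \<in> carrier G" for g
      unfolding if_P[OF u] if_P[OF module_act[OF Eob_module g u]]
      unfolding E by (rule lop_act[OF g])
    fix v assume v: "v \<in> Mcarr (Eob (j + n))"
    show "(if u + v \<in> Mcarr (Eob (j + n)) then lop (d ! ix j) (u + v) else 0) =
        (if u \<in> Mcarr (Eob (j + n)) then lop (d ! ix j) u else 0) + (if v \<in> Mcarr (Eob (j + n)) then lop (d ! ix j) v else 0)"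
      unfolding if_P[OF u] if_P[OF v] if_P[OF module_add[OF Eob_module u v]] by (rule lop_add)
  qed simp
qed

lemma fm_comp:
  assumes "fam_ok (ix m) d'" "length d = 8"
  shows "endo_comp n (fm n d) (fm m d') = fm (n + m) (fcomp (ix n) d d')"
proof (rule ext, rule ext)
  fix j u
  have e: "fcomp (ix n) d d' ! ix j = lab_comp (d' ! ix (j + n)) (d ! ix j)"
    using assms fam_okD(1)[OF assms(1)] by (simp add: fcomp_nth ix_add)
  show "endo_comp n (fm n d) (fm m d') j u = fm (n + m) (fcomp (ix n) d d') j u"
    using lop_Eob[OF assms(1), of "j + n" u]
    by (simp add: endo_comp_def fm_def e lop_comp add.assoc)
qed

lemma fm_add: "length d = 8 \<Longrightarrow> length d' = 8 \<Longrightarrow> fm n d + fm n d' = fm n (fadd d d')"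
  by (simp add: fun_eq_iff fm_def fadd_def)

lemma fm_null: "length d = 8 \<Longrightarrow> fnull d \<Longrightarrow> fm n d = 0"
  by (simp add: fun_eq_iff fm_def fnull_def list_all_length lop_null)

section \<open>Augmentations and the minimal complete resolution\<close>

definition augm :: "nat \<Rightarrow> (nat \<times> 'g \<Rightarrow> 'k) \<Rightarrow> 'k" where
  "augm i f = (\<Sum>h\<in>carrier G. f (i, h))"

lemma augm_add: "augm i (f + g) = augm i f + augm i g" and augm_zero [simp]: "augm i 0 = 0"
  by (simp_all add: augm_def sum.distrib)

lemma augm_el: "augm l (el (i, j, t) f) = (if l = j then augm i f else 0)"
proof -
  have "(\<Sum>h\<in>carrier G. f (i, h \<otimes>\<^bsub>G\<^esub> inv\<^bsub>G\<^esub> el_of t)) = (\<Sum>h\<in>carrier G. f (i, h))"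
    by (rule sum.reindex_bij_witness[of _ "\<lambda>h. h \<otimes>\<^bsub>G\<^esub> el_of t" "\<lambda>h. h \<otimes>\<^bsub>G\<^esub> inv\<^bsub>G\<^esub> el_of t"]) (auto simp: m_assoc)
  then show ?thesis by (simp add: augm_def el_def)
qed

lemma augm_act: "g \<in> carrier G \<Longrightarrow> augm i (Mact (F m) g f) = augm i f"
proof -
  assume g: "g \<in> carrier G"
  have "(\<Sum>h\<in>carrier G. f (i, inv\<^bsub>G\<^esub> g \<otimes>\<^bsub>G\<^esub> h)) = (\<Sum>h\<in>carrier G. f (i, h))"
    by (rule sum.reindex_bij_witness[of _ "\<lambda>h. g \<otimes>\<^bsub>G\<^esub> h" "\<lambda>h. inv\<^bsub>G\<^esub> g \<otimes>\<^bsub>G\<^esub> h"]) (use g in \<open>auto simp: m_assoc[symmetric]\<close>)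
  then show ?thesis by (simp add: augm_def)
qed

lemma augm_scale: "augm i (Mscale (F m) c f) = c * augm i f"
  by (simp add: augm_def sum_distrib_left)

lemma augm_lop: "augm l (lop ls u) = (\<Sum>i\<leftarrow>arow1 l ls. augm i u)"
proof (induction ls)
  case (Cons x ls)
  obtain i j t where x: "x = (i, j, t)" by (metis prod_cases3)
  show ?case unfolding x lop_simps augm_add augm_el Cons.IH by simp
next
  case Nil
  show ?case unfolding lop_simps augm_zero by simp
qed

lemma augm_arow: "(\<Sum>l\<leftarrow>r. augm l (lop ls u)) = (\<Sum>i\<leftarrow>arow r ls. augm i u)"
  by (induction r) (simp_all add: augm_lop)

text \<open>Families are indexed by the degree of the target, as in \<open>endo_cochains\<close>,
  but differentials by the degree of the source; hence the shift by one.\<close>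

definition Eres :: "('g, 'k, nat \<times> 'g \<Rightarrow> 'k) complete_res" where
  "Eres = \<lparr>Pobj = Eob, Pbd = (\<lambda>j. fm 1 famD (j - 1)),
     Paug = (\<lambda>f. if f \<in> Mcarr (Eob 0) then augm 0 f else 0),
     Pcoaug = (\<lambda>c (i, h). if i = 0 \<and> h \<in> carrier G then c else 0)\<rparr>"

lemma Eres_simps [simp]: "Pobj Eres = Eob" "Pbd Eres = (\<lambda>j. fm 1 famD (j - 1))"
    "Paug Eres = (\<lambda>f. if f \<in> Mcarr (Eob 0) then augm 0 f else 0)"
    "Pcoaug Eres = (\<lambda>c (i, h). if i = 0 \<and> h \<in> carrier G then c else 0)"
  by (simp_all add: Eres_def)

lemma ix_simps [simp]: "ix 0 = 0" "ix 1 = 1" "ix (-1) = 7"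
  by (simp_all add: ix_def)

lemma rk_0 [simp]: "rk 0 = 1" and rk_7 [simp]: "rk 7 = 1"
  by (simp_all add: rk_def)

text \<open>The matrix unit from the basis vector \<open>t e_i\<close> to the basis vector
  \<open>t' e_j\<close>.\<close>

definition hel :: "hlab \<Rightarrow> (nat \<times> 'g \<Rightarrow> 'k) \<Rightarrow> nat \<times> 'g \<Rightarrow> 'k" where
  "hel = (\<lambda>((i, t), (j, t')) f p. if p = (j, el_of t') then f (i, el_of t) else 0)"

definition hop :: "hlab list \<Rightarrow> (nat \<times> 'g \<Rightarrow> 'k) \<Rightarrow> nat \<times> 'g \<Rightarrow> 'k" where
  "hop ls f = (\<Sum>x\<leftarrow>ls. hel x f)"

lemma hop_simps [simp]: "hop [] f = 0" "hop (x # ls) f = hel x f + hop ls f" "hop (ls @ ms) f = hop ls f + hop ms f"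
  by (simp_all add: hop_def)

lemma hel_add: "hel x (f + g) = hel x f + hel x g" and hel_zero [simp]: "hel x 0 = 0"
  by (auto simp: hel_def fun_eq_iff split: prod.splits)

lemma hop_add: "hop ls (f + g) = hop ls f + hop ls g" and hop_zero [simp]: "hop ls 0 = 0"
  by (induction ls) (simp_all add: hel_add add.assoc add.left_commute)

lemma hel_hel: "hel (p', q') (hel (p, q) f) = (if q = p' then hel (p, q') f else 0)"
  by (cases p; cases q; cases p'; cases q') (auto simp: hel_def fun_eq_iff)

lemma hop_comp: "hop (hcomp ls ms) f = hop ms (hop ls f)"
proof (induction ls)
  case (Cons x ls)
  have "hop (hcomp1 x ms) f = hop ms (hel x f)" for f
  proof (induction ms)
    case (Cons y ms)
    obtain p q p' q' where xy: "x = (p, q)" "y = (p', q')" by (metis surj_pair)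
    show ?case
      using Cons unfolding xy by (cases "q = p'") (simp_all only: hcomp1.simps hop_simps hel_hel if_True if_False simp_thms add_0_left)
  next
    case Nil
    show ?case unfolding hcomp1.simps hop_simps ..
  qed
  then have c1: "hop (hcomp1 x ms) f = hop ms (hel x f)" .
  show ?case unfolding hcomp.simps hop_simps c1 Cons.IH hop_add ..
next
  case Nil
  show ?case unfolding hcomp.simps hop_simps hop_zero ..
qed

lemma sum_all_q8: "(\<Sum>t\<leftarrow>all_q8. \<phi> t) = (\<Sum>t\<in>UNIV. \<phi> t)" for \<phi> :: "q8 \<Rightarrow> 'b::comm_monoid_add"
proof -
  have "distinct all_q8" "set all_q8 = UNIV" by (auto simp: all_q8_def)
  then show ?thesis using sum_list_distinct_conv_sum_set by metis
qed

lemma sum_list_fun_apply: "(\<Sum>x\<leftarrow>xs. \<phi> x) p = (\<Sum>x\<leftarrow>xs. \<phi> x p)"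
  by (induction xs) simp_all

lemma hop_expand: "hop (expand ls) f = lop ls f"
proof (induction ls)
  case (Cons x ls)
  obtain i j t where x: "x = (i, j, t)" by (metis prod_cases3)
  have "hop (map (\<lambda>u. ((i, u), (j, qmul u t))) all_q8) f = el (i, j, t) f"
  proof
    fix p :: "nat \<times> 'g"
    obtain l h where p: "p = (l, h)" by (cases p)
    have "hop (map (\<lambda>u. ((i, u), (j, qmul u t))) all_q8) f p =
        (\<Sum>u\<in>UNIV. if l = j \<and> h = el_of (qmul u t) then f (i, el_of u) else 0)"
      unfolding sum_all_q8[symmetric] by (simp add: hop_def sum_list_fun_apply hel_def p o_def)
    also have "\<dots> = el (i, j, t) f p"
    proof (cases "h \<in> carrier G")
      case True
      then obtain w where w: "h = el_of w" by (rule el_cases)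
      obtain u0 where u0: "h \<otimes>\<^bsub>G\<^esub> inv\<^bsub>G\<^esub> el_of t = el_of u0"
        by (rule el_cases[of "h \<otimes>\<^bsub>G\<^esub> inv\<^bsub>G\<^esub> el_of t"]) (use True in auto)
      have "h = el_of (qmul u t) \<longleftrightarrow> u = u0" for u
      proof -
        have "h = el_of u \<otimes>\<^bsub>G\<^esub> el_of t \<longleftrightarrow> el_of u = el_of u0"
          unfolding u0[symmetric] using True by (metis el_closed inv_closed inv_solve_right' m_closed)
        then show ?thesis by (simp add: el_mult)
      qed
      then show ?thesis
        using True by (auto simp: p el_def u0)
    next
      case False
      then have "h \<noteq> el_of (qmul u t)" for u by auto
      then show ?thesis using False by (simp add: p el_def)
    qed
    finally show "hop (map (\<lambda>u. ((i, u), (j, qmul u t))) all_q8) f p = el (i, j, t) f p" .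
  qed
  then show ?case using Cons by (simp add: x expand_def)
qed (simp add: expand_def)

lemma hop_hid:
  assumes v: "v \<in> Mcarr (F m)"
  shows "hop (hid m) v = v"
proof
  fix p :: "nat \<times> 'g"
  obtain l h where p: "p = (l, h)" by (cases p)
  have *: "hop (concat (map (\<lambda>i. map (\<lambda>t. ((i, t), (i, t))) all_q8) ns)) v p =
      (\<Sum>i\<leftarrow>ns. \<Sum>t\<in>UNIV. if l = i \<and> h = el_of t then v (i, el_of t) else 0)" for ns
    unfolding sum_all_q8[symmetric]
    by (induction ns) (simp_all add: hop_def sum_list_fun_apply hel_def p o_def)
  have "hop (hid m) v p = (\<Sum>i\<in>{..<m}. \<Sum>t\<in>UNIV. if l = i \<and> h = el_of t then v (i, el_of t) else 0)"
    unfolding hid_def * by (simp add: sum_list_distinct_conv_sum_set atLeast0LessThan)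
  also have "\<dots> = (\<Sum>i\<in>{..<m}. if i = l then \<Sum>t\<in>UNIV. if h = el_of t then v (i, el_of t) else 0 else 0)"
    by (rule sum.cong) auto
  also have "\<dots> = (if l < m then \<Sum>t\<in>UNIV. if h = el_of t then v (l, h) else 0 else 0)"
    by (simp add: sum.delta cong: if_cong)
  also have "\<dots> = v p"
  proof (cases "h \<in> carrier G")
    case True
    then obtain w where "h = el_of w" by (rule el_cases)
    then show ?thesis using v by (auto simp: p F_carr)
  next
    case False
    then have "h \<noteq> el_of t" for t by auto
    then show ?thesis using False v by (auto simp: p F_carr)
  qed
  finally show "hop (hid m) v p = v p" .
qed

lemma hop_carr: "list_all (\<lambda>((i, t), (l, t')). l < m) ls \<Longrightarrow> hop ls f \<in> Mcarr (F m)"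
proof (induction ls)
  case (Cons x ls)
  have "hel x f \<in> Mcarr (F m)"
    using Cons.prems by (cases x) (auto simp: F_carr hel_def split: if_splits)
  moreover have "hop ls f \<in> Mcarr (F m)" using Cons by simp
  ultimately show ?case unfolding hop_simps by (rule module_add[OF F_module])
next
  case Nil
  show ?case unfolding hop_simps by (rule module_zero[OF F_module])
qed

lemma ix_pred: "ix (j - 1) = (ix j + 7) mod 8" and ix_succ: "ix (j + 1) = (ix j + 1) mod 8"
  using ix_add[of j "-1"] ix_add[of j 1] by simp_all

lemma contraction:
  assumes v: "v \<in> Mcarr (Eob j)"
  shows "v = lop (famD ! ix j) (hop (contr (ix j)) v) + hop (contr (ix (j - 1))) (lop (famD ! ix (j - 1)) v)"
    and "hop (contr (ix j)) v \<in> Mcarr (Eob (j + 1))"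
proof -
  have ix: "ix j \<in> set [0..<8]" using ix_less[of j] by simp
  have "hop (reduce (hcomp (contr (ix j)) (expand (famD ! ix j)) @
     hcomp (expand (famD ! ix (j - 1))) (contr (ix (j - 1))) @ hid (rk (ix j)))) v = 0"
    using contraction_check[rule_format, OF ix] by (simp add: ix_pred)
  then have "hop (hcomp (contr (ix j)) (expand (famD ! ix j)) @
     hcomp (expand (famD ! ix (j - 1))) (contr (ix (j - 1))) @ hid (rk (ix j))) v = 0"
    unfolding hop_def using sum_list_reduce[of "\<lambda>x. hel x v"] by simp
  then have "lop (famD ! ix j) (hop (contr (ix j)) v) + (hop (contr (ix (j - 1))) (lop (famD ! ix (j - 1)) v) + v) = 0"
    using v by (simp add: hop_comp hop_expand hop_hid Eob_def)
  then show "v = lop (famD ! ix j) (hop (contr (ix j)) v) + hop (contr (ix (j - 1))) (lop (famD ! ix (j - 1)) v)"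
    by (rule add2f_move)
  show "hop (contr (ix j)) v \<in> Mcarr (Eob (j + 1))"
    unfolding Eob_def ix_succ by (rule hop_carr) (use contraction_ok[rule_format, OF ix] in simp)
qed

lemma famD_ok: "fam_ok (ix 1) famD" "length famD = 8"
  using famD_check(1) fam_okD(1)[OF famD_check(1)] by simp_all

lemma lop_famD_famD: "lop (famD ! ix j) (lop (famD ! ix (j + 1)) u) = 0"
proof -
  have "reduce (fcomp 1 famD famD ! ix j) = []"
    using famD_check(2) famD_ok(2) by (simp add: fnull_def list_all_length)
  then have "lop (fcomp 1 famD famD ! ix j) u = 0" by (rule lop_null)
  then show ?thesis using famD_ok(2) by (simp add: fcomp_nth lop_comp ix_succ)
qed

lemma Eres_complete: "complete_resolution G Eres"
  unfolding complete_resolution_def Eres_simps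
proof (intro conjI allI)
  show "projective_module G (Eob j)" for j
    unfolding Eob_def by (rule projective_free) (rule group)
  show "fm 1 famD (j - 1) \<in> kG_hom G (Eob j) (Eob (j - 1))" for j
    using fm_hom[OF famD_ok(1), of "j - 1"] by simp
  show "fm 1 famD (j + 1 - 1) ` Mcarr (Eob (j + 1)) = {v \<in> Mcarr (Eob j). fm 1 famD (j - 1) v = 0}" for j
  proof (intro equalityI subsetI)
    fix v assume "v \<in> fm 1 famD (j + 1 - 1) ` Mcarr (Eob (j + 1))"
    then obtain u where "u \<in> Mcarr (Eob (j + 1))" "v = lop (famD ! ix j) u" by (auto simp: fm_def)
    then show "v \<in> {v \<in> Mcarr (Eob j). fm 1 famD (j - 1) v = 0}"
      using lop_Eob[OF famD_ok(1), of j u] lop_famD_famD[of "j - 1" u] by (simp add: fm_def)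
  next
    fix v assume "v \<in> {v \<in> Mcarr (Eob j). fm 1 famD (j - 1) v = 0}"
    then have v: "v \<in> Mcarr (Eob j)" "lop (famD ! ix (j - 1)) v = 0" by (auto simp: fm_def)
    then have "v = lop (famD ! ix j) (hop (contr (ix j)) v)"
      using contraction(1)[OF v(1)] by simp
    then show "v \<in> fm 1 famD (j + 1 - 1) ` Mcarr (Eob (j + 1))"
      using contraction(2)[OF v(1)] by (intro image_eqI[of _ _ "hop (contr (ix j)) v"]) (simp_all add: fm_def)
  qed
  show "(\<lambda>f. if f \<in> Mcarr (Eob 0) then augm 0 f else 0) \<in> kG_hom G (Eob 0) trivial_module"
  proof -
    have E: "Eob 0 = F 1" by (simp add: Eob_def)
    show ?thesis
      unfolding kG_hom_def trivial_module_def E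
      using module_add[OF F_module, of _ 1] module_scale[OF F_module, of _ 1] module_act[OF F_module, of _ _ 1]
      by (simp add: augm_add augm_act) (simp add: augm_def sum_distrib_left)
  qed
  show "(\<lambda>f. if f \<in> Mcarr (Eob 0) then augm 0 f else 0) ` Mcarr (Eob 0) = UNIV"
  proof -
    have "c \<in> (\<lambda>f. if f \<in> Mcarr (Eob 0) then augm 0 f else 0) ` Mcarr (Eob 0)" for c
    proof
      show in0: "(\<lambda>p. if p = (0, \<one>\<^bsub>G\<^esub>) then c else 0) \<in> Mcarr (Eob 0)"
        by (auto simp: Eob_def F_carr)
      have "augm 0 (\<lambda>p. if p = (0, \<one>\<^bsub>G\<^esub>) then c else 0) = c"
        using finite_G by (simp add: augm_def sum.delta)
      with in0 show "c = (if (\<lambda>p. if p = (0, \<one>\<^bsub>G\<^esub>) then c else 0) \<in> Mcarr (Eob 0)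
          then augm 0 (\<lambda>p. if p = (0, \<one>\<^bsub>G\<^esub>) then c else 0) else 0)" by simp
    qed
    then show ?thesis by blast
  qed
  show "(\<lambda>c (i, h). if i = 0 \<and> h \<in> carrier G then c else 0) \<in> kG_hom G trivial_module (Eob (-1))"
    by (auto simp: kG_hom_def trivial_module_def Eob_def F_carr fun_eq_iff)
  show "inj (\<lambda>c (i, h). if (i::nat) = 0 \<and> h \<in> carrier G then c else (0 :: 'k))"
  proof (rule injI)
    fix c c' assume "(\<lambda>(i, h). if (i::nat) = 0 \<and> h \<in> carrier G then c else (0 :: 'k)) =
      (\<lambda>(i, h). if i = 0 \<and> h \<in> carrier G then c' else 0)"
    from fun_cong[OF this, of "(0, \<one>\<^bsub>G\<^esub>)"] show "c = c'" by simp
  qed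
  show "\<forall>v\<in>Mcarr (Eob 0). fm 1 famD (0 - 1) v =
      (\<lambda>(i, h). if i = 0 \<and> h \<in> carrier G then if v \<in> Mcarr (Eob 0) then augm 0 v else 0 else 0)"
  proof
    fix v assume v: "v \<in> Mcarr (Eob 0)"
    \<comment> \<open>Multiplication by the norm element makes every coefficient equal to the sum of
      all coefficients of \<open>v\<close>. So this differential is the augmentation followed by the
      coaugmentation.\<close>
    have "lop (map (\<lambda>t. (0, 0, t)) [q1, qI, qz, qzI, qJ, qK, qzJ, qzK]) v (l, h) = (if l = 0 \<and> h \<in> carrier G then augm 0 v else 0)" for l h
    proof (cases "l = 0 \<and> h \<in> carrier G")
      case True
      have set: "distinct [q1, qI, qz, qzI, qJ, qK, qzJ, qzK]" "set [q1, qI, qz, qzI, qJ, qK, qzJ, qzK] = (UNIV :: q8 set)"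
        by auto
      have "lop (map (\<lambda>t. (0, 0, t)) [q1, qI, qz, qzI, qJ, qK, qzJ, qzK]) v (l, h) =
          (\<Sum>t\<leftarrow>[q1, qI, qz, qzI, qJ, qK, qzJ, qzK]. v (0, h \<otimes>\<^bsub>G\<^esub> inv\<^bsub>G\<^esub> el_of t))"
        unfolding lop_def sum_list_fun_apply using True by (simp add: el_def o_def)
      also have "\<dots> = (\<Sum>t\<in>UNIV. v (0, h \<otimes>\<^bsub>G\<^esub> inv\<^bsub>G\<^esub> el_of t))"
        using sum_list_distinct_conv_sum_set[OF set(1)] set(2) by metis
      also have "\<dots> = (\<Sum>g\<in>carrier G. v (0, h \<otimes>\<^bsub>G\<^esub> inv\<^bsub>G\<^esub> g))"
        by (rule sum.reindex_bij_betw[OF el_bij, of "\<lambda>g. v (0, h \<otimes>\<^bsub>G\<^esub> inv\<^bsub>G\<^esub> g)"])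
      also have "\<dots> = (\<Sum>g\<in>carrier G. v (0, g))"
        by (rule sum.reindex_bij_witness[of _ "\<lambda>g. inv\<^bsub>G\<^esub> g \<otimes>\<^bsub>G\<^esub> h" "\<lambda>g. h \<otimes>\<^bsub>G\<^esub> inv\<^bsub>G\<^esub> g"])
          (use True in \<open>auto simp: inv_mult_group m_assoc[symmetric]\<close>, simp add: m_assoc)
      finally show ?thesis using True by (simp add: augm_def)
    next
      case False
      then show ?thesis by (auto simp: el_def)
    qed
    then show "fm 1 famD (0 - 1) v =
      (\<lambda>(i, h). if i = 0 \<and> h \<in> carrier G then if v \<in> Mcarr (Eob 0) then augm 0 v else 0 else 0)"
      using v by (auto simp: fun_eq_iff fm_def famD_check(3) simp del: list.map)
  qed
qed

sublocale E: char2_res G Eres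
  by unfold_locales (rule finite_G, rule char, rule Eres_complete)

end

section \<open>Comparison of two complete resolutions\<close>

text \<open>The two chain maps are only required to respect the augmentations. That they are inverse
  to each other up to homotopy is a consequence, see \<open>\<gamma>_homot\<close>, which after
  exchanging the roles also covers the other composite.\<close>

locale res_pair = p: char2_res G P + r: char2_res G R
  for G :: "'g monoid" and P :: "('g, 'k::field, 'v::ab_group_add) complete_res"
    and R :: "('g, 'k, 'w::ab_group_add) complete_res" +
  fixes \<alpha> :: "int \<Rightarrow> 'v \<Rightarrow> 'w" and \<beta> :: "int \<Rightarrow> 'w \<Rightarrow> 'v"
  assumes \<alpha>: "\<alpha> j \<in> kG_hom G (Pobj P j) (Pobj R j)" "Pbd R (j + 1) (\<alpha> (j + 1) v) = \<alpha> j (Pbd P (j + 1) v)"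
      "Paug R (\<alpha> 0 v) = Paug P v"
    and \<beta>: "\<beta> j \<in> kG_hom G (Pobj R j) (Pobj P j)" "Pbd P (j + 1) (\<beta> (j + 1) w) = \<beta> j (Pbd R (j + 1) w)"
      "Paug P (\<beta> 0 w) = Paug R w"
begin

lemma swap: "res_pair G R P \<beta> \<alpha>"
  by unfold_locales (rule \<alpha> \<beta>)+

lemma \<alpha>_mem [simp]: "v \<in> Mcarr (Pobj P j) \<Longrightarrow> \<alpha> j v \<in> Mcarr (Pobj R j)"
  and \<beta>_mem [simp]: "w \<in> Mcarr (Pobj R j) \<Longrightarrow> \<beta> j w \<in> Mcarr (Pobj P j)"
  using hom_mem[OF \<alpha>(1)] hom_mem[OF \<beta>(1)] by auto

definition \<Phi> :: "int \<Rightarrow> (int \<Rightarrow> 'w \<Rightarrow> 'w) \<Rightarrow> int \<Rightarrow> 'v \<Rightarrow> 'v" where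
  "\<Phi> n f = (\<lambda>j. \<beta> j \<circ> f j \<circ> \<alpha> (j + n))"

definition \<gamma> :: "int \<Rightarrow> 'w \<Rightarrow> 'w" where
  "\<gamma> = (\<lambda>j. \<alpha> j \<circ> \<beta> j)"

definition tot\<alpha> :: "(int \<Rightarrow> 'v) \<Rightarrow> int \<Rightarrow> 'w" where
  "tot\<alpha> u = (\<lambda>j. \<alpha> j (p.pr j (u j)))"

definition tot\<beta> :: "(int \<Rightarrow> 'w) \<Rightarrow> int \<Rightarrow> 'v" where
  "tot\<beta> u = (\<lambda>j. \<beta> j (r.pr j (u j)))"

lemma tot_add: "tot\<alpha> (u + v) = tot\<alpha> u + tot\<alpha> v" "tot\<beta> (w + w') = tot\<beta> w + tot\<beta> w'"
  by (simp_all add: fun_eq_iff tot\<alpha>_def tot\<beta>_def p.pr_add r.pr_add hom_add[OF \<alpha>(1)] hom_add[OF \<beta>(1)])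

definition tr :: "(int \<Rightarrow> 'w) aend \<Rightarrow> (int \<Rightarrow> 'v) aend" where
  "tr X = Aend (\<lambda>u. tot\<beta> (app X (tot\<alpha> u)))"

lemma app_tr: "app (tr X) u = tot\<beta> (app X (tot\<alpha> u))"
  unfolding tr_def by (subst Aend_inverse) (simp_all add: tot_add app_add)

lemma \<Phi>_A:
  assumes f: "f \<in> r.A n" shows "\<Phi> n f \<in> p.A n"
proof -
  have "\<beta> j \<circ> (f j \<circ> \<alpha> (j + n)) \<in> kG_hom G (Pobj P (j + n)) (Pobj P j)" for j
    by (rule hom_comp[OF p.mP hom_comp[OF r.mP \<alpha>(1) r.A_hom[OF f] r.mP] \<beta>(1) r.mP])
  then show ?thesis by (simp add: endo_cochains_def \<Phi>_def comp_assoc)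
qed

lemma \<gamma>_A: "\<gamma> \<in> r.A 0"
proof -
  have "\<alpha> j \<circ> \<beta> j \<in> kG_hom G (Pobj R j) (Pobj R j)" for j
    by (rule hom_comp[OF r.mP \<beta>(1) \<alpha>(1) p.mP])
  then show ?thesis by (simp add: endo_cochains_def \<gamma>_def)
qed

lemma em_\<Phi>: "f \<in> r.A n \<Longrightarrow> p.em n (\<Phi> n f) = tr (r.em n f)"
proof (intro aend_eqI ext)
  fix u j assume f: "f \<in> r.A n"
  have "f j (\<alpha> (j + n) (p.pr (j + n) (u (j + n)))) \<in> Mcarr (Pobj R j)"
    by (rule r.A_mem[OF f]) simp
  then show "app (p.em n (\<Phi> n f)) u j = app (tr (r.em n f)) u j"
    by (simp add: p.app_em[OF \<Phi>_A[OF f]] app_tr tot\<beta>_def r.app_em[OF f] tot\<alpha>_def) (simp add: \<Phi>_def)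
qed

lemma tot\<alpha>_tot\<beta>: "tot\<alpha> (tot\<beta> w) = app (r.em 0 \<gamma>) w"
  by (simp add: fun_eq_iff tot\<alpha>_def tot\<beta>_def r.app_em[OF \<gamma>_A]) (simp add: \<gamma>_def)

text \<open>Transport is not multiplicative: between the factors appears \<open>\<gamma>\<close>,
  which is only homotopic to the identity. The homotopy has to be built into the second choice
  \<open>f_2\<close>.\<close>

lemma tr_mult: "tr X * tr Y = tr (X * r.em 0 \<gamma> * Y)"
  by (intro aend_eqI) (simp add: app_tr tot\<alpha>_tot\<beta>)

lemma tr_plus: "tr (X + Y) = tr X + tr Y"
  by (intro aend_eqI) (simp add: app_tr tot_add)

lemma tr_zero: "tr 0 = 0"
  using tr_plus[of 0 0] by simp

lemma app_D:
  "app p.D u j = Pbd P (j + 1) (p.pr (j + 1) (u (j + 1)))" "app r.D w j = Pbd R (j + 1) (r.pr (j + 1) (w (j + 1)))"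
  by (simp_all add: p.D_def r.D_def p.app_em[OF p.bd_A] r.app_em[OF r.bd_A])

lemma tr_D: "p.D * tr X = tr (r.D * X)" "tr X * p.D = tr (X * r.D)"
proof -
  have bm: "Pbd P (j + 1) v \<in> Mcarr (Pobj P j)" if "v \<in> Mcarr (Pobj P (j + 1))" for v j
    using hom_mem[OF res_bd'[OF p.P] that] .
  have bm': "Pbd R (j + 1) v \<in> Mcarr (Pobj R j)" if "v \<in> Mcarr (Pobj R (j + 1))" for v j
    using hom_mem[OF res_bd'[OF r.P] that] .
  have b: "app p.D (tot\<beta> w) = tot\<beta> (app r.D w)" for w
    by (simp add: fun_eq_iff app_D tot\<beta>_def \<beta>(2) bm')
  have a: "tot\<alpha> (app p.D u) = app r.D (tot\<alpha> u)" for u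
    by (simp add: fun_eq_iff app_D tot\<alpha>_def \<alpha>(2) bm)
  show "p.D * tr X = tr (r.D * X)" "tr X * p.D = tr (X * r.D)"
    by (intro aend_eqI, simp add: app_tr a b)+
qed

lemma tr_sc: "p.sc c * tr X = tr (r.sc c * X)"
proof -
  have "app (p.sc c) (tot\<beta> w) = tot\<beta> (app (r.sc c) w)" for w
    by (simp add: fun_eq_iff p.app_sc r.app_sc tot\<beta>_def r.pr_scale hom_scale[OF \<beta>(1)])
  then show ?thesis
    by (intro aend_eqI) (simp add: app_tr)
qed

lemma \<Phi>_Z: "f \<in> r.Z n \<Longrightarrow> \<Phi> n f \<in> p.Z n"
  by (simp add: p.Z_iff r.Z_iff \<Phi>_A em_\<Phi> tr_D)

lemma \<Phi>_plus: "f \<in> r.A n \<Longrightarrow> g \<in> r.A n \<Longrightarrow> \<Phi> n (f + g) = \<Phi> n f + \<Phi> n g"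
  by (rule p.em_inj[of _ n]) (simp_all add: p.A_plus r.A_plus \<Phi>_A em_\<Phi> p.em_plus r.em_plus tr_plus)

lemma \<Phi>_scale: "f \<in> r.A n \<Longrightarrow> \<Phi> n (endo_scale R c f) = endo_scale P c (\<Phi> n f)"
  by (rule p.em_inj[of _ n]) (simp_all add: p.A_scale r.A_scale \<Phi>_A em_\<Phi> p.em_scale r.em_scale tr_sc)

lemma \<Phi>_homot: "r.homot n f g \<Longrightarrow> f \<in> r.A n \<Longrightarrow> g \<in> r.A n \<Longrightarrow> p.homot n (\<Phi> n f) (\<Phi> n g)"
proof -
  assume "r.homot n f g" and fg: "f \<in> r.A n" "g \<in> r.A n"
  then obtain h where h: "h \<in> r.A (n - 1)" "r.em n f + r.em n g = r.D * r.em (n - 1) h + r.em (n - 1) h * r.D"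
    unfolding r.homot_def by blast
  have "p.em n (\<Phi> n f) + p.em n (\<Phi> n g) = p.D * p.em (n - 1) (\<Phi> (n - 1) h) + p.em (n - 1) (\<Phi> (n - 1) h) * p.D"
    using h fg by (simp add: em_\<Phi> tr_D flip: tr_plus)
  then show ?thesis unfolding p.homot_def using \<Phi>_A[OF h(1)] by blast
qed

lemma Paug_\<Phi>: "Paug P (\<Phi> n f 0 v) = Paug R (f 0 (\<alpha> n v))"
  by (simp add: \<Phi>_def \<beta>(3))

lemma \<gamma>_Z: "\<gamma> \<in> r.Z 0"
  unfolding r.Z_iff
proof (intro conjI \<gamma>_A aend_eqI ext)
  fix u j
  have bm: "Pbd R (j + 1) v \<in> Mcarr (Pobj R j)" if "v \<in> Mcarr (Pobj R (j + 1))" for v j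
    using hom_mem[OF res_bd'[OF r.P] that] .
  show "app (r.D * r.em 0 \<gamma>) u j = app (r.em 0 \<gamma> * r.D) u j"
    by (simp add: app_D r.app_em[OF \<gamma>_A] r.A_mem[OF \<gamma>_A]) (simp add: \<gamma>_def \<alpha>(2) \<beta>(2) bm)
qed

text \<open>Chain maps are determined up to homotopy by their augmented component in degree 0, and
  \<open>\<gamma>\<close> preserves the augmentation.\<close>

lemma \<gamma>_homot: "r.homot 0 \<gamma> r.idc"
proof -
  have "Paug R \<circ> \<gamma> 0 = Paug R \<circ> r.idc 0"
    using hom_out[OF res_aug[OF r.P]] by (auto simp: fun_eq_iff \<gamma>_def \<alpha>(3) \<beta>(3) r.idc_def res_aug_zero[OF r.P])
  then have "r.tcl 0 \<gamma> = r.tcl 0 r.idc" by (simp add: r.tcl_def)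
  then show ?thesis using r.tcl_eq_iff[OF \<gamma>_Z r.idc_Z] by simp
qed

lemma \<gamma>_homotopy:
  obtains h where "h \<in> r.A (-1)" "r.em 0 \<gamma> = r.em 0 r.idc + r.D * r.em (-1) h + r.em (-1) h * r.D"
  using r.homotD[OF \<gamma>_homot] by auto

text \<open>Transporting to \<open>R\<close> and back composes \<open>f\<close> on both sides with
  \<open>s.\<gamma>\<close>, which is homotopic to the identity. So every class of \<open>P\<close>
  is a transported one.\<close>

lemma \<Phi>_\<Psi>_homot:
  assumes f: "f \<in> p.Z n"
  shows "\<exists>g\<in>r.Z n. p.homot n (\<Phi> n g) f"
proof -
  interpret s: res_pair G R P \<beta> \<alpha> by (rule swap)
  have 1: "s.\<Phi> n f \<in> r.Z n" using s.\<Phi>_Z[OF f] .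
  have 2: "\<Phi> n (s.\<Phi> n f) = endo_comp 0 s.\<gamma> (endo_comp n f s.\<gamma>)"
    by (simp add: \<Phi>_def s.\<Phi>_def s.\<gamma>_def endo_comp_def fun_eq_iff)
  have f1: "endo_comp n f s.\<gamma> \<in> p.Z n" using p.Z_comp[OF f s.\<gamma>_Z] by simp
  have f2: "p.homot n (endo_comp n f s.\<gamma>) f"
    using p.homot_comp[OF p.homot_refl s.\<gamma>_homot f f s.\<gamma>_Z p.idc_Z] p.idc_comp[OF p.Z_A[OF f]] by simp
  have "p.homot n (\<Phi> n (s.\<Phi> n f)) f"
    using p.homot_comp[OF s.\<gamma>_homot f2 s.\<gamma>_Z p.idc_Z f1 f] p.idc_comp[OF p.Z_A[OF f]] 2 by simp
  then show ?thesis using 1 by blast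
qed

lemma \<Phi>_homot_iff:
  assumes f: "f \<in> r.Z n" "g \<in> r.Z n"
  shows "p.homot n (\<Phi> n f) (\<Phi> n g) \<longleftrightarrow> r.homot n f g"
proof
  interpret s: res_pair G R P \<beta> \<alpha> by (rule swap)
  assume "p.homot n (\<Phi> n f) (\<Phi> n g)"
  then have "r.homot n (s.\<Phi> n (\<Phi> n f)) (s.\<Phi> n (\<Phi> n g))"
    using s.\<Phi>_homot[OF _ p.Z_A p.Z_A] \<Phi>_Z f by blast
  then have eq: "r.tcl n (s.\<Phi> n (\<Phi> n f)) = r.tcl n (s.\<Phi> n (\<Phi> n g))"
    using r.tcl_eq_iff s.\<Phi>_Z \<Phi>_Z f by blast
  have *: "r.tcl n (s.\<Phi> n (\<Phi> n u)) = r.tcl n u" if u: "u \<in> r.Z n" for u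
  proof -
    have c: "s.\<Phi> n (\<Phi> n u) = endo_comp 0 \<gamma> (endo_comp n u \<gamma>)"
      by (simp add: \<Phi>_def s.\<Phi>_def \<gamma>_def endo_comp_def fun_eq_iff)
    have u1: "endo_comp n u \<gamma> \<in> r.Z n" using r.Z_comp[OF u \<gamma>_Z] by simp
    have u2: "r.homot n (endo_comp n u \<gamma>) u"
      using r.homot_comp[OF r.homot_refl \<gamma>_homot u u \<gamma>_Z r.idc_Z] r.idc_comp[OF r.Z_A[OF u]] by simp
    have "r.homot n (endo_comp 0 \<gamma> (endo_comp n u \<gamma>)) u"
      using r.homot_comp[OF \<gamma>_homot u2 \<gamma>_Z r.idc_Z u1 u] r.idc_comp[OF r.Z_A[OF u]] by simp
    then show ?thesis using c r.tcl_eq_iff u s.\<Phi>_Z \<Phi>_Z by metis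
  qed
  show "r.homot n f g" using eq * r.tcl_eq_iff f by metis
next
  assume "r.homot n f g"
  then show "p.homot n (\<Phi> n f) (\<Phi> n g)" using \<Phi>_homot r.Z_A f by blast
qed

end

text \<open>Lifting the augmentation of \<open>R\<close> gives a map backwards. The forward map is
  arbitrary, so that the comparison map of the theorem can take its place.\<close>

lemma res_pair_inverse:
  fixes P :: "('g, 'k::field, 'v::ab_group_add) complete_res" and R :: "('g, 'k, 'w::ab_group_add) complete_res"
  assumes "char2_res G P" "char2_res G R"
    and \<alpha>: "\<And>j. \<alpha> j \<in> kG_hom G (Pobj P j) (Pobj R j)" "\<And>j v. Pbd R (j + 1) (\<alpha> (j + 1) v) = \<alpha> j (Pbd P (j + 1) v)"
      "\<And>v. Paug R (\<alpha> 0 v) = Paug P v"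
  shows "\<exists>\<beta>. res_pair G P R \<alpha> \<beta>"
proof -
  interpret p: char2_res G P by fact
  interpret r: char2_res G R by fact
  obtain \<beta> where \<beta>: "\<And>j. \<beta> j \<in> kG_hom G (Pobj R (j + 0)) (Pobj P j)"
      "\<And>j v. Pbd P (j + 1) (\<beta> (j + 1) v) = \<beta> j (Pbd R (j + 0 + 1) v)" "\<And>v. Paug P (\<beta> 0 v) = Paug R v"
    by (rule chain_map_lifting[OF p.fin p.char r.P p.P res_aug[OF r.P]]) (use res_aug_bd[OF r.P] in simp, blast)
  have "res_pair G P R \<alpha> \<beta>"
    by unfold_locales (use \<alpha> \<beta> in simp_all)
  then show ?thesis by (rule exI[of _ \<beta>])
qed

lemma res_pair_exists:
  fixes P :: "('g, 'k::field, 'v::ab_group_add) complete_res" and R :: "('g, 'k, 'w::ab_group_add) complete_res"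
  assumes P: "char2_res G P" and R: "char2_res G R"
  obtains \<alpha> \<beta> where "res_pair G P R \<alpha> \<beta>"
proof -
  interpret p: char2_res G P by fact
  interpret r: char2_res G R by fact
  obtain \<alpha> where \<alpha>: "\<And>j. \<alpha> j \<in> kG_hom G (Pobj P (j + 0)) (Pobj R j)"
      "\<And>j v. Pbd R (j + 1) (\<alpha> (j + 1) v) = \<alpha> j (Pbd P (j + 0 + 1) v)" "\<And>v. Paug R (\<alpha> 0 v) = Paug P v"
    by (rule chain_map_lifting[OF p.fin p.char p.P r.P res_aug[OF p.P]]) (use res_aug_bd[OF p.P] in simp, blast)
  then have "\<exists>\<beta>. res_pair G P R \<alpha> \<beta>"
    by (intro res_pair_inverse P R) simp_all
  then obtain \<beta> where "res_pair G P R \<alpha> \<beta>" by (rule exE)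
  then show thesis by (rule that)
qed

context char2_res
begin

lemma A_sum: "(\<And>i. i \<in> S \<Longrightarrow> f i \<in> A n) \<Longrightarrow> (\<Sum>i\<in>S. f i) \<in> A n"
  by (induction S rule: infinite_finite_induct) (simp_all only: sum.infinite sum.empty sum.insert A_zero A_plus insert_iff simp_thms)

lemma em_sum: "(\<And>i. i \<in> S \<Longrightarrow> f i \<in> A n) \<Longrightarrow> em n (\<Sum>i\<in>S. f i) = (\<Sum>i\<in>S. em n (f i))"
  by (induction S rule: infinite_finite_induct)
    (simp_all only: sum.infinite sum.empty sum.insert em_zero em_plus A_sum insert_iff simp_thms)

lemma Z_sum: "(\<And>i. i \<in> S \<Longrightarrow> f i \<in> Z n) \<Longrightarrow> (\<Sum>i\<in>S. f i) \<in> Z n"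
  by (induction S rule: infinite_finite_induct) (simp_all only: sum.infinite sum.empty sum.insert Z_zero Z_plus insert_iff simp_thms)

lemma sc_sum: "sc (\<Sum>i\<in>S. c i) = (\<Sum>i\<in>S. sc (c i))"
  by (induction S rule: infinite_finite_induct) (simp_all add: sc_zero sc_add)

end

section \<open>Cohomology of the quaternion group\<close>

text \<open>Families are stored with period eight for the sake of the homotopies, but ranks,
  differentials and representatives have period four. So a check for the degree \<open>m\<close>
  also covers \<open>m + 4\<close>.\<close>

lemma rk_rot: "\<forall>m\<in>set [0..<8]. rot ((m + 4) mod 8) (map rk [0..<8]) = rot m (map rk [0..<8])"
  by code_simp

lemma famD_rot: "\<forall>m\<in>set [0..<8]. rot ((m + 4) mod 8) famD = rot m famD"
  by code_simp

lemma fam1_rot: "\<forall>l\<in>set [0..<6]. \<forall>m\<in>set [0..<8]. rot ((m + 4) mod 8) (fam1 ! l) = rot m (fam1 ! l)"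
  by code_simp

lemma ptab_distinct: "\<forall>a\<in>set [0..<6]. \<forall>b\<in>set [0..<6]. distinct (ptab a b)"
  by code_simp

lemma mtab_distinct: "\<forall>p\<in>set [False, True]. \<forall>a\<in>set [0..<6]. \<forall>b\<in>set [0..<6]. \<forall>c\<in>set [0..<6]. distinct (mtab p a b c)"
  by code_simp

lemma in_6: "l < 6 \<Longrightarrow> l \<in> set [0..<6]"
  by simp

lemma mod_8_shift:
  "(x :: nat) = d \<or> x = (d + 4) mod 8 \<Longrightarrow> y = d' \<or> y = (d' + 4) mod 8 \<Longrightarrow>
    (x + y + 7) mod 8 = (d + d' + 7) mod 8 \<or> (x + y + 7) mod 8 = ((d + d' + 7) mod 8 + 4) mod 8"
proof (elim disjE)
  assume x: "x = d" "y = (d' + 4) mod 8"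
  have "(d + 7 + (d' + 4) mod 8) mod 8 = (d + 7 + (d' + 4)) mod 8"
    by (rule mod_add_cong[OF refl]) simp
  moreover have "((d + d' + 7) mod 8 + 4) mod 8 = (d + d' + 7 + 4) mod 8"
    by (rule mod_add_cong[OF _ refl]) simp
  ultimately show ?thesis unfolding x by (intro disjI2) (simp add: ac_simps)
next
  assume x: "x = (d + 4) mod 8" "y = d'"
  have "((d + 4) mod 8 + (d' + 7)) mod 8 = (d + 4 + (d' + 7)) mod 8"
    by (rule mod_add_cong[OF _ refl]) simp
  moreover have "((d + d' + 7) mod 8 + 4) mod 8 = (d + d' + 7 + 4) mod 8"
    by (rule mod_add_cong[OF _ refl]) simp
  ultimately show ?thesis unfolding x by (intro disjI2) (simp add: ac_simps)
next
  assume x: "x = (d + 4) mod 8" "y = (d' + 4) mod 8"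
  have "((d + 4) mod 8 + (d' + 4) mod 8 + 7) mod 8 = (d + 4 + (d' + 4) + 7) mod 8"
    by (intro mod_add_cong refl) simp_all
  also have "\<dots> = (d + d' + 7 + 8) mod 8" by (simp add: ac_simps)
  also have "\<dots> = (d + d' + 7) mod 8" by (rule mod_add_self2)
  finally show ?thesis unfolding x ..
qed simp

text \<open>The indices of those basis elements that some power of \<open>s\<close> moves into
  degree \<open>n\<close>.\<close>

definition L :: "int \<Rightarrow> nat set" where
  "L n = {l. l < 6 \<and> int (bdeg l) = n mod 4}"

lemma bdeg_simps [simp]: "bdeg 0 = 0" "bdeg (Suc 0) = 1" "bdeg 2 = 1" "bdeg 3 = 2" "bdeg 4 = 2" "bdeg 5 = 3"
  by (simp_all add: bdeg_def)

lemma less_6: "l < 6 \<longleftrightarrow> l \<in> {0, 1, 2, 3, 4, 5 :: nat}"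
  by auto

lemma L_finite [simp]: "finite (L n)" and L_less: "l \<in> L n \<Longrightarrow> l < 6" and L_bdeg: "l \<in> L n \<Longrightarrow> int (bdeg l) = n mod 4"
  by (simp_all add: L_def)

lemma bdeg_L: "l < 6 \<Longrightarrow> l \<in> L (4 * i + int (bdeg l))"
  by (auto simp: L_def less_6)

lemma L_eq: "n mod 4 = 0 \<Longrightarrow> L n = {0}" "n mod 4 = 1 \<Longrightarrow> L n = {1, 2}" "n mod 4 = 2 \<Longrightarrow> L n = {3, 4}"
    "n mod 4 = 3 \<Longrightarrow> L n = {5}"
  by (auto simp: L_def less_6)

lemma L_ptab: "l \<in> L n \<Longrightarrow> l' \<in> L n' \<Longrightarrow> m \<in> set (ptab l l') \<Longrightarrow> m \<in> L (n + n')"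
proof -
  assume l: "l \<in> L n" "l' \<in> L n'" and m: "m \<in> set (ptab l l')"
  have "m < 6" "bdeg m = bdeg l + bdeg l'"
    using ptab_deg[rule_format, OF in_6 in_6 m] l L_less by auto
  moreover have "bdeg m < 4" using \<open>m < 6\<close> by (auto simp: less_6)
  moreover have "(n + n') mod 4 = (n mod 4 + n' mod 4) mod 4"
    by (intro mod_diff_cong mod_add_cong refl) simp_all
  ultimately show ?thesis
    using L_bdeg[OF l(1)] L_bdeg[OF l(2)] by (simp add: L_def)
qed

lemma L_mtab: "a \<in> L n \<Longrightarrow> b \<in> L n' \<Longrightarrow> c \<in> L n'' \<Longrightarrow> l \<in> set (mtab p a b c) \<Longrightarrow> l \<in> L (n + n' + n'' - 1)"
proof -
  assume l: "a \<in> L n" "b \<in> L n'" "c \<in> L n''" and m: "l \<in> set (mtab p a b c)"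
  have "l < 6" "bdeg l + 1 = bdeg a + bdeg b + bdeg c"
    using mtab_deg[rule_format, OF _ in_6 in_6 in_6 m] l L_less by auto
  moreover have "bdeg l < 4" using \<open>l < 6\<close> by (auto simp: less_6)
  moreover have "(n + n' + n'' - 1) mod 4 = (n mod 4 + n' mod 4 + n'' mod 4 - 1) mod 4"
    by (intro mod_diff_cong mod_add_cong refl) simp_all
  ultimately show ?thesis
    using L_bdeg[OF l(1)] L_bdeg[OF l(2)] L_bdeg[OF l(3)] by (simp add: L_def)
qed

definition unit_at :: "nat \<Rightarrow> nat \<Rightarrow> 'k::zero_neq_one" where
  "unit_at a = (\<lambda>l. if l = a then 1 else 0)"

context quat
begin

lemma ix_L: "l \<in> L n \<Longrightarrow> ix n = bdeg l \<or> ix n = (bdeg l + 4) mod 8"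
proof -
  assume l: "l \<in> L n"
  have "bdeg l < 4" using L_less[OF l] by (auto simp: less_6)
  moreover have "n mod 8 = int (bdeg l) \<or> n mod 8 = int (bdeg l) + 4"
    using L_bdeg[OF l] by presburger
  ultimately show ?thesis by (auto simp: ix_def)
qed

lemma bdeg_less: "l \<in> L n \<Longrightarrow> bdeg l < 4"
  by (auto simp: L_def less_6)

lemma ix_L2: "l \<in> L n \<Longrightarrow> l' \<in> L n' \<Longrightarrow>
    ix (n + n' - 1) = (bdeg l + bdeg l' + 7) mod 8 \<or> ix (n + n' - 1) = ((bdeg l + bdeg l' + 7) mod 8 + 4) mod 8"
proof -
  assume l: "l \<in> L n" "l' \<in> L n'"
  have "ix (n + n' - 1) = (ix n + ix n' + 7) mod 8"
    using ix_add[of "n + n'" "-1"] ix_add[of n n'] by (simp add: mod_add_left_eq)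
  then show ?thesis using mod_8_shift[OF ix_L[OF l(1)] ix_L[OF l(2)]] by simp
qed

lemma fam_ok_shift: "m < 8 \<Longrightarrow> fam_ok ((m + 4) mod 8) d \<longleftrightarrow> fam_ok m d"
  using rk_rot by (simp add: fam_ok_def)

lemma fcomp_shift: "rot ((m + 4) mod 8) g = rot m g \<Longrightarrow> fcomp ((m + 4) mod 8) f g = fcomp m f g"
  by (simp add: fcomp_def)

lemma fdiff_shift: "m < 8 \<Longrightarrow> fdiff ((m + 4) mod 8) f = fdiff m f"
  using famD_rot by (simp add: fdiff_def fcomp_def)

text \<open>One list serves all powers of \<open>s\<close>: for \<open>l\<close> in
  \<open>L n\<close> this is the representative of the basis element \<open>l\<close> times the
  power of the shift that brings it into degree \<open>n\<close>.\<close>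

definition W :: "nat \<Rightarrow> int \<Rightarrow> int \<Rightarrow> (nat \<times> 'g \<Rightarrow> 'k) \<Rightarrow> nat \<times> 'g \<Rightarrow> 'k" where
  "W l n = fm n (fam1 ! l)"

definition V :: "nat \<Rightarrow> nat \<Rightarrow> int \<Rightarrow> int \<Rightarrow> (nat \<times> 'g \<Rightarrow> 'k) \<Rightarrow> nat \<times> 'g \<Rightarrow> 'k" where
  "V l l' m = fm m (fam2 ! l ! l')"

lemma W_ok: "l \<in> L n \<Longrightarrow> fam_ok (ix n) (fam1 ! l)"
proof -
  assume l: "l \<in> L n"
  have "fam_ok (bdeg l) (fam1 ! l)" using fam1_check L_less[OF l] by simp
  then show ?thesis using ix_L[OF l] fam_ok_shift[of "bdeg l"] bdeg_less[OF l] by auto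
qed

lemma V_ok: "l \<in> L n \<Longrightarrow> l' \<in> L n' \<Longrightarrow> fam_ok (ix (n + n' - 1)) (fam2 ! l ! l')"
proof -
  assume l: "l \<in> L n" "l' \<in> L n'"
  have "fam_ok ((bdeg l + bdeg l' + 7) mod 8) (fam2 ! l ! l')"
    using fam2_ok L_less[OF l(1)] L_less[OF l(2)] by simp
  then show ?thesis using ix_L2[OF l] fam_ok_shift[of "(bdeg l + bdeg l' + 7) mod 8"] by auto
qed

lemma fm_A: "fam_ok (ix n) d \<Longrightarrow> fm n d \<in> E.A n"
  using fm_hom by (simp add: endo_cochains_def)

lemma W_A: "l \<in> L n \<Longrightarrow> W l n \<in> E.A n" and V_A: "l \<in> L n \<Longrightarrow> l' \<in> L n' \<Longrightarrow> V l l' (n + n' - 1) \<in> E.A (n + n' - 1)"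
  unfolding W_def V_def by (intro fm_A W_ok V_ok; assumption)+

lemma bd_fm: "(\<lambda>j. Pbd Eres (j + 1)) = fm 1 famD"
  by simp

lemma famD_length [simp]: "length famD = 8"
  by (rule famD_ok)

lemma fam_ok_length: "fam_ok m d \<Longrightarrow> length d = 8"
  by (simp add: fam_ok_def)

lemma fm_diff: "fam_ok (ix n) d \<Longrightarrow> endo_diff Eres n (fm n d) = fm (n + 1) (fdiff (ix n) d)"
proof -
  assume d: "fam_ok (ix n) d"
  then have l: "length d = 8" by (rule fam_ok_length)
  have "endo_diff Eres n (fm n d) = fm (1 + n) (fcomp (ix 1) famD d) + fm (n + 1) (fcomp (ix n) d famD)"
    unfolding E.endo_diff_comp bd_fm using fm_comp[OF d famD_length] fm_comp[OF famD_ok(1) l] by simp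
  also have "\<dots> = fm (n + 1) (fdiff (ix n) d)"
    using fm_add[of "fcomp 1 famD d" "fcomp (ix n) d famD" "n + 1"] l by (simp add: fdiff_def add.commute)
  finally show ?thesis .
qed

lemma W_Z: "l \<in> L n \<Longrightarrow> W l n \<in> E.Z n"
proof -
  assume l: "l \<in> L n"
  have "fdiff (ix n) (fam1 ! l) = fdiff (bdeg l) (fam1 ! l)"
    using ix_L[OF l] fdiff_shift[of "bdeg l"] bdeg_less[OF l] by auto
  then have "fnull (fdiff (ix n) (fam1 ! l))"
    using fam1_check L_less[OF l] by simp
  moreover have "length (fdiff (ix n) (fam1 ! l)) = 8"
    using fam_ok_length[OF W_ok[OF l]] by (simp add: fdiff_def)
  ultimately have "endo_diff Eres n (W l n) = 0"
    unfolding W_def fm_diff[OF W_ok[OF l]] using fm_null by blast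
  then show ?thesis using W_A[OF l] by (simp add: cocycles_def)
qed

lemma fsum_length: "set ls \<subseteq> {..<6} \<Longrightarrow> length (fsum ls) = 8"
proof (induction ls)
  case (Cons l ls)
  then have "length (fam1 ! l) = 8" using fam1_check by (simp add: fam_ok_def)
  then show ?case using Cons by (simp add: fsum_def)
qed (simp add: fsum_def fzero_def)

lemma fm_fsum:
  assumes "set ls \<subseteq> {..<6}" "distinct ls"
  shows "fm n (fsum ls) = (\<Sum>l\<in>set ls. W l n)"
  using assms
proof (induction ls)
  case (Cons l ls)
  have "length (fam1 ! l) = 8" using Cons.prems fam1_check by (simp add: fam_ok_def)
  then have "fm n (fsum (l # ls)) = W l n + fm n (fsum ls)"
    unfolding W_def using fm_add[of "fam1 ! l" "fsum ls" n] fsum_length[of ls] Cons.prems by (simp add: fsum_def)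
  then show ?case using Cons by simp
next
  case Nil
  have "fm n fzero = 0" by (rule fm_null) (simp_all add: fzero_def fnull_def list_all_iff)
  then show ?case by (simp add: fsum_def)
qed

text \<open>\<open>fam2_check\<close> treats the basis elements in their own degrees 0 to 3. Ranks,
  differentials and representatives depend on the degree modulo four, so the identity carries over
  to all multiples by powers of \<open>s\<close>.\<close>

lemma V_diff:
  assumes l: "l \<in> L n" "l' \<in> L n'"
  shows "E.D * E.em (n + n' - 1) (V l l' (n + n' - 1)) + E.em (n + n' - 1) (V l l' (n + n' - 1)) * E.D =
    E.em n (W l n) * E.em n' (W l' n') + (\<Sum>m\<in>set (ptab l l'). E.em (n + n') (W m (n + n')))"
proof -
  note ok = V_ok[OF l] W_ok[OF l(1)] W_ok[OF l(2)]
  note len = ok[THEN fam_ok_length]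
  define k where "k = (bdeg l + bdeg l' + 7) mod 8"
  have ls: "set (ptab l l') \<subseteq> {..<6}" "distinct (ptab l l')"
    using ptab_deg[rule_format, OF in_6 in_6] ptab_distinct[rule_format, OF in_6 in_6] L_less[OF l(1)] L_less[OF l(2)] by blast+
  have "fdiff (ix (n + n' - 1)) (fam2 ! l ! l') = fdiff k (fam2 ! l ! l')"
    using ix_L2[OF l] fdiff_shift[of k] by (auto simp: k_def)
  moreover have "fcomp (ix n) (fam1 ! l) (fam1 ! l') = fcomp (bdeg l) (fam1 ! l) (fam1 ! l')"
  proof -
    have "rot ((bdeg l + 4) mod 8) (fam1 ! l') = rot (bdeg l) (fam1 ! l')"
      using fam1_rot[rule_format, OF in_6[OF L_less[OF l(2)]], of "bdeg l"] bdeg_less[OF l(1)] by simp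
    from fcomp_shift[OF this] show ?thesis using ix_L[OF l(1)] by metis
  qed
  ultimately have null: "fnull (fadd (fdiff (ix (n + n' - 1)) (fam2 ! l ! l'))
      (fadd (fsum (ptab l l')) (fcomp (ix n) (fam1 ! l) (fam1 ! l'))))"
    using fam2_check L_less[OF l(1)] L_less[OF l(2)] by (simp add: k_def)
  have lens: "length (fdiff (ix (n + n' - 1)) (fam2 ! l ! l')) = 8" "length (fsum (ptab l l')) = 8"
      "length (fcomp (ix n) (fam1 ! l) (fam1 ! l')) = 8"
    using len fsum_length[OF ls(1)] by (simp_all add: fdiff_def)
  have "fm (n + n') (fdiff (ix (n + n' - 1)) (fam2 ! l ! l')) +
      (fm (n + n') (fsum (ptab l l')) + fm (n + n') (fcomp (ix n) (fam1 ! l) (fam1 ! l'))) = 0"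
    using fm_null[OF _ null] lens by (simp only: fm_add fam_length)
  then have "endo_diff Eres (n + n' - 1) (V l l' (n + n' - 1)) +
      ((\<Sum>m\<in>set (ptab l l'). W m (n + n')) + endo_comp n (W l n) (W l' n')) = 0"
    using fm_diff[OF ok(1)] fm_fsum[OF ls, of "n + n'"] fm_comp[OF ok(3) len(2), of n] by (simp add: V_def W_def)
  then have "E.em (n + n') (endo_diff Eres (n + n' - 1) (V l l' (n + n' - 1)) +
      ((\<Sum>m\<in>set (ptab l l'). W m (n + n')) + endo_comp n (W l n) (W l' n'))) = 0"
    by (simp only: E.em_zero)
  moreover have "endo_diff Eres (n + n' - 1) (V l l' (n + n' - 1)) \<in> E.A (n + n')"
    using E.A_diff[OF V_A[OF l]] by simp
  moreover have Wm: "W m (n + n') \<in> E.A (n + n')" if "m \<in> set (ptab l l')" for m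
    using W_A[OF L_ptab[OF l that]] .
  moreover have "endo_comp n (W l n) (W l' n') \<in> E.A (n + n')"
    using E.A_comp[OF W_A[OF l(1)] W_A[OF l(2)]] .
  ultimately have "E.em (n + n') (endo_diff Eres (n + n' - 1) (V l l' (n + n' - 1))) +
      ((\<Sum>m\<in>set (ptab l l'). E.em (n + n') (W m (n + n'))) + E.em n (W l n) * E.em n' (W l' n')) = 0"
    by (simp only: E.em_plus E.A_plus E.A_sum E.em_sum E.em_comp W_A l)
  then show ?thesis
    using E.em_diff[OF V_A[OF l]] E.ring_eq_iff by (simp add: add.commute)
qed

text \<open>The choices \<open>f_1\<close> and \<open>f_2\<close> for the minimal resolution,
  extended linearly to coordinates: \<open>X\<close> and \<open>GG\<close>. The product of classes
  in coordinates is \<open>mulc\<close>.\<close>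

definition X :: "int \<Rightarrow> (nat \<Rightarrow> 'k) \<Rightarrow> int \<Rightarrow> (nat \<times> 'g \<Rightarrow> 'k) \<Rightarrow> nat \<times> 'g \<Rightarrow> 'k" where
  "X n c = (\<Sum>l\<in>L n. endo_scale Eres (c l) (W l n))"

definition GG :: "int \<Rightarrow> int \<Rightarrow> (nat \<Rightarrow> 'k) \<Rightarrow> (nat \<Rightarrow> 'k) \<Rightarrow> int \<Rightarrow> (nat \<times> 'g \<Rightarrow> 'k) \<Rightarrow> nat \<times> 'g \<Rightarrow> 'k" where
  "GG n n' c c' = (\<Sum>l\<in>L n. \<Sum>l'\<in>L n'. endo_scale Eres (c l * c' l') (V l l' (n + n' - 1)))"

definition mulc :: "int \<Rightarrow> int \<Rightarrow> (nat \<Rightarrow> 'k) \<Rightarrow> (nat \<Rightarrow> 'k) \<Rightarrow> nat \<Rightarrow> 'k" where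
  "mulc n n' c c' m = (\<Sum>l\<in>L n. \<Sum>l'\<in>L n'. if m \<in> set (ptab l l') then c l * c' l' else 0)"

lemma X_Z: "X n c \<in> E.Z n"
  unfolding X_def by (intro E.Z_sum E.Z_scale W_Z)

lemma X_A: "X n c \<in> E.A n"
  by (rule E.Z_A[OF X_Z])

lemma GG_A: "GG n n' c c' \<in> E.A (n + n' - 1)"
  unfolding GG_def by (intro E.A_sum E.A_scale V_A)

lemma em_X: "E.em n (X n c) = (\<Sum>l\<in>L n. E.sc (c l) * E.em n (W l n))"
  unfolding X_def by (subst E.em_sum) (simp_all add: E.A_scale W_A E.em_scale cong: sum.cong)

lemma em_GG: "E.em (n + n' - 1) (GG n n' c c') =
    (\<Sum>l\<in>L n. \<Sum>l'\<in>L n'. E.sc (c l * c' l') * E.em (n + n' - 1) (V l l' (n + n' - 1)))"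
  unfolding GG_def by (subst E.em_sum, intro E.A_sum E.A_scale V_A, assumption+, rule sum.cong[OF refl],
    subst E.em_sum, intro E.A_scale V_A, assumption+, rule sum.cong[OF refl], rule E.em_scale, rule V_A)

lemma GG_diff:
  "E.D * E.em (n + n' - 1) (GG n n' c c') + E.em (n + n' - 1) (GG n n' c c') * E.D =
    E.em n (X n c) * E.em n' (X n' c') + E.em (n + n') (X (n + n') (mulc n n' c c'))"
proof -
  let ?v = "\<lambda>l l'. E.em (n + n' - 1) (V l l' (n + n' - 1))" and ?w = "\<lambda>m. E.em (n + n') (W m (n + n'))"
  have "E.D * E.em (n + n' - 1) (GG n n' c c') + E.em (n + n' - 1) (GG n n' c c') * E.D =
      (\<Sum>l\<in>L n. \<Sum>l'\<in>L n'. E.sc (c l * c' l') * (E.D * ?v l l' + ?v l l' * E.D))"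
    unfolding em_GG sum_distrib_left sum_distrib_right
    by (simp add: distrib_left sum.distrib mult.assoc[symmetric] E.D_sc)
  also have "\<dots> = (\<Sum>l\<in>L n. \<Sum>l'\<in>L n'. E.sc (c l * c' l') * (E.em n (W l n) * E.em n' (W l' n') + (\<Sum>m\<in>set (ptab l l'). ?w m)))"
    by (intro sum.cong refl) (simp only: V_diff)
  also have "\<dots> = (\<Sum>l\<in>L n. \<Sum>l'\<in>L n'. E.sc (c l * c' l') * (E.em n (W l n) * E.em n' (W l' n'))) +
      (\<Sum>l\<in>L n. \<Sum>l'\<in>L n'. E.sc (c l * c' l') * (\<Sum>m\<in>set (ptab l l'). ?w m))"
    by (simp only: distrib_left sum.distrib)
  also have "(\<Sum>l\<in>L n. \<Sum>l'\<in>L n'. E.sc (c l * c' l') * (E.em n (W l n) * E.em n' (W l' n'))) =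
      E.em n (X n c) * E.em n' (X n' c')"
  proof -
    have "E.sc (c l * c' l') * (E.em n (W l n) * E.em n' (W l' n')) = (E.sc (c l) * E.em n (W l n)) * (E.sc (c' l') * E.em n' (W l' n'))"
      if "l \<in> L n" for l l'
    proof -
      have "(E.sc (c l) * E.em n (W l n)) * (E.sc (c' l') * E.em n' (W l' n')) =
          E.sc (c l) * ((E.em n (W l n) * E.sc (c' l')) * E.em n' (W l' n'))"
        by (simp only: mult.assoc)
      also have "\<dots> = E.sc (c l * c' l') * (E.em n (W l n) * E.em n' (W l' n'))"
        unfolding E.em_sc[OF W_A[OF that]] by (simp only: E.sc_mult[symmetric] mult.assoc)
      finally show ?thesis by (rule sym)
    qed
    then show ?thesis
      unfolding em_X sum_product by (intro sum.cong refl) simp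
  qed
  also have "(\<Sum>l\<in>L n. \<Sum>l'\<in>L n'. E.sc (c l * c' l') * (\<Sum>m\<in>set (ptab l l'). ?w m)) =
      E.em (n + n') (X (n + n') (mulc n n' c c'))"
  proof -
    have "E.sc (c l * c' l') * (\<Sum>m\<in>set (ptab l l'). ?w m) =
        (\<Sum>m\<in>L (n + n'). E.sc (if m \<in> set (ptab l l') then c l * c' l' else 0) * ?w m)" if "l \<in> L n" "l' \<in> L n'" for l l'
    proof -
      have sub: "set (ptab l l') \<subseteq> L (n + n')" using L_ptab that by blast
      have "(\<Sum>m\<in>L (n + n'). E.sc (if m \<in> set (ptab l l') then c l * c' l' else 0) * ?w m) =
          (\<Sum>m\<in>set (ptab l l'). E.sc (c l * c' l') * ?w m)"
        by (rule sum.mono_neutral_cong_right) (use sub in \<open>auto simp: E.sc_zero\<close>)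
      then show ?thesis by (simp only: sum_distrib_left)
    qed
    then have "(\<Sum>l\<in>L n. \<Sum>l'\<in>L n'. E.sc (c l * c' l') * (\<Sum>m\<in>set (ptab l l'). ?w m)) =
        (\<Sum>l\<in>L n. \<Sum>l'\<in>L n'. \<Sum>m\<in>L (n + n'). E.sc (if m \<in> set (ptab l l') then c l * c' l' else 0) * ?w m)"
      by (intro sum.cong refl) simp
    also have "\<dots> = (\<Sum>l\<in>L n. \<Sum>m\<in>L (n + n'). \<Sum>l'\<in>L n'. E.sc (if m \<in> set (ptab l l') then c l * c' l' else 0) * ?w m)"
      by (rule sum.cong[OF refl]) (rule sum.swap)
    also have "\<dots> = (\<Sum>m\<in>L (n + n'). \<Sum>l\<in>L n. \<Sum>l'\<in>L n'. E.sc (if m \<in> set (ptab l l') then c l * c' l' else 0) * ?w m)"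
      by (rule sum.swap)
    also have "\<dots> = E.em (n + n') (X (n + n') (mulc n n' c c'))"
      unfolding em_X mulc_def E.sc_sum sum_distrib_right ..
    finally show ?thesis .
  qed
  finally show ?thesis .
qed

end

section \<open>Minimality: classes are read off from the augmented component\<close>

lemma rk_bound: "\<forall>m\<in>set [0..<8]. rk m \<le> 2"
  by code_simp

lemma arow1_0: "(\<And>i l t. (i, l, t) \<in> set ls \<Longrightarrow> l = 0) \<Longrightarrow> arow1 0 ls = map fst ls"
proof (induction ls)
  case (Cons x ls)
  obtain i l t where x: "x = (i, l, t)" by (metis prod_cases3)
  then have "l = 0" using Cons.prems[of i l t] by simp
  moreover have "arow1 0 ls = map fst ls"
  proof (rule Cons.IH)
    fix i l t assume "(i, l, t) \<in> set ls"
    then show "l = 0" using Cons.prems[of i l t] by simp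
  qed
  ultimately show ?case by (simp add: x)
qed simp

lemma fam1_row [simp]: "row (fam1 ! 0) = [0]" "row (fam1 ! 1) = [0]" "row (fam1 ! Suc 0) = [0]" "row (fam1 ! 2) = [1]"
    "row (fam1 ! 3) = [0, 1]" "row (fam1 ! 4) = [0]" "row (fam1 ! 5) = [0]"
proof -
  have "length (map row fam1) = 6" by (simp add: fam1_rows)
  then have "row (fam1 ! l) = [[0], [0], [1], [0, 1], [0], [0]] ! l" if "l < 6" for l
  proof -
    have "row (fam1 ! l) = map row fam1 ! l" using that \<open>length (map row fam1) = 6\<close> by simp
    then show ?thesis unfolding fam1_rows .
  qed
  from this[of 0] this[of 1] this[of 2] this[of 3] this[of 4] this[of 5]
  show "row (fam1 ! 0) = [0]" "row (fam1 ! 1) = [0]" "row (fam1 ! Suc 0) = [0]" "row (fam1 ! 2) = [1]"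
    "row (fam1 ! 3) = [0, 1]" "row (fam1 ! 4) = [0]" "row (fam1 ! 5) = [0]" by simp_all
qed

context quat
begin

declare Eres_simps(3) [simp del]

lemma Paug_E: "f \<in> Mcarr (Eob 0) \<Longrightarrow> Paug Eres f = augm 0 f"
  by (simp add: Eres_simps)

lemma row_arow1: "fam_ok (ix n) d \<Longrightarrow> arow1 0 (d ! 0) = row d"
  unfolding row_def by (rule arow1_0) (use fam_okD(2)[of "ix n" d 0] in fastforce)

lemma fm_apply: "u \<in> Mcarr (Eob (j + n)) \<Longrightarrow> fm n d j u = lop (d ! ix j) u"
  by (simp add: fm_def)

lemma Paug_fm: "fam_ok (ix n) d \<Longrightarrow> u \<in> Mcarr (Eob n) \<Longrightarrow> Paug Eres (fm n d 0 u) = (\<Sum>i\<leftarrow>row d. augm i u)"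
  using lop_Eob[of n d 0 u] fm_apply[of u 0 n d] by (simp add: Paug_E augm_lop row_arow1)

lemma Paug_comp:
  assumes d: "fam_ok (ix k) d" "fam_ok (ix m) d'" and u: "u \<in> Mcarr (Eob (k + m))"
  shows "Paug Eres (endo_comp k (fm k d) (fm m d') 0 u) = (\<Sum>i\<leftarrow>arow (row d) (d' ! ix k). augm i u)"
proof -
  have "endo_comp k (fm k d) (fm m d') 0 u = fm k d 0 (lop (d' ! ix k) u)"
    using fm_apply[OF u] by (simp add: endo_comp_def)
  then show ?thesis
    using Paug_fm[OF d(1) lop_Eob[OF d(2)]] augm_arow by simp
qed

lemma augm_gen: "augm i (free_gen j \<one>\<^bsub>G\<^esub>) = (if i = j then 1 else 0)"
  using finite_G by (simp add: augm_def free_gen_def sum.delta)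

text \<open>An equivariant functional takes the same value on all translates of a generator, so it
  is a combination of the coefficient sums \<open>augm i\<close>.\<close>

lemma functional_expand:
  assumes \<phi>: "\<phi> \<in> kG_hom G (Eob n) trivial_module" and u: "u \<in> Mcarr (Eob n)"
  shows "\<phi> u = (\<Sum>i<rk (ix n). \<phi> (free_gen i \<one>\<^bsub>G\<^esub>) * augm i u)"
proof -
  let ?m = "rk (ix n)" and ?c = "\<lambda>i. \<phi> (free_gen i \<one>\<^bsub>G\<^esub>)"
  define \<psi> where "\<psi> u = (if u \<in> Mcarr (F ?m) then \<Sum>i<?m. ?c i * augm i u else 0)" for u
  have "\<psi> \<in> kG_hom G (F ?m) trivial_module"
    unfolding kG_hom_def mem_Collect_eq trivial_module_def
  proof (intro conjI ballI allI impI)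
    fix u v assume uv: "u \<in> Mcarr (F ?m)" "v \<in> Mcarr (F ?m)"
    then have "u + v \<in> Mcarr (F ?m)" by (rule module_add[OF F_module])
    with uv show "\<psi> (u + v) = \<psi> u + \<psi> v"
      by (simp only: \<psi>_def if_True augm_add distrib_left sum.distrib)
  next
    fix c u assume u: "u \<in> Mcarr (F ?m)"
    then have "Mscale (F ?m) c u \<in> Mcarr (F ?m)" by (rule module_scale[OF F_module])
    with u show "\<psi> (Mscale (F ?m) c u) = Mscale \<lparr>Mcarr = UNIV, Mscale = (*), Mact = \<lambda>g c. c\<rparr> c (\<psi> u)"
      unfolding \<psi>_def by (simp only: if_True augm_scale kG_mod.simps sum_distrib_left mult.left_commute)
  next
    fix g u assume u: "g \<in> carrier G" "u \<in> Mcarr (F ?m)"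
    then have "Mact (F ?m) g u \<in> Mcarr (F ?m)" by (rule module_act[OF F_module])
    with u show "\<psi> (Mact (F ?m) g u) = Mact \<lparr>Mcarr = UNIV, Mscale = (*), Mact = \<lambda>g c. c\<rparr> g (\<psi> u)"
      unfolding \<psi>_def by (simp only: if_True augm_act kG_mod.simps)
  qed (simp_all add: \<psi>_def)
  moreover have "?c i = \<psi> (free_gen i \<one>\<^bsub>G\<^esub>)" if "i \<in> {..<?m}" for i
  proof -
    have "free_gen i \<one>\<^bsub>G\<^esub> \<in> Mcarr (F ?m)" by (rule free_gen_carr[OF that one_closed])
    then show ?thesis using that by (simp add: \<psi>_def augm_gen sum.delta' if_distrib cong: if_cong)
  qed
  ultimately have "\<phi> = \<psi>"
    using free_hom_eqI[OF trivial_kG_module[OF group]] \<phi> unfolding Eob_def by blast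
  then show ?thesis using u by (simp add: \<psi>_def Eob_def)
qed

lemma rk_le: "rk (ix n) \<le> 2"
  using rk_bound[rule_format, of "ix n"] by simp

text \<open>Functionals are combinations of coefficient sums, and the coefficient sums of a boundary
  cancel in pairs by \<open>famD_minimal\<close>.\<close>

lemma minimal:
  assumes \<phi>: "\<phi> \<in> kG_hom G (Eob n) trivial_module"
  shows "\<phi> (Pbd Eres (n + 1) w) = 0"
proof (cases "w \<in> Mcarr (Eob (n + 1))")
  case True
  have "augm i (lop (famD ! ix n) w) = 0" if "i < 2" for i
  proof -
    have "reduce (arow1 i (famD ! ix n)) = []"
      using famD_minimal that ix_less by simp
    then have "(\<Sum>l\<leftarrow>arow1 i (famD ! ix n). augm l w) = 0"
      using sum_list_reduce[of "\<lambda>l. augm l w", OF add2] by (metis list.simps(8) sum_list.Nil)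
    then show ?thesis by (simp add: augm_lop)
  qed
  then have "augm i (lop (famD ! ix n) w) = 0" if "i < rk (ix n)" for i
    using that rk_le[of n] by simp
  moreover have "Pbd Eres (n + 1) w = lop (famD ! ix n) w"
    using True by (simp add: fm_def)
  ultimately show ?thesis
    using functional_expand[OF \<phi> lop_Eob[OF famD_ok(1)]] by simp
next
  case False
  then have "Pbd Eres (n + 1) w = 0" by (simp add: fm_def)
  then show ?thesis using hom_zero[OF \<phi> Eob_module] by simp
qed

text \<open>By minimality the only coboundary in the Tate complex is zero. So homotopy of chain maps
  becomes equality of their augmented components.\<close>

lemma E_homot_iff:
  assumes f: "f \<in> E.Z n" "g \<in> E.Z n"
  shows "E.homot n f g \<longleftrightarrow> (\<forall>u\<in>Mcarr (Eob n). Paug Eres (f 0 u) = Paug Eres (g 0 u))"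
proof -
  have "tate_diff Eres (n - 1) \<psi> = 0" if "\<psi> \<in> E.TC (n - 1)" for \<psi>
    using minimal[of \<psi> "n - 1"] that unfolding tate_cochains_def tate_diff_def by (auto simp: fun_eq_iff)
  then have "E.homot n f g \<longleftrightarrow> (Paug Eres \<circ> f 0) - (Paug Eres \<circ> g 0) = 0"
    using E.tate_cobd_aug[OF f] E.tate_cobd(1)[of n] unfolding coboundaries_def by fastforce
  also have "\<dots> \<longleftrightarrow> (\<forall>u. Paug Eres (f 0 u) = Paug Eres (g 0 u))"
    by (auto simp: fun_eq_iff)
  also have "\<dots> \<longleftrightarrow> (\<forall>u\<in>Mcarr (Eob n). Paug Eres (f 0 u) = Paug Eres (g 0 u))"
    using E.A_out[OF E.Z_A[OF f(1)], of _ 0] E.A_out[OF E.Z_A[OF f(2)], of _ 0] by auto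
  finally show ?thesis .
qed

lemma Paug_sum:
  assumes "\<And>l. l \<in> S \<Longrightarrow> f l \<in> E.A n" "u \<in> Mcarr (Eob n)"
  shows "Paug Eres ((\<Sum>l\<in>S. f l) 0 u) = (\<Sum>l\<in>S. Paug Eres (f l 0 u))"
proof -
  have m: "f l 0 u \<in> Mcarr (Pobj Eres 0)" if "l \<in> S" for l
    using E.A_mem[OF assms(1)[OF that], of u 0] assms(2) by simp
  have "Paug Eres (\<Sum>l\<in>S. f l 0 u) = (\<Sum>l\<in>S. Paug Eres (f l 0 u))"
    by (rule hom_sum[OF res_aug[OF E.P] res_module[OF E.P]]) (rule m)
  then show ?thesis unfolding sum_fun_apply .
qed

lemma Paug_scale:
  assumes "f \<in> E.A n" "u \<in> Mcarr (Eob n)"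
  shows "Paug Eres (endo_scale Eres c f 0 u) = c * Paug Eres (f 0 u)"
proof -
  have "f 0 u \<in> Mcarr (Pobj Eres 0)" using E.A_mem[OF assms(1), of u 0] assms(2) by simp
  from hom_scale[OF res_aug[OF E.P] this] show ?thesis by (simp add: endo_scale_def trivial_module_def)
qed

lemma Paug_X: "u \<in> Mcarr (Eob n) \<Longrightarrow>
    Paug Eres (X n c 0 u) = (\<Sum>l\<in>L n. c l * (\<Sum>i\<leftarrow>row (fam1 ! l). augm i u))"
proof -
  assume u: "u \<in> Mcarr (Eob n)"
  have "Paug Eres (X n c 0 u) = (\<Sum>l\<in>L n. Paug Eres (endo_scale Eres (c l) (W l n) 0 u))"
    unfolding X_def by (rule Paug_sum[OF _ u]) (intro E.A_scale W_A)
  also have "\<dots> = (\<Sum>l\<in>L n. c l * Paug Eres (W l n 0 u))"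
    by (rule sum.cong[OF refl]) (rule Paug_scale[OF W_A u])
  also have "\<dots> = (\<Sum>l\<in>L n. c l * (\<Sum>i\<leftarrow>row (fam1 ! l). augm i u))"
    by (rule sum.cong[OF refl]) (simp only: W_def Paug_fm[OF W_ok u])
  finally show ?thesis .
qed

lemma ix_cases: "n mod 4 = 0 \<Longrightarrow> ix n = 0 \<or> ix n = 4" "n mod 4 = 1 \<Longrightarrow> ix n = 1 \<or> ix n = 5"
    "n mod 4 = 2 \<Longrightarrow> ix n = 2 \<or> ix n = 6" "n mod 4 = 3 \<Longrightarrow> ix n = 3 \<or> ix n = 7"
proof -
  have *: "n mod 8 = n mod 4 \<or> n mod 8 = n mod 4 + 4" by presburger
  show "n mod 4 = 0 \<Longrightarrow> ix n = 0 \<or> ix n = 4" "n mod 4 = 1 \<Longrightarrow> ix n = 1 \<or> ix n = 5"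
    "n mod 4 = 2 \<Longrightarrow> ix n = 2 \<or> ix n = 6" "n mod 4 = 3 \<Longrightarrow> ix n = 3 \<or> ix n = 7"
    using * by (auto simp: ix_def)
qed

lemma rk_cases: "n mod 4 = 0 \<Longrightarrow> rk (ix n) = 1" "n mod 4 = 1 \<Longrightarrow> rk (ix n) = 2"
    "n mod 4 = 2 \<Longrightarrow> rk (ix n) = 2" "n mod 4 = 3 \<Longrightarrow> rk (ix n) = 1"
  using ix_cases[of n] by (auto simp: rk_def)

lemma mod_4_cases:
  fixes n :: int
  obtains "n mod 4 = 0" | "n mod 4 = 1" | "n mod 4 = 2" | "n mod 4 = 3"
proof -
  have "n mod 4 = 0 \<or> n mod 4 = 1 \<or> n mod 4 = 2 \<or> n mod 4 = 3" by presburger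
  then show thesis
  proof (elim disjE)
    assume "n mod 4 = 0" then show thesis by (rule that(1))
  next
    assume "n mod 4 = 1" then show thesis by (rule that(2))
  next
    assume "n mod 4 = 2" then show thesis by (rule that(3))
  next
    assume "n mod 4 = 3" then show thesis by (rule that(4))
  qed
qed

lemma sum_less_2: "(\<Sum>i<2. f i) = f 0 + f (1 :: nat)" for f :: "nat \<Rightarrow> 'b::comm_monoid_add"
  by (simp add: numeral_2_eq_2)

lemma coord_exists:
  assumes \<phi>: "\<phi> \<in> kG_hom G (Eob n) trivial_module"
  shows "\<exists>c. \<forall>u\<in>Mcarr (Eob n). \<phi> u = (\<Sum>l\<in>L n. c l * (\<Sum>i\<leftarrow>row (fam1 ! l). augm i u))"
proof -
  define w where "w i = \<phi> (free_gen i \<one>\<^bsub>G\<^esub>)" for i :: nat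
  have *: "\<phi> u = (\<Sum>i<rk (ix n). w i * augm i u)" if "u \<in> Mcarr (Eob n)" for u
    using functional_expand[OF \<phi> that] by (simp add: w_def)
  \<comment> \<open>In degrees congruent to 2 modulo 4 the rows are not the standard ones:
    \<open>x^2\<close> has the row \<open>[0, 1]\<close> and \<open>y^2\<close> the row
    \<open>[0]\<close>. This is the corresponding change of coordinates.\<close>
  have swap2: "w 0 * a + w 1 * b = w 1 * (a + b) + (w 0 + w 1) * a" for a b
  proof -
    have "w 1 * (a + b) + (w 0 + w 1) * a = w 0 * a + w 1 * b + (w 1 * a + w 1 * a)"
      by (simp only: distrib_left distrib_right ac_simps)
    then show ?thesis by (simp only: add2 add_0_right)
  qed
  show ?thesis
  proof (cases rule: mod_4_cases[of n])
    case 1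
    then show ?thesis using * by (intro exI[of _ "\<lambda>_. w 0"]) (simp add: rk_cases L_eq)
  next
    case 2
    then show ?thesis using * by (intro exI[of _ "\<lambda>l. w (l - 1)"]) (simp add: rk_cases L_eq sum_less_2)
  next
    case 3
    then show ?thesis using * by (intro exI[of _ "\<lambda>l. if l = 3 then w 1 else w 0 + w 1"]) (simp add: rk_cases L_eq sum_less_2 swap2[unfolded One_nat_def])
  next
    case 4
    then show ?thesis using * by (intro exI[of _ "\<lambda>_. w 0"]) (simp add: rk_cases L_eq)
  qed
qed

lemma coord_unique:
  assumes eq: "\<And>u. u \<in> Mcarr (Eob n) \<Longrightarrow> (\<Sum>l\<in>L n. c l * (\<Sum>i\<leftarrow>row (fam1 ! l). augm i u)) =
      (\<Sum>l\<in>L n. c' l * (\<Sum>i\<leftarrow>row (fam1 ! l). augm i u))" and l: "l \<in> L n"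
  shows "c l = c' l"
proof -
  have gen: "free_gen i \<one>\<^bsub>G\<^esub> \<in> Mcarr (Eob n)" if "i < rk (ix n)" for i
    unfolding Eob_def by (rule free_gen_carr) (use that in simp_all)
  show ?thesis
  proof (cases rule: mod_4_cases[of n])
    case 1
    then show ?thesis using eq[OF gen[of 0]] l by (simp add: rk_cases L_eq augm_gen)
  next
    case 2
    then show ?thesis using eq[OF gen[of 0]] eq[OF gen[of 1]] l by (auto simp add: rk_cases L_eq augm_gen)
  next
    case 3
    then show ?thesis using eq[OF gen[of 0]] eq[OF gen[of 1]] l by (auto simp add: rk_cases L_eq augm_gen)
  next
    case 4
    then show ?thesis using eq[OF gen[of 0]] l by (simp add: rk_cases L_eq augm_gen)
  qed
qed

lemma X_homot_iff: "E.homot n (X n c) (X n c') \<longleftrightarrow> (\<forall>l\<in>L n. c l = c' l)"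
proof
  assume "E.homot n (X n c) (X n c')"
  then show "\<forall>l\<in>L n. c l = c' l"
    using coord_unique[of n c c'] unfolding E_homot_iff[OF X_Z X_Z] by (simp add: Paug_X)
next
  assume "\<forall>l\<in>L n. c l = c' l"
  then have "X n c = X n c'" by (simp add: X_def)
  then show "E.homot n (X n c) (X n c')" by (simp add: E.homot_refl)
qed

lemma E_coords:
  assumes f: "f \<in> E.Z n"
  shows "\<exists>c. E.homot n f (X n c)"
proof -
  have "Paug Eres \<circ> f 0 \<in> kG_hom G (Eob n) trivial_module"
    using E.aug_Z[OF f] by (simp add: cocycles_def tate_cochains_def)
  from coord_exists[OF this] obtain c where
    "\<forall>u\<in>Mcarr (Eob n). (Paug Eres \<circ> f 0) u = (\<Sum>l\<in>L n. c l * (\<Sum>i\<leftarrow>row (fam1 ! l). augm i u))" ..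
  then have "E.homot n f (X n c)"
    unfolding E_homot_iff[OF f X_Z] by (simp add: Paug_X)
  then show ?thesis by (rule exI[of _ c])
qed

end

section \<open>The canonical cocycle on the minimal resolution\<close>

context quat
begin

text \<open>The formula of the canonical cocycle with \<open>X\<close> as \<open>f_1\<close>,
  \<open>GG\<close> as \<open>f_2\<close>, and products taken in coordinates.\<close>

definition M0 where
  "M0 n n' n'' c c' c'' = endo_comp (n + n' - 1) (GG n n' c c') (X n'' c'') + GG n (n' + n'') c (mulc n' n'' c' c'') +
     GG (n + n') n'' (mulc n n' c c') c'' + endo_comp n (X n c) (GG n' n'' c' c'')"

lemma deg_simps:
  "n + (n' + n'') - 1 = n + n' + n'' - (1 :: int)" "n + n' - 1 + n'' = n + n' + n'' - (1 :: int)"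
  "n + (n' + n'' - 1) = n + n' + n'' - (1 :: int)"
  by simp_all

lemma M0_parts_A:
  "endo_comp (n + n' - 1) (GG n n' c c') (X n'' c'') \<in> E.A (n + n' + n'' - 1)"
  "GG n (n' + n'') c e \<in> E.A (n + n' + n'' - 1)"
  "GG (n + n') n'' e' c'' \<in> E.A (n + n' + n'' - 1)"
  "endo_comp n (X n c) (GG n' n'' c' c'') \<in> E.A (n + n' + n'' - 1)"
  using E.A_comp[OF GG_A[of n n' c c'] X_A[of n'' c'']] GG_A[of n "n' + n''" c e] GG_A[of "n + n'" n'' e' c'']
    E.A_comp[OF X_A[of n c] GG_A[of n' n'' c' c'']]
  by (simp_all only: deg_simps)

lemma M0_A: "M0 n n' n'' c c' c'' \<in> E.A (n + n' + n'' - 1)"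
  unfolding M0_def by (intro E.A_plus M0_parts_A)

lemma em_M0: "E.em (n + n' + n'' - 1) (M0 n n' n'' c c' c'') =
    E.em (n + n' - 1) (GG n n' c c') * E.em n'' (X n'' c'') + E.em (n + (n' + n'') - 1) (GG n (n' + n'') c (mulc n' n'' c' c'')) +
    E.em (n + n' + n'' - 1) (GG (n + n') n'' (mulc n n' c c') c'') + E.em n (X n c) * E.em (n' + n'' - 1) (GG n' n'' c' c'')"
proof -
  have "E.em (n + n' + n'' - 1) (endo_comp (n + n' - 1) (GG n n' c c') (X n'' c'')) = E.em (n + n' - 1) (GG n n' c c') * E.em n'' (X n'' c'')"
    using E.em_comp[OF GG_A[of n n' c c'] X_A[of n'' c'']] by (simp only: deg_simps)
  moreover have "E.em (n + n' + n'' - 1) (endo_comp n (X n c) (GG n' n'' c' c'')) = E.em n (X n c) * E.em (n' + n'' - 1) (GG n' n'' c' c'')"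
    using E.em_comp[OF X_A[of n c] GG_A[of n' n'' c' c'']] by (simp only: deg_simps)
  ultimately show ?thesis
    unfolding M0_def by (simp only: E.em_plus E.A_plus M0_parts_A deg_simps)
qed

lemma scale_one: "f \<in> E.A n \<Longrightarrow> endo_scale Eres 1 f = f" and scale_zero: "f \<in> E.A n \<Longrightarrow> endo_scale Eres 0 f = 0"
  by (rule E.em_inj[of _ n]; simp add: E.A_scale E.A_zero E.em_scale E.sc_one E.sc_zero)+

lemma sum_unit_at: "finite S \<Longrightarrow> a \<in> S \<Longrightarrow> (\<And>l. l \<in> S \<Longrightarrow> f l \<in> E.A n) \<Longrightarrow>
    (\<Sum>l\<in>S. endo_scale Eres (unit_at a l) (f l)) = f a"
proof -
  assume S: "finite S" "a \<in> S" "\<And>l. l \<in> S \<Longrightarrow> f l \<in> E.A n"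
  have "(\<Sum>l\<in>S. endo_scale Eres (unit_at a l) (f l)) = (\<Sum>l\<in>S. if l = a then f l else 0)"
    by (rule sum.cong[OF refl]) (use S in \<open>simp add: unit_at_def scale_one[OF S(3)] scale_zero[OF S(3)]\<close>)
  also have "\<dots> = f a" using S by (simp only: sum.delta if_True)
  finally show ?thesis .
qed

lemma X_unit: "a \<in> L n \<Longrightarrow> X n (unit_at a) = W a n"
  unfolding X_def by (rule sum_unit_at[OF L_finite _ W_A])

lemma GG_unit_left: "a \<in> L n \<Longrightarrow> GG n n' (unit_at a) c = (\<Sum>l'\<in>L n'. endo_scale Eres (c l') (V a l' (n + n' - 1)))"
proof -
  assume a: "a \<in> L n"
  have "GG n n' (unit_at a) c = (\<Sum>l\<in>L n. if l = a then \<Sum>l'\<in>L n'. endo_scale Eres (c l') (V a l' (n + n' - 1)) else 0)"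
    unfolding GG_def
    by (rule sum.cong[OF refl]) (auto simp: unit_at_def scale_zero[OF V_A] intro!: sum.neutral sum.cong)
  also have "\<dots> = (\<Sum>l'\<in>L n'. endo_scale Eres (c l') (V a l' (n + n' - 1)))"
    using a by (simp only: sum.delta L_finite if_True)
  finally show ?thesis .
qed

lemma GG_unit_right: "a \<in> L n' \<Longrightarrow> GG n n' c (unit_at a) = (\<Sum>l\<in>L n. endo_scale Eres (c l) (V l a (n + n' - 1)))"
proof -
  assume a: "a \<in> L n'"
  have "(\<Sum>l'\<in>L n'. endo_scale Eres (c l * unit_at a l') (V l l' (n + n' - 1))) = endo_scale Eres (c l) (V l a (n + n' - 1))"
    if l: "l \<in> L n" for l
  proof -
    have "(\<Sum>l'\<in>L n'. endo_scale Eres (c l * unit_at a l') (V l l' (n + n' - 1))) =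
        (\<Sum>l'\<in>L n'. if l' = a then endo_scale Eres (c l) (V l a (n + n' - 1)) else 0)"
      by (rule sum.cong[OF refl]) (auto simp: unit_at_def scale_zero[OF V_A[OF l]])
    also have "\<dots> = endo_scale Eres (c l) (V l a (n + n' - 1))"
      using a by (simp only: sum.delta L_finite if_True)
    finally show ?thesis .
  qed
  then show ?thesis unfolding GG_def by (rule sum.cong[OF refl])
qed

lemma sum_indicator: "S \<subseteq> L n \<Longrightarrow> (\<And>l. l \<in> L n \<Longrightarrow> f l \<in> E.A m) \<Longrightarrow>
    (\<Sum>l\<in>L n. endo_scale Eres (of_bool (l \<in> S)) (f l)) = (\<Sum>l\<in>S. f l)"
proof -
  assume S: "S \<subseteq> L n" and f: "\<And>l. l \<in> L n \<Longrightarrow> f l \<in> E.A m"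
  show ?thesis
    by (rule sum.mono_neutral_cong_right) (use S in \<open>auto simp: scale_one[OF f] scale_zero[OF f]\<close>)
qed

lemma mulc_unit: "a \<in> L n \<Longrightarrow> b \<in> L n' \<Longrightarrow> mulc n n' (unit_at a) (unit_at b) = (\<lambda>m. of_bool (m \<in> set (ptab a b)))"
proof
  fix m assume ab: "a \<in> L n" "b \<in> L n'"
  have "(\<Sum>l'\<in>L n'. if m \<in> set (ptab l l') then unit_at a l * unit_at b l' else 0) =
      (\<Sum>l'\<in>L n'. if l' = b then (if m \<in> set (ptab l b) then unit_at a l else (0 :: 'k)) else 0)" for l
    by (rule sum.cong[OF refl]) (simp add: unit_at_def)
  then have "mulc n n' (unit_at a) (unit_at b) m = (\<Sum>l\<in>L n. if m \<in> set (ptab l b) then unit_at a l else (0 :: 'k))"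
    unfolding mulc_def using ab(2) by (simp add: sum.delta)
  also have "\<dots> = (\<Sum>l\<in>L n. if l = a then of_bool (m \<in> set (ptab a b)) else 0)"
    by (rule sum.cong[OF refl]) (simp add: unit_at_def)
  finally show "mulc n n' (unit_at a) (unit_at b) m = (of_bool (m \<in> set (ptab a b)) :: 'k)"
    using ab(1) by (simp add: sum.delta)
qed

lemma M0_unit:
  assumes a: "a \<in> L n" and b: "b \<in> L n'" and c: "c \<in> L n''"
  shows "M0 n n' n'' (unit_at a) (unit_at b) (unit_at c) =
    endo_comp (n + n' - 1) (V a b (n + n' - 1)) (W c n'') + (\<Sum>l\<in>set (ptab b c). V a l (n + n' + n'' - 1)) +
    (\<Sum>l\<in>set (ptab a b). V l c (n + n' + n'' - 1)) + endo_comp n (W a n) (V b c (n' + n'' - 1))"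
proof -
  have 1: "GG n n' (unit_at a) (unit_at b) = V a b (n + n' - 1)"
    unfolding GG_unit_left[OF a] by (rule sum_unit_at[OF L_finite b V_A[OF a]])
  have 2: "GG n' n'' (unit_at b) (unit_at c) = V b c (n' + n'' - 1)"
    unfolding GG_unit_left[OF b] by (rule sum_unit_at[OF L_finite c V_A[OF b]])
  have 3: "GG n (n' + n'') (unit_at a) (mulc n' n'' (unit_at b) (unit_at c)) = (\<Sum>l\<in>set (ptab b c). V a l (n + n' + n'' - 1))"
    unfolding GG_unit_left[OF a] mulc_unit[OF b c] deg_simps
    by (rule sum_indicator) (use L_ptab[OF b c] V_A[OF a, of _ "n' + n''"] in \<open>auto simp: deg_simps\<close>)
  have 4: "GG (n + n') n'' (mulc n n' (unit_at a) (unit_at b)) (unit_at c) = (\<Sum>l\<in>set (ptab a b). V l c (n + n' + n'' - 1))"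
    unfolding GG_unit_right[OF c] mulc_unit[OF a b]
    by (rule sum_indicator) (use L_ptab[OF a b] V_A[OF _ c, of _ "n + n'"] in auto)
  show ?thesis unfolding M0_def 1 2 3 4 X_unit[OF a] X_unit[OF c] ..
qed

lemma k_move: "a + t = 0 \<Longrightarrow> a = (t :: 'k)"
  by (metis add2 add_right_cancel)

lemma k_move5: "x + (y + (z + (w + t))) = 0 \<Longrightarrow> x + y + z + w = (t :: 'k)"
  by (rule k_move) (simp only: add.assoc)

lemma sum_list_augm: "(\<Sum>i\<leftarrow>concat (map f ls). augm i u) = (\<Sum>l\<leftarrow>ls. \<Sum>i\<leftarrow>f l. augm i u)"
  by (induction ls) simp_all

lemma Paug_plus:
  assumes "f \<in> E.A n" "g \<in> E.A n" "u \<in> Mcarr (Eob n)"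
  shows "Paug Eres ((f + g) 0 u) = Paug Eres (f 0 u) + Paug Eres (g 0 u)"
proof -
  have "f 0 u \<in> Mcarr (Pobj Eres 0)" "g 0 u \<in> Mcarr (Pobj Eres 0)"
    using E.A_mem[OF assms(1), of u 0] E.A_mem[OF assms(2), of u 0] assms(3) by simp_all
  from hom_add[OF res_aug[OF E.P] this] show ?thesis by simp
qed

text \<open>The four summands have as augmented components the first four lists of
  \<open>mrow\<close>, so \<open>mrow_check\<close> identifies their sum with the last list. Of the
  powers of \<open>s\<close> in the arguments only the parity of the one in the first argument
  remains.\<close>

lemma Paug_M0:
  assumes a: "a \<in> L n" and b: "b \<in> L n'" and c: "c \<in> L n''" and u: "u \<in> Mcarr (Eob (n + n' + n'' - 1))"
  shows "Paug Eres (M0 n n' n'' (unit_at a) (unit_at b) (unit_at c) 0 u) =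
    (\<Sum>l\<in>set (mtab (ix n \<noteq> bdeg a) a b c). \<Sum>i\<leftarrow>row (fam1 ! l). augm i u)"
proof -
  let ?p = "ix n \<noteq> bdeg a" and ?N = "n + n' + n'' - 1"
  note less = L_less[OF a] L_less[OF b] L_less[OF c]
  have 1: "Paug Eres (endo_comp (n + n' - 1) (V a b (n + n' - 1)) (W c n'') 0 u) =
      (\<Sum>i\<leftarrow>arow (row (fam2 ! a ! b)) (fam1 ! c ! ((bdeg a + bdeg b + 7) mod 8)). augm i u)"
  proof -
    have "Paug Eres (endo_comp (n + n' - 1) (V a b (n + n' - 1)) (W c n'') 0 u) =
      (\<Sum>i\<leftarrow>arow (row (fam2 ! a ! b)) (fam1 ! c ! ix (n + n' - 1)). augm i u)"
      unfolding V_def W_def by (rule Paug_comp[OF V_ok[OF a b] W_ok[OF c]]) (use u in \<open>simp only: deg_simps\<close>)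
    moreover have "fam1 ! c ! ix (n + n' - 1) = fam1 ! c ! ((bdeg a + bdeg b + 7) mod 8)"
    proof -
      \<comment> \<open>The representatives have period four, so powers of \<open>s\<close> in
        \<open>a\<close> and \<open>b\<close> do not change this term.\<close>
      have per: "fam1 ! c ! ((k + 4) mod 8) = fam1 ! c ! k" if "k < 8" for k
      proof (cases "k < 4")
        case True
        then show ?thesis using fam1_periodic[rule_format, OF in_6[OF less(3)], of k] by simp
      next
        case False
        then have "(k + 4) mod 8 = k - 4" "k - 4 < 4" "k - 4 + 4 = k" using that by (simp_all add: mod_if)
        then show ?thesis using fam1_periodic[rule_format, OF in_6[OF less(3)], of "k - 4"] by simp
      qed
      show ?thesis using ix_L2[OF a b] per[of "(bdeg a + bdeg b + 7) mod 8"] by auto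
    qed
    ultimately show ?thesis by simp
  qed
  have pt: "(\<Sum>l\<in>set ls. \<psi> l) = (\<Sum>l\<leftarrow>ls. \<psi> l)" if "distinct ls" for ls and \<psi> :: "nat \<Rightarrow> 'k"
    using that by (simp add: sum_list_distinct_conv_sum_set)
  have V1: "V a l ?N \<in> E.A ?N" "fam_ok (ix ?N) (fam2 ! a ! l)" if "l \<in> set (ptab b c)" for l
    using V_A[OF a L_ptab[OF b c that]] V_ok[OF a L_ptab[OF b c that]] by (simp_all only: deg_simps)
  have V2: "V l c ?N \<in> E.A ?N" "fam_ok (ix ?N) (fam2 ! l ! c)" if "l \<in> set (ptab a b)" for l
    using V_A[OF L_ptab[OF a b that] c] V_ok[OF L_ptab[OF a b that] c] by (simp_all only: deg_simps)
  have 2: "Paug Eres ((\<Sum>l\<in>set (ptab b c). V a l ?N) 0 u) = (\<Sum>i\<leftarrow>concat (map (\<lambda>l. row (fam2 ! a ! l)) (ptab b c)). augm i u)"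
    unfolding sum_list_augm pt[OF ptab_distinct[rule_format, OF in_6 in_6, OF less(2,3)], symmetric]
    by (subst Paug_sum[OF V1(1) u]) (auto simp: V_def Paug_fm[OF V1(2) u] intro!: sum.cong)
  have 3: "Paug Eres ((\<Sum>l\<in>set (ptab a b). V l c ?N) 0 u) = (\<Sum>i\<leftarrow>concat (map (\<lambda>l. row (fam2 ! l ! c)) (ptab a b)). augm i u)"
    unfolding sum_list_augm pt[OF ptab_distinct[rule_format, OF in_6 in_6, OF less(1,2)], symmetric]
    by (subst Paug_sum[OF V2(1) u]) (auto simp: V_def Paug_fm[OF V2(2) u] intro!: sum.cong)
  have 4: "Paug Eres (endo_comp n (W a n) (V b c (n' + n'' - 1)) 0 u) =
      (\<Sum>i\<leftarrow>arow (row (fam1 ! a)) (fam2 ! b ! c ! ((bdeg a + (if ?p then 4 else 0)) mod 8)). augm i u)"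
  proof -
    \<comment> \<open>Modulo eight the degree of the first argument is \<open>bdeg a\<close> or four
      more. The flag records which, that is, the parity of the power of \<open>s\<close>.\<close>
    have "(bdeg a + (if ?p then 4 else 0)) mod 8 = ix n"
      using ix_L[OF a] bdeg_less[OF a] by auto
    moreover have "Paug Eres (endo_comp n (W a n) (V b c (n' + n'' - 1)) 0 u) =
      (\<Sum>i\<leftarrow>arow (row (fam1 ! a)) (fam2 ! b ! c ! ix n). augm i u)"
      unfolding V_def W_def by (rule Paug_comp[OF W_ok[OF a] V_ok[OF b c]]) (use u in \<open>simp only: deg_simps\<close>)
    ultimately show ?thesis by simp
  qed
  have "reduce (mrow ?p a b c) = []"
    using mrow_check[rule_format, OF _ in_6 in_6 in_6, OF _ less, of ?p] by simp
  then have "(\<Sum>i\<leftarrow>mrow ?p a b c. augm i u) = 0"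
    using sum_list_reduce[of "\<lambda>i. augm i u", OF add2] by (metis list.simps(8) sum_list.Nil)
  then have "Paug Eres (endo_comp (n + n' - 1) (V a b (n + n' - 1)) (W c n'') 0 u) + (Paug Eres ((\<Sum>l\<in>set (ptab b c). V a l ?N) 0 u) +
     (Paug Eres ((\<Sum>l\<in>set (ptab a b). V l c ?N) 0 u) + (Paug Eres (endo_comp n (W a n) (V b c (n' + n'' - 1)) 0 u) +
     (\<Sum>i\<leftarrow>concat (map (\<lambda>l. row (fam1 ! l)) (mtab ?p a b c)). augm i u)))) = 0"
    unfolding 1 2 3 4 mrow_def map_append sum_list_append .
  then have sum0: "Paug Eres (endo_comp (n + n' - 1) (V a b (n + n' - 1)) (W c n'') 0 u) + Paug Eres ((\<Sum>l\<in>set (ptab b c). V a l ?N) 0 u) +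
     Paug Eres ((\<Sum>l\<in>set (ptab a b). V l c ?N) 0 u) + Paug Eres (endo_comp n (W a n) (V b c (n' + n'' - 1)) 0 u) =
     (\<Sum>i\<leftarrow>concat (map (\<lambda>l. row (fam1 ! l)) (mtab ?p a b c)). augm i u)"
    by (rule k_move5)
  have A1: "endo_comp (n + n' - 1) (V a b (n + n' - 1)) (W c n'') \<in> E.A ?N"
    using E.A_comp[OF V_A[OF a b] W_A[OF c]] by (simp only: deg_simps)
  have A4: "endo_comp n (W a n) (V b c (n' + n'' - 1)) \<in> E.A ?N"
    using E.A_comp[OF W_A[OF a] V_A[OF b c]] by (simp only: deg_simps)
  have "Paug Eres (M0 n n' n'' (unit_at a) (unit_at b) (unit_at c) 0 u) =
      (\<Sum>i\<leftarrow>concat (map (\<lambda>l. row (fam1 ! l)) (mtab ?p a b c)). augm i u)"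
    unfolding M0_unit[OF a b c] sum0[symmetric]
    by (simp only: Paug_plus[OF _ _ u] E.A_plus E.A_sum A1 A4 V1(1) V2(1))
  moreover have "distinct (mtab ?p a b c)"
    using mtab_distinct[rule_format, OF _ in_6 in_6 in_6, OF _ less, of ?p] by simp
  ultimately show ?thesis by (simp only: sum_list_augm pt)
qed

lemma M0_unit_homot:
  assumes a: "a \<in> L n" and b: "b \<in> L n'" and c: "c \<in> L n''"
    and Z: "M0 n n' n'' (unit_at a) (unit_at b) (unit_at c) \<in> E.Z (n + n' + n'' - 1)"
  shows "E.homot (n + n' + n'' - 1) (M0 n n' n'' (unit_at a) (unit_at b) (unit_at c))
    (X (n + n' + n'' - 1) (\<lambda>l. of_bool (l \<in> set (mtab (ix n \<noteq> bdeg a) a b c))))"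
  unfolding E_homot_iff[OF Z X_Z]
proof
  fix u assume u: "u \<in> Mcarr (Eob (n + n' + n'' - 1))"
  let ?S = "set (mtab (ix n \<noteq> bdeg a) a b c)"
  have "?S \<subseteq> L (n + n' + n'' - 1)" using L_mtab[OF a b c] by blast
  then have "(\<Sum>l\<in>L (n + n' + n'' - 1). of_bool (l \<in> ?S) * (\<Sum>i\<leftarrow>row (fam1 ! l). augm i u)) = (\<Sum>l\<in>?S. \<Sum>i\<leftarrow>row (fam1 ! l). augm i u)"
    by (intro sum.mono_neutral_cong_right) auto
  then show "Paug Eres (M0 n n' n'' (unit_at a) (unit_at b) (unit_at c) 0 u) =
      Paug Eres (X (n + n' + n'' - 1) (\<lambda>l. of_bool (l \<in> ?S)) 0 u)"
    unfolding Paug_M0[OF a b c u] Paug_X[OF u] by simp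
qed

end

section \<open>Transport to an arbitrary complete resolution\<close>

locale quat_res = quat G I J K ty
  for G :: "'g monoid" and I J K :: 'g and ty :: "'k::field itself" +
  fixes P :: "('g, 'k, 'v::ab_group_add) complete_res" and \<alpha> :: "int \<Rightarrow> 'v \<Rightarrow> nat \<times> 'g \<Rightarrow> 'k" and \<beta>
  assumes pair: "res_pair G P Eres \<alpha> \<beta>"
begin

sublocale T: res_pair G P Eres \<alpha> \<beta>
  by (rule pair)

abbreviation "\<Lambda> \<equiv> tate_alg G P"
abbreviation "H \<equiv> endo_alg G P"

text \<open>The class with coordinates \<open>c\<close> in degree \<open>n\<close>, in Tate
  cohomology; \<open>kh\<close> is the same class in the cohomology of the endomorphism dga.\<close>

definition kl :: "int \<Rightarrow> (nat \<Rightarrow> 'k) \<Rightarrow> int \<times> ('v \<Rightarrow> 'k) set" where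
  "kl n c = T.p.tcl n (T.\<Phi> n (X n c))"

definition kh :: "int \<Rightarrow> (nat \<Rightarrow> 'k) \<Rightarrow> int \<times> (int \<Rightarrow> 'v \<Rightarrow> 'v) set" where
  "kh n c = T.p.ecl n (T.\<Phi> n (X n c))"

lemma \<Phi>X_Z: "T.\<Phi> n (X n c) \<in> T.p.Z n"
  by (rule T.\<Phi>_Z[OF X_Z])

lemma \<Phi>X_homot: "T.p.homot n (T.\<Phi> n (X n c)) (T.\<Phi> n (X n c')) \<longleftrightarrow> (\<forall>l\<in>L n. c l = c' l)"
  unfolding T.\<Phi>_homot_iff[OF X_Z X_Z] by (rule X_homot_iff)

lemma kl_eq: "kl n c = kl n c' \<longleftrightarrow> (\<forall>l\<in>L n. c l = c' l)" and kh_eq: "kh n c = kh n c' \<longleftrightarrow> (\<forall>l\<in>L n. c l = c' l)"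
  by (simp_all add: kl_def kh_def T.p.tcl_eq_iff T.p.ecl_eq_iff \<Phi>X_Z \<Phi>X_homot)

lemma kl_fst [simp]: "fst (kl n c) = n" and kh_fst [simp]: "fst (kh n c) = n"
  by (simp_all add: kl_def kh_def)

lemma kl_gcomp: "kl n c \<in> gcomp \<Lambda> n" and kh_gcomp: "kh n c \<in> gcomp H n"
  unfolding kl_def kh_def T.p.L_gcomp T.p.H_gcomp by (intro imageI \<Phi>X_Z)+

lemma kl_homog [simp]: "kl n c \<in> homog \<Lambda>" and kh_homog [simp]: "kh n c \<in> homog H"
  unfolding kl_def kh_def by (rule T.p.tcl_homog[OF \<Phi>X_Z] T.p.ecl_homog[OF \<Phi>X_Z])+

lemma ft_kl: "from_tate G P (kl n c) = kh n c"
  unfolding kl_def kh_def by (rule T.p.from_tate_tcl[OF \<Phi>X_Z])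

lemma Z_coords: "f \<in> T.p.Z n \<Longrightarrow> \<exists>c. T.p.ecl n f = kh n c \<and> T.p.tcl n f = kl n c"
proof -
  assume f: "f \<in> T.p.Z n"
  obtain g where g: "g \<in> E.Z n" "T.p.homot n (T.\<Phi> n g) f" using T.\<Phi>_\<Psi>_homot[OF f] by blast
  obtain c where "E.homot n g (X n c)" using E_coords[OF g(1)] by (rule exE)
  then have "T.p.homot n (T.\<Phi> n g) (T.\<Phi> n (X n c))" using T.\<Phi>_homot_iff[OF g(1) X_Z] by simp
  then have "T.p.ecl n f = kh n c" "T.p.tcl n f = kl n c"
    using g(2) f \<Phi>X_Z[of n c] T.\<Phi>_Z[OF g(1)] unfolding kh_def kl_def
    by (metis T.p.ecl_eq_iff, metis T.p.tcl_eq_iff)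
  then show ?thesis by (intro exI[of _ c] conjI)
qed

lemma kl_cases: "a \<in> gcomp \<Lambda> n \<Longrightarrow> (\<And>c. a = kl n c \<Longrightarrow> thesis) \<Longrightarrow> thesis"
  using Z_coords by (metis T.p.L_gcompE)

lemma kh_cases: "a \<in> gcomp H n \<Longrightarrow> (\<And>c. a = kh n c \<Longrightarrow> thesis) \<Longrightarrow> thesis"
proof -
  assume a: "a \<in> gcomp H n" and th: "\<And>c. a = kh n c \<Longrightarrow> thesis"
  from a obtain f where f: "a = T.p.ecl n f" "f \<in> T.p.Z n" unfolding T.p.H_gcomp by (rule imageE)
  obtain c where "T.p.ecl n f = kh n c \<and> T.p.tcl n f = kl n c" using Z_coords[OF f(2)] by (rule exE)
  then show thesis using th[of c] f(1) by simp
qed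

lemma sum_add_apply: "(c + c') l = c l + (c' l :: 'k)"
  by simp

lemma X_add: "X n (c + c') = X n c + X n c'"
  by (rule E.em_inj[of _ n])
    (simp_all only: X_A E.A_plus E.em_plus em_X sum_add_apply E.sc_add distrib_right sum.distrib)

lemma X_scale: "X n (\<lambda>l. e * c l) = endo_scale Eres e (X n c)"
  by (rule E.em_inj[of _ n])
    (simp_all only: X_A E.A_scale E.em_scale em_X E.sc_mult[symmetric] mult.assoc sum_distrib_left)

lemma kl_add: "gadd \<Lambda> (kl n c) (kl n c') = kl n (c + c')" and kh_add: "gadd H (kh n c) (kh n c') = kh n (c + c')"
  unfolding kl_def kh_def X_add T.\<Phi>_plus[OF X_A X_A] by (rule T.p.L_gadd T.p.H_gadd; rule \<Phi>X_Z)+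

lemma kl_scale: "gscale \<Lambda> e (kl n c) = kl n (\<lambda>l. e * c l)" and kh_scale: "gscale H e (kh n c) = kh n (\<lambda>l. e * c l)"
  unfolding kl_def kh_def X_scale T.\<Phi>_scale[OF X_A] by (rule T.p.L_gscale T.p.H_gscale; rule \<Phi>X_Z)+

lemma kl_zero: "gzero \<Lambda> n = kl n (\<lambda>_. 0)"
proof -
  have "E.em n (X n (\<lambda>_. 0)) = E.em n 0" unfolding em_X by (simp add: E.sc_zero)
  then have "X n (\<lambda>_. 0) = 0" by (rule E.em_inj[OF X_A E.A_zero])
  moreover have "T.\<Phi> n 0 = 0"
    by (rule T.p.em_inj[of _ n]) (simp_all add: T.\<Phi>_A E.A_zero T.p.A_zero T.em_\<Phi> T.tr_zero)
  ultimately show ?thesis by (simp only: kl_def T.p.L_gzero)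
qed

lemma kl_one: "gone \<Lambda> = kl 0 (unit_at 0)"
proof -
  have 0: "0 \<in> L 0" by (simp add: L_def)
  have "Paug P \<circ> T.p.idc 0 = Paug P \<circ> T.\<Phi> 0 (X 0 (unit_at 0)) 0"
  proof
    fix v show "(Paug P \<circ> T.p.idc 0) v = (Paug P \<circ> T.\<Phi> 0 (X 0 (unit_at 0)) 0) v"
    proof (cases "v \<in> Mcarr (Pobj P 0)")
      case True
      then have m: "\<alpha> 0 v \<in> Mcarr (Eob 0)" using T.\<alpha>_mem[OF True] by simp
      have "Paug Eres (W 0 0 0 (\<alpha> 0 v)) = augm 0 (\<alpha> 0 v)"
        unfolding W_def using Paug_fm[OF W_ok[OF 0] m] by simp
      then show ?thesis using True m T.\<alpha>(3)[of v] by (simp add: T.p.idc_def T.Paug_\<Phi> X_unit[OF 0] Paug_E)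
    next
      case False
      have "T.\<Phi> 0 (X 0 (unit_at 0)) 0 v = 0"
        by (rule T.p.A_out[OF T.\<Phi>_A[OF X_A]]) (use False in simp)
      then show ?thesis using False by (simp add: T.p.idc_def)
    qed
  qed
  then show ?thesis by (simp add: T.p.L_gone kl_def T.p.tcl_def)
qed

text \<open>A homotopy from \<open>\<gamma>\<close> to the identity. One is fixed once and for all,
  because \<open>f_2\<close> for \<open>P\<close> is defined with it and must be bilinear.\<close>

definition deforms where
  "deforms h \<longleftrightarrow> h \<in> E.A (-1) \<and> E.em 0 T.\<gamma> = E.em 0 E.idc + E.D * E.em (-1) h + E.em (-1) h * E.D"

definition hh where "hh = (SOME h. deforms h)"

lemma hh: "hh \<in> E.A (-1)" "E.em 0 T.\<gamma> = E.em 0 E.idc + E.D * E.em (-1) hh + E.em (-1) hh * E.D"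
proof -
  obtain h where "h \<in> E.A (-1)" "E.em 0 T.\<gamma> = E.em 0 E.idc + E.D * E.em (-1) h + E.em (-1) h * E.D"
    by (rule T.\<gamma>_homotopy)
  then have "deforms h" unfolding deforms_def by (intro conjI)
  then have "deforms hh" unfolding hh_def by (rule someI[of deforms h])
  then show "hh \<in> E.A (-1)" "E.em 0 T.\<gamma> = E.em 0 E.idc + E.D * E.em (-1) hh + E.em (-1) hh * E.D"
    unfolding deforms_def by simp_all
qed

definition hc where
  "hc n f g = endo_comp (n + -1) (endo_comp n f hh) g"

lemma hc: assumes f: "f \<in> E.A n" and g: "g \<in> E.A n'"
  shows "hc n f g \<in> E.A (n + n' - 1)" "E.em (n + n' - 1) (hc n f g) = E.em n f * E.em (-1) hh * E.em n' g"
proof -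
  have d: "n + -1 + n' = n + n' - 1" by simp
  note 1 = E.A_comp[OF f hh(1)]
  show "hc n f g \<in> E.A (n + n' - 1)"
    using E.A_comp[OF 1 g] unfolding d hc_def .
  show "E.em (n + n' - 1) (hc n f g) = E.em n f * E.em (-1) hh * E.em n' g"
    using E.em_comp[OF 1 g] unfolding d hc_def E.em_comp[OF f hh(1)] .
qed

definition KK where
  "KK n n' c c' = GG n n' c c' + hc n (X n c) (X n' c')"

lemma KK_A: "KK n n' c c' \<in> E.A (n + n' - 1)"
  unfolding KK_def by (intro E.A_plus GG_A hc X_A)

lemma em_KK: "E.em (n + n' - 1) (KK n n' c c') = E.em (n + n' - 1) (GG n n' c c') + E.em n (X n c) * E.em (-1) hh * E.em n' (X n' c')"
  unfolding KK_def E.em_plus[OF GG_A hc(1)[OF X_A X_A]] hc(2)[OF X_A X_A] ..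

lemma D_X: "E.D * E.em n (X n c) = E.em n (X n c) * E.D"
  by (rule E.Z_D[OF X_Z])

lemma em_\<gamma>_X: "E.em 0 T.\<gamma> * E.em n f = E.em n f + E.D * (E.em (-1) hh * E.em n f) + E.em (-1) hh * (E.D * E.em n f)"
  if "f \<in> E.A n"
  unfolding hh(2) distrib_right mult.assoc E.em_idc[OF that] ..

text \<open>The boundary of \<open>g\<close> gives \<open>x y + m\<close>, and that of
  \<open>x h y\<close> gives \<open>x (C - 1) y\<close>; together they give
  \<open>x C y + m\<close>, the form in which a product survives transport. The homotopy enters only
  through its effect on \<open>y\<close>, as the identity cochain is not assumed to be a unit of the
  ring.\<close>

lemma ring_product:
  fixes x y g h m d C :: "(int \<Rightarrow> nat \<times> 'g \<Rightarrow> 'k) aend"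
  assumes x: "d * x = x * d" and y: "d * y = y * d" and g: "d * g + g * d = x * y + m"
    and C: "C * y = y + d * (h * y) + h * (d * y)"
  shows "d * (g + x * h * y) + (g + x * h * y) * d = x * C * y + m"
proof -
  have xl: "d * (x * t) = x * (d * t)" and yl: "d * (y * t) = y * (d * t)" for t
    by (simp_all only: mult.assoc[symmetric] x y)
  have gl: "d * g = g * d + (x * y + m)" by (rule E.ring_move[OF g])
  show ?thesis by (simp add: mult.assoc C distrib_left distrib_right x xl y yl gl E.c2_simps)
qed

lemma KK_diff:
  "E.D * E.em (n + n' - 1) (KK n n' c c') + E.em (n + n' - 1) (KK n n' c c') * E.D =
    E.em n (X n c) * E.em 0 T.\<gamma> * E.em n' (X n' c') + E.em (n + n') (X (n + n') (mulc n n' c c'))"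
  unfolding em_KK by (rule ring_product[OF D_X D_X GG_diff em_\<gamma>_X[OF X_A]])

lemma \<Phi>KK_diff:
  "endo_diff P (n + n' - 1) (T.\<Phi> (n + n' - 1) (KK n n' c c')) =
    T.\<Phi> (n + n') (X (n + n') (mulc n n' c c')) - endo_comp n (T.\<Phi> n (X n c)) (T.\<Phi> n' (X n' c'))"
proof (rule T.p.em_inj[of _ "n + n'"])
  note A = T.\<Phi>_A[OF KK_A[of n n' c c']]
  note B = T.\<Phi>_A[OF X_A[of "n + n'" "mulc n n' c c'"]] T.\<Phi>_A[OF X_A[of n c]] T.\<Phi>_A[OF X_A[of n' c']]
  have d: "n + n' - 1 + 1 = n + n'" by simp
  show "endo_diff P (n + n' - 1) (T.\<Phi> (n + n' - 1) (KK n n' c c')) \<in> T.p.A (n + n')"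
    using T.p.A_diff[OF A] unfolding d .
  show "T.\<Phi> (n + n') (X (n + n') (mulc n n' c c')) - endo_comp n (T.\<Phi> n (X n c)) (T.\<Phi> n' (X n' c')) \<in> T.p.A (n + n')"
    unfolding T.p.A_minus_plus by (intro T.p.A_plus T.p.A_comp B)
  have "T.p.em (n + n') (endo_diff P (n + n' - 1) (T.\<Phi> (n + n' - 1) (KK n n' c c'))) =
      T.tr (E.em n (X n c) * E.em 0 T.\<gamma> * E.em n' (X n' c') + E.em (n + n') (X (n + n') (mulc n n' c c')))"
    using T.p.em_diff[OF A] unfolding d T.em_\<Phi>[OF KK_A] T.tr_D T.tr_plus[symmetric] KK_diff .
  also have "\<dots> = T.p.em (n + n') (T.\<Phi> (n + n') (X (n + n') (mulc n n' c c')) - endo_comp n (T.\<Phi> n (X n c)) (T.\<Phi> n' (X n' c')))"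
    by (simp only: T.p.em_minus T.p.A_comp B T.p.em_comp T.em_\<Phi>[OF X_A] T.tr_mult T.tr_plus add.commute)
  finally show "T.p.em (n + n') (endo_diff P (n + n' - 1) (T.\<Phi> (n + n' - 1) (KK n n' c c'))) =
    T.p.em (n + n') (T.\<Phi> (n + n') (X (n + n') (mulc n n' c c')) - endo_comp n (T.\<Phi> n (X n c)) (T.\<Phi> n' (X n' c')))" .
qed

lemma mult_homot: "T.p.homot (n + n') (endo_comp n (T.\<Phi> n (X n c)) (T.\<Phi> n' (X n' c'))) (T.\<Phi> (n + n') (X (n + n') (mulc n n' c c')))"
proof -
  have "T.p.em (n + n') (endo_comp n (T.\<Phi> n (X n c)) (T.\<Phi> n' (X n' c'))) + T.p.em (n + n') (T.\<Phi> (n + n') (X (n + n') (mulc n n' c c'))) =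
      T.tr (E.D * E.em (n + n' - 1) (KK n n' c c') + E.em (n + n' - 1) (KK n n' c c') * E.D)"
    unfolding KK_diff by (simp only: T.p.em_comp T.\<Phi>_A X_A T.em_\<Phi>[OF X_A] T.tr_mult T.tr_plus)
  then show ?thesis
    unfolding T.p.homot_def T.tr_plus T.tr_D[symmetric] T.em_\<Phi>[OF KK_A, symmetric]
    using T.\<Phi>_A[OF KK_A] by blast
qed

lemma kl_mult: "gmult \<Lambda> (kl n c) (kl n' c') = kl (n + n') (mulc n n' c c')"
  and kh_mult: "gmult H (kh n c) (kh n' c') = kh (n + n') (mulc n n' c c')"
  unfolding kl_def kh_def T.p.L_gmult[OF \<Phi>X_Z \<Phi>X_Z] T.p.H_gmult[OF \<Phi>X_Z \<Phi>X_Z]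
  using mult_homot T.p.Z_comp[OF \<Phi>X_Z \<Phi>X_Z] \<Phi>X_Z by (metis T.p.tcl_eq_iff, metis T.p.ecl_eq_iff)

text \<open>Coordinates are determined by the class on \<open>L n\<close>, so associativity is
  inherited from the product of classes without consulting the table.\<close>

lemma mulc_assoc: "X (n + n' + n'') (mulc (n + n') n'' (mulc n n' c c') c'') = X (n + n' + n'') (mulc n (n' + n'') c (mulc n' n'' c' c''))"
proof -
  have "kh (n + n' + n'') (mulc (n + n') n'' (mulc n n' c c') c'') = kh (n + n' + n'') (mulc n (n' + n'') c (mulc n' n'' c' c''))"
    using T.p.H_mult_assoc[OF kh_homog[of n c] kh_homog[of n' c'] kh_homog[of n'' c'']] by (simp add: kh_mult add.assoc)
  then show ?thesis unfolding kh_eq X_def by (intro sum.cong refl) simp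
qed

definition supp :: "int \<Rightarrow> (nat \<Rightarrow> 'k) \<Rightarrow> bool" where
  "supp n c \<longleftrightarrow> (\<forall>l. l \<notin> L n \<longrightarrow> c l = 0)"

text \<open>Coordinates at indices outside \<open>L n\<close> have no effect on the class;
  prescribing zero there makes the coordinates unique, and hence linear in the class.\<close>

definition co :: "int \<times> (int \<Rightarrow> 'v \<Rightarrow> 'v) set \<Rightarrow> nat \<Rightarrow> 'k" where
  "co a = (THE c. supp (fst a) c \<and> a = kh (fst a) c)"

lemma co_kh: "supp n c \<Longrightarrow> co (kh n c) = c"
  unfolding co_def
proof (rule the_equality)
  fix c' assume c: "supp n c" "supp (fst (kh n c)) c' \<and> kh n c = kh (fst (kh n c)) c'"
  show "c' = c"
  proof
    fix l show "c' l = c l"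
      using c by (cases "l \<in> L n") (auto simp: supp_def kh_eq)
  qed
qed simp

lemma supp_simps: "supp n c \<Longrightarrow> supp n c' \<Longrightarrow> supp n (c + c')" "supp n c \<Longrightarrow> supp n (\<lambda>l. e * c l)"
    "a \<in> L n \<Longrightarrow> supp n (unit_at a)"
  by (auto simp: supp_def unit_at_def)

lemma supp_mulc: "supp (n + n') (mulc n n' c c')"
  unfolding supp_def mulc_def by (auto intro!: sum.neutral dest: L_ptab)

lemma kh_supp_cases:
  assumes "a \<in> gcomp H n" obtains c where "supp n c" "a = kh n c"
proof -
  obtain c where c: "a = kh n c" using assms by (rule kh_cases)
  show thesis
    by (rule that[of "\<lambda>l. if l \<in> L n then c l else 0"]) (simp_all add: supp_def c kh_eq)
qed

lemma kh_supp_cases_homog: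
  assumes "a \<in> homog H" obtains n c where "supp n c" "a = kh n c"
  using assms kh_supp_cases unfolding homog_def by (metis UN_E)

definition ff1 where "ff1 a = T.\<Phi> (fst a) (X (fst a) (co a))"
definition ff2 where "ff2 a b = T.\<Phi> (fst a + fst b - 1) (KK (fst a) (fst b) (co a) (co b))"

lemma ff1_kh: "supp n c \<Longrightarrow> ff1 (kh n c) = T.\<Phi> n (X n c)"
  by (simp add: ff1_def co_kh)

lemma ff2_kh: "supp n c \<Longrightarrow> supp n' c' \<Longrightarrow> ff2 (kh n c) (kh n' c') = T.\<Phi> (n + n' - 1) (KK n n' c c')"
  by (simp add: ff2_def co_kh)

lemma GG_add: "GG n n' (c + e) c' = GG n n' c c' + GG n n' e c'" "GG n n' c (c' + e') = GG n n' c c' + GG n n' c e'"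
  by (rule E.em_inj[of _ "n + n' - 1"];
    simp only: GG_A E.A_plus E.em_plus em_GG sum_add_apply E.sc_add distrib_right distrib_left sum.distrib)+

lemma GG_scale: "GG n n' (\<lambda>l. e * c l) c' = endo_scale Eres e (GG n n' c c')" "GG n n' c (\<lambda>l. e * c' l) = endo_scale Eres e (GG n n' c c')"
  by (rule E.em_inj[of _ "n + n' - 1"];
    simp only: GG_A E.A_scale E.em_scale em_GG E.sc_mult[symmetric] mult.assoc mult.left_commute[of _ e] sum_distrib_left)+

lemma KK_add: "KK n n' (c + e) c' = KK n n' c c' + KK n n' e c'" "KK n n' c (c' + e') = KK n n' c c' + KK n n' c e'"
  by (rule E.em_inj[of _ "n + n' - 1"];
    simp only: KK_A E.A_plus E.em_plus em_KK GG_add GG_A X_add X_A distrib_right distrib_left ac_simps)+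

lemma KK_scale: "KK n n' (\<lambda>l. e * c l) c' = endo_scale Eres e (KK n n' c c')"
  "KK n n' c (\<lambda>l. e * c' l) = endo_scale Eres e (KK n n' c c')"
proof -
  have s: "E.em n (X n c) * (E.em (-1) hh * (E.sc e * y)) = E.sc e * (E.em n (X n c) * (E.em (-1) hh * y))" for y
  proof -
    have "E.em n (X n c) * (E.em (-1) hh * (E.sc e * y)) = E.em n (X n c) * (E.em (-1) hh * E.sc e) * y"
      by (simp only: mult.assoc)
    also have "\<dots> = (E.em n (X n c) * E.sc e) * E.em (-1) hh * y"
      unfolding E.em_sc[OF hh(1)] by (simp only: mult.assoc)
    also have "\<dots> = E.sc e * (E.em n (X n c) * (E.em (-1) hh * y))"
      unfolding E.em_sc[OF X_A] by (simp only: mult.assoc)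
    finally show ?thesis .
  qed
  show "KK n n' (\<lambda>l. e * c l) c' = endo_scale Eres e (KK n n' c c')"
    by (rule E.em_inj[of _ "n + n' - 1"];
      simp only: KK_A E.A_scale E.em_scale em_KK GG_scale GG_A X_scale X_A distrib_left mult.assoc)
  have "E.em n (X n c) * E.em (-1) hh * (E.sc e * E.em n' (X n' c')) = E.sc e * (E.em n (X n c) * E.em (-1) hh * E.em n' (X n' c'))"
    by (simp only: mult.assoc s)
  then show "KK n n' c (\<lambda>l. e * c' l) = endo_scale Eres e (KK n n' c c')"
    by (intro E.em_inj[of _ "n + n' - 1"])
      (simp_all only: KK_A E.A_scale E.em_scale em_KK GG_scale GG_A X_scale X_A distrib_left)
qed

lemma choice: "canonical_choice G P ff1 ff2"
  unfolding canonical_choice_def Let_def T.p.H_gdeg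
proof (intro conjI allI ballI)
  fix a assume "a \<in> homog H"
  then obtain n c where a: "supp n c" "a = kh n c" by (rule kh_supp_cases_homog)
  show "ff1 a \<in> snd a"
    unfolding a(2) ff1_kh[OF a(1)] using T.p.snd_ecl[OF \<Phi>X_Z, of "T.\<Phi> n (X n c)" n c] \<Phi>X_Z T.p.homot_refl
    by (simp add: kh_def)
  fix e
  show "ff1 (gscale H e a) = endo_scale P e (ff1 a)"
    unfolding a(2) kh_scale ff1_kh[OF a(1)] ff1_kh[OF supp_simps(2)[OF a(1)]] X_scale by (rule T.\<Phi>_scale[OF X_A])
next
  fix n a b assume "a \<in> gcomp H n" "b \<in> gcomp H n"
  then obtain c c' where a: "supp n c" "a = kh n c" and b: "supp n c'" "b = kh n c'" by (metis kh_supp_cases)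
  show "ff1 (gadd H a b) = ff1 a + ff1 b"
    unfolding a(2) b(2) kh_add ff1_kh[OF a(1)] ff1_kh[OF b(1)] ff1_kh[OF supp_simps(1)[OF a(1) b(1)]] X_add
    by (rule T.\<Phi>_plus[OF X_A X_A])
next
  fix a b assume "a \<in> homog H" "b \<in> homog H"
  then obtain n c n' c' where a: "supp n c" "a = kh n c" and b: "supp n' c'" "b = kh n' c'" by (metis kh_supp_cases_homog)
  show "ff2 a b \<in> endo_cochains G P (fst a + fst b - 1)"
    unfolding a(2) b(2) ff2_kh[OF a(1) b(1)] kh_fst by (rule T.\<Phi>_A[OF KK_A])
  show "endo_diff P (fst a + fst b - 1) (ff2 a b) = ff1 (gmult H a b) - endo_comp (fst a) (ff1 a) (ff1 b)"
    unfolding a(2) b(2) ff2_kh[OF a(1) b(1)] kh_fst kh_mult ff1_kh[OF a(1)] ff1_kh[OF b(1)] ff1_kh[OF supp_mulc]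
    by (rule \<Phi>KK_diff)
  fix e
  show "ff2 (gscale H e a) b = endo_scale P e (ff2 a b)" "ff2 a (gscale H e b) = endo_scale P e (ff2 a b)"
    unfolding a(2) b(2) kh_scale ff2_kh[OF a(1) b(1)] ff2_kh[OF supp_simps(2)[OF a(1)] b(1)] ff2_kh[OF a(1) supp_simps(2)[OF b(1)]]
      KK_scale by (rule T.\<Phi>_scale[OF KK_A])+
next
  fix n a a' b assume "a \<in> gcomp H n" "a' \<in> gcomp H n" "b \<in> homog H"
  then obtain c c' n' e where a: "supp n c" "a = kh n c" and a': "supp n c'" "a' = kh n c'" and b: "supp n' e" "b = kh n' e"
    by (metis kh_supp_cases kh_supp_cases_homog)
  show "ff2 (gadd H a a') b = ff2 a b + ff2 a' b"
    unfolding a(2) a'(2) b(2) kh_add ff2_kh[OF a(1) b(1)] ff2_kh[OF a'(1) b(1)] ff2_kh[OF supp_simps(1)[OF a(1) a'(1)] b(1)] KK_add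
    by (rule T.\<Phi>_plus[OF KK_A KK_A])
next
  fix n b a a' assume "b \<in> homog H" "a \<in> gcomp H n" "a' \<in> gcomp H n"
  then obtain c c' n' e where a: "supp n c" "a = kh n c" and a': "supp n c'" "a' = kh n c'" and b: "supp n' e" "b = kh n' e"
    by (metis kh_supp_cases kh_supp_cases_homog)
  show "ff2 b (gadd H a a') = ff2 b a + ff2 b a'"
    unfolding a(2) a'(2) b(2) kh_add ff2_kh[OF b(1) a(1)] ff2_kh[OF b(1) a'(1)] ff2_kh[OF b(1) supp_simps(1)[OF a(1) a'(1)]] KK_add
    by (rule T.\<Phi>_plus[OF KK_A KK_A])
qed

sublocale C: char2_choice G P ff1 ff2
  by unfold_locales (rule choice)

text \<open>The boundaries of \<open>gab z\<close> and \<open>x gbc\<close> both contain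
  \<open>x y z\<close>, which cancels; their other terms cancel against those of \<open>ga\<close>
  and \<open>gc\<close>. That both of these involve the same \<open>xyz\<close> is
  associativity.\<close>

lemma ring_cocycle:
  fixes x y z xy yz xyz gab gbc ga gc d :: "(int \<Rightarrow> nat \<times> 'g \<Rightarrow> 'k) aend"
  assumes x: "d * x = x * d" and z: "d * z = z * d"
    and gab: "d * gab + gab * d = x * y + xy" and gbc: "d * gbc + gbc * d = y * z + yz"
    and ga: "d * ga + ga * d = x * yz + xyz" and gc: "d * gc + gc * d = xy * z + xyz"
  shows "d * (gab * z + ga + gc + x * gbc) = (gab * z + ga + gc + x * gbc) * d"
proof -
  have l: "d * (x * t) = x * (d * t)" "d * (gab * t) = gab * (d * t) + (x * (y * t) + xy * t)" for t
    using x arg_cong[OF E.ring_move[OF gab], of "\<lambda>u. u * t"] by (simp_all only: mult.assoc[symmetric] distrib_right)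
  show ?thesis
    by (simp add: mult.assoc distrib_left distrib_right l x z E.ring_move[OF gab] E.ring_move[OF gbc]
      E.ring_move[OF ga] E.ring_move[OF gc] E.c2_simps)
qed

lemma M0_Z: "M0 n n' n'' c c' c'' \<in> E.Z (n + n' + n'' - 1)"
  unfolding E.Z_iff em_M0
proof (intro conjI M0_A ring_cocycle[OF D_X D_X GG_diff GG_diff])
  show "E.D * E.em (n + (n' + n'') - 1) (GG n (n' + n'') c (mulc n' n'' c' c'')) + E.em (n + (n' + n'') - 1) (GG n (n' + n'') c (mulc n' n'' c' c'')) * E.D =
      E.em n (X n c) * E.em (n' + n'') (X (n' + n'') (mulc n' n'' c' c'')) +
      E.em (n + n' + n'') (X (n + n' + n'') (mulc (n + n') n'' (mulc n n' c c') c''))"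
    unfolding mulc_assoc using GG_diff[of n "n' + n''"] by (simp only: add.assoc)
qed (rule GG_diff)

text \<open>On the left stands the canonical cocycle of the corrected homotopies, with
  \<open>C\<close> inserted by transport, plus the uncorrected cocycle. Replacing \<open>C\<close>
  by the identity in the two outer products contributes \<open>gab h z\<close> and
  \<open>x h gbc\<close> to the homotopy, and the correction inside them contributes
  \<open>x h y h z\<close>.\<close>

lemma ring_compare:
  fixes x y z xy yz gab gbc ga gc d h C :: "(int \<Rightarrow> nat \<times> 'g \<Rightarrow> 'k) aend"
  assumes x: "d * x = x * d" and y: "d * y = y * d" and z: "d * z = z * d"
    and gab: "d * gab + gab * d = x * y + xy" and gbc: "d * gbc + gbc * d = y * z + yz"
    and C: "C * z = z + d * (h * z) + h * (d * z)" "C * gbc = gbc + d * (h * gbc) + h * (d * gbc)"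
      "C * (y * h * z) = y * h * z + d * (h * (y * h * z)) + h * (d * (y * h * z))"
  shows "(gab + x * h * y) * C * z + (ga + x * h * yz) + (gc + xy * h * z) + x * C * (gbc + y * h * z) + (gab * z + ga + gc + x * gbc) =
    d * (gab * h * z + x * h * gbc + x * h * y * h * z) + (gab * h * z + x * h * gbc + x * h * y * h * z) * d"
proof -
  have l: "d * (x * t) = x * (d * t)" "d * (y * t) = y * (d * t)" "d * (z * t) = z * (d * t)"
      "d * (gab * t) = gab * (d * t) + (x * (y * t) + xy * t)" for t
    using x y z arg_cong[OF E.ring_move[OF gab], of "\<lambda>u. u * t"] by (simp_all only: mult.assoc[symmetric] distrib_right)
  show ?thesis
    by (simp add: mult.assoc distrib_left distrib_right C(1,2) C(3)[unfolded mult.assoc] l x y z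
      E.ring_move[OF gab] E.ring_move[OF gbc] E.c2_simps)
qed

end

context quat_res
begin

lemma F_kh: "supp n c \<Longrightarrow> C.F1 (kh n c) = T.tr (E.em n (X n c))"
  "supp n c \<Longrightarrow> supp n' c' \<Longrightarrow> C.F2 (kh n c) (kh n' c') = T.tr (E.em (n + n' - 1) (KK n n' c c'))"
  by (simp_all add: C.F1_def C.F2_def ff1_kh ff2_kh T.em_\<Phi> X_A KK_A)

text \<open>By \<open>ring_compare\<close> the cocycle for \<open>P\<close> and the transported one
  of the minimal resolution have the same class, so values can be read off on the minimal
  resolution.\<close>

lemma MM_homot:
  assumes s: "supp n c" "supp n' c'" "supp n'' c''"
  shows "T.p.homot (n + n' + n'' - 1) (C.MM (kh n c) (kh n' c') (kh n'' c'')) (T.\<Phi> (n + n' + n'' - 1) (M0 n n' n'' c c' c''))"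
proof -
  let ?N = "n + n' + n'' - 1" and ?C = "E.em 0 T.\<gamma>" and ?h = "E.em (-1) hh"
  define x y z where "x = E.em n (X n c)" and "y = E.em n' (X n' c')" and "z = E.em n'' (X n'' c'')"
  define gab gbc where "gab = E.em (n + n' - 1) (GG n n' c c')" and "gbc = E.em (n' + n'' - 1) (GG n' n'' c' c'')"
  define ga gc where "ga = E.em (n + (n' + n'') - 1) (GG n (n' + n'') c (mulc n' n'' c' c''))"
    and "gc = E.em (n + n' + n'' - 1) (GG (n + n') n'' (mulc n n' c c') c'')"
  define xy yz where "xy = E.em (n + n') (X (n + n') (mulc n n' c c'))" and "yz = E.em (n' + n'') (X (n' + n'') (mulc n' n'' c' c''))"
  note defs = x_def y_def z_def gab_def gbc_def ga_def gc_def xy_def yz_def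
  define w where "w = hc (n + n' - 1) (GG n n' c c') (X n'' c'') + hc n (X n c) (GG n' n'' c' c'') +
    hc (n + n' - 1) (hc n (X n c) (X n' c')) (X n'' c'')"
  have d: "n + n' - 1 + n'' - 1 = ?N - 1" "n + (n' + n'' - 1) - 1 = ?N - 1" by simp_all
  note w1 = hc[OF GG_A[of n n' c c'] X_A[of n'' c''], unfolded d]
  note w2 = hc[OF X_A[of n c] GG_A[of n' n'' c' c''], unfolded d]
  note w3 = hc[OF hc(1)[OF X_A[of n c] X_A[of n' c']] X_A[of n'' c''], unfolded d hc(2)[OF X_A[of n c] X_A[of n' c']]]
  have w_A: "w \<in> E.A (?N - 1)" unfolding w_def by (intro E.A_plus w1 w2 w3)
  have em_w: "E.em (?N - 1) w = gab * ?h * z + x * ?h * gbc + x * ?h * y * ?h * z"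
    unfolding w_def by (simp only: E.em_plus E.A_plus w1 w2 w3 defs)
  note MM = C.em_MM[OF kh_homog[of n c] kh_homog[of n' c'] kh_homog[of n'' c''], unfolded kh_fst]
  have yhz: "y * ?h * z = E.em (n' + n'' - 1) (hc n' (X n' c') (X n'' c''))"
    unfolding hc(2)[OF X_A X_A] defs ..
  have "T.p.em ?N (C.MM (kh n c) (kh n' c') (kh n'' c'')) + T.p.em ?N (T.\<Phi> ?N (M0 n n' n'' c c' c'')) =
      T.tr ((gab + x * ?h * y) * ?C * z + (ga + x * ?h * yz) + (gc + xy * ?h * z) + x * ?C * (gbc + y * ?h * z) + (gab * z + ga + gc + x * gbc))"
    unfolding MM kh_mult F_kh[OF s(1)] F_kh[OF s(2)] F_kh[OF s(3)] F_kh(2)[OF s(1,2)] F_kh(2)[OF s(2,3)] F_kh(2)[OF s(1) supp_mulc]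
      F_kh(2)[OF supp_mulc s(3)] em_KK T.em_\<Phi>[OF M0_A] em_M0 T.tr_mult T.tr_plus[symmetric] defs ..
  also have "\<dots> = T.tr (E.D * E.em (?N - 1) w + E.em (?N - 1) w * E.D)"
    unfolding em_w
  proof (rule arg_cong[of _ _ T.tr], rule ring_compare)
    show "E.D * x = x * E.D" "E.D * y = y * E.D" "E.D * z = z * E.D" unfolding defs by (rule D_X)+
    show "E.D * gab + gab * E.D = x * y + xy" "E.D * gbc + gbc * E.D = y * z + yz" unfolding defs by (rule GG_diff)+
    show "?C * z = z + E.D * (?h * z) + ?h * (E.D * z)" "?C * gbc = gbc + E.D * (?h * gbc) + ?h * (E.D * gbc)"
      unfolding defs by (rule em_\<gamma>_X, rule X_A GG_A)+
    show "?C * (y * ?h * z) = y * ?h * z + E.D * (?h * (y * ?h * z)) + ?h * (E.D * (y * ?h * z))"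
      unfolding yhz by (rule em_\<gamma>_X, rule hc[OF X_A X_A])
  qed
  finally show ?thesis
    unfolding T.p.homot_def T.tr_plus T.tr_D[symmetric] T.em_\<Phi>[OF w_A, symmetric] using T.\<Phi>_A[OF w_A] by blast
qed

lemma cocycle_unit:
  assumes a: "a \<in> L n" and b: "b \<in> L n'" and c: "c \<in> L n''"
  shows "canonical_cocycle G P ff1 ff2 [kl n (unit_at a), kl n' (unit_at b), kl n'' (unit_at c)] =
    kl (n + n' + n'' - 1) (\<lambda>l. of_bool (l \<in> set (mtab (ix n \<noteq> bdeg a) a b c)))"
proof -
  let ?N = "n + n' + n'' - 1" and ?M = "M0 n n' n'' (unit_at a) (unit_at b) (unit_at c)"
  note Z = M0_Z[of n n' n'' "unit_at a" "unit_at b" "unit_at c"]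
  have "canonical_cocycle G P ff1 ff2 [kl n (unit_at a), kl n' (unit_at b), kl n'' (unit_at c)] =
      T.p.tcl ?N (C.MM (kh n (unit_at a)) (kh n' (unit_at b)) (kh n'' (unit_at c)))"
    by (simp add: C.canonical_cocycle_eq ft_kl)
  also have "\<dots> = T.p.tcl ?N (T.\<Phi> ?N ?M)"
    using T.p.tcl_eq_iff[OF _ T.\<Phi>_Z[OF Z]] MM_homot[OF supp_simps(3)[OF a] supp_simps(3)[OF b] supp_simps(3)[OF c]]
      C.MM_Z[OF kh_homog[of n "unit_at a"] kh_homog[of n' "unit_at b"] kh_homog[of n'' "unit_at c"]] by simp
  also have "\<dots> = kl ?N (\<lambda>l. of_bool (l \<in> set (mtab (ix n \<noteq> bdeg a) a b c)))"
    unfolding kl_def T.p.tcl_eq_iff[OF T.\<Phi>_Z[OF Z] \<Phi>X_Z] T.\<Phi>_homot_iff[OF Z X_Z]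
    by (rule M0_unit_homot[OF a b c Z])
  finally show ?thesis .
qed

section \<open>Degree one classes as homomorphisms\<close>

lemma snd_kl: "\<phi> \<in> snd (kl n c) \<Longrightarrow> \<exists>\<psi>\<in>T.p.TC (n - 1). \<forall>v. \<phi> v = Paug Eres (X n c 0 (\<alpha> n v)) + \<psi> (Pbd P n v)"
proof -
  assume "\<phi> \<in> snd (kl n c)"
  then have "\<phi> - (Paug P \<circ> T.\<Phi> n (X n c) 0) \<in> coboundaries T.p.TC (tate_diff P) n"
    by (simp add: kl_def T.p.tcl_def coh_class_def)
  then obtain \<psi> where \<psi>: "\<psi> \<in> T.p.TC (n - 1)" "\<phi> - (Paug P \<circ> T.\<Phi> n (X n c) 0) = tate_diff P (n - 1) \<psi>"
    by (auto simp: coboundaries_def)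
  have "\<phi> v = Paug Eres (X n c 0 (\<alpha> n v)) + \<psi> (Pbd P n v)" for v
    using fun_cong[OF \<psi>(2), of v] by (simp add: tate_diff_def T.Paug_\<Phi> algebra_simps)
  then show ?thesis using \<psi>(1) by blast
qed

text \<open>The two generators in degree 1 witness \<open>I - 1\<close> and \<open>J - 1\<close>.
  Therefore the two coordinates of a degree one class are its values at \<open>I\<close> and
  \<open>J\<close>.\<close>

lemma bd_gen:
  "Pbd Eres 1 (free_gen 0 \<one>\<^bsub>G\<^esub>) = Mact (Eob 0) I (free_gen 0 \<one>\<^bsub>G\<^esub>) + free_gen 0 \<one>\<^bsub>G\<^esub>"
  "Pbd Eres 1 (free_gen 1 \<one>\<^bsub>G\<^esub>) = Mact (Eob 0) J (free_gen 0 \<one>\<^bsub>G\<^esub>) + free_gen 0 \<one>\<^bsub>G\<^esub>"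
proof -
  have el_gen: "el (i, 0, t) (free_gen j \<one>\<^bsub>G\<^esub>) = (if i = j then free_gen 0 (el_of t) else (0 :: nat \<times> 'g \<Rightarrow> 'k))" for i j t
  proof
    fix p :: "nat \<times> 'g"
    obtain l h where p: "p = (l, h)" by (cases p)
    have "h \<otimes>\<^bsub>G\<^esub> inv\<^bsub>G\<^esub> el_of t = \<one>\<^bsub>G\<^esub> \<longleftrightarrow> h = el_of t" if "h \<in> carrier G"
      using that by (metis el_closed inv_closed inv_inv inv_equality r_inv)
    then show "el (i, 0, t) (free_gen j \<one>\<^bsub>G\<^esub>) p = (if i = j then free_gen 0 (el_of t) else (0 :: nat \<times> 'g \<Rightarrow> 'k)) p"
      by (auto simp: p el_def free_gen_def)
  qed
  have m: "free_gen 0 \<one>\<^bsub>G\<^esub> \<in> Mcarr (Eob 1)" "free_gen 1 \<one>\<^bsub>G\<^esub> \<in> Mcarr (Eob 1)"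
    unfolding Eob_def by (rule free_gen_carr; simp add: rk_def)+
  have act: "Mact (Eob 0) g (free_gen 0 \<one>\<^bsub>G\<^esub>) = free_gen 0 g" if "g \<in> carrier G" for g
    unfolding Eob_def using free_gen_act[OF group that one_closed] that by simp
  have bd: "Pbd Eres 1 u = el (0, 0, q1) u + (el (0, 0, qI) u + (el (1, 0, q1) u + (el (1, 0, qJ) u + 0)))" if "u \<in> Mcarr (Eob 1)" for u
    unfolding Eres_simps using fm_apply[of u 0 1 famD] that by (simp only: famD_gen lop_simps diff_self add_0_left ix_simps)
  show "Pbd Eres 1 (free_gen 0 \<one>\<^bsub>G\<^esub>) = Mact (Eob 0) I (free_gen 0 \<one>\<^bsub>G\<^esub>) + free_gen 0 \<one>\<^bsub>G\<^esub>"
    unfolding bd[OF m(1)] act[OF IJ(1)] el_gen el_simps by (simp add: add.commute)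
  show "Pbd Eres 1 (free_gen 1 \<one>\<^bsub>G\<^esub>) = Mact (Eob 0) J (free_gen 0 \<one>\<^bsub>G\<^esub>) + free_gen 0 \<one>\<^bsub>G\<^esub>"
    unfolding bd[OF m(2)] act[OF IJ(2)] el_gen el_simps by (simp add: add.commute)
qed

text \<open>Any \<open>e\<close> of augmentation 1 differs from the generator by a boundary
  \<open>d t\<close>. Then \<open>w\<close>, the generator \<open>e_i\<close> and
  \<open>g t - t\<close> add up to a cycle, hence to a boundary, where a functional vanishes by
  minimality; on \<open>g t - t\<close> it vanishes by equivariance.\<close>

lemma X1_value:
  assumes g: "g \<in> carrier G" and i: "i < 2" and bd: "Pbd Eres 1 (free_gen i \<one>\<^bsub>G\<^esub>) = Mact (Eob 0) g (free_gen 0 \<one>\<^bsub>G\<^esub>) + free_gen 0 \<one>\<^bsub>G\<^esub>"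
    and e: "e \<in> Mcarr (Eob 0)" "Paug Eres e = 1" and w: "w \<in> Mcarr (Eob 1)" "Pbd Eres 1 w = Mact (Eob 0) g e + e"
  shows "Paug Eres (X 1 c 0 w) = c (Suc i)"
proof -
  let ?g0 = "free_gen 0 \<one>\<^bsub>G\<^esub> :: nat \<times> 'g \<Rightarrow> 'k" and ?gi = "free_gen i \<one>\<^bsub>G\<^esub> :: nat \<times> 'g \<Rightarrow> 'k"
  define \<rho> where "\<rho> u = Paug Eres (X 1 c 0 u)" for u
  have \<rho>: "\<rho> \<in> kG_hom G (Eob 1) trivial_module"
    using E.aug_Z[OF X_Z[of 1 c]] by (simp add: cocycles_def tate_cochains_def \<rho>_def[abs_def] comp_def)
  have g0: "?g0 \<in> Mcarr (Eob 0)" unfolding Eob_def by (rule free_gen_carr) (simp_all add: rk_def)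
  have gi: "?gi \<in> Mcarr (Eob 1)" unfolding Eob_def by (rule free_gen_carr) (use i in \<open>simp_all add: rk_def\<close>)
  have a0: "Paug Eres ?g0 = 1" using g0 by (simp add: Paug_E augm_gen)
  have eg: "e + ?g0 \<in> Mcarr (Eob 0)" by (rule module_add[OF Eob_module e(1) g0])
  have "Paug Eres (e + ?g0) = 1 + 1"
    using hom_add[OF res_aug[OF E.P], of e ?g0] e g0 a0 by simp
  then have "Pbd Eres 0 (e + ?g0) = 0"
    unfolding res_bd_0[OF E.P] by (simp only: add2 res_coaug_zero[OF E.P])
  then have "e + ?g0 \<in> Pbd Eres (0 + 1) ` Mcarr (Pobj Eres (0 + 1))"
    unfolding res_image[OF E.P] using eg by simp
  then obtain t where t: "t \<in> Mcarr (Eob 1)" "Pbd Eres 1 t = e + ?g0" by auto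
  have bdh: "Pbd Eres 1 \<in> kG_hom G (Eob 1) (Eob 0)" using res_bd[OF E.P, of 1] by simp
  have gt: "Mact (Eob 1) g t \<in> Mcarr (Eob 1)" by (rule module_act[OF Eob_module g t(1)])
  have sum: "w + ?gi \<in> Mcarr (Eob 1)" "t + Mact (Eob 1) g t \<in> Mcarr (Eob 1)"
    by (rule module_add[OF Eob_module]; fact)+
  have "Pbd Eres 1 (w + ?gi + (t + Mact (Eob 1) g t)) =
      Pbd Eres 1 w + Pbd Eres 1 ?gi + (Pbd Eres 1 t + Mact (Eob 0) g (Pbd Eres 1 t))"
    unfolding hom_add[OF bdh sum] hom_add[OF bdh w(1) gi] hom_add[OF bdh t(1) gt] hom_act[OF bdh g t(1)] ..
  also have "\<dots> = (Mact (Eob 0) g e + e) + (Mact (Eob 0) g ?g0 + ?g0) + ((e + ?g0) + (Mact (Eob 0) g e + Mact (Eob 0) g ?g0))"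
    unfolding w(2) bd t(2) module_act_add[OF Eob_module g] ..
  also have "\<dots> = (Mact (Eob 0) g e + Mact (Eob 0) g e) + (e + e) + ((Mact (Eob 0) g ?g0 + Mact (Eob 0) g ?g0) + (?g0 + ?g0))"
    by (simp only: ac_simps)
  also have "\<dots> = 0" by (simp only: add2f add_0_left)
  finally have "w + ?gi + (t + Mact (Eob 1) g t) \<in> Pbd Eres (1 + 1) ` Mcarr (Pobj Eres (1 + 1))"
    unfolding res_image[OF E.P] using module_add[OF Eob_module sum] by simp
  then obtain q where "w + ?gi + (t + Mact (Eob 1) g t) = Pbd Eres (1 + 1) q" by blast
  then have "\<rho> (w + ?gi + (t + Mact (Eob 1) g t)) = 0" using minimal[OF \<rho>] by simp
  moreover have "\<rho> (w + ?gi + (t + Mact (Eob 1) g t)) = \<rho> w + \<rho> ?gi + (\<rho> t + \<rho> t)"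
    unfolding hom_add[OF \<rho> sum] hom_add[OF \<rho> w(1) gi] hom_add[OF \<rho> t(1) gt] hom_act[OF \<rho> g t(1)] by (simp add: trivial_module_def)
  ultimately have "\<rho> w + \<rho> ?gi = 0" by (simp only: add2 add_0_right)
  then have "\<rho> w = \<rho> ?gi" by (rule k_move)
  also have "\<dots> = c (Suc i)"
  proof -
    have "i = 0 \<or> i = 1" using i by auto
    then show ?thesis unfolding \<rho>_def Paug_X[OF gi]
      by (elim disjE) (simp_all add: L_eq augm_gen numeral_2_eq_2[symmetric])
  qed
  finally show ?thesis unfolding \<rho>_def .
qed

text \<open>The value must be the same for all admissible \<open>\<phi>\<close>, \<open>u\<close>
  and \<open>v\<close>. The map \<open>\<alpha>\<close> carries \<open>u\<close> and
  \<open>v\<close> to the minimal resolution, and the coboundary part of \<open>\<phi>\<close>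
  contributes \<open>\<psi> (g u) - \<psi> u = 0\<close>.\<close>

lemma hom_of_class_value:
  assumes g: "g \<in> carrier G" and i: "i < 2" and bd: "Pbd Eres 1 (free_gen i \<one>\<^bsub>G\<^esub>) = Mact (Eob 0) g (free_gen 0 \<one>\<^bsub>G\<^esub>) + free_gen 0 \<one>\<^bsub>G\<^esub>"
  shows "hom_of_class P (kl 1 c) g = c (Suc i)"
  unfolding hom_of_class_def
proof (rule the_equality)
  have val: "\<phi> v = c (Suc i)"
    if \<phi>: "\<phi> \<in> snd (kl 1 c)" and u: "u \<in> Mcarr (Pobj P 0)" and v: "v \<in> Mcarr (Pobj P 1)"
      and uv: "Paug P u = 1" "Pbd P 1 v = Mact (Pobj P 0) g u - u" for \<phi> u v
  proof -
    have gu: "Mact (Pobj P 0) g u \<in> Mcarr (Pobj P 0)" by (rule module_act[OF T.p.mP g u])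
    obtain \<psi> where \<psi>: "\<psi> \<in> T.p.TC 0" "\<And>v. \<phi> v = Paug Eres (X 1 c 0 (\<alpha> 1 v)) + \<psi> (Pbd P 1 v)"
      using snd_kl[OF \<phi>] by auto
    have \<psi>h: "\<psi> \<in> kG_hom G (Pobj P 0) trivial_module" using \<psi>(1) by (simp add: tate_cochains_def)
    have "\<psi> (Pbd P 1 v) = \<psi> (Mact (Pobj P 0) g u) + \<psi> u"
      unfolding uv(2) T.p.minus_plus by (rule hom_add[OF \<psi>h gu u])
    also have "\<dots> = 0" unfolding hom_act[OF \<psi>h g u] by (simp add: trivial_module_def)
    finally have 1: "\<psi> (Pbd P 1 v) = 0" .
    have "Pbd Eres 1 (\<alpha> 1 v) = \<alpha> 0 (Mact (Pobj P 0) g u + u)"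
      using T.\<alpha>(2)[of 0 v] unfolding uv(2)[symmetric] T.p.minus_plus[symmetric] by simp
    also have "\<dots> = Mact (Eob 0) g (\<alpha> 0 u) + \<alpha> 0 u"
      unfolding hom_add[OF T.\<alpha>(1) gu u] hom_act[OF T.\<alpha>(1) g u] by simp
    finally have "Paug Eres (X 1 c 0 (\<alpha> 1 v)) = c (Suc i)"
      using X1_value[OF g i bd, of "\<alpha> 0 u" "\<alpha> 1 v"] T.\<alpha>_mem[OF u] T.\<alpha>_mem[OF v] T.\<alpha>(3)[of u] uv(1) by simp
    then show ?thesis using \<psi>(2)[of v] 1 by simp
  qed
  obtain u where u: "u \<in> Mcarr (Pobj P 0)" "Paug P u = 1"
    using res_aug_surj[OF T.p.P] by (metis UNIV_I imageE)
  have gu: "Mact (Pobj P 0) g u \<in> Mcarr (Pobj P 0)" by (rule module_act[OF T.p.mP g u(1)])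
  have m: "Mact (Pobj P 0) g u - u \<in> Mcarr (Pobj P 0)"
    unfolding T.p.minus_plus by (rule module_add[OF T.p.mP gu u(1)])
  have "Paug P (Mact (Pobj P 0) g u - u) = Paug P u + Paug P u"
    unfolding T.p.minus_plus hom_add[OF res_aug[OF T.p.P] gu u(1)] hom_act[OF res_aug[OF T.p.P] g u(1)] by (simp add: trivial_module_def)
  then have "Pbd P 0 (Mact (Pobj P 0) g u - u) = 0"
    unfolding res_bd_0[OF T.p.P] by (simp add: res_coaug_zero[OF T.p.P])
  then have "Mact (Pobj P 0) g u - u \<in> Pbd P (0 + 1) ` Mcarr (Pobj P (0 + 1))"
    unfolding res_image[OF T.p.P] using m by simp
  then obtain v where v: "v \<in> Mcarr (Pobj P 1)" "Pbd P 1 v = Mact (Pobj P 0) g u - u" by auto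
  have \<phi>: "Paug P \<circ> T.\<Phi> 1 (X 1 c) 0 \<in> snd (kl 1 c)"
    using T.p.aug_Z[OF \<Phi>X_Z[of 1 c]] T.p.tate_cobd(1) by (simp add: kl_def T.p.tcl_def coh_class_def)
  show "\<exists>\<phi>\<in>snd (kl 1 c). \<exists>u\<in>Mcarr (Pobj P 0). \<exists>v\<in>Mcarr (Pobj P 1).
      Paug P u = 1 \<and> Pbd P 1 v = Mact (Pobj P 0) g u - u \<and> c (Suc i) = \<phi> v"
    using \<phi> u v val[OF \<phi> u(1) v(1) u(2) v(2), symmetric] by (intro bexI[of _ u] bexI[of _ v] bexI[OF _ \<phi>] conjI)
  show "d = c (Suc i)" if "\<exists>\<phi>\<in>snd (kl 1 c). \<exists>u\<in>Mcarr (Pobj P 0). \<exists>v\<in>Mcarr (Pobj P 1).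
      Paug P u = 1 \<and> Pbd P 1 v = Mact (Pobj P 0) g u - u \<and> d = \<phi> v" for d
    using that val by blast
qed

end

section \<open>The shift map of a four-periodic resolution\<close>

context char2_res
begin

text \<open>Periodicity allows the identity family to be read as a cochain of degree
  \<open>n\<close>; this is the shift map.\<close>

lemma idc_periodic:
  assumes per: "\<And>j. Pobj P (j + n) = Pobj P j" "\<And>j. Pbd P (j + n) = Pbd P j"
  shows "idc \<in> Z n"
proof -
  have A: "idc \<in> A n"
    using idc_A per(1) by (simp add: endo_cochains_def)
  have mem: "Pbd P (j + 1) v \<in> Mcarr (Pobj P j)" if "v \<in> Mcarr (Pobj P (j + 1))" for j v
    using hom_mem[OF res_bd'[OF P] that] .
  have "endo_diff P n idc j v = 0" for j v
  proof -
    have p: "Pbd P (j + n + 1) = Pbd P (j + 1)" using per(2)[of "j + 1"] by (simp add: ac_simps)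
    show ?thesis
      unfolding endo_diff_apply p using mem[of v j] hom_out[OF res_bd'[OF P], of v j] res_bd_zero[OF P]
      by (cases "v \<in> Mcarr (Pobj P (j + 1))") (simp_all add: idc_def)
  qed
  then show ?thesis using A by (simp add: cocycles_def fun_eq_iff)
qed

end

context res_pair
begin

text \<open>The product of transported maps contains \<open>\<gamma>\<close> in the middle, which is
  homotopic to the identity. So transport is multiplicative on classes.\<close>

lemma \<Phi>_mult:
  assumes f: "f \<in> r.Z n" and g: "g \<in> r.Z m"
  shows "p.homot (n + m) (endo_comp n (\<Phi> n f) (\<Phi> m g)) (\<Phi> (n + m) (endo_comp n f g))"
proof -
  have eq: "endo_comp n (\<Phi> n f) (\<Phi> m g) = \<Phi> (n + m) (endo_comp n f (endo_comp 0 \<gamma> g))"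
    by (simp add: \<Phi>_def \<gamma>_def endo_comp_def fun_eq_iff add.assoc)
  have \<gamma>g: "endo_comp 0 \<gamma> g \<in> r.Z m" using r.Z_comp[OF \<gamma>_Z g] by simp
  have 1: "r.homot m (endo_comp 0 \<gamma> g) g"
    using r.homot_comp[OF \<gamma>_homot r.homot_refl \<gamma>_Z r.idc_Z g g] r.idc_comp[OF r.Z_A[OF g]] by simp
  have "r.homot (n + m) (endo_comp n f (endo_comp 0 \<gamma> g)) (endo_comp n f g)"
    by (rule r.homot_comp[OF r.homot_refl 1 f f \<gamma>g g])
  then show ?thesis unfolding eq by (rule \<Phi>_homot) (intro r.Z_A r.Z_comp f g \<gamma>g)+
qed

lemma \<Phi>_idc: "p.homot 0 (\<Phi> 0 r.idc) p.idc"
proof -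
  have "Paug P \<circ> \<Phi> 0 r.idc 0 = Paug P \<circ> p.idc 0"
  proof
    fix v show "(Paug P \<circ> \<Phi> 0 r.idc 0) v = (Paug P \<circ> p.idc 0) v"
    proof (cases "v \<in> Mcarr (Pobj P 0)")
      case True
      then show ?thesis by (simp add: Paug_\<Phi> r.idc_def p.idc_def \<alpha>(3))
    next
      case False
      then have "\<alpha> 0 v = 0" by (rule hom_out[OF \<alpha>(1)])
      then show ?thesis using False by (simp add: Paug_\<Phi> r.idc_def p.idc_def res_aug_zero[OF p.P] res_aug_zero[OF r.P])
    qed
  qed
  then have "p.tcl 0 (\<Phi> 0 r.idc) = p.tcl 0 p.idc" by (simp add: p.tcl_def)
  then show ?thesis using p.tcl_eq_iff[OF \<Phi>_Z[OF r.idc_Z] p.idc_Z] by simp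
qed

text \<open>The shift by \<open>-4\<close> is the inverse of the shift by 4 on \<open>R\<close>, and
  transport preserves products and the unit up to homotopy. Invertibility later shows that
  \<open>s\<close> is a nonzero multiple of the standard generator of degree 4.\<close>

lemma shift_unit:
  assumes R: "four_periodic R"
  shows "shift_class G P R \<alpha> \<in> gcomp (tate_alg G P) 4"
    "\<exists>s'\<in>gcomp (tate_alg G P) (-4). gmult (tate_alg G P) (shift_class G P R \<alpha>) s' = gone (tate_alg G P)"
proof -
  have per: "Pobj R (j + 4) = Pobj R j" "Pbd R (j + 4) = Pbd R j" for j
    using R by (simp_all add: four_periodic_def)
  have Z: "r.idc \<in> r.Z 4" by (rule r.idc_periodic) (rule per)+
  have Z': "r.idc \<in> r.Z (-4)"
    by (rule r.idc_periodic) (use per(1)[of "j - 4" for j] per(2)[of "j - 4" for j] in simp_all)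
  have s: "shift_class G P R \<alpha> = p.tcl 4 (\<Phi> 4 r.idc)"
    unfolding shift_class_def p.tcl_def by (simp add: comp_def Paug_\<Phi>) (simp add: shift_map_def r.idc_def)
  show "shift_class G P R \<alpha> \<in> gcomp (tate_alg G P) 4"
    unfolding s p.L_gcomp by (rule imageI[OF \<Phi>_Z[OF Z]])
  have "endo_comp 4 r.idc r.idc = r.idc"
    by (auto simp: endo_comp_def r.idc_def fun_eq_iff per(1))
  then have 1: "p.homot 0 (endo_comp 4 (\<Phi> 4 r.idc) (\<Phi> (-4) r.idc)) (\<Phi> 0 r.idc)"
    using \<Phi>_mult[OF Z Z'] by simp
  have "p.tcl 0 (endo_comp 4 (\<Phi> 4 r.idc) (\<Phi> (-4) r.idc)) = p.tcl 0 (\<Phi> 0 r.idc)"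
    using p.tcl_eq_iff[OF p.Z_comp[OF \<Phi>_Z[OF Z] \<Phi>_Z[OF Z']], of "\<Phi> 0 r.idc"] \<Phi>_Z[OF r.idc_Z] 1 by simp
  also have "\<dots> = gone (tate_alg G P)"
    using p.tcl_eq_iff[OF \<Phi>_Z[OF r.idc_Z] p.idc_Z] \<Phi>_idc by (simp add: p.L_gone)
  finally have "gmult (tate_alg G P) (shift_class G P R \<alpha>) (p.tcl (-4) (\<Phi> (-4) r.idc)) = gone (tate_alg G P)"
    unfolding s p.L_gmult[OF \<Phi>_Z[OF Z] \<Phi>_Z[OF Z']] by simp
  moreover have "p.tcl (-4) (\<Phi> (-4) r.idc) \<in> gcomp (tate_alg G P) (-4)"
    unfolding p.L_gcomp by (rule imageI[OF \<Phi>_Z[OF Z']])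
  ultimately show "\<exists>s'\<in>gcomp (tate_alg G P) (-4). gmult (tate_alg G P) (shift_class G P R \<alpha>) s' = gone (tate_alg G P)"
    by blast
qed

end

section \<open>Powers of \<open>s\<close> and the homogeneous basis\<close>

lemma ptab_0: "\<forall>l\<in>set [0..<6]. ptab l 0 = [l] \<and> ptab 0 l = [l]"
  by code_simp

lemma ptab_values: "ptab 1 1 = [3]" "ptab 2 2 = [4]" "ptab 3 2 = [5]"
  by (simp_all add: ptab_def)

lemma mlist_less: "\<forall>(p, a, b, c)\<in>fst ` set mlist. a < 6 \<and> b < 6 \<and> c < 6"
  by code_simp

context quat_res
begin

text \<open>A scalar multiple of a basis class. The scalar is carried along because \<open>s\<close>
  is only known to be some multiple of the class \<open>kb 1 0 4\<close>, the shift of the minimal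
  resolution.\<close>

definition kb :: "'k \<Rightarrow> nat \<Rightarrow> int \<Rightarrow> int \<times> ('v \<Rightarrow> 'k) set" where
  "kb \<mu> l n = kl n (\<lambda>m. \<mu> * unit_at l m)"

lemma kb_scale: "kb \<mu> l n = gscale \<Lambda> \<mu> (kl n (unit_at l))"
  by (simp add: kb_def kl_scale)

lemma kl_unit: "kl n (unit_at l) = kb 1 l n"
  by (simp add: kb_def)

lemma L_4: "L (4 * i) = {0}" and L_add_4: "L (n + 4 * i) = L n" and L_add_4': "L (4 * i + n) = L n"
  by (simp_all add: L_def set_eq_iff less_6) auto

lemma mulc_0: "m \<in> L n \<Longrightarrow> mulc n (4 * i) c (\<lambda>m. \<nu> * unit_at 0 m) m = \<nu> * c m"
  "m \<in> L n \<Longrightarrow> mulc (4 * i) n (\<lambda>m. \<nu> * unit_at 0 m) c m = \<nu> * c m"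
proof -
  assume m: "m \<in> L n"
  have "mulc n (4 * i) c (\<lambda>m. \<nu> * unit_at 0 m) m = (\<Sum>l\<in>L n. if l = m then \<nu> * c m else 0)"
    unfolding mulc_def L_4
    by (rule sum.cong[OF refl]) (use ptab_0 L_less in \<open>auto simp: unit_at_def ac_simps\<close>)
  then show "mulc n (4 * i) c (\<lambda>m. \<nu> * unit_at 0 m) m = \<nu> * c m"
    using m by (simp add: sum.delta)
  have "mulc (4 * i) n (\<lambda>m. \<nu> * unit_at 0 m) c m =
      (\<Sum>l\<in>L n. if m \<in> set (ptab 0 l) then \<nu> * unit_at 0 0 * c l else 0)"
    unfolding mulc_def L_4 by simp
  also have "\<dots> = (\<Sum>l\<in>L n. if l = m then \<nu> * c m else 0)"
    by (rule sum.cong[OF refl]) (use ptab_0 L_less in \<open>auto simp: unit_at_def ac_simps\<close>)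
  finally show "mulc (4 * i) n (\<lambda>m. \<nu> * unit_at 0 m) c m = \<nu> * c m"
    using m by (simp add: sum.delta)
qed

lemma kl_mult_0: "gmult \<Lambda> (kl n c) (kb \<nu> 0 (4 * i)) = kl (n + 4 * i) (\<lambda>m. \<nu> * c m)"
  "gmult \<Lambda> (kb \<nu> 0 (4 * i)) (kl n c) = kl (4 * i + n) (\<lambda>m. \<nu> * c m)"
  by (simp_all add: kb_def kl_mult kl_eq L_add_4 L_add_4' mulc_0)

lemma kb_mult_0: "gmult \<Lambda> (kb \<mu> l n) (kb \<nu> 0 (4 * i)) = kb (\<mu> * \<nu>) l (n + 4 * i)"
  "gmult \<Lambda> (kb \<nu> 0 (4 * i)) (kb \<mu> l n) = kb (\<mu> * \<nu>) l (4 * i + n)"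
  unfolding kb_def[of \<mu> l n] kl_mult_0 kb_def[of "\<mu> * \<nu>"] by (simp_all add: ac_simps)

lemma kb_gcomp: "kb \<mu> l n \<in> gcomp \<Lambda> n" and kb_homog [simp]: "kb \<mu> l n \<in> homog \<Lambda>" and fst_kb [simp]: "fst (kb \<mu> l n) = n"
  unfolding kb_def by (rule kl_gcomp kl_homog kl_fst)+

lemma gpow_kb:
  assumes lam: "lam \<noteq> 0"
  shows "gpow \<Lambda> (kb lam 0 4) i = kb (lam powi i) 0 (4 * i)"
proof -
  have one: "gone \<Lambda> = kb 1 0 0" by (simp add: kl_one kl_unit)
  have pow: "(gmult \<Lambda> (kb \<mu> 0 (4 * k)) ^^ n) (gone \<Lambda>) = kb (\<mu> ^ n) 0 (4 * (k * int n))" for \<mu> k n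
  proof (induction n)
    case (Suc n)
    then show ?case using kb_mult_0(2)[where \<nu> = \<mu> and i = k and \<mu> = "\<mu> ^ n" and l = 0 and n = "4 * (k * int n)"] by (simp add: algebra_simps)
  qed (simp add: one)
  have inv: "ginv \<Lambda> (kb lam 0 4) = kb (inverse lam) 0 (-4)"
    unfolding ginv_def
  proof (rule the_equality)
    show "kb (inverse lam) 0 (-4) \<in> gcomp \<Lambda> (- gdeg \<Lambda> (kb lam 0 4)) \<and>
        gmult \<Lambda> (kb lam 0 4) (kb (inverse lam) 0 (-4)) = gone \<Lambda> \<and> gmult \<Lambda> (kb (inverse lam) 0 (-4)) (kb lam 0 4) = gone \<Lambda>"
      using kb_gcomp kb_mult_0(1)[where \<mu> = lam and l = 0 and n = 4 and \<nu> = "inverse lam" and i = "-1"]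
        kb_mult_0(1)[where \<mu> = "inverse lam" and l = 0 and n = "-4" and \<nu> = lam and i = 1] lam one by simp
    \<comment> \<open>Degree \<open>-4\<close> is one-dimensional, so the equation fixes the single
      coordinate of \<open>b\<close>.\<close>
    fix b assume b: "b \<in> gcomp \<Lambda> (- gdeg \<Lambda> (kb lam 0 4)) \<and> gmult \<Lambda> (kb lam 0 4) b = gone \<Lambda> \<and> gmult \<Lambda> b (kb lam 0 4) = gone \<Lambda>"
    then obtain c where c: "b = kl (-4) c" using kl_cases[of b "-4"] by auto
    have "kl 0 (\<lambda>m. lam * c m) = kl 0 (unit_at 0)"
      using b kl_mult_0(1)[where n = "-4" and c = c and \<nu> = lam and i = 1] by (simp add: c kl_one)
    then have "lam * c 0 = 1" by (simp add: kl_eq L_eq unit_at_def)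
    then have "c 0 = inverse lam" by (metis inverse_unique mult.commute)
    then show "b = kb (inverse lam) 0 (-4)" by (simp add: c kb_def kl_eq L_eq unit_at_def)
  qed
  show ?thesis
  proof (cases "0 \<le> i")
    case True
    then show ?thesis using pow[where \<mu> = lam and k = 1 and n = "nat i"] by (simp add: gpow_def power_int_def)
  next
    case False
    then show ?thesis
      unfolding gpow_def inv using pow[where \<mu> = "inverse lam" and k = "-1" and n = "nat (- i)"] by (simp add: power_int_def)
  qed
qed

lemma kb_mult: "a \<in> L n \<Longrightarrow> b \<in> L n' \<Longrightarrow> ptab a b = [l] \<Longrightarrow> gmult \<Lambda> (kb 1 a n) (kb 1 b n') = kb 1 l (n + n')"
  unfolding kl_unit[symmetric] kl_mult kl_eq mulc_unit by (simp add: unit_at_def)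

lemma Q_basis_kb: "Q_basis \<Lambda> (kb 1 1 1) (kb 1 2 1) = map (\<lambda>l. kb 1 l (int (bdeg l))) [0, 1, 2, 3, 4, 5]"
proof -
  have "gmult \<Lambda> (kb 1 1 1) (kb 1 1 1) = kb 1 3 2" "gmult \<Lambda> (kb 1 2 1) (kb 1 2 1) = kb 1 4 2" "gmult \<Lambda> (kb 1 3 2) (kb 1 2 1) = kb 1 5 3"
    using kb_mult[OF _ _ ptab_values(1), of 1 1] kb_mult[OF _ _ ptab_values(2), of 1 1] kb_mult[OF _ _ ptab_values(3), of 2 1]
    by (simp_all add: L_eq)
  then show ?thesis by (simp add: Q_basis_def kl_one kl_unit)
qed

lemma Q_basis_nth: "l < 6 \<Longrightarrow> Q_basis \<Lambda> (kb 1 1 1) (kb 1 2 1) ! l = kb 1 l (int (bdeg l))"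
  unfolding Q_basis_kb less_6 by (elim insertE emptyE) simp_all

lemma fst_gcomp: "a \<in> gcomp \<Lambda> n \<Longrightarrow> fst a = n"
  by (erule kl_cases) simp

lemma gsum_kl: "gsum \<Lambda> n (map (\<lambda>p. kl n (d p)) ps) = kl n (\<lambda>m. \<Sum>p\<leftarrow>ps. d p m)"
proof (induction ps)
  case (Cons p ps)
  then show ?case unfolding gsum_def by (simp add: kl_add) (simp add: kl_eq)
qed (simp add: gsum_def kl_zero)

lemma basis:
  assumes lam: "lam \<noteq> 0"
  shows "homogeneous_basis \<Lambda> ({..<6} \<times> UNIV)
    (\<lambda>(l, i). gmult \<Lambda> (Q_basis \<Lambda> (kb 1 1 1) (kb 1 2 1) ! l) (gpow \<Lambda> (kb lam 0 4) i))"
proof -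
  define e where "e = (\<lambda>(l, i). gmult \<Lambda> (Q_basis \<Lambda> (kb 1 1 1) (kb 1 2 1) ! l) (gpow \<Lambda> (kb lam 0 4) i))"
  have e: "e (l, i) = kb (lam powi i) l (int (bdeg l) + 4 * i)" if "l < 6" for l i
    unfolding e_def prod.case Q_basis_nth[OF that] gpow_kb[OF lam] kb_mult_0 by simp
  have deg: "n = int (bdeg l) + 4 * i" if "l < 6" "e (l, i) \<in> gcomp \<Lambda> n" for l i n
    using fst_gcomp[OF that(2)] unfolding e[OF that(1)] by simp
  \<comment> \<open>Basis degrees are below 4, so the degree of a product with a power of
    \<open>s\<close> determines the exponent as its quotient by 4.\<close>
  have div: "l \<in> L n" "i = n div 4" if "l < 6" "n = int (bdeg l) + 4 * i" for l i n
  proof -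
    have "bdeg l < 4" using that(1) by (auto simp: less_6)
    then show "l \<in> L n" "i = n div 4" using that by (simp_all add: L_def)
  qed
  have cong: "gsum \<Lambda> n (map (\<lambda>p. gscale \<Lambda> (c p) (e p)) ps) =
      kl n (\<lambda>m. \<Sum>p\<leftarrow>ps. c p * (lam powi snd p * unit_at (fst p) m))"
    if ps: "set ps \<subseteq> {p \<in> {..<6} \<times> UNIV. e p \<in> gcomp \<Lambda> n}" for n c ps
  proof -
    have "gscale \<Lambda> (c p) (e p) = kl n (\<lambda>m. c p * (lam powi snd p * unit_at (fst p) m))" if "p \<in> set ps" for p
      using ps that e[of "fst p" "snd p"] deg[of "fst p" "snd p" n] by (auto simp: kb_def kl_scale)
    then have "map (\<lambda>p. gscale \<Lambda> (c p) (e p)) ps = map (\<lambda>p. kl n (\<lambda>m. c p * (lam powi snd p * unit_at (fst p) m))) ps"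
      by simp
    then show ?thesis by (simp only: gsum_kl)
  qed
  show ?thesis
    unfolding homogeneous_basis_def e_def[symmetric]
  proof (intro conjI allI ballI impI)
    show "e ` ({..<6} \<times> UNIV) \<subseteq> homog \<Lambda>" using e by auto
  next
    fix n a assume "a \<in> gcomp \<Lambda> n"
    then obtain c where a: "a = kl n c" by (rule kl_cases)
    define ls where "ls = sorted_list_of_set (L n)"
    have ls: "set ls = L n" "distinct ls" by (simp_all add: ls_def)
    \<comment> \<open>All members have the same exponent \<open>n div 4\<close>. The power of
      \<open>lam\<close> that comes with this power of \<open>s\<close> is divided out in the
      coefficients.\<close>
    let ?ps = "map (\<lambda>l. (l, n div 4)) ls" and ?c = "\<lambda>p. c (fst p) / lam powi snd p"
    have ps: "set ?ps \<subseteq> {p \<in> {..<6} \<times> UNIV. e p \<in> gcomp \<Lambda> n}"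
    proof
      fix p assume "p \<in> set ?ps"
      then obtain l where l: "p = (l, n div 4)" "l \<in> L n" using ls by auto
      have "int (bdeg l) + 4 * (n div 4) = n" unfolding L_bdeg[OF l(2)] by simp
      then show "p \<in> {p \<in> {..<6} \<times> UNIV. e p \<in> gcomp \<Lambda> n}"
        using l L_less[OF l(2)] e[OF L_less[OF l(2)], of "n div 4"] kb_gcomp by simp
    qed
    have "(\<Sum>p\<leftarrow>?ps. ?c p * (lam powi snd p * unit_at (fst p) m)) = c m" if m: "m \<in> L n" for m
    proof -
      have "(\<Sum>p\<leftarrow>?ps. ?c p * (lam powi snd p * unit_at (fst p) m)) = (\<Sum>l\<in>L n. if l = m then c m else 0)"
        unfolding ls(1)[symmetric] sum_list_distinct_conv_sum_set[OF ls(2), symmetric]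
        using lam by (simp add: o_def unit_at_def if_distrib) (rule arg_cong[of _ _ sum_list], auto simp: unit_at_def)
      then show ?thesis using m by (simp add: sum.delta)
    qed
    then have "a = gsum \<Lambda> n (map (\<lambda>p. gscale \<Lambda> (?c p) (e p)) ?ps)"
      unfolding cong[OF ps] a kl_eq by simp
    then show "\<exists>is c. set is \<subseteq> {i \<in> {..<6} \<times> UNIV. e i \<in> gcomp \<Lambda> n} \<and> a = gsum \<Lambda> n (map (\<lambda>i. gscale \<Lambda> (c i) (e i)) is)"
      using ps by (intro exI[of _ ?ps] exI[of _ ?c] conjI)
  next
    fix n ps c p
    assume h: "distinct ps \<and> set ps \<subseteq> {i \<in> {..<6} \<times> UNIV. e i \<in> gcomp \<Lambda> n} \<and>
      gsum \<Lambda> n (map (\<lambda>i. gscale \<Lambda> (c i) (e i)) ps) = gzero \<Lambda> n" and p: "p \<in> set ps"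
    have ps: "snd q = n div 4" "fst q \<in> L n" if "q \<in> set ps" for q
      using h that deg[of "fst q" "snd q" n] div[of "fst q" n "snd q"] by auto
    have "kl n (\<lambda>m. \<Sum>p\<leftarrow>ps. c p * (lam powi snd p * unit_at (fst p) m)) = kl n (\<lambda>_. 0)"
      using h cong[of ps n c] by (simp add: kl_zero)
    then have "0 = (\<Sum>q\<leftarrow>ps. c q * (lam powi snd q * unit_at (fst q) (fst p)))"
      using ps(2)[OF p] by (simp add: kl_eq)
    also have "\<dots> = (\<Sum>q\<in>set ps. c q * (lam powi snd q * unit_at (fst q) (fst p)))"
      using h by (simp add: sum_list_distinct_conv_sum_set)
    also have "\<dots> = (\<Sum>q\<in>set ps. if q = p then c p * lam powi snd p else 0)"
    proof (rule sum.cong[OF refl])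
      fix q assume "q \<in> set ps"
      then have "fst p = fst q \<longleftrightarrow> q = p" using ps(1)[of q] ps(1)[OF p] by (auto simp only: prod_eq_iff)
      then show "c q * (lam powi snd q * unit_at (fst q) (fst p)) = (if q = p then c p * lam powi snd p else 0)"
        by (auto simp: unit_at_def)
    qed
    also have "\<dots> = c p * lam powi snd p" using p by (simp add: sum.delta)
    finally show "c p = 0" using lam by simp
  qed
qed

end

section \<open>Values of the canonical cocycle and uniqueness of the prescribed cochain\<close>

context char2_res
begin

lemma cochain_scale:
  assumes \<phi>: "\<phi> \<in> hh_cochains \<Lambda> 3 m" and h: "u \<in> homog \<Lambda>" "v \<in> homog \<Lambda>" "w \<in> homog \<Lambda>"
  shows "\<phi> [gscale \<Lambda> e u, v, w] = gscale \<Lambda> e (\<phi> [u, v, w])" "\<phi> [u, gscale \<Lambda> e v, w] = gscale \<Lambda> e (\<phi> [u, v, w])"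
    "\<phi> [u, v, gscale \<Lambda> e w] = gscale \<Lambda> e (\<phi> [u, v, w])"
proof -
  have t: "[u, v, w] \<in> tuples \<Lambda> 3" using h by (simp add: tuples_def)
  have *: "\<forall>as\<in>tuples \<Lambda> 3. \<forall>i<3. \<forall>c. \<forall>a\<in>homog \<Lambda>. \<phi> (as[i := gscale \<Lambda> c a]) = gscale \<Lambda> c (\<phi> (as[i := a]))"
    using \<phi> unfolding hh_cochains_def by blast
  show "\<phi> [gscale \<Lambda> e u, v, w] = gscale \<Lambda> e (\<phi> [u, v, w])"
    using *[rule_format, OF t, of 0 u e] h by simp
  show "\<phi> [u, gscale \<Lambda> e v, w] = gscale \<Lambda> e (\<phi> [u, v, w])"
    using *[rule_format, OF t, of 1 v e] h by simp
  show "\<phi> [u, v, gscale \<Lambda> e w] = gscale \<Lambda> e (\<phi> [u, v, w])"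
    using *[rule_format, OF t, of 2 w e] h by (simp add: numeral_2_eq_2)
qed

lemma cochain_add:
  assumes \<phi>: "\<phi> \<in> hh_cochains \<Lambda> 3 m" and g: "u \<in> gcomp \<Lambda> n" "u' \<in> gcomp \<Lambda> n" and h: "v \<in> homog \<Lambda>" "w \<in> homog \<Lambda>"
  shows "\<phi> [gadd \<Lambda> u u', v, w] = gadd \<Lambda> (\<phi> [u, v, w]) (\<phi> [u', v, w])" "\<phi> [v, gadd \<Lambda> u u', w] = gadd \<Lambda> (\<phi> [v, u, w]) (\<phi> [v, u', w])"
    "\<phi> [v, w, gadd \<Lambda> u u'] = gadd \<Lambda> (\<phi> [v, w, u]) (\<phi> [v, w, u'])"
proof -
  have "u \<in> homog \<Lambda>" using g by (auto simp: homog_def)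
  then have t: "[u, v, w] \<in> tuples \<Lambda> 3" "[v, u, w] \<in> tuples \<Lambda> 3" "[v, w, u] \<in> tuples \<Lambda> 3" using h by (simp_all add: tuples_def)
  have *: "\<forall>as\<in>tuples \<Lambda> 3. \<forall>i<3. \<forall>d. \<forall>a\<in>gcomp \<Lambda> d. \<forall>b\<in>gcomp \<Lambda> d.
      \<phi> (as[i := gadd \<Lambda> a b]) = gadd \<Lambda> (\<phi> (as[i := a])) (\<phi> (as[i := b]))"
    using \<phi> unfolding hh_cochains_def by blast
  show "\<phi> [gadd \<Lambda> u u', v, w] = gadd \<Lambda> (\<phi> [u, v, w]) (\<phi> [u', v, w])"
    using *[rule_format, OF t(1) _ g, of 0] by simp
  show "\<phi> [v, gadd \<Lambda> u u', w] = gadd \<Lambda> (\<phi> [v, u, w]) (\<phi> [v, u', w])"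
    using *[rule_format, OF t(2) _ g, of 1] by simp
  show "\<phi> [v, w, gadd \<Lambda> u u'] = gadd \<Lambda> (\<phi> [v, w, u]) (\<phi> [v, w, u'])"
    using *[rule_format, OF t(3) _ g, of 2] by (simp add: numeral_2_eq_2)
qed

end

lemma mlist_distinct: "distinct (map fst mlist)"
  by code_simp

lemma mtab_mlist: "((p, a, b, c), ls) \<in> set mlist \<Longrightarrow> mtab p a b c = ls"
  using map_of_is_SomeI[OF mlist_distinct] by (simp add: mtab_def)

lemma mtab_notin: "(p, a, b, c) \<notin> fst ` set mlist \<Longrightarrow> mtab p a b c = []"
  by (simp add: mtab_def map_of_eq_None_iff[symmetric] split: option.split)

text \<open>\<open>A p l\<close> stands for the basis element \<open>l\<close>, multiplied by
  \<open>s\<close> if \<open>p\<close> holds. It is kept abstract here and in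
  \<open>table_values\<close>, so that both tables are matched by rewriting with the listed products
  alone.\<close>

lemma table_keys:
  fixes A :: "bool \<Rightarrow> nat \<Rightarrow> 'a"
  assumes "gmult \<Lambda> (A False 1) (A False 1) = A False 3" "gmult \<Lambda> (A False 2) (A False 2) = A False 4"
    "gmult \<Lambda> (A False 3) (A False 2) = A False 5" "gmult \<Lambda> (A True 0) (A False 1) = A True 1"
    "gmult \<Lambda> (A True 0) (A False 2) = A True 2" "gmult \<Lambda> (A True 0) (A False 3) = A True 3" "gmult \<Lambda> (A True 0) (A False 4) = A True 4"
  shows "map fst (Q_table \<Lambda> (A False 1) (A False 2) (A True 0)) = map (\<lambda>((p, a, b, c), ls). [A p a, A False b, A False c]) mlist"
  by (simp only: Q_table_def Let_def mlist_def assms list.map fst_conv prod.case)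

lemma table_values:
  fixes A :: "bool \<Rightarrow> nat \<Rightarrow> 'a"
  assumes "gmult \<Lambda> (A False 1) (A False 1) = A False 3" "gmult \<Lambda> (A False 2) (A False 2) = A False 4"
    "gmult \<Lambda> (A False 3) (A False 2) = A False 5" "gmult \<Lambda> (A False 3) (A True 0) = A True 3"
    "gmult \<Lambda> (A False 4) (A True 0) = A True 4" "gmult \<Lambda> (A False 5) (A True 0) = A True 5"
    "gmult \<Lambda> (gadd \<Lambda> (A False 1) (A False 2)) (A True 0) = B 5 [1, 2]" "gmult \<Lambda> (gadd \<Lambda> (A False 3) (A False 4)) (A True 0) = B 6 [3, 4]"
    and deg: "A False 3 = B 2 [3]" "A False 4 = B 2 [4]" "A True 3 = B 6 [3]" "A True 4 = B 6 [4]" "A True 5 = B 7 [5]"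
  shows "map snd (Q_table \<Lambda> (A False 1) (A False 2) (A True 0)) =
    map (\<lambda>((p, a, b, c), ls). B (int (bdeg a) + (if p then 4 else 0) + int (bdeg b) + int (bdeg c) - 1) ls) mlist"
proof -
  have "map snd (Q_table \<Lambda> (A False 1) (A False 2) (A True 0)) =
    [A False 3, A False 4, B 5 [1, 2], B 5 [1, 2], A True 3, A True 3, B 6 [3, 4], B 6 [3, 4], A True 4, A True 4,
     A True 5, A True 5, B 6 [3, 4], B 6 [3, 4], A True 4, A True 3, A True 5, A True 5, A True 5, A True 5, A True 5,
     A True 5, A True 5, A True 5, A True 5, A True 5, A True 5, A True 5]"
    by (simp only: Q_table_def Let_def assms(1-8) list.map snd_conv)
  then show ?thesis
    by (simp add: mlist_def deg)
qed

lemma zip_map_same: "zip (map f xs) (map g xs) = map (\<lambda>x. (f x, g x)) xs"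
  by (induction xs) simp_all

context quat_res
begin

abbreviation "cc \<equiv> canonical_cocycle G P ff1 ff2"

lemma cc_kb:
  assumes "a \<in> L n" "b \<in> L n'" "c \<in> L n''"
  shows "cc [kb \<mu> a n, kb \<nu> b n', kb \<rho> c n''] =
    kl (n + n' + n'' - 1) (\<lambda>l. \<mu> * (\<nu> * (\<rho> * of_bool (l \<in> set (mtab (ix n \<noteq> bdeg a) a b c)))))"
proof -
  note cc = C.canonical_cocycle_cochain
  note 1 = T.p.cochain_scale(1)[OF cc kl_homog T.p.L_scale_homog[OF kl_homog] T.p.L_scale_homog[OF kl_homog]]
  note 2 = T.p.cochain_scale(2)[OF cc kl_homog kl_homog T.p.L_scale_homog[OF kl_homog]]
  note 3 = T.p.cochain_scale(3)[OF cc kl_homog kl_homog kl_homog]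
  have "cc [kb \<mu> a n, kb \<nu> b n', kb \<rho> c n''] =
      gscale \<Lambda> \<mu> (gscale \<Lambda> \<nu> (gscale \<Lambda> \<rho> (cc [kl n (unit_at a), kl n' (unit_at b), kl n'' (unit_at c)])))"
    unfolding kb_scale 1 2 3 ..
  then show ?thesis unfolding cocycle_unit[OF assms] kl_scale .
qed

definition AA :: "'k \<Rightarrow> bool \<Rightarrow> nat \<Rightarrow> int \<times> ('v \<Rightarrow> 'k) set" where
  "AA lam p l = kb (if p then lam else 1) l (int (bdeg l) + (if p then 4 else 0))"

text \<open>The sum of the basis classes in \<open>ls\<close>, with the scalar of \<open>s\<close>
  where the value contains \<open>s\<close>. In the table this is the case exactly in degrees above
  4, see \<open>mlist_deg\<close>.\<close>

definition BB :: "'k \<Rightarrow> int \<Rightarrow> nat list \<Rightarrow> int \<times> ('v \<Rightarrow> 'k) set" where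
  "BB lam n ls = kl n (\<lambda>l. (if 4 < n then lam else 1) * of_bool (l \<in> set ls))"

lemma ix_parity: "a < 6 \<Longrightarrow> ix (int (bdeg a) + (if p then 4 else 0) + 8 * h) \<noteq> bdeg a \<longleftrightarrow> p"
  unfolding ix_def less_6 by (elim insertE emptyE) (simp_all add: mod_mult_self2)

lemma cc_values:
  assumes "a < 6" "b < 6" "c < 6"
  shows "cc [kb \<mu> a (int (bdeg a) + (if p then 4 else 0) + 8 * h), kb \<nu> b (int (bdeg b) + 4 * i), kb \<rho> c (int (bdeg c) + 4 * j)] =
    kl (int (bdeg a) + (if p then 4 else 0) + 8 * h + (int (bdeg b) + 4 * i) + (int (bdeg c) + 4 * j) - 1)
      (\<lambda>l. \<mu> * (\<nu> * (\<rho> * of_bool (l \<in> set (mtab p a b c)))))"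
proof -
  have L: "l \<in> L (int (bdeg l) + 4 * i)" if "l < 6" for l i
    using bdeg_L[OF that, of i] by (simp add: add.commute)
  have "a \<in> L (int (bdeg a) + (if p then 4 else 0) + 8 * h)"
    using L[OF assms(1), of "(if p then 1 else 0) + 2 * h"] by (cases p) (simp_all add: algebra_simps)
  from cc_kb[OF this L[OF assms(2)] L[OF assms(3)]] show ?thesis
    unfolding ix_parity[OF assms(1)] .
qed

lemma mlist_deg: "((p, a, b, c), ls) \<in> set mlist \<Longrightarrow> 4 < int (bdeg a) + (if p then 4 else 0) + int (bdeg b) + int (bdeg c) - 1 \<longleftrightarrow> p"
  unfolding mlist_def by auto

context
  fixes lam :: 'k
  assumes lam: "lam \<noteq> 0"
begin

abbreviation "x \<equiv> kb 1 1 1"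
abbreviation "y \<equiv> kb 1 2 1"
abbreviation "s \<equiv> kb lam 0 4"

lemma AA_simps: "x = AA lam False 1" "y = AA lam False 2" "s = AA lam True 0"
  by (simp_all add: AA_def)

lemma AA_s: "gmult \<Lambda> (AA lam False l) s = AA lam True l" "gmult \<Lambda> s (AA lam False l) = AA lam True l"
  using kb_mult_0(1)[where \<mu> = 1 and l = l and n = "int (bdeg l)" and \<nu> = lam and i = 1]
    kb_mult_0(2)[where \<mu> = 1 and l = l and n = "int (bdeg l)" and \<nu> = lam and i = 1]
  by (simp_all add: AA_def add.commute)

lemma AA_pow: "gmult \<Lambda> (AA lam p l) (gpow \<Lambda> s i) =
    kb ((if p then lam else 1) * lam powi i) l (int (bdeg l) + (if p then 4 else 0) + 4 * i)"
  unfolding AA_def gpow_kb[OF lam] kb_mult_0 ..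

lemma AA_pow': "gmult \<Lambda> (AA lam False l) (gpow \<Lambda> s i) = kb (lam powi i) l (int (bdeg l) + 4 * i)"
  using AA_pow[of False] by simp

lemma set_basis: "set (Q_basis \<Lambda> x y) = AA lam False ` {..<6}"
proof -
  have "{..<6} = {0, 1, 2, 3, 4, 5 :: nat}" by auto
  then show ?thesis unfolding Q_basis_kb by (simp add: AA_def)
qed

lemma set_basis_s: "set (Q_basis \<Lambda> x y) \<union> (\<lambda>b. gmult \<Lambda> b s) ` set (Q_basis \<Lambda> x y) = {AA lam p l | p l. l < 6}"
proof -
  have "(\<lambda>b. gmult \<Lambda> b s) ` AA lam False ` {..<6} = AA lam True ` {..<6}"
    unfolding image_image AA_s ..
  moreover have "AA lam False ` {..<6} \<union> AA lam True ` {..<6} = {AA lam p l | p l. l < 6}"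
  proof -
    have "{AA lam p l | p l. l < 6} = (\<Union>p. AA lam p ` {..<6})" by blast
    then show ?thesis by (simp add: UNIV_bool Un_commute)
  qed
  ultimately show ?thesis unfolding set_basis by simp
qed

lemma products:
  "gmult \<Lambda> (AA lam False 1) (AA lam False 1) = AA lam False 3" "gmult \<Lambda> (AA lam False 2) (AA lam False 2) = AA lam False 4"
  "gmult \<Lambda> (AA lam False 3) (AA lam False 2) = AA lam False 5"
  using kb_mult[OF _ _ ptab_values(1), of 1 1] kb_mult[OF _ _ ptab_values(2), of 1 1] kb_mult[OF _ _ ptab_values(3), of 2 1]
  by (simp_all add: L_eq AA_def)

lemma sums:
  "gmult \<Lambda> (gadd \<Lambda> (AA lam False 1) (AA lam False 2)) (AA lam True 0) = BB lam 5 [1, 2]"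
  "gmult \<Lambda> (gadd \<Lambda> (AA lam False 3) (AA lam False 4)) (AA lam True 0) = BB lam 6 [3, 4]"
  unfolding AA_simps(3)[symmetric]
  using kl_mult_0(1)[where n = 1 and c = "\<lambda>m. unit_at 1 m + unit_at 2 m" and \<nu> = lam and i = 1]
    kl_mult_0(1)[where n = 2 and c = "\<lambda>m. unit_at 3 m + unit_at 4 m" and \<nu> = lam and i = 1]
  by (simp_all add: AA_def BB_def kb_def kl_add plus_fun_def kl_eq L_eq unit_at_def)

lemma singles: "AA lam False 3 = BB lam 2 [3]" "AA lam False 4 = BB lam 2 [4]" "AA lam True 3 = BB lam 6 [3]"
    "AA lam True 4 = BB lam 6 [4]" "AA lam True 5 = BB lam 7 [5]"
  by (simp_all add: AA_def BB_def kb_def unit_at_def kl_eq L_eq)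

lemma table: "Q_table \<Lambda> x y s = map (\<lambda>e. ((\<lambda>((p, a, b, c), ls). [AA lam p a, AA lam False b, AA lam False c]) e,
    (\<lambda>((p, a, b, c), ls). BB lam (int (bdeg a) + (if p then 4 else 0) + int (bdeg b) + int (bdeg c) - 1) ls) e)) mlist"
proof -
  note S = AA_s[unfolded AA_simps(3)]
  note keys = table_keys[of \<Lambda> "AA lam", OF products S(2) S(2) S(2) S(2)]
  note vals = table_values[of \<Lambda> "AA lam", OF products S(1) S(1) S(1) sums singles]
  have "zip (map fst (Q_table \<Lambda> x y s)) (map snd (Q_table \<Lambda> x y s)) = Q_table \<Lambda> x y s"
    by (rule zip_map_fst_snd)
  then show ?thesis
    unfolding AA_simps keys vals zip_map_same by (rule sym)
qed

lemma cc_AA: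
  assumes "a < 6" "b < 6" "c < 6"
  shows "cc [AA lam p a, AA lam False b, AA lam False c] =
    kl (int (bdeg a) + (if p then 4 else 0) + int (bdeg b) + int (bdeg c) - 1) (\<lambda>l. (if p then lam else 1) * of_bool (l \<in> set (mtab p a b c)))"
  using cc_values[OF assms, where h = 0 and i = 0 and j = 0 and p = p and \<mu> = "if p then lam else 1" and \<nu> = 1 and \<rho> = 1] by (simp add: AA_def)

lemma cc_Q_values: "Q_values \<Lambda> x y s cc"
  unfolding Q_values_def Let_def set_basis_s
proof (intro conjI allI ballI impI)
  fix h i j u v w
  assume "u \<in> {AA lam p l | p l. l < 6}" "v \<in> set (Q_basis \<Lambda> x y)" "w \<in> set (Q_basis \<Lambda> x y)"
  then obtain p a b c where u: "u = AA lam p a" "a < 6" and v: "v = AA lam False b" "b < 6" and w: "w = AA lam False c" "c < 6"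
    unfolding set_basis by auto
  show "cc [gmult \<Lambda> u (gpow \<Lambda> s (2 * h)), gmult \<Lambda> v (gpow \<Lambda> s i), gmult \<Lambda> w (gpow \<Lambda> s j)] =
      gmult \<Lambda> (cc [u, v, w]) (gpow \<Lambda> s (2 * h + i + j))"
  proof -
    have h8: "4 * (2 * h) = 8 * h" by simp
    note lhs = cc_values[OF u(2) v(2) w(2), where h = h and i = i and j = j and p = p and \<mu> = "(if p then lam else 1) * lam powi (2 * h)"
        and \<nu> = "lam powi i" and \<rho> = "lam powi j"]
    show ?thesis
      unfolding u(1) v(1) w(1) AA_pow' AA_pow[of p] h8 lhs
      unfolding cc_AA[OF u(2) v(2) w(2)] gpow_kb[OF lam] kl_mult_0
    proof (rule arg_cong2[of _ _ _ _ kl], goal_cases)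
      case 1
      show ?case by simp
    next
      case 2
      show ?case using lam by (simp add: power_int_add fun_eq_iff ac_simps)
    qed
  qed
next
  fix u v w
  assume "u \<in> {AA lam p l | p l. l < 6}" "v \<in> set (Q_basis \<Lambda> x y)" "w \<in> set (Q_basis \<Lambda> x y)"
    and notin: "[u, v, w] \<notin> fst ` set (Q_table \<Lambda> x y s)"
  then obtain p a b c where u: "u = AA lam p a" "a < 6" and v: "v = AA lam False b" "b < 6" and w: "w = AA lam False c" "c < 6"
    unfolding set_basis by auto
  have "(p, a, b, c) \<notin> fst ` set mlist"
  proof
    assume "(p, a, b, c) \<in> fst ` set mlist"
    then obtain ls where "((p, a, b, c), ls) \<in> set mlist" by auto
    then have "[u, v, w] \<in> fst ` set (Q_table \<Lambda> x y s)"
      unfolding table u(1) v(1) w(1) set_map image_image by (intro image_eqI) auto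
    then show False using notin by simp
  qed
  then have "mtab p a b c = []" by (rule mtab_notin)
  then show "cc [u, v, w] = gzero \<Lambda> (tdeg \<Lambda> [u, v, w] - 1)"
    unfolding u(1) v(1) w(1) cc_AA[OF u(2) v(2) w(2)] kl_zero by (simp add: tdeg_def AA_def add.assoc)
next
  fix e assume "e \<in> set (Q_table \<Lambda> x y s)"
  then obtain p a b c ls where m: "((p, a, b, c), ls) \<in> set mlist"
    and e: "e = ([AA lam p a, AA lam False b, AA lam False c], BB lam (int (bdeg a) + (if p then 4 else 0) + int (bdeg b) + int (bdeg c) - 1) ls)"
    unfolding table set_map by auto
  have "a < 6 \<and> b < 6 \<and> c < 6" using mlist_less m by force
  then show "case e of (as, v) \<Rightarrow> cc as = v"
    unfolding e prod.case using mtab_mlist[OF m] mlist_deg[OF m] by (simp add: cc_AA BB_def)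
qed

text \<open>Multilinear statements are reduced to basis classes. Each degree contains at most two of
  them, so the sums are written out for every residue modulo four.\<close>

lemma kl_induct:
  assumes unit: "\<And>l. l \<in> L n \<Longrightarrow> Pr (kl n (unit_at l))"
    and add: "\<And>c c'. Pr (kl n c) \<Longrightarrow> Pr (kl n c') \<Longrightarrow> Pr (gadd \<Lambda> (kl n c) (kl n c'))"
    and scale: "\<And>e c. Pr (kl n c) \<Longrightarrow> Pr (gscale \<Lambda> e (kl n c))"
  shows "Pr (kl n c)"
proof -
  have one: "Pr (kl n (\<lambda>m. c l * unit_at l m))" if "l \<in> L n" for l
    using scale[OF unit[OF that], of "c l"] by (simp only: kl_scale)
  have two: "Pr (kl n (\<lambda>m. c l * unit_at l m + c l' * unit_at l' m))" if "l \<in> L n" "l' \<in> L n" for l l'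
    using add[OF one[OF that(1)] one[OF that(2)]] by (simp only: kl_add plus_fun_def)
  show ?thesis
  proof (cases rule: mod_4_cases[of n])
    case 1
    have "kl n c = kl n (\<lambda>m. c 0 * unit_at 0 m)" by (simp add: kl_eq L_eq[OF] 1 unit_at_def)
    then show ?thesis using one[of 0] by (simp add: L_eq 1)
  next
    case 2
    have "kl n c = kl n (\<lambda>m. c 1 * unit_at 1 m + c 2 * unit_at 2 m)" by (simp add: kl_eq L_eq 2 unit_at_def)
    then show ?thesis using two[of 1 2] by (simp add: L_eq 2)
  next
    case 3
    have "kl n c = kl n (\<lambda>m. c 3 * unit_at 3 m + c 4 * unit_at 4 m)" by (simp add: kl_eq L_eq 3 unit_at_def)
    then show ?thesis using two[of 3 4] by (simp add: L_eq 3)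
  next
    case 4
    have "kl n c = kl n (\<lambda>m. c 5 * unit_at 5 m)" by (simp add: kl_eq L_eq 4 unit_at_def)
    then show ?thesis using one[of 5] by (simp add: L_eq 4)
  qed
qed

text \<open>The table allows arbitrary powers of \<open>s\<close> in the last two arguments but only
  even ones in the first, where an odd power leaves one factor \<open>s\<close> in
  \<open>AA lam True l\<close>. So each basis class needs both normal forms.\<close>

lemma unit_repr:
  assumes l: "l \<in> L n"
  shows "\<exists>\<mu> i. kl n (unit_at l) = gscale \<Lambda> \<mu> (gmult \<Lambda> (AA lam False l) (gpow \<Lambda> s i))"
    and "\<exists>\<mu> p h. kl n (unit_at l) = gscale \<Lambda> \<mu> (gmult \<Lambda> (AA lam p l) (gpow \<Lambda> s (2 * h)))"
proof -
  have n: "n = int (bdeg l) + 4 * (n div 4)" unfolding L_bdeg[OF l] by simp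
  have sc: "kl n (unit_at l) = gscale \<Lambda> (inverse \<mu>) (kb \<mu> l n)" if "\<mu> \<noteq> 0" for \<mu>
    using that by (simp add: kb_def kl_scale mult.assoc[symmetric])
  show "\<exists>\<mu> i. kl n (unit_at l) = gscale \<Lambda> \<mu> (gmult \<Lambda> (AA lam False l) (gpow \<Lambda> s i))"
    using sc[of "lam powi (n div 4)"] lam n
    by (intro exI[of _ "inverse (lam powi (n div 4))"] exI[of _ "n div 4"]) (simp add: AA_pow)
  define p h where "p = odd (n div 4)" and "h = n div 4 div 2"
  have "4 * (n div 4) = (if p then 4 else 0) + 4 * (2 * h)" unfolding p_def h_def by presburger
  then have n': "n = int (bdeg l) + (if p then 4 else 0) + 4 * (2 * h)" using n by linarith
  show "\<exists>\<mu> p h. kl n (unit_at l) = gscale \<Lambda> \<mu> (gmult \<Lambda> (AA lam p l) (gpow \<Lambda> s (2 * h)))"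
  proof (intro exI)
    show "kl n (unit_at l) = gscale \<Lambda> (inverse ((if p then lam else 1) * lam powi (2 * h))) (gmult \<Lambda> (AA lam p l) (gpow \<Lambda> s (2 * h)))"
      unfolding AA_pow n'[symmetric] by (rule sc) (use lam in simp)
  qed
qed

text \<open>The prescribed values determine a cochain on basis elements times powers of
  \<open>s\<close>. Multilinearity extends this to all homogeneous arguments, one argument after the
  other, and outside the tuples cochains are extensional.\<close>

lemma Q_values_unique:
  assumes \<phi>: "\<phi> \<in> hh_cochains \<Lambda> 3 (-1)" "Q_values \<Lambda> x y s \<phi>" and \<psi>: "\<psi> \<in> hh_cochains \<Lambda> 3 (-1)" "Q_values \<Lambda> x y s \<psi>"
  shows "\<phi> = \<psi>"
proof -
  have AA_mem: "AA lam p l \<in> {AA lam p l | p l. l < 6}" if "l < 6" for p l using that by blast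
  have AA_mem': "AA lam False l \<in> set (Q_basis \<Lambda> x y)" if "l < 6" for l using that unfolding set_basis by simp
  have base: "\<phi> [AA lam p a, AA lam False b, AA lam False c] = \<psi> [AA lam p a, AA lam False b, AA lam False c]"
    if "a < 6" "b < 6" "c < 6" for p a b c
  proof (cases "[AA lam p a, AA lam False b, AA lam False c] \<in> fst ` set (Q_table \<Lambda> x y s)")
    case True
    then obtain v where "([AA lam p a, AA lam False b, AA lam False c], v) \<in> set (Q_table \<Lambda> x y s)" by force
    then have "\<phi>' [AA lam p a, AA lam False b, AA lam False c] = v" if "Q_values \<Lambda> x y s \<phi>'" for \<phi>'
    proof -
      have "\<forall>(as, v)\<in>set (Q_table \<Lambda> x y s). \<phi>' as = v"
        using that unfolding Q_values_def Let_def by (elim conjE)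
      from bspec[OF this \<open>_ \<in> set (Q_table \<Lambda> x y s)\<close>] show ?thesis by simp
    qed
    from this[OF \<phi>(2)] this[OF \<psi>(2)] show ?thesis by simp
  next
    case False
    have "\<phi>' [AA lam p a, AA lam False b, AA lam False c] = gzero \<Lambda> (tdeg \<Lambda> [AA lam p a, AA lam False b, AA lam False c] - 1)"
      if "Q_values \<Lambda> x y s \<phi>'" for \<phi>'
    proof -
      have "\<forall>a\<in>{AA lam p l | p l. l < 6}. \<forall>b\<in>set (Q_basis \<Lambda> x y). \<forall>c\<in>set (Q_basis \<Lambda> x y).
          [a, b, c] \<notin> fst ` set (Q_table \<Lambda> x y s) \<longrightarrow> \<phi>' [a, b, c] = gzero \<Lambda> (tdeg \<Lambda> [a, b, c] - 1)"
        using that unfolding Q_values_def Let_def set_basis_s by (elim conjE)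
      from this[rule_format, OF AA_mem[OF \<open>a < 6\<close>] AA_mem'[OF \<open>b < 6\<close>] AA_mem'[OF \<open>c < 6\<close>] False] show ?thesis .
    qed
    from this[OF \<phi>(2)] this[OF \<psi>(2)] show ?thesis by simp
  qed
  have pow: "\<phi>' [gmult \<Lambda> (AA lam p a) (gpow \<Lambda> s (2 * h)), gmult \<Lambda> (AA lam False b) (gpow \<Lambda> s i), gmult \<Lambda> (AA lam False c) (gpow \<Lambda> s j)]
      = gmult \<Lambda> (\<phi>' [AA lam p a, AA lam False b, AA lam False c]) (gpow \<Lambda> s (2 * h + i + j))"
    if "Q_values \<Lambda> x y s \<phi>'" "a < 6" "b < 6" "c < 6" for \<phi>' p a b c h i j
  proof -
    have "\<forall>h i j. \<forall>a\<in>{AA lam p l | p l. l < 6}. \<forall>b\<in>set (Q_basis \<Lambda> x y). \<forall>c\<in>set (Q_basis \<Lambda> x y).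
        \<phi>' [gmult \<Lambda> a (gpow \<Lambda> s (2 * h)), gmult \<Lambda> b (gpow \<Lambda> s i), gmult \<Lambda> c (gpow \<Lambda> s j)] =
          gmult \<Lambda> (\<phi>' [a, b, c]) (gpow \<Lambda> s (2 * h + i + j))"
      using that(1) unfolding Q_values_def Let_def set_basis_s by (elim conjE)
    from this[rule_format, OF AA_mem[OF that(2)] AA_mem'[OF that(3)] AA_mem'[OF that(4)]] show ?thesis .
  qed
  have units: "\<phi> [kl n (unit_at a), kl n' (unit_at b), kl n'' (unit_at c)] = \<psi> [kl n (unit_at a), kl n' (unit_at b), kl n'' (unit_at c)]"
    if L: "a \<in> L n" "b \<in> L n'" "c \<in> L n''" for a b c n n' n''
  proof -
    obtain \<mu> p h where a: "kl n (unit_at a) = gscale \<Lambda> \<mu> (gmult \<Lambda> (AA lam p a) (gpow \<Lambda> s (2 * h)))" using unit_repr(2)[OF L(1)] by blast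
    obtain \<nu> i where b: "kl n' (unit_at b) = gscale \<Lambda> \<nu> (gmult \<Lambda> (AA lam False b) (gpow \<Lambda> s i))" using unit_repr(1)[OF L(2)] by blast
    obtain \<rho> j where c: "kl n'' (unit_at c) = gscale \<Lambda> \<rho> (gmult \<Lambda> (AA lam False c) (gpow \<Lambda> s j))" using unit_repr(1)[OF L(3)] by blast
    note less = L_less[OF L(1)] L_less[OF L(2)] L_less[OF L(3)]
    have hom: "gmult \<Lambda> (AA lam p l) (gpow \<Lambda> s k) \<in> homog \<Lambda>" for p l k unfolding AA_pow by simp
    have *: "\<phi>' [kl n (unit_at a), kl n' (unit_at b), kl n'' (unit_at c)] = gscale \<Lambda> \<mu> (gscale \<Lambda> \<nu> (gscale \<Lambda> \<rho>
        (gmult \<Lambda> (\<phi>' [AA lam p a, AA lam False b, AA lam False c]) (gpow \<Lambda> s (2 * h + i + j)))))"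
      if \<phi>': "\<phi>' \<in> hh_cochains \<Lambda> 3 (-1)" "Q_values \<Lambda> x y s \<phi>'" for \<phi>'
      unfolding a b c T.p.cochain_scale(1)[OF \<phi>'(1) hom T.p.L_scale_homog[OF hom] T.p.L_scale_homog[OF hom]]
        T.p.cochain_scale(2)[OF \<phi>'(1) hom hom T.p.L_scale_homog[OF hom]]
        T.p.cochain_scale(3)[OF \<phi>'(1) hom hom hom] pow[OF \<phi>'(2) less] ..
    show ?thesis unfolding *[OF \<phi>] *[OF \<psi>] base[OF less] ..
  qed
  have 1: "\<phi> [kl n c, kl n' (unit_at b), kl n'' (unit_at d)] = \<psi> [kl n c, kl n' (unit_at b), kl n'' (unit_at d)]"
    if L: "b \<in> L n'" "d \<in> L n''" for n c b n' d n''
    by (rule kl_induct[of n "\<lambda>u. \<phi> [u, kl n' (unit_at b), kl n'' (unit_at d)] = \<psi> [u, kl n' (unit_at b), kl n'' (unit_at d)]"])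
      (simp_all only: units[OF _ L] T.p.cochain_add(1)[OF \<phi>(1) kl_gcomp kl_gcomp kl_homog kl_homog]
        T.p.cochain_add(1)[OF \<psi>(1) kl_gcomp kl_gcomp kl_homog kl_homog] T.p.cochain_scale(1)[OF \<phi>(1) kl_homog kl_homog kl_homog]
        T.p.cochain_scale(1)[OF \<psi>(1) kl_homog kl_homog kl_homog])
  have 2: "\<phi> [kl n c, kl n' c', kl n'' (unit_at d)] = \<psi> [kl n c, kl n' c', kl n'' (unit_at d)]"
    if L: "d \<in> L n''" for n c c' n' d n''
    by (rule kl_induct[of n' "\<lambda>u. \<phi> [kl n c, u, kl n'' (unit_at d)] = \<psi> [kl n c, u, kl n'' (unit_at d)]"])
      (simp_all only: 1[OF _ L] T.p.cochain_add(2)[OF \<phi>(1) kl_gcomp kl_gcomp kl_homog kl_homog]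
        T.p.cochain_add(2)[OF \<psi>(1) kl_gcomp kl_gcomp kl_homog kl_homog] T.p.cochain_scale(2)[OF \<phi>(1) kl_homog kl_homog kl_homog]
        T.p.cochain_scale(2)[OF \<psi>(1) kl_homog kl_homog kl_homog])
  have 3: "\<phi> [kl n c, kl n' c', kl n'' c''] = \<psi> [kl n c, kl n' c', kl n'' c'']" for n c c' n' c'' n''
    by (rule kl_induct[of n'' "\<lambda>u. \<phi> [kl n c, kl n' c', u] = \<psi> [kl n c, kl n' c', u]"])
      (simp_all only: 2 T.p.cochain_add(3)[OF \<phi>(1) kl_gcomp kl_gcomp kl_homog kl_homog]
        T.p.cochain_add(3)[OF \<psi>(1) kl_gcomp kl_gcomp kl_homog kl_homog] T.p.cochain_scale(3)[OF \<phi>(1) kl_homog kl_homog kl_homog]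
        T.p.cochain_scale(3)[OF \<psi>(1) kl_homog kl_homog kl_homog])
  have klh: "\<exists>n c. u = kl n c" if "u \<in> homog \<Lambda>" for u
    using that kl_cases unfolding homog_def by blast
  show ?thesis
  proof
    fix as show "\<phi> as = \<psi> as"
    proof (cases "as \<in> tuples \<Lambda> 3")
      case True
      then obtain u v w where "as = [u, v, w]" "u \<in> homog \<Lambda>" "v \<in> homog \<Lambda>" "w \<in> homog \<Lambda>"
        by (auto simp: T.p.tuples_3)
      then show ?thesis using klh 3 by metis
    next
      case False
      have "\<phi> \<in> extensional (tuples \<Lambda> 3)" "\<psi> \<in> extensional (tuples \<Lambda> 3)"
        using \<phi>(1) \<psi>(1) by (simp_all add: hh_cochains_def)
      then show ?thesis using False by (simp add: extensional_def)
    qed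
  qed
qed

text \<open>The canonical cocycle of the constructed choice takes the prescribed values, which gives
  existence. By uniqueness every \<open>m\<close> with these values is that very cocycle, so it is
  closed and represents the canonical class.\<close>

theorem quaternion_canonical_class:
  "homogeneous_basis \<Lambda> ({..<6} \<times> UNIV) (\<lambda>(l, i). gmult \<Lambda> (Q_basis \<Lambda> x y ! l) (gpow \<Lambda> s i)) \<and>
   (\<exists>!m. m \<in> hh_cochains \<Lambda> 3 (-1) \<and> Q_values \<Lambda> x y s m) \<and>
   (\<forall>m. m \<in> hh_cochains \<Lambda> 3 (-1) \<and> Q_values \<Lambda> x y s m \<longrightarrow>
      m \<in> hh_cocycles \<Lambda> 3 (-1) \<and> canonical_class G P = hh_class \<Lambda> 3 (-1) m)"
proof (intro conjI)
  show "homogeneous_basis \<Lambda> ({..<6} \<times> UNIV) (\<lambda>(l, i). gmult \<Lambda> (Q_basis \<Lambda> x y ! l) (gpow \<Lambda> s i))"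
    by (rule basis[OF lam])
  note cc = C.canonical_cocycle_cochain cc_Q_values
  show "\<exists>!m. m \<in> hh_cochains \<Lambda> 3 (-1) \<and> Q_values \<Lambda> x y s m"
    by (rule ex1I[of _ cc]) (use cc Q_values_unique in blast)+
  show "\<forall>m. m \<in> hh_cochains \<Lambda> 3 (-1) \<and> Q_values \<Lambda> x y s m \<longrightarrow>
      m \<in> hh_cocycles \<Lambda> 3 (-1) \<and> canonical_class G P = hh_class \<Lambda> 3 (-1) m"
    using Q_values_unique[OF _ _ cc] C.canonical_cocycle_cocycle T.p.canonical_class_eq[OF choice] by blast
qed

end

end

theorem theorem2p10:
  fixes Q :: "'g monoid"
    and I J K :: 'g
    and P :: "('g, 'k::field, 'v::ab_group_add) complete_res"
    and R :: "('g, 'k, 'w::ab_group_add) complete_res"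
    and \<theta> :: "int \<Rightarrow> 'v \<Rightarrow> 'w"
    and x y s :: "int \<times> ('v \<Rightarrow> 'k) set"
  defines "\<Lambda> \<equiv> tate_alg Q P"
  assumes "CHAR('k) = 2"
    and "quaternion_group Q I J K"
    and "complete_resolution Q P"
    and "complete_resolution Q R" and "four_periodic R" and "comparison_map Q P R \<theta>"
    and "x \<in> gcomp \<Lambda> 1" and "hom_of_class P x I = 1" and "hom_of_class P x J = 0"
    and "y \<in> gcomp \<Lambda> 1" and "hom_of_class P y I = 0" and "hom_of_class P y J = 1"
    and "s = shift_class Q P R \<theta>"
  shows "homogeneous_basis \<Lambda> ({..<6} \<times> UNIV)
           (\<lambda>(l, i). gmult \<Lambda> (Q_basis \<Lambda> x y ! l) (gpow \<Lambda> s i)) \<and>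
         (\<exists>!m. m \<in> hh_cochains \<Lambda> 3 (-1) \<and> Q_values \<Lambda> x y s m) \<and>
         (\<forall>m. m \<in> hh_cochains \<Lambda> 3 (-1) \<and> Q_values \<Lambda> x y s m \<longrightarrow>
            m \<in> hh_cocycles \<Lambda> 3 (-1) \<and> canonical_class Q P = hh_class \<Lambda> 3 (-1) m)"
proof -
  interpret q: quat Q I J K "TYPE('k)"
    by unfold_locales (rule assms)+
  have p: "char2_res Q P" and r: "char2_res Q R"
    using assms q.finite_G by (simp_all add: char2_res_def)
  \<comment> \<open>This equivalence carries the computation from the minimal resolution to
    \<open>P\<close>; it is unrelated to the comparison map \<open>\<theta>\<close>.\<close>
  obtain \<alpha> \<beta> where pair: "res_pair Q P q.Eres \<alpha> \<beta>"
    using res_pair_exists[OF p q.E.char2_res_axioms] by blast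
  interpret t: quat_res Q I J K "TYPE('k)" P \<alpha> \<beta>
    by (rule quat_res.intro[OF q.quat_axioms quat_res_axioms.intro[OF pair]])
  have \<theta>: "\<theta> j \<in> kG_hom Q (Pobj P j) (Pobj R j)" "Pbd R (j + 1) (\<theta> (j + 1) v) = \<theta> j (Pbd P (j + 1) v)"
    "Paug R (\<theta> 0 v) = Paug P v" for j v
  proof -
    have c: "\<forall>j. \<theta> j \<in> kG_hom Q (Pobj P j) (Pobj R j)" "\<forall>j. \<theta> (j - 1) \<circ> Pbd P j = Pbd R j \<circ> \<theta> j" "Paug R \<circ> \<theta> 0 = Paug P"
      using assms unfolding comparison_map_def by simp_all
    show "\<theta> j \<in> kG_hom Q (Pobj P j) (Pobj R j)" using c(1) ..
    show "Pbd R (j + 1) (\<theta> (j + 1) v) = \<theta> j (Pbd P (j + 1) v)"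
      using fun_cong[OF spec[OF c(2), of "j + 1"], of v] by simp
    show "Paug R (\<theta> 0 v) = Paug P v" using fun_cong[OF c(3), of v] by simp
  qed
  \<comment> \<open>Completing \<open>\<theta>\<close> to a homotopy equivalence makes the shift
    class of \<open>R\<close> invertible in the cohomology of \<open>P\<close>.\<close>
  obtain \<eta> where "res_pair Q P R \<theta> \<eta>"
    using res_pair_inverse[OF p r \<theta>] by (rule exE)
  then interpret u: res_pair Q P R \<theta> \<eta> .
  have s: "s = shift_class Q P R \<theta>" by fact
  obtain c where c: "s = t.kl 4 c"
    using u.shift_unit(1)[OF \<open>four_periodic R\<close>] unfolding s[symmetric] by (rule t.kl_cases)
  \<comment> \<open>Degree 4 has a single basis class, so \<open>s\<close> is a multiple of it; the
    scalar \<open>c 0\<close> plays the role of \<open>lam\<close>.\<close>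
  then have s_kb: "s = t.kb (c 0) 0 4"
    by (simp add: t.kb_def t.kl_eq L_eq unit_at_def)
  obtain s' where s': "s' \<in> gcomp (tate_alg Q P) (-4)" "gmult (tate_alg Q P) s s' = gone (tate_alg Q P)"
    using u.shift_unit(2)[OF \<open>four_periodic R\<close>] unfolding s[symmetric] by blast
  obtain c' where c': "s' = t.kl (-4) c'"
    using s'(1) by (rule t.kl_cases)
  \<comment> \<open>Comparing degree 0 coordinates in \<open>s s' = 1\<close> shows that this scalar
    is not zero.\<close>
  have "t.kl 0 (\<lambda>m. c 0 * c' m) = t.kl 0 (unit_at 0)"
    using s'(2) t.kl_mult_0(2)[where \<nu> = "c 0" and i = 1 and n = "-4" and c = c'] by (simp add: s_kb c' t.kl_one)
  then have "c 0 * c' 0 = 1"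
    by (simp add: t.kl_eq L_eq unit_at_def)
  then have lam: "c 0 \<noteq> 0" by auto
  \<comment> \<open>The coordinates of a degree one class are its values at \<open>I\<close> and
    \<open>J\<close>, so the conditions on \<open>x\<close> and \<open>y\<close> single out the two
    basis classes of degree 1.\<close>
  have gen: "hom_of_class P (t.kl 1 e) I = e 1" "hom_of_class P (t.kl 1 e) J = e 2" for e
    using t.hom_of_class_value[OF q.IJ(1) _ t.bd_gen(1), of e] t.hom_of_class_value[OF q.IJ(2) _ t.bd_gen(2), of e]
    by (simp_all add: numeral_2_eq_2)
  obtain e where e: "x = t.kl 1 e"
    using \<open>x \<in> gcomp \<Lambda> 1\<close> unfolding \<Lambda>_def by (rule t.kl_cases)
  have x: "x = t.kb 1 1 1"
    using \<open>hom_of_class P x I = 1\<close> \<open>hom_of_class P x J = 0\<close> unfolding e gen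
    by (simp add: t.kb_def t.kl_eq L_eq unit_at_def)
  obtain e' where e': "y = t.kl 1 e'"
    using \<open>y \<in> gcomp \<Lambda> 1\<close> unfolding \<Lambda>_def by (rule t.kl_cases)
  have y: "y = t.kb 1 2 1"
    using \<open>hom_of_class P y I = 0\<close> \<open>hom_of_class P y J = 1\<close> unfolding e' gen
    by (simp add: t.kb_def t.kl_eq L_eq unit_at_def)
  show ?thesis
    unfolding \<Lambda>_def x y s_kb by (rule t.quaternion_canonical_class[OF lam])
qed

end
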